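(* Let $(X,\mathsf d,\mathfrak m)$ be an $\mathrm{RCD}(K,N)$ space, $K\in\mathbb R$, $N\in[1,\infty)$. Then the following two conditions are equivalent. (1) There exist sequences $\{t_i\}\subset\mathbb R$ and $\{s_i\}\subset\mathbb R$ such that $t_i\to t_0$ for some $t_0>0$ and such that $s_i\Phi_{t_i}$ is an isometric immersion for any $i$, i.e. $s_i^2\,g_{t_i}=g$ for any $i$. (2) $(X,\mathsf d,\mathfrak m)$ is an isometrically heat kernel immersing (IHKI) $\mathrm{RCD}(K,N)$ space, i.e. there exists a non-negative function $c(t)$ such that $\sqrt{c(t)}\,\Phi_t$ is an isometric immersion for all $t>0$, namely $c(t)g_t=g$ for all $t>0$.
   Context: A metric measure space $(X,\mathsf d,\mathfrak m)$ is a complete separable metric space with a nonnegative Borel measure of full support, finite on bounded sets. Its Cheeger energy is $\mathrm{Ch}(f)=\inf\{\liminf_i\int_X(\mathrm{lip} f_i)^2d\mathfrak m\}$ over sequences of bounded Lipschitz $f_i\in L^2(\mathfrak m)$ with $f_i\to f$ in $L^2(\mathfrak m)$, where $\mathrm{lip}$ is the local Lipschitz constant; $H^{1,2}(X,\mathsf d,\mathfrak m)=\{\mathrm{Ch}<\infty\}$, $\mathrm{Ch}(f)=\int|\mathrm Df|^2d\mathfrak m$ with $|\mathrm Df|$ the minimal relaxed slope. If $H^{1,2}$ is a Hilbert space (infinitesimal Hilbertianity), set $\langle\nabla f,\nabla h\rangle=\lim_{\epsilon\to0}\frac{|\mathrm D(f+\epsilon h)|^2-|\mathrm Df|^2}{2\epsilon}$,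 and $f\in D(\Delta)$, $\Delta f=h\in L^2(\mathfrak m)$, iff $f\in H^{1,2}$ and $\int\langle\nabla f,\nabla\varphi\rangle d\mathfrak m=-\int h\varphi\, d\mathfrak m$ for all $\varphi\in H^{1,2}$. For $K\in\mathbb R$, $N\in[1,\infty)$, the space is $\mathrm{RCD}(K,N)$ if: it is infinitesimally Hilbertian; there are $x\in X$, $C>0$ with $\mathfrak m(B_r(x))\le Ce^{Cr^2}$ for all $r>0$; every $f\in H^{1,2}$ with $|\mathrm Df|\le1$ a.e. has a 1-Lipschitz representative; and for $f\in D(\Delta)$ with $\Delta f\in H^{1,2}$ and all $\varphi\ge0$ in $\{\varphi\in \mathrm{Lip}\cap D(\Delta)\cap L^\infty:\Delta\varphi\in H^{1,2}\cap L^\infty\}$, $\frac12\int|\nabla f|^2\Delta\varphi\,d\mathfrak m\ge\int\varphi(\langle\nabla f,\nabla\Delta f\rangle+K|\nabla f|^2+\frac{(\Delta f)^2}{N})d\mathfrak m$. Let $L^2(T^*(X,\mathsf d,\mathfrak m))$ be Gigli's cotangent module with differential $d$, and $(T^* )^{\otimes2}$ its tensor square with pointwise inner product $\langle\cdot,\cdot\rangle$ (induced by $\langle df_1\otimes df_2,df_3\otimes df_4\rangle=\langle\nabla f_1,\nabla f_3\rangle\langle\nabla f_2,\nabla f_4\rangle$). A semi-Riemannian metric is a symmetric element $\bar g$ of $L^\infty_{\mathrm{loc}}((T^* )^{\otimes2})$ with $\bar g(V,V)\ge0$ $\mathfrak m$-a.e. for every $L^2$ vector field $V$; it is a Riemannian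 metric if moreover $\bar g(V,V)>0$ $\mathfrak m$-a.e. on $\{|V|>0\}$. The canonical Riemannian metric $g$ is the unique one with $g(\nabla f_1,\nabla f_2)=\langle\nabla f_1,\nabla f_2\rangle$ $\mathfrak m$-a.e. for all $f_1,f_2\in H^{1,2}$. Let $\rho$ be the locally Lipschitz representative on $X\times X\times(0,\infty)$ of the heat kernel (the kernel of the heat flow $\partial_t u=\Delta u$ on $L^2(\mathfrak m)$). For $t>0$ the $t$-time heat kernel mapping is $\Phi_t:X\to L^2(\mathfrak m)$, $\Phi_t(x)=\rho(x,\cdot,t)$. The pull-back $g_t=\Phi_t^*g_{L^2(\mathfrak m)}$ is the unique semi-Riemannian metric such that for all $\eta_1,\eta_2\in L^2(T^*(X,\mathsf d,\mathfrak m))$ with bounded support $\int_X\langle g_t,\eta_1\otimes\eta_2\rangle d\mathfrak m=\int_X\int_X\langle d_x\rho(x,y,t),\eta_1\rangle\langle d_x\rho(x,y,t),\eta_2\rangle d\mathfrak m(x)d\mathfrak m(y)$. For $s\in\mathbb R$, $(s\Phi_t)^*g_{L^2(\mathfrak m)}=s^2g_t$, and $s\Phi_t$ is called an isometric immersion if $s^2g_t=g$.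
   Formalization: In (1) the times t_i are required to be positive and to differ from t_0 for infinitely many i; with an eventually constant sequence (1) does not imply (2), e.g. on S^1(r)×S^2 with r<1/√2, where g_t is proportional to g at some time but not at all times. *)

theory Defs
  imports "HOL-Analysis.Analysis"
begin

text \<open>
  The underlying metric space is the type \<open>'a :: polish_space\<close> (complete and separable).
  Elements of \<open>L\<^sup>p\<close> and Sobolev spaces are honest functions; all notions below respect
  almost everywhere equality.  Objects that are only determined up to null sets are picked by
  Hilbert choice.
\<close>

definition metric_measure_space :: "'a::polish_space measure \<Rightarrow> bool" where
  "metric_measure_space m \<longleftrightarrow>
     sets m = sets borel \<and>
     (\<forall>x. \<forall>r>0. emeasure m (ball x r) > 0) \<and>
     (\<forall>B\<in>sets borel. bounded B \<longrightarrow> emeasure m B < \<infinity>)"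


section \<open>Cheeger energy and Sobolev space\<close>

definition L2 :: "'a measure \<Rightarrow> ('a \<Rightarrow> real) set" where
  "L2 m = {f \<in> borel_measurable m. integrable m (\<lambda>x. (f x)\<^sup>2)}"

definition Linf :: "'a measure \<Rightarrow> ('a \<Rightarrow> real) set" where
  "Linf m = {f \<in> borel_measurable m. \<exists>C. AE x in m. \<bar>f x\<bar> \<le> C}"

definition L2_tendsto ::
  "'a measure \<Rightarrow> ('i \<Rightarrow> 'a \<Rightarrow> real) \<Rightarrow> ('a \<Rightarrow> real) \<Rightarrow> 'i filter \<Rightarrow> bool" where
  "L2_tendsto m F f \<F> \<longleftrightarrow> ((\<lambda>i. \<integral>x. (F i x - f x)\<^sup>2 \<partial>m) \<longlongrightarrow> 0) \<F>"

text \<open>At an isolated point the filter \<open>at x\<close> is trivial and the value is \<open>0\<close>, as it should be.\<close>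

definition lip :: "('a::metric_space \<Rightarrow> real) \<Rightarrow> 'a \<Rightarrow> ennreal" where
  "lip f x = Limsup (at x) (\<lambda>y. ennreal (\<bar>f y - f x\<bar> / dist y x))"

definition bdd_Lip_L2 :: "'a::metric_space measure \<Rightarrow> ('a \<Rightarrow> real) set" where
  "bdd_Lip_L2 m = {f \<in> L2 m. bounded (range f) \<and> (\<exists>C. C-lipschitz_on UNIV f)}"

definition Ch :: "'a::metric_space measure \<Rightarrow> ('a \<Rightarrow> real) \<Rightarrow> ennreal" where
  "Ch m f = Inf {liminf (\<lambda>i. \<integral>\<^sup>+x. (lip (F i) x)\<^sup>2 \<partial>m) | F :: nat \<Rightarrow> 'a \<Rightarrow> real.
       (\<forall>i. F i \<in> bdd_Lip_L2 m) \<and> L2_tendsto m F f sequentially}"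

definition H12 :: "'a::metric_space measure \<Rightarrow> ('a \<Rightarrow> real) set" where
  "H12 m = {f \<in> L2 m. Ch m f < \<infinity>}"

text \<open>Relaxed slopes in the sense of Ambrosio, Gigli and Savare: functions dominating a weak
  \<open>L\<^sup>2\<close> limit of local Lipschitz constants of an approximating sequence; the minimal
  one is the one of least \<open>L\<^sup>2\<close> norm.\<close>

definition relaxed_slope ::
  "'a::metric_space measure \<Rightarrow> ('a \<Rightarrow> real) \<Rightarrow> ('a \<Rightarrow> real) \<Rightarrow> bool" where
  "relaxed_slope m f G \<longleftrightarrow> G \<in> L2 m \<and>
     (\<exists>F G'. (\<forall>i::nat. F i \<in> bdd_Lip_L2 m \<and> (\<lambda>x. enn2real (lip (F i) x)) \<in> L2 m) \<and>
        L2_tendsto m F f sequentially \<and>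
        G' \<in> L2 m \<and>
        (\<forall>\<phi>\<in>L2 m. (\<lambda>i. \<integral>x. enn2real (lip (F i) x) * \<phi> x \<partial>m) \<longlonglongrightarrow> (\<integral>x. G' x * \<phi> x \<partial>m)) \<and>
        (AE x in m. G' x \<le> G x))"

definition min_slope :: "'a::metric_space measure \<Rightarrow> ('a \<Rightarrow> real) \<Rightarrow> 'a \<Rightarrow> real" where
  "min_slope m f = (SOME G. relaxed_slope m f G \<and>
     (\<forall>H. relaxed_slope m f H \<longrightarrow> (\<integral>x. (G x)\<^sup>2 \<partial>m) \<le> (\<integral>x. (H x)\<^sup>2 \<partial>m)))"

definition H12_sqnorm :: "'a::metric_space measure \<Rightarrow> ('a \<Rightarrow> real) \<Rightarrow> real" where
  "H12_sqnorm m f = (\<integral>x. (f x)\<^sup>2 \<partial>m) + enn2real (Ch m f)"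

text \<open>\<open>H\<^sup>1\<^sup>,\<^sup>2\<close> is a Hilbert space: its norm comes from an inner product and is complete.\<close>

definition infinitesimally_Hilbertian :: "'a::metric_space measure \<Rightarrow> bool" where
  "infinitesimally_Hilbertian m \<longleftrightarrow>
     (\<exists>B :: ('a \<Rightarrow> real) \<Rightarrow> ('a \<Rightarrow> real) \<Rightarrow> real.
        (\<forall>f\<in>H12 m. \<forall>h\<in>H12 m. B f h = B h f) \<and>
        (\<forall>f\<in>H12 m. \<forall>h\<in>H12 m. \<forall>k\<in>H12 m. B (\<lambda>x. f x + h x) k = B f k + B h k) \<and>
        (\<forall>c. \<forall>f\<in>H12 m. \<forall>h\<in>H12 m. B (\<lambda>x. c * f x) h = c * B f h) \<and>
        (\<forall>f\<in>H12 m. B f f = H12_sqnorm m f)) \<and>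
     (\<forall>F. (\<forall>n::nat. F n \<in> H12 m) \<and>
          (\<forall>e>0. \<exists>n0. \<forall>i\<ge>n0. \<forall>j\<ge>n0. H12_sqnorm m (\<lambda>x. F i x - F j x) < e) \<longrightarrow>
          (\<exists>f\<in>H12 m. (\<lambda>n. H12_sqnorm m (\<lambda>x. F n x - f x)) \<longlonglongrightarrow> 0))"

text \<open>\<open>grad_inner m f h\<close> is \<open>\<langle>\<nabla>f, \<nabla>h\<rangle>\<close>; the limit of the difference quotients is taken in
  \<open>L\<^sup>1(m)\<close>.\<close>

definition grad_inner ::
  "'a::metric_space measure \<Rightarrow> ('a \<Rightarrow> real) \<Rightarrow> ('a \<Rightarrow> real) \<Rightarrow> 'a \<Rightarrow> real" where
  "grad_inner m f h = (SOME G. integrable m G \<and>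
     ((\<lambda>\<epsilon>. \<integral>x. \<bar>((min_slope m (\<lambda>y. f y + \<epsilon> * h y) x)\<^sup>2 - (min_slope m f x)\<^sup>2) / (2 * \<epsilon>) - G x\<bar> \<partial>m)
        \<longlongrightarrow> 0) (at 0))"

text \<open>\<open>f \<in> D(\<Delta>)\<close> and \<open>\<Delta>f = h\<close>.\<close>

definition has_laplacian ::
  "'a::metric_space measure \<Rightarrow> ('a \<Rightarrow> real) \<Rightarrow> ('a \<Rightarrow> real) \<Rightarrow> bool" where
  "has_laplacian m f h \<longleftrightarrow> f \<in> H12 m \<and> h \<in> L2 m \<and>
     (\<forall>\<phi>\<in>H12 m. (\<integral>x. grad_inner m f \<phi> x \<partial>m) = - (\<integral>x. h x * \<phi> x \<partial>m))"


section \<open>RCD spaces and their heat kernel\<close>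

definition RCD :: "real \<Rightarrow> real \<Rightarrow> 'a::polish_space measure \<Rightarrow> bool" where
  "RCD K N m \<longleftrightarrow>
     metric_measure_space m \<and>
     infinitesimally_Hilbertian m \<and>
     (\<exists>x. \<exists>C>0. \<forall>r>0. measure m (ball x r) \<le> C * exp (C * r\<^sup>2)) \<and>
     (\<forall>f\<in>H12 m. (AE x in m. min_slope m f x \<le> 1) \<longrightarrow>
        (\<exists>h. 1-lipschitz_on UNIV h \<and> (AE x in m. f x = h x))) \<and>
     (\<forall>f Lf \<phi> L\<phi>.
        has_laplacian m f Lf \<and> Lf \<in> H12 m \<and>
        (\<forall>x. 0 \<le> \<phi> x) \<and> (\<exists>C. C-lipschitz_on UNIV \<phi>) \<and> \<phi> \<in> Linf m \<and>
        has_laplacian m \<phi> L\<phi> \<and> L\<phi> \<in> H12 m \<and> L\<phi> \<in> Linf m \<longrightarrow>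
        1 / 2 * (\<integral>x. (min_slope m f x)\<^sup>2 * L\<phi> x \<partial>m) \<ge>
        (\<integral>x. \<phi> x * (grad_inner m f Lf x + K * (min_slope m f x)\<^sup>2 + (Lf x)\<^sup>2 / N) \<partial>m))"

text \<open>\<open>u\<close> is the heat flow starting at \<open>f\<close>; the time derivative is taken in \<open>L\<^sup>2(m)\<close>.\<close>

definition heat_flow ::
  "'a::metric_space measure \<Rightarrow> ('a \<Rightarrow> real) \<Rightarrow> (real \<Rightarrow> 'a \<Rightarrow> real) \<Rightarrow> bool" where
  "heat_flow m f u \<longleftrightarrow>
     (\<forall>t>0. \<exists>h. has_laplacian m (u t) h \<and>
        L2_tendsto m (\<lambda>s x. (u s x - u t x) / (s - t)) h (at t)) \<and>
     L2_tendsto m u f (at_right 0)"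

definition heat_kernel ::
  "'a::metric_space measure \<Rightarrow> ('a \<Rightarrow> 'a \<Rightarrow> real \<Rightarrow> real) \<Rightarrow> bool" where
  "heat_kernel m \<rho> \<longleftrightarrow>
     (\<forall>x y t. t > 0 \<longrightarrow> (\<exists>r>0. \<exists>C. C-lipschitz_on (ball (x, y, t) r \<inter> UNIV \<times> UNIV \<times> {0<..})
        (\<lambda>(x', y', t'). \<rho> x' y' t'))) \<and>
     (\<forall>f\<in>L2 m. (\<forall>t>0. AE x in m. integrable m (\<lambda>y. \<rho> x y t * f y)) \<and>
        heat_flow m f (\<lambda>t x. \<integral>y. \<rho> x y t * f y \<partial>m))"


section \<open>Convergence in measure on bounded sets\<close>

definition L0_tendsto ::
  "'a::metric_space measure \<Rightarrow> (nat \<Rightarrow> 'a \<Rightarrow> real) \<Rightarrow> ('a \<Rightarrow> real) \<Rightarrow> bool" where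
  "L0_tendsto m F f \<longleftrightarrow>
     (\<forall>B\<in>sets borel. bounded B \<longrightarrow>
        (\<forall>\<epsilon>>0. (\<lambda>n. measure m {x\<in>B. \<epsilon> \<le> \<bar>F n x - f x\<bar>}) \<longlonglongrightarrow> 0))"

definition L0_lim :: "'a::metric_space measure \<Rightarrow> (nat \<Rightarrow> 'a \<Rightarrow> real) \<Rightarrow> 'a \<Rightarrow> real" where
  "L0_lim m F = (SOME f. f \<in> borel_measurable m \<and> L0_tendsto m F f)"


section \<open>The cotangent module\<close>

text \<open>
  Gigli's construction.  The list of the pairs \<open>(a\<^sub>i, f\<^sub>i)\<close>, with \<open>a\<^sub>i\<close> bounded and \<open>f\<^sub>i\<close> Sobolev,
  stands for the 1-form \<open>\<Sum>i. a\<^sub>i df\<^sub>i\<close> (Gigli's pre-cotangent module consists of those whose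
  \<open>a\<^sub>i\<close> are the indicators of a Borel partition; the pointwise norm is then \<open>|Df\<^sub>i|\<close> on
  the \<open>i\<close>-th piece).  The module \<open>L\<^sup>2(T\<^sup>*)\<close> is the completion for the \<open>L\<^sup>2\<close> norm of the
  pointwise norm, an element being represented by a Cauchy sequence.
\<close>

type_synonym 'a simple_form = "(('a \<Rightarrow> real) \<times> ('a \<Rightarrow> real)) list"
type_synonym 'a form = "nat \<Rightarrow> 'a simple_form"

definition coeff_fun :: "'a measure \<Rightarrow> ('a \<Rightarrow> real) set" where
  "coeff_fun m = {a \<in> borel_measurable m. bounded (range a)}"

definition simple_forms :: "'a::metric_space measure \<Rightarrow> 'a simple_form set" where
  "simple_forms m = {w. \<forall>(a, f)\<in>set w. a \<in> coeff_fun m \<and> f \<in> H12 m}"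

definition sform_inner ::
  "'a::metric_space measure \<Rightarrow> 'a simple_form \<Rightarrow> 'a simple_form \<Rightarrow> 'a \<Rightarrow> real" where
  "sform_inner m v w x = (\<Sum>(a, f)\<leftarrow>v. \<Sum>(b, h)\<leftarrow>w. a x * b x * grad_inner m f h x)"

definition sform_diff :: "'a simple_form \<Rightarrow> 'a simple_form \<Rightarrow> 'a simple_form" where
  "sform_diff v w = v @ map (\<lambda>(a, f). (\<lambda>x. - a x, f)) w"

definition L2_forms :: "'a::metric_space measure \<Rightarrow> 'a form set" where
  "L2_forms m = {\<omega>. (\<forall>n. \<omega> n \<in> simple_forms m) \<and>
     (\<forall>e>0. \<exists>n0. \<forall>i\<ge>n0. \<forall>j\<ge>n0.
        (\<integral>x. sform_inner m (sform_diff (\<omega> i) (\<omega> j)) (sform_diff (\<omega> i) (\<omega> j)) x \<partial>m) < e)}"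

definition form_inner :: "'a::metric_space measure \<Rightarrow> 'a form \<Rightarrow> 'a form \<Rightarrow> 'a \<Rightarrow> real" where
  "form_inner m \<omega> \<eta> = L0_lim m (\<lambda>n. sform_inner m (\<omega> n) (\<eta> n))"

definition differential :: "('a \<Rightarrow> real) \<Rightarrow> 'a form" where
  "differential f = (\<lambda>n. [(\<lambda>x. 1, f)])"

definition bounded_support :: "'a::metric_space measure \<Rightarrow> 'a form \<Rightarrow> bool" where
  "bounded_support m \<eta> \<longleftrightarrow> (\<exists>B. bounded B \<and> (AE x in m. x \<notin> B \<longrightarrow> form_inner m \<eta> \<eta> x = 0))"


section \<open>Its tensor square\<close>

text \<open>
  The list of the triples \<open>(a\<^sub>i, f\<^sub>i, h\<^sub>i)\<close> stands for \<open>\<Sum>i. a\<^sub>i df\<^sub>i \<otimes> dh\<^sub>i\<close>.  Measurable tensors are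
  obtained by completing with respect to convergence in measure on bounded sets.
\<close>

type_synonym 'a simple_tensor = "(('a \<Rightarrow> real) \<times> ('a \<Rightarrow> real) \<times> ('a \<Rightarrow> real)) list"
type_synonym 'a tensor = "nat \<Rightarrow> 'a simple_tensor"

definition simple_tensors :: "'a::metric_space measure \<Rightarrow> 'a simple_tensor set" where
  "simple_tensors m =
     {T. \<forall>(a, f, h)\<in>set T. a \<in> coeff_fun m \<and> f \<in> H12 m \<and> h \<in> H12 m}"

definition stensor_inner ::
  "'a::metric_space measure \<Rightarrow> 'a simple_tensor \<Rightarrow> 'a simple_tensor \<Rightarrow> 'a \<Rightarrow> real" where
  "stensor_inner m S T x =
     (\<Sum>(a, f, h)\<leftarrow>S. \<Sum>(b, u, v)\<leftarrow>T. a x * b x * grad_inner m f u x * grad_inner m h v x)"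

definition stensor_scale :: "real \<Rightarrow> 'a simple_tensor \<Rightarrow> 'a simple_tensor" where
  "stensor_scale c T = map (\<lambda>(a, f, h). (\<lambda>x. c * a x, f, h)) T"

definition stensor_diff :: "'a simple_tensor \<Rightarrow> 'a simple_tensor \<Rightarrow> 'a simple_tensor" where
  "stensor_diff S T = S @ stensor_scale (-1) T"

definition L0_tensors :: "'a::metric_space measure \<Rightarrow> 'a tensor set" where
  "L0_tensors m = {T. (\<forall>n. T n \<in> simple_tensors m) \<and>
     (\<forall>B\<in>sets borel. bounded B \<longrightarrow> (\<forall>\<epsilon>>0. \<forall>\<delta>>0. \<exists>n0. \<forall>i\<ge>n0. \<forall>j\<ge>n0.
        measure m {x\<in>B. \<epsilon> \<le>
          stensor_inner m (stensor_diff (T i) (T j)) (stensor_diff (T i) (T j)) x} < \<delta>))}"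

definition tensor_inner :: "'a::metric_space measure \<Rightarrow> 'a tensor \<Rightarrow> 'a tensor \<Rightarrow> 'a \<Rightarrow> real" where
  "tensor_inner m S T = L0_lim m (\<lambda>n. stensor_inner m (S n) (T n))"

definition tensor_scale :: "real \<Rightarrow> 'a tensor \<Rightarrow> 'a tensor" where
  "tensor_scale c T = (\<lambda>n. stensor_scale c (T n))"

definition tensor_diff :: "'a tensor \<Rightarrow> 'a tensor \<Rightarrow> 'a tensor" where
  "tensor_diff S T = (\<lambda>n. stensor_diff (S n) (T n))"

definition tensor_transpose :: "'a tensor \<Rightarrow> 'a tensor" where
  "tensor_transpose T = (\<lambda>n. map (\<lambda>(a, f, h). (a, h, f)) (T n))"

definition tensor_prod :: "'a form \<Rightarrow> 'a form \<Rightarrow> 'a tensor" where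
  "tensor_prod \<omega> \<eta> =
     (\<lambda>n. concat (map (\<lambda>(a, f). map (\<lambda>(b, h). (\<lambda>x. a x * b x, f, h)) (\<eta> n)) (\<omega> n)))"

text \<open>Equality of the represented elements of the completion.\<close>

definition tensor_eq :: "'a::metric_space measure \<Rightarrow> 'a tensor \<Rightarrow> 'a tensor \<Rightarrow> bool" where
  "tensor_eq m S T \<longleftrightarrow> (AE x in m. tensor_inner m (tensor_diff S T) (tensor_diff S T) x = 0)"

definition Linf_loc_tensors :: "'a::metric_space measure \<Rightarrow> 'a tensor set" where
  "Linf_loc_tensors m = {T \<in> L0_tensors m.
     \<forall>B. bounded B \<longrightarrow> (\<exists>C. AE x in m. x \<in> B \<longrightarrow> sqrt (tensor_inner m T T x) \<le> C)}"


section \<open>Riemannian metrics and isometric immersions by the heat kernel\<close>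

text \<open>
  \<open>L\<^sup>2\<close> vector fields are identified with elements of \<open>L\<^sup>2(T\<^sup>*)\<close> by the Riesz isomorphism
  of Hilbert modules, under which \<open>\<nabla>f\<close> corresponds to \<open>df\<close> and
  \<open>g(V, W) = \<langle>g, V \<otimes> W\<rangle>\<close>.
\<close>

definition metric_eval ::
  "'a::metric_space measure \<Rightarrow> 'a tensor \<Rightarrow> 'a form \<Rightarrow> 'a form \<Rightarrow> 'a \<Rightarrow> real" where
  "metric_eval m g V W = tensor_inner m g (tensor_prod V W)"

definition semi_Riemannian_metric :: "'a::metric_space measure \<Rightarrow> 'a tensor \<Rightarrow> bool" where
  "semi_Riemannian_metric m g \<longleftrightarrow>
     g \<in> Linf_loc_tensors m \<and> tensor_eq m g (tensor_transpose g) \<and>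
     (\<forall>V\<in>L2_forms m. AE x in m. metric_eval m g V V x \<ge> 0)"

definition Riemannian_metric :: "'a::metric_space measure \<Rightarrow> 'a tensor \<Rightarrow> bool" where
  "Riemannian_metric m g \<longleftrightarrow> semi_Riemannian_metric m g \<and>
     (\<forall>V\<in>L2_forms m. AE x in m. sqrt (form_inner m V V x) > 0 \<longrightarrow> metric_eval m g V V x > 0)"

definition canonical_metric :: "'a::metric_space measure \<Rightarrow> 'a tensor \<Rightarrow> bool" where
  "canonical_metric m g \<longleftrightarrow> Riemannian_metric m g \<and>
     (\<forall>f1\<in>H12 m. \<forall>f2\<in>H12 m. AE x in m.
        metric_eval m g (differential f1) (differential f2) x = grad_inner m f1 f2 x)"

definition heat_pullback_metric ::
  "'a::metric_space measure \<Rightarrow> ('a \<Rightarrow> 'a \<Rightarrow> real \<Rightarrow> real) \<Rightarrow> real \<Rightarrow> 'a tensor \<Rightarrow> bool" where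
  "heat_pullback_metric m \<rho> t gt \<longleftrightarrow> semi_Riemannian_metric m gt \<and>
     (\<forall>\<eta>1\<in>L2_forms m. \<forall>\<eta>2\<in>L2_forms m. bounded_support m \<eta>1 \<and> bounded_support m \<eta>2 \<longrightarrow>
        (\<integral>x. tensor_inner m gt (tensor_prod \<eta>1 \<eta>2) x \<partial>m) =
        (\<integral>y. (\<integral>x. form_inner m (differential (\<lambda>x'. \<rho> x' y t)) \<eta>1 x *
                  form_inner m (differential (\<lambda>x'. \<rho> x' y t)) \<eta>2 x \<partial>m) \<partial>m))"

text \<open>\<open>s \<Phi>\<^sub>t\<close> is an isometric immersion: \<open>s\<^sup>2 g\<^sub>t = g\<close>.  The metrics \<open>g\<^sub>t\<close> and \<open>g\<close> are
  determined by their defining properties up to \<^const>\<open>tensor_eq\<close>.\<close>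

definition heat_isometric_immersion ::
  "'a::metric_space measure \<Rightarrow> ('a \<Rightarrow> 'a \<Rightarrow> real \<Rightarrow> real) \<Rightarrow> real \<Rightarrow> real \<Rightarrow> bool" where
  "heat_isometric_immersion m \<rho> s t \<longleftrightarrow>
     (\<exists>gt g. heat_pullback_metric m \<rho> t gt \<and> canonical_metric m g \<and>
        tensor_eq m (tensor_scale (s\<^sup>2) gt) g)"

definition IHKI ::
  "real \<Rightarrow> real \<Rightarrow> 'a::polish_space measure \<Rightarrow> ('a \<Rightarrow> 'a \<Rightarrow> real \<Rightarrow> real) \<Rightarrow> bool" where
  "IHKI K N m \<rho> \<longleftrightarrow> RCD K N m \<and>
     (\<exists>c :: real \<Rightarrow> real. \<forall>t>0. c t \<ge> 0 \<and> heat_isometric_immersion m \<rho> (sqrt (c t)) t)"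

end

theory Submission
  imports Defs "HOL-Complex_Analysis.Complex_Analysis"
begin

text \<open>
  Let \<open>A\<close> be a bounded Borel set and \<open>\<eta>\<close> a form in \<open>L\<^sup>2(T\<^sup>*)\<close> that is bounded on \<open>A\<close>, and put
  \<open>T f = 1\<^sub>A \<langle>df, \<eta>\<rangle>\<close>.  The pull-back metric \<open>g\<^sub>t\<close> satisfies
  \<open>\<integral>\<^sub>A g\<^sub>t(\<eta>, \<eta>) dm = \<integral>\<integral>\<^sub>A \<langle>d\<rho>(\<cdot>, y, t), \<eta>\<rangle>\<^sup>2 dm dm(y)\<close>.  Since \<open>\<rho>\<close> is the kernel of the heat flow
  \<open>P\<^sub>t\<close>, this is the squared Hilbert--Schmidt norm of \<open>T P\<^sub>t\<close>.  Computed with another system of functions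
  it is a sum \<open>\<Sum>k. |P\<^sub>t\<^sub>-\<^sub>e w\<^sub>k|\<^sup>2\<close> in which the \<open>w\<^sub>k\<close> do not depend on \<open>t > e\<close> (\<open>HS_expansion\<close>).  Every
  summand is completely monotone in \<open>t\<close>.  By Bernstein's theorem it is, seen from any time towards the
  past, a power series with nonnegative coefficients (\<open>P_norm_series\<close>), and positivity lets this property
  pass to the sum (\<open>past_series_sums\<close>).  So the Hilbert--Schmidt norms are real analytic in time.

  If \<open>s\<^sub>i\<^sup>2 g\<^bsub>t\<^sub>i\<^esub> = g\<close>, the squared Hilbert--Schmidt norm at time \<open>t\<^sub>i\<close> is \<open>\<integral>\<^sub>A |\<eta>|\<^sup>2 dm / s\<^sub>i\<^sup>2\<close>.  Hence the norms of any
  two pairs \<open>(A, \<eta>)\<close> have at all the times \<open>t\<^sub>i\<close> the same ratio, and by the identity theorem they have it at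
  every time (\<open>past_series_identity\<close>).  Consequently the squared norm at time \<open>t\<close> is
  \<open>\<mu>(t) \<integral>\<^sub>A |\<eta>|\<^sup>2 dm\<close> for all pairs (\<open>proportionality\<close>), with \<open>\<mu>(t) > 0\<close> because a norm that vanishes once
  vanishes always (\<open>HS_positive\<close>).  Summation over a countable decomposition of the space and
  polarization show that \<open>\<mu>(t) g\<close> has the defining property of \<open>g\<^sub>t\<close>, so \<open>c(t) = 1 / \<mu>(t)\<close>.  The converse
  implication only needs a convergent sequence of times.

  Three ingredients carry this argument.  The Hilbert--Schmidt norms are finite for small \<open>A\<close>, by
  Caccioppoli's inequality and Tonelli's theorem (\<open>local_energy_finite\<close>).  The parallelogram identity of
  the Cheeger energy localizes (\<open>D_parallelogram\<close>); therefore \<open>\<langle>\<nabla>f, \<nabla>h\<rangle>\<close> is almost everywhere a bilinear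
  form, given by a Gram matrix on finitely many functions (\<open>G_gram\<close>).  Finally the modules of forms and
  tensors are completions in measure (\<open>L0_completion\<close>), in which the canonical metric pairs with
  \<open>\<omega> \<otimes> \<eta>\<close> to \<open>\<langle>\<omega>, \<eta>\<rangle>\<close> (\<open>canonical_tensor_prod\<close>).
\<close>

section \<open>The Hilbert space of square integrable functions\<close>

abbreviation rcp :: "nat => real" where "rcp n == inverse (real (Suc n))"

definition ip :: "'a measure => ('a => real) => ('a => real) => real" where
 "ip m f g = (LINT x|m. f x * g x)"

definition lnorm :: "'a measure => ('a => real) => real" where
 "lnorm m f = sqrt (LINT x|m. (f x)^2)"

lemma L2_measurable [measurable_dest]: "f : L2 m ==> f : borel_measurable m"
 by (simp add: L2_def)

lemma L2_sq_integrable: "f : L2 m ==> integrable m (%x. (f x)^2)"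
 by (simp add: L2_def)

lemma L2_integrable_mult:
 assumes "f : L2 m" "g : L2 m" shows "integrable m (%x. f x * g x)"
proof (rule Bochner_Integration.integrable_bound)
 show "integrable m (%x. (f x)^2 + (g x)^2)"
  using assms by (intro Bochner_Integration.integrable_add) (auto simp: L2_def)
 show "(%x. f x * g x) : borel_measurable m" using assms by (auto simp: L2_def)
 show "AE x in m. norm (f x * g x) <= norm ((f x)^2 + (g x)^2)"
 proof (rule AE_I2)
  fix x
  have "2 * (abs (f x) * abs (g x)) <= abs (f x)^2 + abs (g x)^2"
   using sum_squares_bound[of "abs (f x)" "abs (g x)"] by simp
  moreover have "0 <= abs (f x) * abs (g x)" by simp
  ultimately have "abs (f x) * abs (g x) <= (f x)^2 + (g x)^2" unfolding power2_abs by linarith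
  then show "norm (f x * g x) <= norm ((f x)^2 + (g x)^2)" by (simp add: abs_mult)
 qed
qed

lemma L2_add [intro]:
 assumes "f : L2 m" "g : L2 m" shows "(%x. f x + g x) : L2 m"
proof -
 have "integrable m (%x. (f x)^2 + (g x)^2 + 2 * (f x * g x))"
  using assms L2_integrable_mult[OF assms]
  by (intro Bochner_Integration.integrable_add integrable_mult_right) (auto simp: L2_def)
 then show ?thesis using assms by (auto simp: L2_def power2_sum mult.assoc intro!: borel_measurable_add)
qed

lemma L2_cmult [intro]: "f : L2 m ==> (%x. c * f x) : L2 m"
 by (auto simp: L2_def power_mult_distrib intro!: borel_measurable_times)

lemma L2_diff [intro]: "f : L2 m ==> g : L2 m ==> (%x. f x - g x) : L2 m"
 using L2_add[of f m "%x. - 1 * g x"] L2_cmult[of g m "-1"] by simp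

lemma L2_uminus [intro]: "f : L2 m ==> (%x. - f x) : L2 m"
 using L2_cmult[of f m "-1"] by simp

lemma L2_zero [simp, intro]: "(%x. 0) : L2 m"
 by (simp add: L2_def)

lemma L2_abs [intro]: "f : L2 m ==> (%x. abs (f x)) : L2 m"
 by (auto simp: L2_def intro!: borel_measurable_abs)

lemma L2_bound:
 assumes "g : L2 m" "f : borel_measurable m" "AE x in m. abs (f x) <= abs (g x)"
 shows "f : L2 m"
proof -
 have "integrable m (%x. (f x)^2)"
 proof (rule Bochner_Integration.integrable_bound[OF L2_sq_integrable[OF assms(1)]])
  show "AE x in m. norm ((f x)^2) <= norm ((g x)^2)"
   using assms(3) by eventually_elim (simp add: abs_le_square_iff)
 qed (use assms in simp)
 then show ?thesis using assms by (simp add: L2_def)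
qed

lemma L2_AE_cong:
 assumes "f : L2 m" "g : borel_measurable m" "AE x in m. f x = g x"
 shows "g : L2 m"
 by (rule L2_bound[OF assms(1,2)]) (use assms(3) in eventually_elim, simp)

lemma L2_bounded_mult:
 assumes "f : L2 m" "g : borel_measurable m" "AE x in m. abs (g x) <= C"
 shows "(%x. g x * f x) : L2 m"
proof (rule L2_bound[of "%x. C * f x"])
 show "AE x in m. abs (g x * f x) <= abs (C * f x)"
  using assms(3) by eventually_elim (simp add: abs_mult mult_right_mono)
qed (use assms in "auto simp: L2_def power_mult_distrib")

lemma ip_commute: "ip m f g = ip m g f"
 by (simp add: ip_def mult.commute)

lemma ip_add_left:
 assumes "f : L2 m" "g : L2 m" "h : L2 m"
 shows "ip m (%x. f x + g x) h = ip m f h + ip m g h"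
 unfolding ip_def using L2_integrable_mult[OF assms(1,3)] L2_integrable_mult[OF assms(2,3)]
 by (simp add: distrib_right)

lemma ip_diff_left:
 assumes "f : L2 m" "g : L2 m" "h : L2 m"
 shows "ip m (%x. f x - g x) h = ip m f h - ip m g h"
 unfolding ip_def using L2_integrable_mult[OF assms(1,3)] L2_integrable_mult[OF assms(2,3)]
 by (simp add: left_diff_distrib)

lemma ip_cmult_left: "ip m (%x. c * f x) h = c * ip m f h"
 by (simp add: ip_def mult.assoc)

lemma ip_add_right:
 assumes "f : L2 m" "g : L2 m" "h : L2 m"
 shows "ip m h (%x. f x + g x) = ip m h f + ip m h g"
 using ip_add_left[OF assms] by (simp add: ip_commute)

lemma ip_diff_right:
 assumes "f : L2 m" "g : L2 m" "h : L2 m"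
 shows "ip m h (%x. f x - g x) = ip m h f - ip m h g"
 using ip_diff_left[OF assms] by (simp add: ip_commute)

lemma ip_cmult_right: "ip m h (%x. c * f x) = c * ip m h f"
 using ip_cmult_left[of m c f h] by (simp add: ip_commute)

lemma ip_cong_AE:
 assumes "AE x in m. f x = f' x" "AE x in m. g x = g' x"
  "f : borel_measurable m" "f' : borel_measurable m" "g : borel_measurable m" "g' : borel_measurable m"
 shows "ip m f g = ip m f' g'"
 unfolding ip_def by (rule integral_cong_AE) (use assms in "auto elim: AE_mp")

lemma lnorm_cong_AE:
 assumes "AE x in m. f x = f' x" "f : borel_measurable m" "f' : borel_measurable m"
 shows "lnorm m f = lnorm m f'"
 unfolding lnorm_def by (rule arg_cong[where f=sqrt], rule integral_cong_AE) (use assms in "auto elim: AE_mp")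

lemma lnorm_nonneg [simp]: "0 <= lnorm m f"
 by (simp add: lnorm_def)

lemma lnorm_sq: "(lnorm m f)^2 = (LINT x|m. (f x)^2)"
 by (simp add: lnorm_def)

lemma ip_self: "ip m f f = (lnorm m f)^2"
 unfolding lnorm_sq ip_def by (simp add: power2_eq_square)

lemma lnorm_zero [simp]: "lnorm m (%x. 0) = 0"
 by (simp add: lnorm_def)

lemma lnorm_cmult: "lnorm m (%x. c * f x) = abs c * lnorm m f"
 by (simp add: lnorm_def power_mult_distrib real_sqrt_mult)

lemma lnorm_uminus [simp]: "lnorm m (%x. - f x) = lnorm m f"
 by (simp add: lnorm_def)

lemma lnorm_abs [simp]: "lnorm m (%x. abs (f x)) = lnorm m f"
 by (simp add: lnorm_def)

lemma lnorm_minus_commute: "lnorm m (%x. f x - g x) = lnorm m (%x. g x - f x)"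
 by (simp add: lnorm_def power2_commute)

lemma nn_integral_sq: "f : L2 m ==> (\<integral>\<^sup>+x. ennreal ((f x)^2) \<partial>m) = ennreal ((lnorm m f)^2)"
 by (simp add: lnorm_sq L2_def nn_integral_eq_integral)

lemma lnorm_sum_sq:
 assumes "f : L2 m" "g : L2 m"
 shows "(lnorm m (%x. f x + g x))^2 = (lnorm m f)^2 + 2 * ip m f g + (lnorm m g)^2"
 using assms by (simp add: ip_self[symmetric] ip_add_left ip_add_right L2_add ip_commute)

lemma lnorm_diff_sq:
 assumes "f : L2 m" "g : L2 m"
 shows "(lnorm m (%x. f x - g x))^2 = (lnorm m f)^2 - 2 * ip m f g + (lnorm m g)^2"
 using assms by (simp add: ip_self[symmetric] ip_diff_left ip_diff_right L2_diff ip_commute)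

lemma L2_CS:
 assumes f: "f : L2 m" and g: "g : L2 m"
 shows "abs (ip m f g) <= lnorm m f * lnorm m g"
proof -
 have q: "0 <= (lnorm m f)^2 - 2 * t * ip m f g + t^2 * (lnorm m g)^2" for t
  using lnorm_diff_sq[OF f L2_cmult[OF g, of t]] zero_le_power2[of "lnorm m (%x. f x - t * g x)"]
  by (simp add: ip_cmult_right lnorm_cmult power_mult_distrib)
 have "(ip m f g)^2 <= (lnorm m f)^2 * (lnorm m g)^2"
 proof (cases "lnorm m g = 0")
  case True
  have "ip m f g = 0"
  proof (rule ccontr)
   assume "ip m f g ~= 0"
   then show False using q[of "((lnorm m f)^2 + 1) / (2 * ip m f g)"] True by simp
  qed
  then show ?thesis by simp
 next
  case False
  then have "(lnorm m g)^2 > 0" by simp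
  have "0 <= ((lnorm m f)^2 - 2 * (ip m f g / (lnorm m g)^2) * ip m f g
    + (ip m f g / (lnorm m g)^2)^2 * (lnorm m g)^2) * (lnorm m g)^2"
   using q[of "ip m f g / (lnorm m g)^2"] by simp
  also have "\<dots> = (lnorm m f)^2 * (lnorm m g)^2 - (ip m f g)^2"
   using False by (simp add: field_simps power2_eq_square)
  finally show ?thesis by simp
 qed
 then have "(ip m f g)^2 <= (lnorm m f * lnorm m g)^2" by (simp add: power_mult_distrib)
 then show ?thesis by (metis abs_le_square_iff abs_of_nonneg lnorm_nonneg mult_nonneg_nonneg)
qed

lemma lnorm_triangle:
 assumes f: "f : L2 m" and g: "g : L2 m"
 shows "lnorm m (%x. f x + g x) <= lnorm m f + lnorm m g"
proof (rule power2_le_imp_le)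
 show "(lnorm m (%x. f x + g x))^2 <= (lnorm m f + lnorm m g)^2"
  using L2_CS[OF f g] by (simp add: lnorm_sum_sq[OF f g] power2_sum)
qed simp

lemma lnorm_triangle_diff:
 assumes "f : L2 m" "g : L2 m" "h : L2 m"
 shows "lnorm m (%x. f x - h x) <= lnorm m (%x. f x - g x) + lnorm m (%x. g x - h x)"
 using lnorm_triangle[of "%x. f x - g x" m "%x. g x - h x"] assms by (simp add: L2_diff)

lemma lnorm_diff_le:
 assumes "f : L2 m" "g : L2 m"
 shows "abs (lnorm m f - lnorm m g) <= lnorm m (%x. f x - g x)"
 using lnorm_triangle[of "%x. f x - g x" m g] lnorm_triangle[of "%x. g x - f x" m f] assms
 by (simp add: L2_diff lnorm_minus_commute[of m g f] abs_le_iff)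

lemma lnorm_mono_AE:
 assumes "g : L2 m" "f : borel_measurable m" "AE x in m. abs (f x) <= abs (g x)"
 shows "lnorm m f <= lnorm m g"
proof -
 have "f : L2 m" by (rule L2_bound[OF assms])
 then show ?thesis unfolding lnorm_def using assms
  by (intro real_sqrt_le_mono integral_mono_AE)
    (auto simp: L2_def abs_le_square_iff)
qed

lemma lnorm_eq_0_AE: "f : L2 m ==> lnorm m f = 0 ==> AE x in m. f x = 0"
 using integral_nonneg_eq_0_iff_AE[of m "%x. (f x)^2"] by (simp add: lnorm_def L2_def)

lemma L2_tendsto_lnorm: "L2_tendsto m F f \<F> \<longleftrightarrow> ((%i. lnorm m (%x. F i x - f x)) \<longlongrightarrow> 0) \<F>"
proof
 assume "L2_tendsto m F f \<F>"
 then show "((%i. lnorm m (%x. F i x - f x)) \<longlongrightarrow> 0) \<F>"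
  using tendsto_real_sqrt[of "%i. \<integral>x. (F i x - f x)^2 \<partial>m" 0] by (simp add: L2_tendsto_def lnorm_def)
next
 assume "((%i. lnorm m (%x. F i x - f x)) \<longlongrightarrow> 0) \<F>"
 from tendsto_power[OF this, of 2] show "L2_tendsto m F f \<F>"
  by (simp add: L2_tendsto_def lnorm_sq)
qed

lemma L2_tendsto_le:
 assumes "\<forall>\<^sub>F i in \<F>. lnorm m (%x. F i x - f x) <= e i" "(e \<longlongrightarrow> 0) \<F>"
 shows "L2_tendsto m F f \<F>"
 unfolding L2_tendsto_lnorm
 by (rule tendsto_sandwich[OF _ assms(1) tendsto_const assms(2)]) simp

lemma L2_tendsto_add:
 assumes "L2_tendsto m F f \<F>" "L2_tendsto m G g \<F>"
  "\<forall>\<^sub>F i in \<F>. F i : L2 m" "\<forall>\<^sub>F i in \<F>. G i : L2 m" "f : L2 m" "g : L2 m"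
 shows "L2_tendsto m (%i x. F i x + G i x) (%x. f x + g x) \<F>"
proof (rule L2_tendsto_le)
 show "\<forall>\<^sub>F i in \<F>. lnorm m (%x. (F i x + G i x) - (f x + g x)) <=
    lnorm m (%x. F i x - f x) + lnorm m (%x. G i x - g x)"
  using assms(3,4)
 proof eventually_elim
  case (elim i)
  then show ?case using lnorm_triangle[of "%x. F i x - f x" m "%x. G i x - g x"] assms(5,6)
   by (simp add: L2_diff algebra_simps)
 qed
 show "((%i. lnorm m (%x. F i x - f x) + lnorm m (%x. G i x - g x)) \<longlongrightarrow> 0) \<F>"
  using tendsto_add[OF assms(1,2)[unfolded L2_tendsto_lnorm]] by simp
qed

lemma L2_tendsto_cmult:
 assumes "L2_tendsto m F f \<F>"
 shows "L2_tendsto m (%i x. c * F i x) (%x. c * f x) \<F>"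
proof -
 have "lnorm m (%x. c * F i x - c * f x) = abs c * lnorm m (%x. F i x - f x)" for i
  using lnorm_cmult[of m c "%x. F i x - f x"] by (simp add: right_diff_distrib)
 then show ?thesis using assms tendsto_mult_right_zero[of "%i. lnorm m (%x. F i x - f x)" \<F> "abs c"]
  by (simp add: L2_tendsto_lnorm)
qed

lemma L2_tendsto_const: "L2_tendsto m (%i. f) f \<F>"
 by (simp add: L2_tendsto_def)

lemma L2_tendsto_ip:
 assumes "L2_tendsto m F f \<F>" "L2_tendsto m G g \<F>"
  "\<forall>\<^sub>F i in \<F>. F i : L2 m" "\<forall>\<^sub>F i in \<F>. G i : L2 m" "f : L2 m" "g : L2 m"
 shows "((%i. ip m (F i) (G i)) \<longlongrightarrow> ip m f g) \<F>"
proof -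
 define a where "a i = lnorm m (%x. F i x - f x)" for i
 define b where "b i = lnorm m (%x. G i x - g x)" for i
 have "((%i. a i * (b i + lnorm m g) + lnorm m f * b i) \<longlongrightarrow> 0 * (0 + lnorm m g) + lnorm m f * 0) \<F>"
  using assms(1,2) by (intro tendsto_intros) (auto simp: L2_tendsto_lnorm a_def b_def)
 then have lim: "((%i. a i * (b i + lnorm m g) + lnorm m f * b i) \<longlongrightarrow> 0) \<F>" by simp
 have "\<forall>\<^sub>F i in \<F>. norm (ip m (F i) (G i) - ip m f g) <= a i * (b i + lnorm m g) + lnorm m f * b i"
  using assms(3,4)
 proof eventually_elim
  case (elim i)
  have "ip m (F i) (G i) - ip m f g = ip m (%x. F i x - f x) (G i) + ip m f (%x. G i x - g x)"
   using elim assms by (simp add: ip_diff_left ip_diff_right)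
  moreover have "abs (ip m (%x. F i x - f x) (G i)) <= a i * lnorm m (G i)"
   unfolding a_def using elim assms by (intro L2_CS) auto
  moreover have "abs (ip m f (%x. G i x - g x)) <= lnorm m f * b i"
   unfolding b_def using elim assms by (intro L2_CS) auto
  moreover have "lnorm m (G i) <= b i + lnorm m g"
   using lnorm_diff_le[of "G i" m g] elim assms by (simp add: b_def)
  moreover have "a i * lnorm m (G i) <= a i * (b i + lnorm m g)"
   using calculation(4) by (intro mult_left_mono) (auto simp: a_def)
  ultimately show ?case by simp
 qed
 from Lim_null_comparison[OF this lim] show ?thesis
  by (simp add: LIM_zero_iff)
qed

lemma L2_tendsto_norm:
 assumes "L2_tendsto m F f \<F>" "\<forall>\<^sub>F i in \<F>. F i : L2 m" "f : L2 m"
 shows "((%i. lnorm m (F i)) \<longlongrightarrow> lnorm m f) \<F>"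
proof -
 have "\<forall>\<^sub>F i in \<F>. norm (lnorm m (F i) - lnorm m f) <= lnorm m (%x. F i x - f x)"
  using assms(2) by eventually_elim (use lnorm_diff_le assms(3) in auto)
 from Lim_null_comparison[OF this assms(1)[unfolded L2_tendsto_lnorm]] show ?thesis
  by (simp add: LIM_zero_iff)
qed

lemma L2_tendsto_AE_subseq:
 assumes "L2_tendsto m F f sequentially" "!!i. F i : L2 m" "f : L2 m"
 shows "EX r::nat=>nat. strict_mono r & (AE x in m. (%n. F (r n) x) \<longlonglongrightarrow> f x)"
proof -
 have "!!n. integrable m (%x. (F n x - f x)^2)"
  by (intro L2_sq_integrable L2_diff assms)
 from tendsto_L1_AE_subseq[of m "%n x. (F n x - f x)^2", OF this] assms(1)
 obtain r :: "nat=>nat" where r: "strict_mono r" "AE x in m. (%n. (F (r n) x - f x)^2) \<longlonglongrightarrow> 0"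
  unfolding L2_tendsto_def real_norm_def abs_power2 by blast
 have "AE x in m. (%n. F (r n) x) \<longlonglongrightarrow> f x"
  using r(2) by eventually_elim (simp add: LIM_zero_iff)
 with r(1) show ?thesis by blast
qed

lemma L2_Fatou:
 assumes G: "!!j. G j : L2 m" and g: "g : borel_measurable m"
  and lim: "AE x in m. (%j. G j x) \<longlonglongrightarrow> g x" and bd: "!!j. lnorm m (G j) <= C"
 shows "g : L2 m" "lnorm m g <= C"
proof -
 have [measurable]: "G j : borel_measurable m" for j using G by (simp add: L2_def)
 have C: "0 <= C" using bd[of 0] lnorm_nonneg[of m "G 0"] by linarith
 have "(\<integral>\<^sup>+x. ennreal ((g x)^2) \<partial>m) = (\<integral>\<^sup>+x. liminf (%j. ennreal ((G j x)^2)) \<partial>m)"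
 proof (rule nn_integral_cong_AE)
  show "AE x in m. ennreal ((g x)^2) = liminf (%j. ennreal ((G j x)^2))"
   using lim
  proof eventually_elim
   case (elim x)
   then have "(%j. ennreal ((G j x)^2)) \<longlonglongrightarrow> ennreal ((g x)^2)"
    by (intro tendsto_ennrealI tendsto_power)
   from lim_imp_Liminf[OF _ this] show ?case by simp
  qed
 qed
 also have "\<dots> <= liminf (%j. \<integral>\<^sup>+x. ennreal ((G j x)^2) \<partial>m)"
  by (rule nn_integral_liminf) simp
 also have "\<dots> <= liminf (%j::nat. ennreal (C^2))"
  using power_mono[OF bd lnorm_nonneg, of _ 2]
  by (intro Liminf_mono always_eventually allI) (simp only: nn_integral_sq[OF G] ennreal_leI)
 finally have le: "(\<integral>\<^sup>+x. ennreal ((g x)^2) \<partial>m) <= ennreal (C^2)" by (simp add: Liminf_const)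
 have "(\<integral>\<^sup>+x. ennreal ((g x)^2) \<partial>m) < \<infinity>"
  using le le_less_trans ennreal_less_top by fastforce
 then have "integrable m (%x. (g x)^2)"
  using g by (intro integrableI_nonneg) auto
 then show 1: "g : L2 m" using g by (simp add: L2_def)
 have "ennreal ((lnorm m g)^2) <= ennreal (C^2)" using le nn_integral_sq[OF 1] by simp
 then show "lnorm m g <= C" using C by (simp add: power2_le_iff_abs_le)
qed

lemma fast_subseq:
 assumes "!!k. \<forall>\<^sub>F n in sequentially. Q k n" shows "EX r::nat=>nat. strict_mono r & (ALL k. Q k (r k))"
proof -
 have "EX r. ALL k. Q k (r k) & r k < r (Suc k)"
 proof (rule dependent_nat_choice)
  show "EX n. Q 0 n" using assms[of 0] by (auto simp: eventually_sequentially)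
  show "EX y. Q (Suc k) y & n < y" for n k
   using eventually_conj[OF assms[of "Suc k"] eventually_gt_at_top[of n]] by (auto simp: eventually_sequentially)
 qed
 then show ?thesis by (auto simp: strict_mono_Suc_iff)
qed

lemma convergent_telescope:
 fixes f :: "nat => real"
 assumes "summable (%k. f (Suc k) - f k)" shows "convergent f"
proof -
 have "convergent (%n. f n - f 0)" using assms unfolding summable_iff_convergent sum_lessThan_telescope .
 then show ?thesis using convergent_add[of "%n. f n - f 0" "%n. f 0"] by (simp add: convergent_const)
qed

text \<open>Along a subsequence with increments of norm at most \<open>2\<^sup>-\<^sup>k\<close> the sum of \<open>2\<^sup>k\<close> times the squared increments is
  integrable, which gives convergence almost everywhere.  Fatou's lemma turns it into convergence in norm.\<close>

lemma L2_complete: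
 assumes F: "!!n. F n : L2 m"
  and cau: "!!e. e > 0 ==> EX N. ALL i>=N. ALL j>=N. lnorm m (%x. F i x - F j x) < e"
 shows "EX f:L2 m. L2_tendsto m F f sequentially"
proof -
 have [measurable]: "F n : borel_measurable m" for n using F by (simp add: L2_def)
 let ?Q = "%k N. ALL i>=N. ALL j>=N. lnorm m (%x. F i x - F j x) < (1/2)^k"
 have "\<forall>\<^sub>F N in sequentially. ?Q k N" for k
 proof -
  obtain N where "?Q k N" using cau[of "(1/2)^k"] by auto
  then show ?thesis unfolding eventually_sequentially by (meson order_trans)
 qed
 from fast_subseq[of ?Q, OF this] obtain r where sm: "strict_mono r"
  and r: "!!k i j. i >= r k ==> j >= r k ==> lnorm m (%x. F i x - F j x) < (1/2)^k" by blast
 define u where "u k x = F (r (Suc k)) x - F (r k) x" for k x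
 have uL: "u k : L2 m" for k unfolding u_def by (intro L2_diff F)
 have [measurable]: "u k : borel_measurable m" for k using uL by (simp add: L2_def)
 have "(\<integral>\<^sup>+x. (\<Sum>k. ennreal (2^k * (u k x)^2)) \<partial>m) = (\<Sum>k. \<integral>\<^sup>+x. ennreal (2^k * (u k x)^2) \<partial>m)"
  by (rule nn_integral_suminf) simp
 also have "\<dots> <= (\<Sum>k. ennreal ((1/2)^k))"
 proof (rule suminf_le)
  fix k
  have "lnorm m (u k) < (1/2)^k" unfolding u_def using sm by (intro r) (auto simp: strict_mono_Suc_iff less_imp_le)
  then have "(lnorm m (u k))^2 <= ((1/2)^k)^2" by (intro power_mono) auto
  then have "2^k * (lnorm m (u k))^2 <= 2^k * ((1/2)^k)^2" by simp
  also have "\<dots> = (1/2)^k" by (simp add: power2_eq_square flip: power_mult_distrib)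
  finally have le: "2^k * (lnorm m (u k))^2 <= (1/2)^k" .
  have "(\<integral>\<^sup>+x. ennreal (2^k * (u k x)^2) \<partial>m) = (\<integral>\<^sup>+x. ennreal (2^k) * ennreal ((u k x)^2) \<partial>m)"
   by (intro nn_integral_cong ennreal_mult) auto
  also have "\<dots> = ennreal (2^k) * (\<integral>\<^sup>+x. ennreal ((u k x)^2) \<partial>m)" by (rule nn_integral_cmult) simp
  also have "\<dots> = ennreal (2^k * (lnorm m (u k))^2)" unfolding nn_integral_sq[OF uL] by (rule ennreal_mult[symmetric]) auto
  also have "\<dots> <= ennreal ((1/2)^k)" by (rule ennreal_leI[OF le])
  finally show "(\<integral>\<^sup>+x. ennreal (2^k * (u k x)^2) \<partial>m) <= ennreal ((1/2)^k)" .
 qed auto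
 finally have le: "(\<integral>\<^sup>+x. (\<Sum>k. ennreal (2^k * (u k x)^2)) \<partial>m) <= (\<Sum>k. ennreal ((1/2)^k))" .
 have "(\<Sum>k. ennreal ((1/2::real)^k)) ~= top" by (rule ennreal_suminf_neq_top) (auto intro!: summable_geometric)
 with le have "(\<integral>\<^sup>+x. (\<Sum>k. ennreal (2^k * (u k x)^2)) \<partial>m) ~= \<infinity>" unfolding infinity_ennreal_def by (metis top_unique)
 then have "AE x in m. (\<Sum>k. ennreal (2^k * (u k x)^2)) ~= \<infinity>" by (rule nn_integral_PInf_AE[rotated]) measurable
 then have conv: "AE x in m. convergent (%k. F (r k) x)"
 proof eventually_elim
  case (elim x)
  then have "summable (%k. 2^k * (u k x)^2)" by (intro summable_suminf_not_top) auto
  from summable_add[OF summable_geometric[of "1/2::real"] this] have s: "summable (%k. (1/2)^k + 2^k * (u k x)^2)" by simp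
  have "norm (u k x) <= (1/2)^k + 2^k * (u k x)^2" for k
  proof (cases "abs (u k x) <= (1/2)^k")
   case False
   then have "1 <= 2^k * abs (u k x)" by (simp add: power_one_over field_simps)
   from mult_right_mono[OF this, of "abs (u k x)"] have "abs (u k x) <= 2^k * (u k x)^2" by (simp add: power2_eq_square mult.assoc)
   then show ?thesis by (simp add: add_increasing)
  qed (simp add: add_increasing2)
  from summable_comparison_test'[OF s this] show ?case unfolding u_def by (rule convergent_telescope)
 qed
 define f where "f x = lim (%k. F (r k) x)" for x
 have f[measurable]: "f : borel_measurable m" unfolding f_def by (rule borel_measurable_lim_metric) simp
 have flim: "AE x in m. (%k. F (r k) x) \<longlonglongrightarrow> f x" using conv by eventually_elim (simp add: f_def convergent_LIMSEQ_iff)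
 have key: "(%x. F i x - f x) : L2 m & lnorm m (%x. F i x - f x) <= (1/2)^k" if "i >= r k" for i k
 proof -
  have b: "lnorm m (%x. F i x - F (r (k + j)) x) <= (1/2)^k" for j
   using r[OF that, of "r (k+j)"] sm by (simp add: strict_mono_less_eq less_imp_le)
  have "AE x in m. (%j. F i x - F (r (k + j)) x) \<longlonglongrightarrow> F i x - f x"
   using flim
  proof eventually_elim
   case (elim x)
   from LIMSEQ_ignore_initial_segment[OF elim, of k] show ?case
    by (intro tendsto_intros) (simp add: add.commute)
  qed
  from L2_Fatou[OF _ _ this b] show ?thesis using F by auto
 qed
 have fL: "f : L2 m"
  using L2_diff[OF F[of "r 0"], of "%x. F (r 0) x - f x"] key[of 0 "r 0"] by simp
 have "L2_tendsto m F f sequentially"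
  unfolding L2_tendsto_lnorm
 proof (rule LIMSEQ_I)
  fix e :: real assume "e > 0"
  then obtain k where "(1/2::real)^k < e" using real_arch_pow_inv[of e "1/2"] by auto
  then show "EX no. ALL n>=no. norm (lnorm m (%x. F n x - f x) - 0) < e"
   using key[of k] by (intro exI[of _ "r k"]) fastforce
 qed
 with fL show ?thesis by blast
qed

text \<open>Almost minimizers of the norm are close to each other by the parallelogram law; it is
  enough that the midpoint of two elements is dominated in norm by some element.  A decreasing sequence of
  sets is needed for the Cheeger energy, which is a relaxation.\<close>

lemma L2_min_seq:
 assumes CL: "!!n. C n \<subseteq> L2 m" and dec: "!!n. C (Suc n) \<subseteq> C n"
  and mid: "!!n f g. f : C n ==> g : C n ==> EX h:C n. lnorm m h <= lnorm m (%x. (f x + g x) / 2)"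
  and bd: "!!n. EX g:C n. lnorm m g <= M"
 shows "EX p c. p : L2 m & (ALL n. c n : C n) & L2_tendsto m c p sequentially &
  (ALL M'. (ALL n. EX g:C n. lnorm m g <= M') --> lnorm m p <= M')"
proof -
 define d where "d n = Inf ((%g. (lnorm m g)^2) ` C n)" for n :: nat
 have ne: "C n ~= {}" for n using bd[of n] by blast
 have bb: "bdd_below ((%g. (lnorm m g)^2) ` C n)" for n by (rule bdd_belowI[of _ 0]) auto
 have dle: "d n <= (lnorm m g)^2" if "g : C n" for g n
  unfolding d_def using bb that by (intro cINF_lower) auto
 have decC: "C k \<subseteq> C n" if "n <= k" for n k
  using that by (induction rule: dec_induct) (use dec in auto)
 have dmono: "d n <= d k" if "n <= k" for n k
  unfolding d_def using decC[OF that] ne bb by (intro cINF_superset_mono) auto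
 have dM: "d n <= M'^2" if M': "!!n. EX g:C n. lnorm m g <= M'" for n M'
 proof -
  obtain g where g: "g : C n" "lnorm m g <= M'" using M' by blast
  then have "(lnorm m g)^2 <= M'^2" by (intro power_mono) auto
  with dle[OF g(1)] show ?thesis by simp
 qed
 have conv: "convergent d"
 proof (rule Bseq_monoseq_convergent)
  have "0 <= d n" for n unfolding d_def by (intro cINF_greatest ne) auto
  then show "Bseq d" using dM[OF bd] by (intro BseqI'[of _ "M^2"]) auto
  show "monoseq d" using dmono by (intro monoI1) auto
 qed
 then obtain D where D: "d \<longlonglongrightarrow> D" by (auto simp: convergent_def)
 have dD: "d n <= D" for n using D dmono by (intro incseq_le) (auto simp: incseq_def)
 have "EX g:C n. (lnorm m g)^2 < d n + 1 / real (Suc n)" for n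
  using cINF_less_iff[OF ne bb, of n "d n + 1 / real (Suc n)"] by (auto simp: d_def)
 then obtain c where c: "!!n. c n : C n" "!!n. (lnorm m (c n))^2 < d n + 1 / real (Suc n)" by metis
 have cL: "c n : L2 m" for n using c(1) CL by auto
 have close: "(lnorm m (%x. c i x - c j x))^2 <= 4 * (D - d N) + 4 / real (Suc N)"
  if ij: "i >= N" "j >= N" for i j N
 proof -
  have "c i : C N" "c j : C N" using c(1) decC ij by blast+
  from mid[OF this] obtain h where h: "h : C N" "lnorm m h <= lnorm m (%x. (c i x + c j x) / 2)" by blast
  have "d N <= (lnorm m h)^2" by (rule dle[OF h(1)])
  also have "\<dots> <= (lnorm m (%x. (c i x + c j x) / 2))^2" using h(2) by (intro power_mono) auto
  also have "(%x. (c i x + c j x) / 2) = (%x. 1/2 * (c i x + c j x))" by auto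
  also have "(lnorm m (%x. 1/2 * (c i x + c j x)))^2 = (lnorm m (%x. c i x + c j x))^2 / 4"
   unfolding lnorm_cmult by (simp add: power_mult_distrib power2_eq_square)
  finally have 1: "4 * d N <= (lnorm m (%x. c i x + c j x))^2" by simp
  have 2: "(lnorm m (c k))^2 <= D + 1 / real (Suc N)" if "k >= N" for k
  proof -
   have "1 / real (Suc k) <= 1 / real (Suc N)" using that by (simp add: frac_le)
   with c(2)[of k] dD[of k] show ?thesis by linarith
  qed
  show ?thesis
   using 1 2[OF ij(1)] 2[OF ij(2)] lnorm_sum_sq[OF cL cL, of i j] lnorm_diff_sq[OF cL cL, of i j] by simp
 qed
 have lim0: "(%N. 4 * (D - d N) + 4 / real (Suc N)) \<longlonglongrightarrow> 0"
 proof -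
  have "(%N. 4 * (D - d N) + 4 * (1 / real (Suc N))) \<longlonglongrightarrow> 4 * (D - D) + 4 * 0"
   using D LIMSEQ_inverse_real_of_nat by (intro tendsto_intros) (simp_all add: inverse_eq_divide)
  then show ?thesis by simp
 qed
 have "EX p:L2 m. L2_tendsto m c p sequentially"
 proof (rule L2_complete[OF cL])
  fix e :: real assume e: "e > 0"
  then have "\<forall>\<^sub>F N in sequentially. 4 * (D - d N) + 4 / real (Suc N) < e^2"
   using order_tendstoD(2)[OF lim0, of "e^2"] by simp
  then obtain N where N: "4 * (D - d N) + 4 / real (Suc N) < e^2"
   unfolding eventually_sequentially by blast
  have "lnorm m (%x. c i x - c j x) < e" if "i >= N" "j >= N" for i j
   using close[OF that] N e by (intro power2_less_imp_less[of _ e]) auto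
  then show "EX N. ALL i>=N. ALL j>=N. lnorm m (%x. c i x - c j x) < e" by blast
 qed
 then obtain p where p: "p : L2 m" "L2_tendsto m c p sequentially" by blast
 have "lnorm m p <= M'" if M': "!!n. EX g:C n. lnorm m g <= M'" for M'
 proof -
  have "0 <= M'" using M'[of 0] by (meson lnorm_nonneg order_trans)
  have "(%n. (lnorm m (c n))^2) \<longlonglongrightarrow> (lnorm m p)^2"
   using L2_tendsto_norm[OF p(2) _ p(1)] cL by (intro tendsto_power) auto
  moreover have "(%n. M'^2 + 1 / real (Suc n)) \<longlonglongrightarrow> M'^2 + 0"
   using LIMSEQ_inverse_real_of_nat by (intro tendsto_intros) (simp_all add: inverse_eq_divide)
  ultimately have "(lnorm m p)^2 <= M'^2 + 0"
  proof (rule LIMSEQ_le)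
   show "EX N. ALL n>=N. (lnorm m (c n))^2 <= M'^2 + 1 / real (Suc n)"
    using c(2) dM[OF M'] by (meson add_mono_thms_linordered_semiring(3) less_imp_le order_trans)
  qed
  with \<open>0 <= M'\<close> show ?thesis by (simp add: power2_le_iff_abs_le)
 qed
 with p c show ?thesis by blast
qed

text \<open>The variational inequality is the first order condition for moving from the minimizer towards \<open>g\<close>.\<close>

lemma L2_min_norm:
 assumes CL: "C \<subseteq> L2 m" and ne: "C ~= {}"
  and conv: "!!f g t. f : C ==> g : C ==> 0 <= t ==> t <= 1 ==> (%x. (1 - t) * f x + t * g x) : C"
 shows "EX p c. p : L2 m & (ALL n::nat. c n : C) & L2_tendsto m c p sequentially &
  (ALL g:C. (lnorm m p)^2 <= ip m p g)"
proof -
 obtain g0 where g0: "g0 : C" using ne by blast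
 have mid: "EX h:C. lnorm m h <= lnorm m (%x. (f x + g x) / 2)" if "f : C" "g : C" for f g
  by (rule bexI[OF _ conv[OF that, of "1/2"]]) (auto simp: add_divide_distrib)
 obtain p c where p: "p : L2 m" "!!n::nat. c n : C" "L2_tendsto m c p sequentially"
  and min: "!!M'. EX g:C. lnorm m g <= M' ==> lnorm m p <= M'"
  using L2_min_seq[of "%n. C" m "lnorm m g0", OF CL _ mid] g0 by blast
 have "(lnorm m p)^2 <= ip m p g" if g: "g : C" for g
 proof -
  have gL: "g : L2 m" and cL: "!!n. c n : L2 m" using g p CL by auto
  have le: "(lnorm m p)^2 <= (lnorm m (%x. (1 - t) * p x + t * g x))^2" if t: "0 <= t" "t <= 1" for t
  proof -
   have "L2_tendsto m (%n x. (1 - t) * c n x + t * g x) (%x. (1 - t) * p x + t * g x) sequentially"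
    by (intro L2_tendsto_add L2_tendsto_cmult p L2_tendsto_const always_eventually allI L2_cmult gL cL)
   then have "(%n. lnorm m (%x. (1 - t) * c n x + t * g x)) \<longlonglongrightarrow> lnorm m (%x. (1 - t) * p x + t * g x)"
    by (rule L2_tendsto_norm) (intro always_eventually allI L2_add L2_cmult gL cL p)+
   then have "lnorm m p <= lnorm m (%x. (1 - t) * p x + t * g x)"
    by (rule LIMSEQ_le_const) (use min conv[OF p(2) g t] in blast)
   then show ?thesis by (intro power_mono) auto
  qed
  define a where "a = (lnorm m p)^2"
  define k where "k = (lnorm m (%x. g x - p x))^2"
  have ineq: "0 <= 2 * (ip m p g - a) + t * k" if t: "0 < t" "t <= 1" for t
  proof -
   have "(%x. (1 - t) * p x + t * g x) = (%x. p x + t * (g x - p x))" by (auto simp: algebra_simps)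
   then have "a <= (lnorm m (%x. p x + t * (g x - p x)))^2" using le[of t] t by (simp add: a_def)
   also have "\<dots> = a + 2 * t * (ip m p g - a) + t^2 * k"
    using p(1) gL lnorm_sum_sq[of p m "%x. t * (g x - p x)"]
    by (simp add: L2_cmult L2_diff ip_cmult_right ip_diff_right ip_self a_def k_def lnorm_cmult power_mult_distrib)
   finally have "0 <= t * (2 * (ip m p g - a) + t * k)" by (simp add: algebra_simps power2_eq_square)
   then show ?thesis using t by (simp add: zero_le_mult_iff)
  qed
  have "((%t. 2 * (ip m p g - a) + t * k) \<longlongrightarrow> 2 * (ip m p g - a) + 0 * k) (at_right 0)"
   by (intro tendsto_intros)
  moreover have "\<forall>\<^sub>F t in at_right (0::real). 0 <= 2 * (ip m p g - a) + t * k"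
   using eventually_at_right_real[OF zero_less_one] by eventually_elim (use ineq in auto)
  ultimately have "0 <= 2 * (ip m p g - a) + 0 * k"
   by (rule tendsto_lowerbound) simp
  then show ?thesis by (simp add: a_def)
 qed
 with p show ?thesis by blast
qed

text \<open>Let \<open>p\<close> be the nearest point, translated by the weak limit \<open>g\<close>.  Its variational inequality survives the
  weak limit and says \<open>|p|\<^sup>2 \<le> 0\<close>.\<close>

lemma L2_Mazur:
 assumes CL: "C \<subseteq> L2 m"
  and conv: "!!f g t. f : C ==> g : C ==> 0 <= t ==> t <= 1 ==> (%x. (1 - t) * f x + t * g x) : C"
  and h: "\<forall>\<^sub>F i in sequentially. h i : C" and g: "g : L2 m"
  and weak: "!!\<phi>. \<phi> : L2 m ==> (%i. ip m (h i) \<phi>) \<longlonglongrightarrow> ip m g \<phi>"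
  and e: "e > 0"
 shows "EX c:C. lnorm m (%x. c x - g x) < e"
proof -
 define C' where "C' = (%c x. c x - g x) ` C"
 have 1: "C' \<subseteq> L2 m" using CL g by (auto simp: C'_def)
 have 2: "C' ~= {}" using h by (auto simp: C'_def eventually_sequentially)
 have 3: "(%x. (1 - t) * f' x + t * g' x) : C'" if fg: "f' : C'" "g' : C'" and t: "0 <= t" "t <= 1" for f' g' t
 proof -
  obtain f0 g0 where "f0 : C" "f' = (%x. f0 x - g x)" "g0 : C" "g' = (%x. g0 x - g x)"
   using fg by (auto simp: C'_def)
  then show ?thesis unfolding C'_def using conv[of f0 g0 t] t
   by (intro image_eqI[where x="%x. (1 - t) * f0 x + t * g0 x"]) (auto simp: algebra_simps)
 qed
 obtain p c where p: "p : L2 m" "!!n::nat. c n : C'" "L2_tendsto m c p sequentially"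
  and var: "!!g. g : C' ==> (lnorm m p)^2 <= ip m p g"
  using L2_min_norm[OF 1 2 3] by blast
 have "(%i. ip m (h i) p - ip m g p) \<longlonglongrightarrow> ip m g p - ip m g p"
  by (intro tendsto_intros weak p)
 moreover have "\<forall>\<^sub>F i in sequentially. (lnorm m p)^2 <= ip m (h i) p - ip m g p"
  using h
 proof eventually_elim
  case (elim i)
  then have "(%x. h i x - g x) : C'" "h i : L2 m" using CL by (auto simp: C'_def)
  from var[OF this(1)] this(2) show ?case using p(1) g by (simp add: ip_diff_left ip_commute[of m p])
 qed
 ultimately have "(lnorm m p)^2 <= 0" using tendsto_lowerbound[OF _ _ sequentially_bot] by fastforce
 then have "lnorm m p = 0" by simp
 have "!!n. c n : L2 m" using p(2) 1 by auto
 then have "(%n. lnorm m (c n)) \<longlonglongrightarrow> 0"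
  using L2_tendsto_norm[OF p(3) _ p(1)] \<open>lnorm m p = 0\<close> by simp
 then have "\<forall>\<^sub>F n in sequentially. lnorm m (c n) < e" using e by (simp add: order_tendstoD)
 then obtain n where "lnorm m (c n) < e" by (auto simp: eventually_sequentially)
 with p(2)[of n] show ?thesis by (auto simp: C'_def)
qed

text \<open>The representing function is a multiple of the element of least norm in the hyperplane \<open>l = 1\<close>, which is
  orthogonal to the kernel of \<open>l\<close>.\<close>

lemma L2_Riesz:
 assumes add: "!!f g. f : L2 m ==> g : L2 m ==> l (%x. f x + g x) = l f + l g"
  and scale: "!!c f. f : L2 m ==> l (%x. c * f x) = c * l f"
  and bd: "!!f. f : L2 m ==> abs (l f) <= K * lnorm m f"
 shows "EX w:L2 m. ALL f:L2 m. l f = ip m w f"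
proof (cases "ALL f:L2 m. l f = 0")
 case True
 then show ?thesis by (intro bexI[of _ "%x. 0"]) (auto simp: ip_def)
next
 case False
 then obtain f0 where f0: "f0 : L2 m" "l f0 ~= 0" by blast
 have diff: "l (%x. f x - g x) = l f - l g" if "f : L2 m" "g : L2 m" for f g
  using add[OF that(1) L2_cmult[OF that(2), of "-1"]] scale[OF that(2), of "-1"] by simp
 define C where "C = {f\<in>L2 m. l f = 1}"
 have 1: "C \<subseteq> L2 m" by (auto simp: C_def)
 have 2: "C ~= {}" using scale[OF f0(1), of "1 / l f0"] L2_cmult[OF f0(1), of "1 / l f0"] f0(2) by (auto simp: C_def)
 have 3: "(%x. (1 - t) * f x + t * g x) : C" if "f : C" "g : C" for f g t
  using that by (auto simp: C_def add scale L2_cmult)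
 obtain p c where p: "p : L2 m" "!!n::nat. c n : C" "L2_tendsto m c p sequentially"
  and var: "!!g. g : C ==> (lnorm m p)^2 <= ip m p g"
  using L2_min_norm[OF 1 2 3] by blast
 have "(%n. l (c n) - l p) \<longlonglongrightarrow> 0"
 proof (rule Lim_null_comparison)
  show "\<forall>\<^sub>F n in sequentially. norm (l (c n) - l p) <= K * lnorm m (%x. c n x - p x)"
   using p(1,2) bd[OF L2_diff[of "c _" m p]] by (simp add: C_def diff)
  show "(%n. K * lnorm m (%x. c n x - p x)) \<longlonglongrightarrow> 0"
   using p(3) by (intro tendsto_mult_right_zero) (simp add: L2_tendsto_lnorm)
 qed
 moreover have "l (c n) = 1" for n using p(2) by (simp add: C_def)
 ultimately have "l p = 1" by (simp add: LIMSEQ_const_iff)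
 have "0 < lnorm m p"
  using bd[OF p(1)] \<open>l p = 1\<close> lnorm_nonneg[of m p] by (cases "lnorm m p = 0") (auto simp: less_le)
 have orth: "ip m p h = 0" if h: "h : L2 m" "l h = 0" for h
 proof -
  have "0 <= t * ip m p h" for t
  proof -
   have "(%x. p x + t * h x) : C" using p(1) h \<open>l p = 1\<close> by (auto simp: C_def add scale L2_cmult)
   from var[OF this] show ?thesis using p(1) h by (simp add: ip_add_right ip_cmult_right L2_cmult ip_self)
  qed
  from this[of 1] this[of "-1"] show ?thesis by simp
 qed
 have "l f = ip m (%x. 1 / (lnorm m p)^2 * p x) f" if f: "f : L2 m" for f
 proof -
  have "ip m p (%x. f x - l f * p x) = 0"
   using p(1) f \<open>l p = 1\<close> by (intro orth) (auto simp: diff scale L2_cmult)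
  then have "ip m p f = l f * (lnorm m p)^2"
   using p(1) f by (simp add: ip_diff_right ip_cmult_right L2_cmult ip_self)
  then show ?thesis using \<open>0 < lnorm m p\<close> unfolding ip_cmult_left by simp
 qed
 then show ?thesis using p(1) by (intro bexI[of _ "%x. 1 / (lnorm m p)^2 * p x"] L2_cmult) auto
qed

text \<open>Lipschitz cut-off functions detect signs, by inner regularity of finite Borel measures.\<close>

definition cutoff :: "('a::metric_space => real) => bool" where
 "cutoff \<psi> \<longleftrightarrow> (EX C. C-lipschitz_on UNIV \<psi>) & (ALL x. 0 <= \<psi> x & \<psi> x <= 1) & bounded {x. \<psi> x ~= 0}"

definition bump :: "'a::metric_space set => real => 'a => real" where
 "bump K r x = max 0 (1 - infdist x K / r)"

lemma bump_cutoff: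
 assumes K: "bounded K" "K ~= {}" and r: "r > 0"
 shows "cutoff (bump K r)"
 unfolding cutoff_def
proof (intro conjI allI exI)
 show "(1/r)-lipschitz_on UNIV (bump K r)"
 proof (rule lipschitz_onI)
  fix x y
  have "abs (infdist x K - infdist y K) <= dist x y" by (rule infdist_triangle_abs)
  then have "abs (infdist x K / r - infdist y K / r) <= 1 / r * dist x y"
   using r by (simp add: diff_divide_distrib[symmetric] divide_right_mono)
  then show "dist (bump K r x) (bump K r y) <= 1 / r * dist x y"
   unfolding bump_def dist_real_def by linarith
 qed (use r in auto)
 show "0 <= bump K r x" for x by (simp add: bump_def)
 show "bump K r x <= 1" for x using r by (simp add: bump_def infdist_nonneg)
 obtain k where k: "k : K" using K by blast
 obtain e where e: "!!y. y : K ==> dist k y <= e" using K(1) bounded_any_center[of K k] by auto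
 show "bounded {x. bump K r x ~= 0}"
 proof (rule bounded_subset[OF bounded_cball[of k "e + r"]], rule subsetI)
  fix x assume "x : {x. bump K r x ~= 0}"
  then have "infdist x K < r" using r by (auto simp: bump_def max_def field_simps split: if_splits)
  then obtain y where "y : K" "dist x y < r"
   using K(2) cINF_less_iff[of K "dist x" r] by (auto simp: infdist_def)
  then show "x : cball k (e + r)" using e[of y] dist_triangle[of k x y] by (simp add: dist_commute)
 qed
qed

text \<open>Indicators of compact sets are limits of cut-off functions, and the finite measure \<open>|z| m\<close> of \<open>{z < 0}\<close> is
  the supremum over its compact subsets.\<close>

lemma cutoff_test_nonneg:
 fixes m :: "'a::polish_space measure"
 assumes sets: "sets m = sets borel" and z: "integrable m z"
  and k: "k > 0" and test: "!!\<psi>. cutoff \<psi> ==> 0 <= (LINT x|m. \<psi> x ^ k * z x)"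
 shows "AE x in m. 0 <= z x"
proof -
 have [measurable]: "z : borel_measurable m" using z by simp
 have meas: "f : borel_measurable m \<longleftrightarrow> f : borel_measurable borel" for f :: "'a => real"
  using measurable_cong_sets[OF sets refl] by blast
 define \<mu> where "\<mu> = density m (%x. ennreal (abs (z x)))"
 define A where "A = {x. z x < 0}"
 have spm: "space m = UNIV" using sets_eq_imp_space_eq[OF sets] by simp
 have As: "A : sets m" using borel_measurable_less[of z m "%x. 0"] by (simp add: A_def spm)
 have fin: "emeasure \<mu> (space \<mu>) ~= \<infinity>"
  using z by (simp add: \<mu>_def emeasure_density integrable_iff_bounded spm[symmetric])
 have Kz: "emeasure \<mu> K = 0" if K: "K \<subseteq> A" "compact K" for K
 proof (cases "K = {}")
  case False
  have Ks: "K : sets m" using K sets by (simp add: compact_imp_closed)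
  have lim: "(%n. \<integral>x. bump K (rcp n) x ^ k * z x \<partial>m) \<longlonglongrightarrow> (LINT x|m. indicator K x * z x)"
  proof (rule integral_dominated_convergence[where w="%x. abs (z x)"])
   show "AE x in m. (%n. bump K (rcp n) x ^ k * z x) \<longlonglongrightarrow> indicator K x * z x"
   proof (intro AE_I2 tendsto_mult tendsto_const)
    fix x
    show "(%n. bump K (rcp n) x ^ k) \<longlonglongrightarrow> indicator K x"
    proof (cases "x : K")
     case True then show ?thesis by (simp add: bump_def)
    next
     case False
     then have pos: "infdist x K > 0"
      using K(2) \<open>K ~= {}\<close> in_closed_iff_infdist_zero[of K x] infdist_nonneg[of x K] by (auto simp: compact_imp_closed less_le)
     then obtain N where N: "rcp N < infdist x K" using reals_Archimedean by blast
     have "\<forall>\<^sub>F n in sequentially. bump K (rcp n) x ^ k = 0"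
      using eventually_ge_at_top[of N]
     proof eventually_elim
      case (elim n)
      then have "rcp n <= rcp N" by (intro le_imp_inverse_le) auto
      with N have "rcp n < infdist x K" by linarith
      then have "1 <= infdist x K / rcp n" by (subst pos_le_divide_eq) (auto simp del: of_nat_Suc)
      then show ?case using k by (simp add: bump_def del: of_nat_Suc)
     qed
     then show ?thesis using False by (simp add: tendsto_eventually)
    qed
   qed
   fix n
   have cb: "cutoff (bump K (rcp n))" using K \<open>K ~= {}\<close> by (intro bump_cutoff) (auto intro: compact_imp_bounded)
   then show "AE x in m. norm (bump K (rcp n) x ^ k * z x) <= abs (z x)"
    by (auto simp: cutoff_def abs_mult power_abs intro!: AE_I2 mult_left_le_one_le power_le_one)
   have "continuous_on UNIV (bump K (rcp n))" using cb lipschitz_on_continuous_on by (auto simp: cutoff_def)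
   then have "bump K (rcp n) : borel_measurable m"
    unfolding meas by (rule borel_measurable_continuous_onI)
   then show "(%x. bump K (rcp n) x ^ k * z x) : borel_measurable m" by simp
  qed (use z Ks in auto)
  have "0 <= (LINT x|m. indicator K x * z x)"
   by (rule LIMSEQ_le_const[OF lim], intro exI[of _ 0] allI impI test bump_cutoff)
    (use K \<open>K ~= {}\<close> compact_imp_bounded in auto)
  also have "(LINT x|m. indicator K x * z x) = - (LINT x|m. abs (z x) * indicator K x)"
   unfolding Bochner_Integration.integral_minus[symmetric]
   by (rule Bochner_Integration.integral_cong) (use K in "auto simp: indicator_def A_def")
  finally have le: "(LINT x|m. abs (z x) * indicator K x) <= 0" by simp
  have int: "integrable m (%x. abs (z x) * indicator K x)" using z Ks by (intro integrable_real_mult_indicator) auto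
  have "emeasure \<mu> K = (\<integral>\<^sup>+x. ennreal (abs (z x) * indicator K x) \<partial>m)"
   unfolding \<mu>_def using Ks by (subst emeasure_density) (auto simp: ennreal_mult ennreal_indicator)
  also have "\<dots> = ennreal (LINT x|m. abs (z x) * indicator K x)" by (rule nn_integral_eq_integral[OF int]) simp
  finally show ?thesis using le by (simp add: ennreal_neg)
 qed simp
 have "emeasure \<mu> A = (SUP K\<in>{K. K \<subseteq> A & compact K}. emeasure \<mu> K)"
  using fin As by (intro inner_regular) (auto simp: \<mu>_def sets)
 also have "\<dots> = 0" using Kz by (auto intro!: SUP_eq_const[of "{K. K \<subseteq> A & compact K}"])
 finally have "(\<integral>\<^sup>+x. ennreal (abs (z x)) * indicator A x \<partial>m) = 0"
  unfolding \<mu>_def using As by (simp add: emeasure_density)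
 then have "AE x in m. ennreal (abs (z x)) * indicator A x = 0"
  using As by (subst (asm) nn_integral_0_iff_AE) auto
 then show ?thesis by eventually_elim (auto simp: A_def indicator_def split: if_splits)
qed

section \<open>Local Lipschitz constants\<close>

definition BL :: "('a::metric_space => real) => bool" where
 "BL f \<longleftrightarrow> bounded (range f) & (EX C. C-lipschitz_on UNIV f)"

lemma BL_iff: "BL f \<longleftrightarrow> (EX B C. 0 <= B & 0 <= C & (ALL x. abs (f x) <= B) & (ALL x y. abs (f x - f y) <= C * dist x y))"
proof
 assume "BL f"
 then obtain B C where "ALL x. abs (f x) <= B" "C-lipschitz_on UNIV f" by (auto simp: BL_def bounded_iff)
 moreover have "0 <= B" using calculation(1) abs_ge_zero order_trans by blast
 ultimately show "EX B C. 0 <= B & 0 <= C & (ALL x. abs (f x) <= B) & (ALL x y. abs (f x - f y) <= C * dist x y)"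
  by (auto simp: lipschitz_on_def dist_real_def)
next
 assume "EX B C. 0 <= B & 0 <= C & (ALL x. abs (f x) <= B) & (ALL x y. abs (f x - f y) <= C * dist x y)"
 then show "BL f" by (auto simp: BL_def bounded_iff lipschitz_on_def dist_real_def)
qed

lemma BL_bdd_Lip_L2: "f : bdd_Lip_L2 m \<longleftrightarrow> f : L2 m & BL f"
 by (auto simp: bdd_Lip_L2_def BL_def)

lemma BL_lincomb: assumes "BL f" "BL g" shows "BL (%x. a * f x + b * g x)"
proof -
 obtain B C where f: "0 <= B" "0 <= C" "!!x. abs (f x) <= B" "!!x y. abs (f x - f y) <= C * dist x y"
  using assms(1) by (auto simp: BL_iff)
 obtain B' C' where g: "0 <= B'" "0 <= C'" "!!x. abs (g x) <= B'" "!!x y. abs (g x - g y) <= C' * dist x y"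
  using assms(2) by (auto simp: BL_iff)
 show ?thesis unfolding BL_iff
 proof (rule exI[of _ "abs a * B + abs b * B'"], rule exI[of _ "abs a * C + abs b * C'"], intro conjI allI)
  fix x y
  show "abs (a * f x + b * g x) <= abs a * B + abs b * B'"
   by (rule order_trans[OF abs_triangle_ineq]) (auto simp: abs_mult intro!: add_mono mult_left_mono f g)
  have "abs (a * f x + b * g x - (a * f y + b * g y)) = abs (a * (f x - f y) + b * (g x - g y))" by (simp add: algebra_simps)
  also have "\<dots> <= abs a * (C * dist x y) + abs b * (C' * dist x y)"
   by (rule order_trans[OF abs_triangle_ineq]) (auto simp: abs_mult intro!: add_mono mult_left_mono f g)
  finally show "abs (a * f x + b * g x - (a * f y + b * g y)) <= (abs a * C + abs b * C') * dist x y"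
   by (simp add: algebra_simps)
 qed (use f g in auto)
qed

lemma BL_mult: assumes "BL f" "BL g" shows "BL (%x. f x * g x)"
proof -
 obtain B C where f: "0 <= B" "0 <= C" "!!x. abs (f x) <= B" "!!x y. abs (f x - f y) <= C * dist x y"
  using assms(1) by (auto simp: BL_iff)
 obtain B' C' where g: "0 <= B'" "0 <= C'" "!!x. abs (g x) <= B'" "!!x y. abs (g x - g y) <= C' * dist x y"
  using assms(2) by (auto simp: BL_iff)
 show ?thesis unfolding BL_iff
 proof (rule exI[of _ "B * B'"], rule exI[of _ "B * C' + B' * C"], intro conjI allI)
  fix x y
  show "abs (f x * g x) <= B * B'" by (simp add: abs_mult mult_mono f g)
  have "abs (f x * g x - f y * g y) = abs (f x * (g x - g y) + g y * (f x - f y))" by (simp add: algebra_simps)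
  also have "\<dots> <= B * (C' * dist x y) + B' * (C * dist x y)"
   by (rule order_trans[OF abs_triangle_ineq]) (auto simp: abs_mult intro!: add_mono mult_mono f g)
  finally show "abs (f x * g x - f y * g y) <= (B * C' + B' * C) * dist x y"
   by (simp add: algebra_simps)
 qed (use f g in auto)
qed

lemma BL_comp: assumes "BL f" "!!s t. abs (\<sigma> s - \<sigma> t) <= L * abs (s - t)" shows "BL (%x. \<sigma> (f x))"
proof -
 obtain B C where f: "0 <= B" "0 <= C" "!!x. abs (f x) <= B" "!!x y. abs (f x - f y) <= C * dist x y"
  using assms(1) by (auto simp: BL_iff)
 have L: "0 <= L" using assms(2)[of 0 1] by simp
 show ?thesis unfolding BL_iff
 proof (rule exI[of _ "abs (\<sigma> 0) + L * B"], rule exI[of _ "L * C"], intro conjI allI)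
  fix x y
  show "abs (\<sigma> (f x)) <= abs (\<sigma> 0) + L * B"
   using assms(2)[of "f x" 0] mult_left_mono[OF f(3)[of x] L] by simp
  show "abs (\<sigma> (f x) - \<sigma> (f y)) <= L * C * dist x y"
   using assms(2)[of "f x" "f y"] mult_left_mono[OF f(4)[of x y] L] by (simp add: mult.assoc)
 qed (use f L in auto)
qed

lemma cutoff_BL: "cutoff f ==> BL f"
 unfolding cutoff_def BL_def bounded_iff by (metis abs_of_nonneg rangeE real_norm_def)

lemma BL_const: "BL (%x. c)"
 by (auto simp: BL_def intro!: exI[of _ 0] lipschitz_onI)

lemma BL_continuous: "BL f ==> continuous_on A f"
 by (meson BL_def continuous_on_subset lipschitz_on_continuous_on subset_UNIV)

definition lc :: "('a::metric_space => real) => 'a => real" where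
 "lc f x = enn2real (lip f x)"

lemma lc_nonneg [simp]: "0 <= lc f x"
 by (simp add: lc_def)

lemma lip_leI:
 assumes c: "0 <= c" and ev: "!!e. e > 0 ==> \<forall>\<^sub>F y in at x. abs (f y - f x) <= (c + e) * dist y x"
 shows "lip f x <= ennreal c"
proof (rule ennreal_le_epsilon)
 fix e :: real assume e: "e > 0"
 have "lip f x <= ennreal (c + e)"
  unfolding lip_def
 proof (rule Limsup_bounded)
  show "\<forall>\<^sub>F y in at x. ennreal (abs (f y - f x) / dist y x) <= ennreal (c + e)"
   using ev[OF e] eventually_neq_at_within[of x x UNIV]
   by eventually_elim (auto intro!: ennreal_leI simp: divide_le_eq)
 qed
 then show "lip f x <= ennreal c + ennreal e" using c e by (simp add: ennreal_plus)
qed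

lemma lc_leI:
 assumes "0 <= c" "!!e. e > 0 ==> \<forall>\<^sub>F y in at x. abs (f y - f x) <= (c + e) * dist y x"
 shows "lc f x <= c"
 unfolding lc_def by (rule enn2real_leI[OF assms(1) lip_leI[OF assms]])

lemma BL_lip_le: assumes "!!x y. abs (f x - f y) <= C * dist x y" "0 <= C" shows "lip f x <= ennreal C"
proof (rule lip_leI[OF assms(2)], rule always_eventually, rule allI)
 fix e :: real and y assume "e > 0"
 then have "C * dist y x <= (C + e) * dist y x" by (intro mult_right_mono) auto
 with assms(1)[of y x] show "abs (f y - f x) <= (C + e) * dist y x" by linarith
qed

lemma lc_le_Lip: assumes "!!x y. abs (f x - f y) <= C * dist x y" "0 <= C" shows "lc f x <= C"
 unfolding lc_def by (rule enn2real_leI[OF assms(2) BL_lip_le[OF assms]])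

lemma lc_const [simp]: "lc (%_. c) x = 0"
 using lc_le_Lip[of "%_. c" 0 x] lc_nonneg[of "%_. c" x] by simp

lemma lip_eq_lc: assumes "BL f" shows "lip f x = ennreal (lc f x)"
proof -
 obtain C where "0 <= C" "!!x y. abs (f x - f y) <= C * dist x y" using assms by (auto simp: BL_iff)
 then have "lip f x < top" using BL_lip_le[of f C x] by (meson ennreal_less_top order_le_less_trans)
 then show ?thesis by (simp add: lc_def)
qed

lemma lc_ev:
 assumes f: "BL f" and e: "e > 0"
 shows "\<forall>\<^sub>F y in at x. abs (f y - f x) <= (lc f x + e) * dist y x"
proof -
 have "lip f x < ennreal (lc f x + e)"
  using e by (simp add: lip_eq_lc[OF f] ennreal_less_iff)
 then have "\<forall>\<^sub>F y in at x. ennreal (abs (f y - f x) / dist y x) < ennreal (lc f x + e)"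
  unfolding lip_def by (rule Limsup_lessD)
 then show ?thesis using eventually_neq_at_within[of x x UNIV]
 proof eventually_elim
  case (elim y)
  then have "abs (f y - f x) / dist y x < lc f x + e" by (subst (asm) ennreal_less_iff) auto
  then show ?case using elim by (simp add: divide_less_eq less_imp_le)
 qed
qed

lemma lc_lincomb:
 assumes f: "BL f" and g: "BL g"
 shows "lc (%x. a * f x + b * g x) x <= abs a * lc f x + abs b * lc g x"
proof (rule lc_leI)
 fix e :: real assume e: "e > 0"
 define e' where "e' = e / (abs a + abs b + 1)"
 have e': "e' > 0" "(abs a + abs b) * e' <= e" using e by (auto simp: e'_def field_simps intro!: add_nonneg_pos)
 show "\<forall>\<^sub>F y in at x. abs (a * f y + b * g y - (a * f x + b * g x)) <= (abs a * lc f x + abs b * lc g x + e) * dist y x"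
  using lc_ev[OF f e'(1), of x] lc_ev[OF g e'(1), of x]
 proof eventually_elim
  case (elim y)
  have "abs (a * f y + b * g y - (a * f x + b * g x)) = abs (a * (f y - f x) + b * (g y - g x))" by (simp add: algebra_simps)
  also have "\<dots> <= abs a * abs (f y - f x) + abs b * abs (g y - g x)"
   by (rule order_trans[OF abs_triangle_ineq]) (simp add: abs_mult)
  also have "\<dots> <= abs a * ((lc f x + e') * dist y x) + abs b * ((lc g x + e') * dist y x)"
   using elim by (intro add_mono mult_left_mono) auto
  also have "\<dots> = (abs a * lc f x + abs b * lc g x + (abs a + abs b) * e') * dist y x" by (simp add: algebra_simps)
  also have "\<dots> <= (abs a * lc f x + abs b * lc g x + e) * dist y x"
   using e'(2) by (intro mult_right_mono) auto
  finally show ?case .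
 qed
qed simp

lemma BL_tendsto_at: "BL f ==> (f \<longlongrightarrow> f x) (at x)"
 using BL_continuous[of f UNIV] by (simp add: continuous_on_def)

text \<open>The product of two increments is of second order.\<close>

lemma lc_frozen:
 assumes p: "BL p" and f: "BL f"
 shows "lc (%y. p y * f y - p x * f y - f x * p y) x <= 0"
proof (rule lc_leI)
 fix e :: real assume e: "e > 0"
 obtain C where C: "0 <= C" "!!y. abs (f y - f x) <= C * dist y x" using f by (auto simp: BL_iff)
 have "e / (C + 1) > 0" using e C by (simp add: add_nonneg_pos)
 from tendstoD[OF BL_tendsto_at[OF p, of x] this]
 show "\<forall>\<^sub>F y in at x. abs (p y * f y - p x * f y - f x * p y - (p x * f x - p x * f x - f x * p x)) <= (0 + e) * dist y x"
 proof eventually_elim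
  case (elim y)
  have "abs (p y * f y - p x * f y - f x * p y - (p x * f x - p x * f x - f x * p x)) = abs (p y - p x) * abs (f y - f x)"
   unfolding abs_mult[symmetric] by (simp add: algebra_simps)
  also have "\<dots> <= e / (C + 1) * (C * dist y x)" using elim C by (intro mult_mono) (auto simp: dist_real_def)
  also have "\<dots> <= e * dist y x" using e C by (simp add: field_simps)
  finally show ?case by simp
 qed
qed simp

lemma lc_product:
 assumes BL: "BL p" "BL f" "BL q" "BL g" "BL k"
 shows "lc (%y. p y * f y + q y * g y + k y) x <= abs (p x) * lc f x + abs (q x) * lc g x + lc (%y. f x * p y + g x * q y + k y) x"
proof -
 have BLs: "BL (%y. a y + b y)" "BL (%y. a y - b y)" if "BL a" "BL b" for a b
  using BL_lincomb[OF that, of 1 1] BL_lincomb[OF that, of 1 "-1"] by simp_all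
 have BLc: "BL (%y. c * a y)" if "BL a" for a c using BL_lincomb[OF that that, of c 0] by simp
 have add: "lc (%y. a y + b y) x <= lc a x + lc b x" if "BL a" "BL b" for a b using lc_lincomb[OF that, of 1 1 x] by simp
 let ?u = "%y. p y * f y - p x * f y - f x * p y" and ?v = "%y. q y * g y - q x * g y - g x * q y"
  and ?w = "%y. p x * f y + q x * g y" and ?z = "%y. f x * p y + g x * q y + k y"
 have B: "BL ?u" "BL ?v" "BL ?w" "BL ?z" by (intro BLs BLc BL_mult BL)+
 have "(%y. p y * f y + q y * g y + k y) = (%y. (?u y + ?v y) + (?w y + ?z y))" by auto
 then have "lc (%y. p y * f y + q y * g y + k y) x <= (lc ?u x + lc ?v x) + (lc ?w x + lc ?z x)"
  using add[OF BLs(1)[OF B(1,2)] BLs(1)[OF B(3,4)]] add[OF B(1,2)] add[OF B(3,4)] by simp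
 with lc_frozen[OF BL(1,2), of x] lc_frozen[OF BL(3,4), of x] lc_lincomb[OF BL(2,4), of "p x" "q x" x] show ?thesis by linarith
qed

lemma lc_comp_local:
 assumes f: "BL f" and L: "0 <= L" and \<sigma>: "\<forall>\<^sub>F s in nhds (f x). abs (\<sigma> s - \<sigma> (f x)) <= L * abs (s - f x)"
 shows "lc (%x. \<sigma> (f x)) x <= L * lc f x"
proof (rule lc_leI)
 fix e :: real assume e: "e > 0"
 define e' where "e' = e / (L + 1)"
 have e': "e' > 0" "L * e' <= e" using e L by (auto simp: e'_def field_simps)
 have "\<forall>\<^sub>F y in at x. abs (\<sigma> (f y) - \<sigma> (f x)) <= L * abs (f y - f x)"
  using filterlim_iff[THEN iffD1, OF BL_tendsto_at[OF f, of x]] \<sigma> by blast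
 then show "\<forall>\<^sub>F y in at x. abs (\<sigma> (f y) - \<sigma> (f x)) <= (L * lc f x + e) * dist y x"
  using lc_ev[OF f e'(1), of x]
 proof eventually_elim
  case (elim y)
  have "abs (\<sigma> (f y) - \<sigma> (f x)) <= L * abs (f y - f x)" by (rule elim)
  also have "\<dots> <= L * ((lc f x + e') * dist y x)" using elim L by (intro mult_left_mono)
  also have "\<dots> = (L * lc f x + L * e') * dist y x" by (simp add: algebra_simps)
  also have "\<dots> <= (L * lc f x + e) * dist y x" using e' by (intro mult_right_mono) auto
  finally show ?case .
 qed
qed (use L in simp)

lemma lip_measurable:
 fixes f :: "'a::polish_space => real"
 assumes f: "continuous_on UNIV f"
 shows "lip f : borel_measurable borel"
proof -
 define q where "q x y = ennreal (abs (f y - f x) / dist y x)" for x y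
 define S where "S n x = (SUP y\<in>ball x (rcp n) - {x}. q x y)" for n x
 have Sm: "S n : borel_measurable borel" for n
 proof (rule borel_measurableI_greater)
  fix c
  have "{x : space borel. c < S n x} = (\<Union>y. ({x. dist x y < rcp n} - {y}) \<inter> (%x. q x y) -` {c<..})"
   by (simp only: S_def less_SUP_iff) (auto simp del: of_nat_Suc)
  moreover have "open (({x. dist x y < rcp n} - {y}) \<inter> (%x. q x y) -` {c<..})" for y
  proof (rule continuous_open_preimage)
   have "continuous_on ({x. dist x y < rcp n} - {y}) f" using f continuous_on_subset by blast
   then show "continuous_on ({x. dist x y < rcp n} - {y}) (%x. q x y)"
    unfolding q_def by (intro continuous_intros continuous_on_ennreal) auto
   show "open ({x. dist x y < rcp n} - {y})"
    by (intro open_Diff open_Collect_less continuous_intros) auto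
  qed simp
  ultimately show "{x : space borel. c < S n x} : sets borel" by (simp add: open_UN borel_open)
 qed
 have "lip f = (%x. INF n. S n x)"
 proof
  fix x
  have "lip f x = (INF e\<in>{0<..}. SUP y\<in>UNIV \<inter> ball x e - {x}. q x y)"
   unfolding lip_def q_def by (rule Limsup_within)
  also have "\<dots> = (INF n. S n x)"
  proof (rule INF_eq)
   fix e :: real assume "e : {0<..}"
   then obtain n where n: "rcp n < e" using reals_Archimedean by auto
   then show "EX n:UNIV. S n x <= (SUP y\<in>UNIV \<inter> ball x e - {x}. q x y)"
    unfolding S_def by (intro bexI[of _ n] SUP_subset_mono) auto
  next
   show "EX e:{0<..}. (SUP y\<in>UNIV \<inter> ball x e - {x}. q x y) <= S n x" for n
    by (rule bexI[of _ "rcp n"]) (auto simp: S_def)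
  qed
  finally show "lip f x = (INF n. S n x)" .
 qed
 then show ?thesis using Sm by simp
qed

section \<open>Relaxed slopes\<close>

locale mms =
 fixes m :: "'a::polish_space measure"
 assumes mms: "metric_measure_space m"
begin

lemma sets_m: "sets m = sets borel"
 using mms by (simp add: metric_measure_space_def)

lemma space_m: "space m = UNIV"
 using sets_eq_imp_space_eq[OF sets_m] by simp

lemma meas_m: "f : borel_measurable m \<longleftrightarrow> f : borel_measurable borel" for f :: "'a => 'b::topological_space"
 using measurable_cong_sets[OF sets_m refl] by blast

lemma fin_bounded: "B : sets borel ==> bounded B ==> emeasure m B < \<infinity>"
 using mms by (simp add: metric_measure_space_def)

lemma BL_measurable: "BL f ==> f : borel_measurable m"
 unfolding meas_m by (rule borel_measurable_continuous_onI[OF BL_continuous])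

lemma lc_measurable: "BL f ==> lc f : borel_measurable m"
 unfolding meas_m lc_def[abs_def]
 using lip_measurable[OF BL_continuous[of f UNIV]] by (intro borel_measurable_enn2real)

lemma L2_BL_mult: "f : L2 m ==> BL \<psi> ==> (%x. \<psi> x * f x) : L2 m"
 using L2_bounded_mult[of f m \<psi>] BL_measurable[of \<psi>] by (auto simp: BL_iff)

lemma L2_boundedsupp:
 assumes f: "f : borel_measurable m" and b: "bounded {x. f x ~= 0}" and C: "!!x. abs (f x) <= C"
 shows "f : L2 m"
proof -
 let ?A = "{x. f x ~= 0}"
 have A: "?A : sets borel" using f unfolding meas_m by measurable
 have "C >= 0" using C[of undefined] by (meson abs_ge_zero order_trans)
 have "(%x. C * indicator ?A x) : L2 m"
 proof (rule L2_cmult)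
  have "(%x. (indicator ?A x :: real)^2) = indicator ?A" by (auto simp: indicator_def)
  then show "indicator ?A : L2 m" unfolding L2_def using A fin_bounded[OF A b]
   by (simp add: sets_m borel_measurable_indicator)
 qed
 then show ?thesis
  by (rule L2_bound) (use f C \<open>C >= 0\<close> in "auto simp: indicator_def")
qed

lemma lc_zero_outside:
 assumes "\<forall>\<^sub>F y in nhds x. f y = 0"
 shows "lc f x = 0"
proof -
 have "f x = 0" using eventually_nhds_x_imp_x[OF assms] .
 have "lc f x <= 0"
 proof (rule lc_leI)
  fix e :: real assume "e > 0"
  have "\<forall>\<^sub>F y in at x. f y = 0" using assms by (simp add: eventually_nhds_conv_at)
  then show "\<forall>\<^sub>F y in at x. abs (f y - f x) <= (0 + e) * dist y x"
   by eventually_elim (use \<open>f x = 0\<close> \<open>e > 0\<close> in auto)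
 qed simp
 then show ?thesis using lc_nonneg[of f x] by linarith
qed

lemma cutoff_lc_L2: assumes "cutoff \<psi>" shows "\<psi> : L2 m" "lc \<psi> : L2 m"
proof -
 have BL: "BL \<psi>" using assms by (rule cutoff_BL)
 show "\<psi> : L2 m"
  using assms by (intro L2_boundedsupp[where C=1] BL_measurable BL) (auto simp: cutoff_def)
 obtain C where C: "0 <= C" "!!x y. abs (\<psi> x - \<psi> y) <= C * dist x y" using BL by (auto simp: BL_iff)
 have sub: "{x. lc \<psi> x ~= 0} \<subseteq> closure {x. \<psi> x ~= 0}"
 proof
  fix x assume x: "x : {x. lc \<psi> x ~= 0}"
  show "x : closure {x. \<psi> x ~= 0}"
  proof (rule ccontr)
   assume "x \<notin> closure {x. \<psi> x ~= 0}"
   then have "\<forall>\<^sub>F y in nhds x. y : - closure {x. \<psi> x ~= 0}" by (intro eventually_nhds_in_open) auto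
   then have "\<forall>\<^sub>F y in nhds x. \<psi> y = 0"
    by eventually_elim (meson ComplD closure_subset mem_Collect_eq subsetD)
   from lc_zero_outside[OF this] x show False by simp
  qed
 qed
 show "lc \<psi> : L2 m"
 proof (rule L2_boundedsupp[where C=C])
  show "bounded {x. lc \<psi> x ~= 0}" using bounded_subset[OF bounded_closure sub] assms by (auto simp: cutoff_def)
  show "abs (lc \<psi> x) <= C" for x using lc_le_Lip[OF C(2,1)] by simp
 qed (rule lc_measurable[OF BL])
qed

end

lemma L2_tendsto_bounded_mult:
 assumes G: "L2_tendsto m G H \<F>" "\<forall>\<^sub>F i in \<F>. G i : L2 m" "H : L2 m"
  and a: "a : borel_measurable m" "!!x. abs (a x) <= C"
 shows "L2_tendsto m (%i x. a x * G i x) (%x. a x * H x) \<F>"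
proof (rule L2_tendsto_le)
 have C: "0 <= C" using a(2)[of undefined] by linarith
 show "\<forall>\<^sub>F i in \<F>. lnorm m (%x. a x * G i x - a x * H x) <= C * lnorm m (%x. G i x - H x)"
  using G(2)
 proof eventually_elim
  case (elim i)
  have "lnorm m (%x. a x * G i x - a x * H x) <= lnorm m (%x. C * (G i x - H x))"
  proof (rule lnorm_mono_AE)
   show "AE x in m. abs (a x * G i x - a x * H x) <= abs (C * (G i x - H x))"
    using a(2) C by (intro AE_I2) (auto simp: right_diff_distrib[symmetric] abs_mult intro!: mult_right_mono)
  qed (use elim G(3) a L2_measurable[of "G i" m] L2_measurable[of H m] in "auto intro!: L2_cmult L2_diff")
  then show ?case using C by (simp add: lnorm_cmult)
 qed
 show "((%i. C * lnorm m (%x. G i x - H x)) \<longlongrightarrow> 0) \<F>"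
  using G(1) by (intro tendsto_mult_right_zero) (simp add: L2_tendsto_lnorm)
qed

lemma L2_dominated:
 assumes u: "!!n. u n : borel_measurable m" "AE x in m. (%n. u n x) \<longlonglongrightarrow> 0"
  and g: "g : L2 m" "!!n. AE x in m. abs (u n x) <= abs (g x)"
 shows "(%n::nat. lnorm m (u n)) \<longlonglongrightarrow> 0"
proof -
 have "(%n. \<integral>x. (u n x)^2 \<partial>m) \<longlonglongrightarrow> (LINT x|m. 0)"
 proof (rule integral_dominated_convergence[where w="%x. (g x)^2"])
  show "integrable m (%x. (g x)^2)" using g by (simp add: L2_def)
  show "AE x in m. (%n. (u n x)^2) \<longlonglongrightarrow> 0" using u(2) by eventually_elim (simp add: tendsto_null_power)
  show "AE x in m. norm ((u n x)^2) <= (g x)^2" for n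
   using g(2)[of n] by eventually_elim (simp add: abs_le_square_iff)
 qed (use u in auto)
 from tendsto_real_sqrt[OF this] show ?thesis by (simp add: lnorm_def)
qed

lemma L2_tendsto_mult_AE:
 assumes G: "L2_tendsto m G H sequentially" "!!i. G i : L2 m" "H : L2 m"
  and a: "!!i. a i : borel_measurable m" "b : borel_measurable m"
   "!!i x. abs (a i x) <= 1" "!!x. abs (b x) <= 1" "AE x in m. (%i. a i x) \<longlonglongrightarrow> b x"
 shows "L2_tendsto m (%i x. a i x * G i x) (%x. b x * H x) sequentially"
proof (rule L2_tendsto_le)
 have [measurable]: "H : borel_measurable m" "G i : borel_measurable m" "a i : borel_measurable m"
  "b : borel_measurable m" for i using G a by (auto simp: L2_def)
 have bd: "abs ((a i x - b x) * H x) <= abs (2 * H x)" for i x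
 proof -
  have "abs (a i x - b x) <= 2" using a(3)[of i x] a(4)[of x] by linarith
  then show ?thesis unfolding abs_mult by (intro mult_right_mono) auto
 qed
 have mm: "(%x. (a i x - b x) * H x) : borel_measurable m" for i by measurable
 have in1: "(%x. (a i x - b x) * H x) : L2 m" for i
  by (rule L2_bound[OF L2_cmult[OF G(3), of 2] mm]) (use bd in auto)
 have in2: "(%x. a i x * (G i x - H x)) : L2 m" for i
  by (rule L2_bounded_mult[where C=1]) (use a G in "auto intro!: L2_diff")
 show "\<forall>\<^sub>F i in sequentially. lnorm m (%x. a i x * G i x - b x * H x) <=
  lnorm m (%x. G i x - H x) + lnorm m (%x. (a i x - b x) * H x)"
 proof (intro always_eventually allI)
  fix i
  have "lnorm m (%x. a i x * G i x - b x * H x) = lnorm m (%x. a i x * (G i x - H x) + (a i x - b x) * H x)"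
   by (simp add: algebra_simps)
  also have "\<dots> <= lnorm m (%x. a i x * (G i x - H x)) + lnorm m (%x. (a i x - b x) * H x)"
   by (rule lnorm_triangle[OF in2 in1])
  also have "lnorm m (%x. a i x * (G i x - H x)) <= lnorm m (%x. G i x - H x)"
   by (rule lnorm_mono_AE[OF L2_diff[OF G(2,3)]])
    (use a(3)[of i] in "auto simp: abs_mult intro!: AE_I2 mult_left_le_one_le")
  finally show "lnorm m (%x. a i x * G i x - b x * H x) <=
   lnorm m (%x. G i x - H x) + lnorm m (%x. (a i x - b x) * H x)" by simp
 qed
 have "(%i. lnorm m (%x. (a i x - b x) * H x)) \<longlonglongrightarrow> 0"
 proof (rule L2_dominated[OF mm _ L2_cmult[OF G(3), of 2]])
  show "AE x in m. (%i. (a i x - b x) * H x) \<longlonglongrightarrow> 0"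
   using a(5) by eventually_elim (intro tendsto_mult_left_zero, simp add: LIM_zero)
 qed (use bd in auto)
 with G(1) show "(%i. lnorm m (%x. G i x - H x) + lnorm m (%x. (a i x - b x) * H x)) \<longlonglongrightarrow> 0"
  using tendsto_add by (fastforce simp: L2_tendsto_lnorm)
qed

lemma L2_tendsto_subseq: "L2_tendsto m F f sequentially ==> strict_mono r ==> L2_tendsto m (%i. F (r i)) f sequentially"
 unfolding L2_tendsto_def by (drule LIMSEQ_subseq_LIMSEQ) (auto simp: o_def)

lemma quadratic_pos_linear_part:
 fixes a b :: real
 assumes "!!t. 0 < t ==> t <= 1 ==> 0 <= 2 * t * a + t^2 * b"
 shows "0 <= a"
proof -
 have "0 <= 2 * a + t * b" if "0 < t" "t <= 1" for t
 proof -
  have "0 <= t * (2 * a + t * b)" using assms[OF that] by (simp add: power2_eq_square algebra_simps)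
  then show ?thesis using that by (simp add: zero_le_mult_iff)
 qed
 then have ev: "\<forall>\<^sub>F t in at_right 0. 0 <= 2 * a + t * b"
  using eventually_at_right_real[OF zero_less_one] by (rule eventually_mono[rotated]) auto
 have "((%t. 2 * a + t * b) \<longlongrightarrow> 2 * a + 0 * b) (at_right 0)" by (intro tendsto_intros)
 from tendsto_lowerbound[OF this ev] show ?thesis by simp
qed

text \<open>The slopes of the Lipschitz functions near \<open>f\<close>, and their limits.  In contrast to
  relaxed slopes only strong convergence is involved, and domination takes place before the limit;
  this is the easier notion to manipulate.\<close>

definition near_slope :: "'a::metric_space measure => ('a => real) => real => ('a => real) set" where
 "near_slope m f e = {H : L2 m. EX K:bdd_Lip_L2 m. lnorm m (%x. K x - f x) < e & (AE x in m. lc K x <= H x)}"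

definition strong_slope :: "'a::metric_space measure => ('a => real) => ('a => real) => bool" where
 "strong_slope m f G \<longleftrightarrow> f : L2 m & G : L2 m & (ALL e>0. EX H:near_slope m f e. lnorm m (%x. H x - G x) < e)"

definition slope_seq where
 "slope_seq m f H F G \<longleftrightarrow> f : L2 m & H : L2 m & (ALL i::nat. F i : L2 m) & (ALL i. BL (F i)) & (ALL i. G i : L2 m) &
  (ALL i. AE x in m. lc (F i) x <= G i x) & L2_tendsto m F f sequentially & L2_tendsto m G H sequentially"

lemma slope_seqD:
 assumes "slope_seq m f H F G"
 shows "f : L2 m" "H : L2 m" "F i : L2 m" "BL (F i)" "G i : L2 m" "AE x in m. lc (F i) x <= G i x"
  "L2_tendsto m F f sequentially" "L2_tendsto m G H sequentially"
 using assms by (simp_all add: slope_seq_def)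

lemma strong_slopeI:
 assumes "slope_seq m f H F G"
 shows "strong_slope m f H"
 unfolding strong_slope_def
proof (intro conjI allI impI slope_seqD[OF assms])
 note F = slope_seqD[OF assms]
 fix e :: real assume "e > 0"
 then have "\<forall>\<^sub>F i in sequentially. lnorm m (%x. F i x - f x) < e & lnorm m (%x. G i x - H x) < e"
  using F(7,8) unfolding L2_tendsto_lnorm by (intro eventually_conj order_tendstoD(2))
 then obtain i where "lnorm m (%x. F i x - f x) < e" "lnorm m (%x. G i x - H x) < e" by (auto simp: eventually_sequentially)
 then show "EX G:near_slope m f e. lnorm m (%x. G x - H x) < e"
  using F by (intro bexI[of _ "G i"]) (auto simp: near_slope_def BL_bdd_Lip_L2 intro!: bexI[of _ "F i"])
qed

lemma strong_slopeD:
 assumes "strong_slope m f H" "0 < e"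
 shows "EX G F. G : L2 m & F : L2 m & BL F & lnorm m (%x. F x - f x) < e & (AE x in m. lc F x <= G x) & lnorm m (%x. G x - H x) < e"
proof -
 obtain G where "G : near_slope m f e" "lnorm m (%x. G x - H x) < e" using assms by (auto simp: strong_slope_def)
 moreover from this(1) obtain F where "G : L2 m" "F : L2 m" "BL F" "lnorm m (%x. F x - f x) < e" "AE x in m. lc F x <= G x"
  by (auto simp: near_slope_def BL_bdd_Lip_L2)
 ultimately show ?thesis by blast
qed

text \<open>Convergence almost everywhere is available along a subsequence, and it is what nonlinear operations need.\<close>

lemma strong_slopeE:
 assumes "strong_slope m f H"
 shows "EX F G. slope_seq m f H F G & (AE x in m. (%i. F i x) \<longlonglongrightarrow> f x) & (AE x in m. (%i. G i x) \<longlonglongrightarrow> H x)"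
proof -
 have L: "f : L2 m" "H : L2 m" using assms by (simp_all add: strong_slope_def)
 have "EX G F. G : L2 m & F : L2 m & BL F & lnorm m (%x. F x - f x) < rcp n &
   (AE x in m. lc F x <= G x) & lnorm m (%x. G x - H x) < rcp n" for n
  by (rule strong_slopeD[OF assms]) simp
 from choice[OF allI, OF this] obtain G where "ALL n. EX F. G n : L2 m & F : L2 m & BL F & lnorm m (%x. F x - f x) < rcp n &
   (AE x in m. lc F x <= G n x) & lnorm m (%x. G n x - H x) < rcp n" ..
 from choice[OF this] obtain F where FG: "!!n. G n : L2 m & F n : L2 m & BL (F n) & lnorm m (%x. F n x - f x) < rcp n &
   (AE x in m. lc (F n) x <= G n x) & lnorm m (%x. G n x - H x) < rcp n" by blast
 have lim: "L2_tendsto m F f sequentially" "L2_tendsto m G H sequentially"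
  by (rule L2_tendsto_le[OF always_eventually LIMSEQ_inverse_real_of_nat], use FG less_imp_le in blast)+
 obtain r :: "nat => nat" where r: "strict_mono r" "AE x in m. (%n. F (r n) x) \<longlonglongrightarrow> f x"
  using L2_tendsto_AE_subseq[OF lim(1)] FG L by blast
 obtain s :: "nat => nat" where s: "strict_mono s" "AE x in m. (%n. G (r (s n)) x) \<longlonglongrightarrow> H x"
  using L2_tendsto_AE_subseq[OF L2_tendsto_subseq[OF lim(2) r(1)]] FG L by blast
 have rs: "strict_mono (%n. r (s n))" using r(1) s(1) by (simp add: strict_mono_def)
 have "AE x in m. (%n. F (r (s n)) x) \<longlonglongrightarrow> f x"
  using r(2) by eventually_elim (drule LIMSEQ_subseq_LIMSEQ[OF _ s(1)], simp add: o_def)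
 then show ?thesis using FG L s(2) L2_tendsto_subseq[OF lim(1) rs] L2_tendsto_subseq[OF lim(2) rs]
  by (intro exI[of _ "%n. F (r (s n))"] exI[of _ "%n. G (r (s n))"]) (simp add: slope_seq_def)
qed

lemma strong_slope_closed:
 assumes SS: "!!n::nat. strong_slope m (f n) (H n)" and lim: "L2_tendsto m f f0 sequentially" "L2_tendsto m H H0 sequentially"
  and L2: "f0 : L2 m" "H0 : L2 m"
 shows "strong_slope m f0 H0"
 unfolding strong_slope_def
proof (intro conjI allI impI L2)
 fix e :: real assume "e > 0"
 then have e: "e / 2 > 0" by simp
 then have "\<forall>\<^sub>F i in sequentially. lnorm m (%x. f i x - f0 x) < e / 2 & lnorm m (%x. H i x - H0 x) < e / 2"
  using lim unfolding L2_tendsto_lnorm by (intro eventually_conj order_tendstoD(2))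
 then obtain i where i: "lnorm m (%x. f i x - f0 x) < e / 2" "lnorm m (%x. H i x - H0 x) < e / 2" by (auto simp: eventually_sequentially)
 obtain G K where G: "G : L2 m" "K : L2 m" "BL K" "lnorm m (%x. K x - f i x) < e / 2" "AE x in m. lc K x <= G x" "lnorm m (%x. G x - H i x) < e / 2"
  using strong_slopeD[OF SS e] by blast
 have L: "f i : L2 m" "H i : L2 m" using SS[of i] by (simp_all add: strong_slope_def)
 have "lnorm m (%x. K x - f0 x) < e" "lnorm m (%x. G x - H0 x) < e"
  using lnorm_triangle_diff[OF G(2) L(1) L2(1)] lnorm_triangle_diff[OF G(1) L(2) L2(2)] i G(4,6) by linarith+
 with G show "EX G:near_slope m f0 e. lnorm m (%x. G x - H0 x) < e"
  by (intro bexI[of _ G]) (auto simp: near_slope_def BL_bdd_Lip_L2)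
qed

lemma strong_slope_nonneg: "strong_slope m f H ==> AE x in m. 0 <= H x"
proof -
 assume "strong_slope m f H"
 then obtain F G where FG: "slope_seq m f H F G" "AE x in m. (%i. G i x) \<longlonglongrightarrow> H x" using strong_slopeE by blast
 have "AE x in m. ALL i. lc (F i) x <= G i x" using slope_seqD(6)[OF FG(1)] by (simp add: AE_all_countable)
 with FG(2) show ?thesis
  by eventually_elim (meson LIMSEQ_le_const lc_nonneg order_trans)
qed

context mms
begin

lemma L2_tendsto_BL_mult:
 assumes "BL a" "L2_tendsto m G H sequentially" "!!i. G i : L2 m" "H : L2 m"
 shows "L2_tendsto m (%i x. a x * G i x) (%x. a x * H x) sequentially"
proof -
 obtain B where "!!x. abs (a x) <= B" using assms(1) by (auto simp: BL_iff)
 then show ?thesis by (intro L2_tendsto_bounded_mult assms BL_measurable always_eventually allI)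
qed

text \<open>The slope of a combination with variable coefficients: freeze the coefficients, then the functions.  The
  bound \<open>Z\<close> for what the coefficients contribute is a parameter, because \<open>\<phi>\<close> and \<open>\<theta>\<close> may be
  dependent: for \<open>\<theta> = c - \<phi>\<close> and \<open>f = g\<close> their contributions cancel.\<close>

lemma strong_slope_product:
 assumes "strong_slope m f H" "strong_slope m g K" and BL: "BL \<phi>" "BL \<theta>" "BL k" and k: "k : L2 m" and C: "0 <= C"
  and Z: "!!a b x. lc (%y. a * \<phi> y + b * \<theta> y + k y) x <= Z a b x" "!!a b a' b' x. abs (Z a b x - Z a' b' x) <= C * (abs (a - a') + abs (b - b'))"
   "!!u v. u : L2 m ==> v : L2 m ==> (%x. Z (u x) (v x) x) : L2 m"
 shows "strong_slope m (%x. \<phi> x * f x + \<theta> x * g x + k x) (%x. abs (\<phi> x) * H x + abs (\<theta> x) * K x + Z (f x) (g x) x)"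
proof -
 obtain F G where "slope_seq m f H F G" using strong_slopeE[OF assms(1)] by blast
 note F = slope_seqD[OF this]
 obtain F' G' where "slope_seq m g K F' G'" using strong_slopeE[OF assms(2)] by blast
 note F' = slope_seqD[OF this]
 have ab: "BL (%x. abs (a x))" if "BL a" for a :: "'a => real" using BL_comp[OF that, of abs 1] by simp
 have BLs: "BL (%x. \<phi> x * F i x + \<theta> x * F' i x + k x)" for i
  using BL_lincomb[OF BL_lincomb[OF BL_mult[OF BL(1) F(4)[of i]] BL_mult[OF BL(2) F'(4)[of i]], of 1 1] BL(3), of 1 1] by simp
 have "L2_tendsto m (%i x. Z (F i x) (F' i x) x) (%x. Z (f x) (g x) x) sequentially"
 proof (rule L2_tendsto_le[OF always_eventually])
  let ?e = "%i. C * (lnorm m (%x. F i x - f x) + lnorm m (%x. F' i x - g x))"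
  show "ALL i. lnorm m (%x. Z (F i x) (F' i x) x - Z (f x) (g x) x) <= ?e i"
  proof
   fix i
   have d: "(%x. abs (F i x - f x)) : L2 m" "(%x. abs (F' i x - g x)) : L2 m" by (intro L2_abs L2_diff F F')+
   have "lnorm m (%x. Z (F i x) (F' i x) x - Z (f x) (g x) x) <= lnorm m (%x. C * (abs (F i x - f x) + abs (F' i x - g x)))"
    by (intro lnorm_mono_AE L2_cmult L2_add d L2_measurable[OF L2_diff] Z(3) F F' AE_I2 order_trans[OF Z(2) abs_ge_self])
   also have "\<dots> <= ?e i" unfolding lnorm_cmult using lnorm_triangle[OF d] C by (simp add: mult_left_mono)
   finally show "lnorm m (%x. Z (F i x) (F' i x) x - Z (f x) (g x) x) <= ?e i" .
  qed
  show "?e \<longlonglongrightarrow> 0" using F(7) F'(7) unfolding L2_tendsto_lnorm by (intro tendsto_mult_right_zero tendsto_add_zero)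
 qed
 then have "slope_seq m (%x. \<phi> x * f x + \<theta> x * g x + k x) (%x. abs (\<phi> x) * H x + abs (\<theta> x) * K x + Z (f x) (g x) x)
   (%i x. \<phi> x * F i x + \<theta> x * F' i x + k x) (%i x. abs (\<phi> x) * G i x + abs (\<theta> x) * G' i x + Z (F i x) (F' i x) x)"
  unfolding slope_seq_def
 proof (intro conjI allI BLs)
  fix i
  show "AE x in m. lc (%x. \<phi> x * F i x + \<theta> x * F' i x + k x) x <= abs (\<phi> x) * G i x + abs (\<theta> x) * G' i x + Z (F i x) (F' i x) x"
   using F(6)[of i] F'(6)[of i]
  proof eventually_elim
   case (elim x)
   have "abs (\<phi> x) * lc (F i) x <= abs (\<phi> x) * G i x" "abs (\<theta> x) * lc (F' i) x <= abs (\<theta> x) * G' i x" using elim by (auto intro: mult_left_mono)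
   with lc_product[OF BL(1) F(4) BL(2) F'(4) BL(3), of i i x] Z(1)[of "F i x" "F' i x" x] show ?case by linarith
  qed
 qed (intro L2_tendsto_add L2_tendsto_BL_mult L2_tendsto_const always_eventually allI L2_add L2_BL_mult Z(3) F F' k BL ab)+
 then show ?thesis by (rule strong_slopeI)
qed

lemma strong_slope_lincomb:
 assumes "strong_slope m f H" "strong_slope m g K"
 shows "strong_slope m (%x. a * f x + b * g x) (%x. abs a * H x + abs b * K x)"
 using strong_slope_product[OF assms BL_const[of a] BL_const[of b] BL_const[of 0], of 0 "%_ _ _. 0"] by simp

lemma strong_slope_leibniz:
 assumes f: "strong_slope m f H" and \<psi>: "cutoff \<psi>"
 shows "strong_slope m (%x. \<psi> x * f x - c * f x - d * \<psi> x) (%x. abs (\<psi> x - c) * H x + abs (f x - d) * lc \<psi> x)"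
proof -
 have BL: "BL \<psi>" using \<psi> by (rule cutoff_BL)
 obtain C where C: "0 <= C" "!!x y. abs (\<psi> x - \<psi> y) <= C * dist x y" using BL by (auto simp: BL_iff)
 have lcC: "abs (lc \<psi> x) <= C" for x using lc_le_Lip[OF C(2,1)] by simp
 note cl = cutoff_lc_L2[OF \<psi>]
 have B: "BL (%x. \<psi> x - c)" "BL (%x. - d * \<psi> x)"
  using BL_lincomb[OF BL BL_const[of 1], of 1 "-c"] BL_lincomb[OF BL BL_const[of 1], of "-d" 0] by simp_all
 have "strong_slope m (%x. (\<psi> x - c) * f x + 0 * f x + - d * \<psi> x) (%x. abs (\<psi> x - c) * H x + abs 0 * H x + abs (f x - d) * lc \<psi> x)"
 proof (rule strong_slope_product[OF f f B(1) BL_const B(2) L2_cmult[OF cl(1)] C(1), where Z="%a b x. abs (a - d) * lc \<psi> x"])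
  fix a b :: real and x
  have "(%y. a * (\<psi> y - c) + b * 0 + - d * \<psi> y) = (%y. (a - d) * \<psi> y + (- a * c) * 1)" by (auto simp: algebra_simps)
  then show "lc (%y. a * (\<psi> y - c) + b * 0 + - d * \<psi> y) x <= abs (a - d) * lc \<psi> x"
   using lc_lincomb[OF BL BL_const[of 1], of "a - d" "- a * c" x] by (simp add: abs_mult)
 next
  fix a b a' b' :: real and x
  have "abs (abs (a - d) * lc \<psi> x - abs (a' - d) * lc \<psi> x) = abs (abs (a - d) - abs (a' - d)) * lc \<psi> x" by (simp add: left_diff_distrib[symmetric] abs_mult)
  also have "\<dots> <= (abs (a - a') + abs (b - b')) * C" using lcC[of x] by (intro mult_mono) auto
  finally show "abs (abs (a - d) * lc \<psi> x - abs (a' - d) * lc \<psi> x) <= C * (abs (a - a') + abs (b - b'))" by (simp add: mult.commute)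
 next
  fix u :: "'a => real" assume u: "u : L2 m"
  have "(%x. abs (lc \<psi> x * u x - d * lc \<psi> x)) : L2 m"
   by (intro L2_abs L2_diff L2_cmult cl L2_bounded_mult[OF u _ AE_I2[OF lcC]] L2_measurable)
  moreover have "abs (lc \<psi> x * u x - d * lc \<psi> x) = abs (u x - d) * lc \<psi> x" for x
   by (simp add: left_diff_distrib[symmetric] abs_mult mult.commute[of "lc \<psi> x"])
  ultimately show "(%x. abs (u x - d) * lc \<psi> x) : L2 m" by simp
 qed
 then show ?thesis by (simp add: algebra_simps)
qed

text \<open>Glue an approximation with slope \<open>H1\<close> to one with slope \<open>H2\<close> by means of \<open>t \<psi>\<close>; the slope of \<open>\<psi>\<close> comes with
  the difference of the two approximations, which tends to zero.\<close>

lemma strong_slope_mix: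
 assumes H: "strong_slope m f H1" "strong_slope m f H2" and \<psi>: "cutoff \<psi>" and t: "0 <= t" "t <= 1"
 shows "strong_slope m f (%x. t * \<psi> x * H1 x + (1 - t * \<psi> x) * H2 x)"
proof -
 have p01: "0 <= t * \<psi> x" "t * \<psi> x <= 1" for x using \<psi> t by (auto simp: cutoff_def mult_le_one)
 have BL: "BL (%x. t * \<psi> x)" "BL (%x. 1 - t * \<psi> x)"
  using BL_lincomb[OF cutoff_BL[OF \<psi>] BL_const[of 1], of t 0] BL_lincomb[OF cutoff_BL[OF \<psi>] BL_const[of 1], of "-t" 1] by simp_all
 obtain C where C: "0 <= C" "!!x y. abs (t * \<psi> x - t * \<psi> y) <= C * dist x y" using BL(1) by (auto simp: BL_iff)
 have "strong_slope m (%x. t * \<psi> x * f x + (1 - t * \<psi> x) * f x + 0) (%x. abs (t * \<psi> x) * H1 x + abs (1 - t * \<psi> x) * H2 x + C * abs (f x - f x))"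
 proof (rule strong_slope_product[OF H BL BL_const L2_zero C(1), where Z="%a b x. C * abs (a - b)"])
  fix a b :: real and x
  have "(%y. a * (t * \<psi> y) + b * (1 - t * \<psi> y) + 0) = (%y. (a - b) * (t * \<psi> y) + b * 1)" by (auto simp: algebra_simps)
  then show "lc (%y. a * (t * \<psi> y) + b * (1 - t * \<psi> y) + 0) x <= C * abs (a - b)"
   using lc_lincomb[OF BL(1) BL_const[of 1], of "a - b" b x] mult_left_mono[OF lc_le_Lip[OF C(2,1), of x] abs_ge_zero, of "a - b"]
   by (simp add: mult.commute)
 next
  fix a b a' b' :: real and x
  have "abs (abs (a - b) - abs (a' - b')) <= abs (a - a') + abs (b - b')" by linarith
  from mult_left_mono[OF this C(1)] show "abs (C * abs (a - b) - C * abs (a' - b')) <= C * (abs (a - a') + abs (b - b'))"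
   using C(1) by (simp add: right_diff_distrib[symmetric] abs_mult)
 qed (intro L2_cmult L2_abs L2_diff)
 then show ?thesis using p01 by (simp add: algebra_simps)
qed

text \<open>Here \<open>\<theta>\<close> bounds the local Lipschitz constants of the contraction \<open>\<sigma>\<close>; its continuity is what lets
  \<open>\<theta> (F i x)\<close> converge.\<close>

lemma strong_slope_comp:
 assumes f: "strong_slope m f H" and \<sigma>: "!!s t. abs (\<sigma> s - \<sigma> t) <= abs (s - t)" "\<sigma> 0 = 0"
  and \<theta>: "continuous_on UNIV \<theta>" "!!s. 0 <= \<theta> s & \<theta> s <= 1" "!!s. \<forall>\<^sub>F t in nhds s. abs (\<sigma> t - \<sigma> s) <= \<theta> s * abs (t - s)"
 shows "strong_slope m (%x. \<sigma> (f x)) (%x. \<theta> (f x) * H x)"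
proof -
 obtain F G where "slope_seq m f H F G" and FAE: "AE x in m. (%i. F i x) \<longlonglongrightarrow> f x" using strong_slopeE[OF f] by blast
 note F = slope_seqD[OF this(1)]
 have "1-lipschitz_on UNIV \<sigma>" using \<sigma>(1) by (intro lipschitz_onI) (auto simp: dist_real_def)
 then have "continuous_on UNIV \<sigma>" by (rule lipschitz_on_continuous_on)
 then have "\<sigma> : borel_measurable borel" "\<theta> : borel_measurable borel" using \<theta>(1) by (auto intro: borel_measurable_continuous_onI)
 note sm = measurable_compose[OF L2_measurable this(1)] and tm = measurable_compose[OF L2_measurable this(2)]
 have th: "abs (\<theta> s) <= 1" for s using \<theta>(2)[of s] by simp
 have sL: "(%x. \<sigma> (h x)) : L2 m" if "h : L2 m" for h
  by (rule L2_bound[OF that sm[OF that]]) (use \<sigma>(1)[of _ 0] \<sigma>(2) in auto)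
 have tL: "(%x. \<theta> (h x) * k x) : L2 m" if "h : L2 m" "k : L2 m" for h k
  by (rule L2_bounded_mult[OF that(2) tm[OF that(1)] AE_I2[OF th]])
 have "slope_seq m (%x. \<sigma> (f x)) (%x. \<theta> (f x) * H x) (%i x. \<sigma> (F i x)) (%i x. \<theta> (F i x) * G i x)"
  unfolding slope_seq_def
 proof (intro conjI allI sL tL F)
  show "BL (%x. \<sigma> (F i x))" for i using BL_comp[OF F(4)[of i], of \<sigma> 1] \<sigma>(1) by simp
  show "AE x in m. lc (%x. \<sigma> (F i x)) x <= \<theta> (F i x) * G i x" for i using F(6)[of i]
  proof eventually_elim
   case (elim x)
   have "lc (%x. \<sigma> (F i x)) x <= \<theta> (F i x) * lc (F i) x" by (rule lc_comp_local[OF F(4) _ \<theta>(3)]) (use \<theta>(2) in blast)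
   then show ?case using mult_left_mono[OF elim, of "\<theta> (F i x)"] \<theta>(2)[of "F i x"] by simp
  qed
  show "L2_tendsto m (%i x. \<sigma> (F i x)) (%x. \<sigma> (f x)) sequentially"
   by (rule L2_tendsto_le[OF always_eventually F(7)[unfolded L2_tendsto_lnorm]])
    (intro allI lnorm_mono_AE L2_diff F L2_measurable sL AE_I2 \<sigma>(1))
  show "L2_tendsto m (%i x. \<theta> (F i x) * G i x) (%x. \<theta> (f x) * H x) sequentially"
   by (rule L2_tendsto_mult_AE[OF F(8) F(5) F(2) tm[OF F(3)] tm[OF F(1)] th th])
    (use FAE in \<open>eventually_elim, use \<theta>(1) in "auto intro: continuous_on_tendsto_compose"\<close>)
 qed
 then show ?thesis by (rule strong_slopeI)
qed

end

lemma convex_comb_norm_le: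
 assumes "f : L2 m" "g : L2 m" "h : L2 m" "0 <= t" "t <= 1" "lnorm m (%x. f x - h x) <= e" "lnorm m (%x. g x - h x) <= e"
 shows "lnorm m (%x. (1 - t) * f x + t * g x - h x) <= e"
proof -
 have "(%x. (1 - t) * f x + t * g x - h x) = (%x. (1 - t) * (f x - h x) + t * (g x - h x))" by (auto simp: algebra_simps)
 then have "lnorm m (%x. (1 - t) * f x + t * g x - h x) <= (1 - t) * lnorm m (%x. f x - h x) + t * lnorm m (%x. g x - h x)"
  using lnorm_triangle[of "%x. (1 - t) * (f x - h x)" m "%x. t * (g x - h x)"] assms by (simp add: L2_cmult L2_diff lnorm_cmult)
 also have "\<dots> <= (1 - t) * e + t * e" using assms by (intro add_mono mult_left_mono) auto
 finally show ?thesis by (simp add: algebra_simps)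
qed

context mms
begin

lemma near_slope_convex:
 assumes f: "f : L2 m" and H: "H1 : near_slope m f e" "H2 : near_slope m f e" and t: "0 <= t" "t <= 1"
 shows "(%x. (1 - t) * H1 x + t * H2 x) : near_slope m f e"
proof -
 obtain K1 where K1: "H1 : L2 m" "K1 : L2 m" "BL K1" "lnorm m (%x. K1 x - f x) < e" "AE x in m. lc K1 x <= H1 x"
  using H(1) by (auto simp: near_slope_def BL_bdd_Lip_L2)
 obtain K2 where K2: "H2 : L2 m" "K2 : L2 m" "BL K2" "lnorm m (%x. K2 x - f x) < e" "AE x in m. lc K2 x <= H2 x"
  using H(2) by (auto simp: near_slope_def BL_bdd_Lip_L2)
 have "AE x in m. lc (%x. (1 - t) * K1 x + t * K2 x) x <= (1 - t) * H1 x + t * H2 x" using K1(5) K2(5)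
 proof eventually_elim
  case (elim x)
  then have "(1 - t) * lc K1 x + t * lc K2 x <= (1 - t) * H1 x + t * H2 x" using t by (intro add_mono mult_left_mono) auto
  with lc_lincomb[OF K1(3) K2(3), of "1 - t" t x] t show ?case by simp
 qed
 moreover have "lnorm m (%x. (1 - t) * K1 x + t * K2 x - f x) <= max (lnorm m (%x. K1 x - f x)) (lnorm m (%x. K2 x - f x))"
  by (rule convex_comb_norm_le[OF K1(2) K2(2) f t]) auto
 then have "lnorm m (%x. (1 - t) * K1 x + t * K2 x - f x) < e" using K1(4) K2(4) by simp
 moreover have "(%x. (1 - t) * K1 x + t * K2 x) : bdd_Lip_L2 m" "(%x. (1 - t) * H1 x + t * H2 x) : L2 m"
  unfolding BL_bdd_Lip_L2 using K1 K2 by (auto intro!: BL_lincomb L2_add L2_cmult)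
 ultimately show ?thesis unfolding near_slope_def by (auto intro!: bexI[of _ "%x. (1 - t) * K1 x + t * K2 x"])
qed

text \<open>The functions \<open>H\<close> dominating the slope of some Lipschitz function near \<open>f\<close> form a convex set, so by Mazur's
  lemma weak limits of slopes are strong limits of such functions.\<close>

lemma relaxed_slope_strong_slope:
 assumes f: "f : L2 m" and rs: "relaxed_slope m f G"
 shows "strong_slope m f G"
 unfolding strong_slope_def
proof (intro conjI allI impI f)
 obtain F G' where G: "G : L2 m" and F: "!!i::nat. F i : bdd_Lip_L2 m" "!!i. lc (F i) : L2 m"
  "L2_tendsto m F f sequentially" and G': "G' : L2 m"
  and weak: "!!\<phi>. \<phi> : L2 m ==> (%i. ip m (lc (F i)) \<phi>) \<longlonglongrightarrow> ip m G' \<phi>" and le: "AE x in m. G' x <= G x"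
  using rs unfolding relaxed_slope_def lc_def[abs_def] ip_def by blast
 show "G : L2 m" by (rule G)
 fix e :: real assume e: "e > 0"
 let ?C = "near_slope m f e"
 have "\<forall>\<^sub>F i in sequentially. lnorm m (%x. F i x - f x) < e" using F(3) e unfolding L2_tendsto_lnorm by (rule order_tendstoD)
 then have ev: "\<forall>\<^sub>F i in sequentially. lc (F i) : ?C" by eventually_elim (use F in "auto simp: near_slope_def")
 have CL: "?C \<subseteq> L2 m" by (auto simp: near_slope_def)
 obtain H where H: "H : ?C" "lnorm m (%x. H x - G' x) < e"
  using L2_Mazur[where h="%i. lc (F i)", OF CL near_slope_convex[OF f] ev G' weak e] by blast
 obtain K where K: "H : L2 m" "K : bdd_Lip_L2 m" "lnorm m (%x. K x - f x) < e" "AE x in m. lc K x <= H x"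
  using H(1) by (auto simp: near_slope_def)
 have "AE x in m. lc K x <= H x + (G x - G' x)" using K(4) le by eventually_elim simp
 then show "EX H:?C. lnorm m (%x. H x - G x) < e"
  using K H(2) by (intro bexI[of _ "%x. H x + (G x - G' x)"]) (auto simp: near_slope_def intro!: L2_add L2_diff G G')
qed

lemma Ch_le_strong_slope:
 assumes "strong_slope m f H"
 shows "Ch m f <= ennreal ((lnorm m H)^2)"
proof -
 obtain F G where "slope_seq m f H F G" using strong_slopeE[OF assms] by blast
 note F = slope_seqD[OF this]
 have "Ch m f <= liminf (%i. \<integral>\<^sup>+x. (lip (F i) x)^2 \<partial>m)"
  unfolding Ch_def by (rule Inf_lower) (use F in "auto simp: BL_bdd_Lip_L2")
 also have "\<dots> <= liminf (%i. ennreal ((lnorm m (G i))^2))"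
 proof (rule Liminf_mono, rule always_eventually, rule allI)
  fix i
  have "(\<integral>\<^sup>+x. (lip (F i) x)^2 \<partial>m) <= (\<integral>\<^sup>+x. ennreal ((G i x)^2) \<partial>m)"
  proof (rule nn_integral_mono_AE)
   show "AE x in m. (lip (F i) x)^2 <= ennreal ((G i x)^2)" using F(6)[of i]
   proof eventually_elim
    case (elim x)
    then have "(lc (F i) x)^2 <= (G i x)^2" by (intro power_mono) auto
    then show ?case by (simp add: lip_eq_lc[OF F(4)] ennreal_power ennreal_leI)
   qed
  qed
  then show "(\<integral>\<^sup>+x. (lip (F i) x)^2 \<partial>m) <= ennreal ((lnorm m (G i))^2)" by (simp add: nn_integral_sq[OF F(5)])
 qed
 also have "\<dots> = ennreal ((lnorm m H)^2)"
  by (rule lim_imp_Liminf) (auto intro!: tendsto_ennrealI tendsto_power L2_tendsto_norm[OF F(8) _ F(2)] F(5) always_eventually)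
 finally show ?thesis .
qed

lemma strong_slope_H12: "strong_slope m f H ==> f : H12 m"
 using Ch_le_strong_slope[of f H] by (auto simp: H12_def strong_slope_def less_top[symmetric] top_unique)

text \<open>Near-minimizers among the Lipschitz functions close to \<open>f\<close> have converging slopes, because the local Lipschitz
  constant is a convex function of its argument.\<close>

lemma Ch_attained:
 assumes f: "f : H12 m"
 shows "EX G. relaxed_slope m f G & ennreal ((lnorm m G)^2) = Ch m f"
proof -
 have fL: "f : L2 m" and fin: "Ch m f < \<infinity>" using f by (auto simp: H12_def)
 define C where "C n = {lc F | F. F : bdd_Lip_L2 m & lc F : L2 m & lnorm m (%x. F x - f x) < rcp n}" for n
 obtain c where c: "0 <= c" "Ch m f = ennreal c" using fin by (metis enn2real_nonneg ennreal_enn2real_if infinity_ennreal_def less_irrefl)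
 have bd: "EX g:C n. lnorm m g <= M" if M: "0 <= M" "c < M^2" for M n
 proof -
  have "Ch m f < ennreal (M^2)" using M c by (simp add: ennreal_less_iff)
  then obtain F :: "nat => 'a => real" where F: "!!i. F i : bdd_Lip_L2 m" "L2_tendsto m F f sequentially"
   "liminf (%i. \<integral>\<^sup>+x. (lip (F i) x)^2 \<partial>m) < ennreal (M^2)"
   unfolding Ch_def Inf_less_iff by blast
  have "\<exists>\<^sub>F i in sequentially. (\<integral>\<^sup>+x. (lip (F i) x)^2 \<partial>m) < ennreal (M^2)"
   unfolding frequently_def not_less
  proof
   assume "\<forall>\<^sub>F i in sequentially. ennreal (M^2) <= (\<integral>\<^sup>+x. (lip (F i) x)^2 \<partial>m)"
   from Liminf_bounded[OF this] F(3) show False by simp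
  qed
  moreover have "\<forall>\<^sub>F i in sequentially. lnorm m (%x. F i x - f x) < rcp n"
   using F(2) unfolding L2_tendsto_lnorm by (rule order_tendstoD) simp
  ultimately have "\<exists>\<^sub>F i in sequentially. (\<integral>\<^sup>+x. (lip (F i) x)^2 \<partial>m) < ennreal (M^2) & lnorm m (%x. F i x - f x) < rcp n"
   by (rule frequently_eventually_frequently)
  then obtain i where i: "(\<integral>\<^sup>+x. (lip (F i) x)^2 \<partial>m) < ennreal (M^2)" "lnorm m (%x. F i x - f x) < rcp n"
   by (rule frequentlyE) blast
  have BL: "BL (F i)" using F(1) by (simp add: BL_bdd_Lip_L2)
  have le: "(\<integral>\<^sup>+x. ennreal ((lc (F i) x)^2) \<partial>m) < ennreal (M^2)" using i(1) by (simp add: lip_eq_lc[OF BL] ennreal_power)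
  then have "integrable m (%x. (lc (F i) x)^2)"
   using lc_measurable[OF BL] by (intro integrableI_nonneg) (auto intro: less_trans)
  then have L: "lc (F i) : L2 m" using lc_measurable[OF BL] by (simp add: L2_def)
  have "(lnorm m (lc (F i)))^2 < M^2" using le M(1) unfolding nn_integral_sq[OF L] by (simp add: ennreal_less_iff)
  then have "lnorm m (lc (F i)) <= M" using M(1) by (simp add: power2_less_imp_less less_imp_le)
  then show ?thesis using L F(1) i(2) by (auto simp: C_def)
 qed
 have CL: "C n \<subseteq> L2 m" for n by (auto simp: C_def)
 have dec: "C (Suc n) \<subseteq> C n" for n
 proof -
  have "inverse (real (Suc (Suc n))) <= rcp n" by (intro le_imp_inverse_le) auto
  then show ?thesis unfolding C_def by (blast intro: less_le_trans)
 qed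
 have mid: "EX h:C n. lnorm m h <= lnorm m (%x. (g1 x + g2 x) / 2)" if g: "g1 : C n" "g2 : C n" for n g1 g2
 proof -
  have "C n \<subseteq> near_slope m f (rcp n)" by (auto simp: C_def near_slope_def)
  with near_slope_convex[OF fL, of g1 _ g2 "1/2"] g
  have "(%x. (g1 x + g2 x) / 2) : near_slope m f (rcp n)" by (simp add: subset_iff add_divide_distrib)
  then obtain K where K: "(%x. (g1 x + g2 x) / 2) : L2 m" "K : bdd_Lip_L2 m" "lnorm m (%x. K x - f x) < rcp n"
   and le: "AE x in m. lc K x <= (g1 x + g2 x) / 2" by (auto simp: near_slope_def)
  have lm: "lc K : borel_measurable m" using K(2) by (intro lc_measurable) (simp add: BL_bdd_Lip_L2)
  have le': "AE x in m. abs (lc K x) <= abs ((g1 x + g2 x) / 2)" using le by eventually_elim (use lc_nonneg[of K] in auto)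
  show ?thesis using L2_bound[OF K(1) lm le'] lnorm_mono_AE[OF K(1) lm le'] K(2,3) unfolding C_def by blast
 qed
 have M0: "c < (sqrt (c + 1))^2" and s0: "0 <= sqrt (c + 1)" using c by simp_all
 obtain p g where p: "p : L2 m" "!!n::nat. g n : C n" "L2_tendsto m g p sequentially"
  and min: "!!M. (ALL n. EX g:C n. lnorm m g <= M) ==> lnorm m p <= M"
  using L2_min_seq[of C m "sqrt (c + 1)", OF CL dec mid bd[OF s0 M0]] by blast
 have "ALL n. EX F. g n = lc F & F : bdd_Lip_L2 m & lnorm m (%x. F x - f x) < rcp n"
  using p(2) by (auto simp: C_def simp del: of_nat_Suc)
 from choice[OF this] obtain F where F: "!!n. g n = lc (F n)" "!!n. F n : bdd_Lip_L2 m" "!!n. lnorm m (%x. F n x - f x) < rcp n" by blast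
 have gL: "g n : L2 m" for n using p(2) CL by auto
 have Ff: "L2_tendsto m F f sequentially"
  by (rule L2_tendsto_le[OF always_eventually LIMSEQ_inverse_real_of_nat]) (use F less_imp_le in blast)
 have rs: "relaxed_slope m f p"
  unfolding relaxed_slope_def
 proof (intro conjI exI)
  show "ALL i. F i : bdd_Lip_L2 m & (%x. enn2real (lip (F i) x)) : L2 m"
   using F(2) gL unfolding F(1) lc_def[abs_def] by blast
  show "\<forall>\<phi>\<in>L2 m. (%i. \<integral>x. enn2real (lip (F i) x) * \<phi> x \<partial>m) \<longlonglongrightarrow> (LINT x|m. p x * \<phi> x)"
  proof
   fix \<phi> assume \<phi>: "\<phi> : L2 m"
   have "(%i. ip m (g i) \<phi>) \<longlonglongrightarrow> ip m p \<phi>"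
    by (rule L2_tendsto_ip[OF p(3) L2_tendsto_const]) (use gL \<phi> p in auto)
   then show "(%i. \<integral>x. enn2real (lip (F i) x) * \<phi> x \<partial>m) \<longlonglongrightarrow> (LINT x|m. p x * \<phi> x)"
    by (simp add: ip_def F(1) lc_def)
  qed
 qed (use p Ff in auto)
 have "lnorm m p <= sqrt (c + e)" if "e > 0" for e
  using that c by (intro min allI bd) auto
 then have "(lnorm m p)^2 <= (sqrt (c + e))^2" if "e > 0" for e
  using that by (intro power_mono) auto
 then have "(lnorm m p)^2 <= c + e" if "e > 0" for e
  using that c(1) by fastforce
 then have "(lnorm m p)^2 <= c" by (rule field_le_epsilon)
 moreover have "ennreal c <= ennreal ((lnorm m p)^2)"
  using Ch_le_strong_slope[OF relaxed_slope_strong_slope[OF fL rs]] c by simp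
 ultimately have "ennreal ((lnorm m p)^2) = Ch m f" using c by (simp add: antisym ennreal_leI)
 with rs show ?thesis by blast
qed

abbreviation D :: "('a => real) => 'a => real" where "D \<equiv> min_slope m"

lemma H12_L2: "f : H12 m ==> f : L2 m"
 by (simp add: H12_def)

lemma min_slope_spec:
 assumes f: "f : H12 m"
 shows "strong_slope m f (D f)" "Ch m f = ennreal ((lnorm m (D f))^2)"
proof -
 have fL: "f : L2 m" using f by (simp add: H12_def)
 obtain G where G: "relaxed_slope m f G" "ennreal ((lnorm m G)^2) = Ch m f" using Ch_attained[OF f] by blast
 have "(lnorm m G)^2 <= (lnorm m H)^2" if "relaxed_slope m f H" for H
 proof -
  have "ennreal ((lnorm m G)^2) <= ennreal ((lnorm m H)^2)"
   using Ch_le_strong_slope[OF relaxed_slope_strong_slope[OF fL that]] G(2) by simp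
  then show ?thesis by simp
 qed
 then have ex: "relaxed_slope m f (D f) & (ALL H. relaxed_slope m f H --> (LINT x|m. (D f x)^2) <= (LINT x|m. (H x)^2))"
  unfolding min_slope_def lnorm_sq using G(1)
  by (intro someI[where P="%G. relaxed_slope m f G & (ALL H. relaxed_slope m f H --> (LINT x|m. (G x)^2) <= (LINT x|m. (H x)^2))" and x=G]) blast
 then show s: "strong_slope m f (D f)" using relaxed_slope_strong_slope[OF fL] by blast
 have "(lnorm m (D f))^2 <= (lnorm m G)^2" using ex G by (simp add: lnorm_sq)
 then have "ennreal ((lnorm m (D f))^2) <= Ch m f" using G(2) by (metis ennreal_leI)
 with Ch_le_strong_slope[OF s] show "Ch m f = ennreal ((lnorm m (D f))^2)" by simp
qed

lemma D_L2: "f : H12 m ==> D f : L2 m"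
 using min_slope_spec(1) by (auto simp: strong_slope_def)

lemma D_nonneg: "f : H12 m ==> AE x in m. 0 <= D f x"
 using min_slope_spec(1) strong_slope_nonneg by blast

text \<open>Minimality in norm implies pointwise minimality: mixing in another slope by means of a cut-off function
  gives the first order condition \<open>0 \<le> \<integral>\<psi> |Df| (H - |Df|)\<close>.\<close>

lemma D_le:
 assumes H: "strong_slope m f H"
 shows "AE x in m. D f x <= H x"
proof -
 have f: "f : H12 m" by (rule strong_slope_H12[OF H])
 have DL: "D f : L2 m" and HL: "H : L2 m" using D_L2[OF f] H by (auto simp: strong_slope_def)
 have HDL: "(%x. H x - D f x) : L2 m" by (rule L2_diff[OF HL DL])
 have "AE x in m. 0 <= D f x * (H x - D f x)"
 proof (rule cutoff_test_nonneg[OF sets_m L2_integrable_mult[OF DL HDL] zero_less_one])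
  fix \<psi> :: "'a => real" assume \<psi>: "cutoff \<psi>"
  have pL: "(%x. \<psi> x * (H x - D f x)) : L2 m" by (rule L2_BL_mult[OF HDL cutoff_BL[OF \<psi>]])
  have "0 <= 2 * t * ip m (D f) (%x. \<psi> x * (H x - D f x)) + t^2 * (lnorm m (%x. \<psi> x * (H x - D f x)))^2" if t: "0 < t" "t <= 1" for t
  proof -
   have "strong_slope m f (%x. t * \<psi> x * H x + (1 - t * \<psi> x) * D f x)"
    by (rule strong_slope_mix[OF H min_slope_spec(1)[OF f] \<psi>]) (use t in auto)
   from Ch_le_strong_slope[OF this] have "(lnorm m (D f))^2 <= (lnorm m (%x. t * \<psi> x * H x + (1 - t * \<psi> x) * D f x))^2"
    unfolding min_slope_spec(2)[OF f] by simp
   also have "(%x. t * \<psi> x * H x + (1 - t * \<psi> x) * D f x) = (%x. D f x + t * (\<psi> x * (H x - D f x)))" by (auto simp: algebra_simps)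
   also have "(lnorm m \<dots>)^2 = (lnorm m (D f))^2 + 2 * t * ip m (D f) (%x. \<psi> x * (H x - D f x)) + t^2 * (lnorm m (%x. \<psi> x * (H x - D f x)))^2"
    using lnorm_sum_sq[OF DL L2_cmult[OF pL], of t] by (simp add: ip_cmult_right lnorm_cmult power_mult_distrib)
   finally show ?thesis by simp
  qed
  from quadratic_pos_linear_part[OF this] show "0 <= (LINT x|m. \<psi> x ^ 1 * (D f x * (H x - D f x)))"
   by (simp add: ip_def mult.left_commute)
 qed
 then show ?thesis using strong_slope_nonneg[OF H] D_nonneg[OF f]
  by eventually_elim (smt (verit) zero_le_mult_iff)
qed

lemma H12_lincomb: "f : H12 m ==> g : H12 m ==> (%x. a * f x + b * g x) : H12 m"
 using strong_slope_H12[OF strong_slope_lincomb[OF min_slope_spec(1) min_slope_spec(1)]] .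

lemma H12_cmult: "f : H12 m ==> (%x. a * f x) : H12 m"
 using H12_lincomb[of f f a 0] by simp

lemma H12_add: "f : H12 m ==> g : H12 m ==> (%x. f x + g x) : H12 m"
 using H12_lincomb[of f g 1 1] by simp

lemma H12_diff: "f : H12 m ==> g : H12 m ==> (%x. f x - g x) : H12 m"
 using H12_lincomb[of f g 1 "-1"] by simp

lemma D_lincomb: "f : H12 m ==> g : H12 m ==> AE x in m. D (%x. a * f x + b * g x) x <= abs a * D f x + abs b * D g x"
 by (rule D_le[OF strong_slope_lincomb[OF min_slope_spec(1) min_slope_spec(1)]])

lemma D_cmult:
 assumes f: "f : H12 m" shows "AE x in m. D (%x. a * f x) x = abs a * D f x"
proof -
 have le: "AE x in m. D (%x. b * g x) x <= abs b * D g x" if "g : H12 m" for b g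
  using D_lincomb[OF that that, of b 0] by simp
 have "AE x in m. 0 <= D (%x. a * f x) x" by (intro D_nonneg H12_cmult f)
 show ?thesis
 proof (cases "a = 0")
  case True
  show ?thesis using le[OF f, of a] \<open>AE x in m. 0 <= D (%x. a * f x) x\<close> by eventually_elim (simp add: True)
 next
  case False
  have "AE x in m. D (%x. 1 / a * (a * f x)) x <= abs (1 / a) * D (%x. a * f x) x" by (rule le[OF H12_cmult[OF f]])
  then show ?thesis using le[OF f, of a]
  proof eventually_elim
   case (elim x)
   then have "abs a * D f x <= D (%x. a * f x) x" using False by (simp add: field_simps)
   with elim show ?case by simp
  qed
 qed
qed

lemma D_diff_le:
 assumes "f : H12 m" "g : H12 m" shows "AE x in m. abs (D f x - D g x) <= D (%x. f x - g x) x"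
proof -
 have fg: "(%x. f x - g x) : H12 m" by (rule H12_diff[OF assms])
 have "AE x in m. D (%x. 1 * (f x - g x) + 1 * g x) x <= abs 1 * D (%x. f x - g x) x + abs 1 * D g x"
  by (rule D_lincomb[OF fg assms(2)])
 moreover have "AE x in m. D (%x. (-1) * (f x - g x) + 1 * f x) x <= abs (-1) * D (%x. f x - g x) x + abs 1 * D f x"
  by (rule D_lincomb[OF fg assms(1)])
 ultimately show ?thesis by eventually_elim (simp add: abs_le_iff)
qed

lemma D_leibniz:
 assumes "f : H12 m" "cutoff \<psi>"
 shows "(%x. \<psi> x * f x - c * f x - d * \<psi> x) : H12 m"
  "AE x in m. D (%x. \<psi> x * f x - c * f x - d * \<psi> x) x <= abs (\<psi> x - c) * D f x + abs (f x - d) * lc \<psi> x"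
 using strong_slope_leibniz[OF min_slope_spec(1)[OF assms(1)] assms(2), of c d] D_le strong_slope_H12 by blast+

lemma H12_comp:
 assumes "f : H12 m" "!!s t. abs (\<sigma> s - \<sigma> t) <= abs (s - t)" "\<sigma> 0 = 0"
 shows "(%x. \<sigma> (f x)) : H12 m"
 using strong_slope_comp[OF min_slope_spec(1)[OF assms(1)] assms(2,3), of "%_. 1"] assms(2) strong_slope_H12 by simp

text \<open>Soft thresholding kills the slope near the zero set and costs nothing in the limit.\<close>

lemma D_zero_set:
 assumes f: "f : H12 m" shows "AE x in m. f x = 0 --> D f x = 0"
proof -
 have fL: "f : L2 m" and DL: "D f : L2 m" using D_L2[OF f] f by (auto simp: H12_def)
 note [measurable] = L2_measurable[OF fL] L2_measurable[OF DL]
 define \<delta> where "\<delta> n = rcp n" for n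
 have d: "\<delta> n > 0" for n by (simp add: \<delta>_def)
 have dlim: "\<delta> \<longlonglongrightarrow> 0" unfolding \<delta>_def[abs_def] by (rule LIMSEQ_inverse_real_of_nat)
 define \<sigma> where "\<sigma> n s = s - max (- \<delta> n) (min (\<delta> n) s)" for n s
 define \<theta> where "\<theta> n s = min 1 (abs s / \<delta> n)" for n s
 have \<sigma>: "abs (\<sigma> n s - \<sigma> n t) <= abs (s - t)" "\<sigma> n 0 = 0" for n s t using d[of n] by (auto simp: \<sigma>_def max_def min_def)
 have th: "0 <= \<theta> n s" "\<theta> n s <= 1" for n s using d[of n] by (auto simp: \<theta>_def)
 have loc: "\<forall>\<^sub>F t in nhds s. abs (\<sigma> n t - \<sigma> n s) <= \<theta> n s * abs (t - s)" for n s
 proof (cases "abs s < \<delta> n")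
  case True
  then have "\<forall>\<^sub>F t in nhds s. t : {-\<delta> n<..<\<delta> n}" by (intro eventually_nhds_in_open) auto
  then show ?thesis by eventually_elim (use True th(1)[of n s] in "auto simp: \<sigma>_def")
 next
  case False
  then show ?thesis using \<sigma>(1)[of n _ s] d[of n] by (auto simp: \<theta>_def)
 qed
 have SS: "strong_slope m (%x. \<sigma> n (f x)) (%x. \<theta> n (f x) * D f x)" for n
  using d[of n] by (intro strong_slope_comp min_slope_spec(1)[OF f] \<sigma> loc) (auto simp: \<theta>_def intro!: continuous_intros)
 let ?H = "%x. (if f x = 0 then 0 else 1) * D f x"
 have "{x : space m. f x = 0} : sets m" using borel_measurable_eq[of f m "%x. 0"] by simp
 then have ifm: "(%x. if f x = 0 then 0 else 1 :: real) : borel_measurable m" by (intro measurable_If) auto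
 have "strong_slope m f ?H"
 proof (rule strong_slope_closed[OF SS _ _ fL])
  show "L2_tendsto m (%n x. \<sigma> n (f x)) f sequentially"
   unfolding L2_tendsto_lnorm
  proof (rule L2_dominated[OF _ _ fL])
   show "AE x in m. (%n. \<sigma> n (f x) - f x) \<longlonglongrightarrow> 0"
   proof (rule AE_I2)
    fix x
    have "(%n. \<sigma> n (f x) - f x) \<longlonglongrightarrow> f x - max (- 0) (min 0 (f x)) - f x" unfolding \<sigma>_def by (intro tendsto_intros dlim)
    then show "(%n. \<sigma> n (f x) - f x) \<longlonglongrightarrow> 0" by (simp add: max_def min_def split: if_splits)
   qed
   show "AE x in m. abs (\<sigma> n (f x) - f x) <= abs (f x)" for n using d[of n] by (intro AE_I2) (auto simp: \<sigma>_def max_def min_def)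
  qed (simp add: \<sigma>_def)
  show "L2_tendsto m (%n x. \<theta> n (f x) * D f x) ?H sequentially"
  proof (rule L2_tendsto_mult_AE[OF L2_tendsto_const DL DL])
   have "(%n. \<theta> n (f x)) \<longlonglongrightarrow> (if f x = 0 then 0 else 1)" for x
   proof (cases "f x = 0")
    case False
    have "\<forall>\<^sub>F n in sequentially. \<delta> n < abs (f x)" using dlim False by (intro order_tendstoD) auto
    then have "\<forall>\<^sub>F n in sequentially. \<theta> n (f x) = 1"
     by eventually_elim (use d in "auto simp: \<theta>_def min_def not_le divide_less_eq")
    then show ?thesis using False by (simp add: tendsto_eventually)
   qed (simp add: \<theta>_def)
   then show "AE x in m. (%n. \<theta> n (f x)) \<longlonglongrightarrow> (if f x = 0 then 0 else 1)" by simp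
   show "abs (\<theta> n (f x)) <= 1" for n x using th[of n "f x"] by simp
  qed (use ifm in "auto simp: \<theta>_def")
  show "?H : L2 m" by (rule L2_bounded_mult[OF DL ifm, where C=1]) auto
 qed
 from D_le[OF this] D_nonneg[OF f] show ?thesis by eventually_elim auto
qed

lemma D_eq_on:
 assumes "f : H12 m" "g : H12 m" shows "AE x in m. f x = g x --> D f x = D g x"
 using D_zero_set[OF H12_diff[OF assms]] D_diff_le[OF assms] by eventually_elim auto

lemma cutoff_mult_H12: "f : H12 m ==> cutoff \<psi> ==> (%x. \<psi> x * f x) : H12 m"
 using D_leibniz(1)[of f \<psi> 0 0] by simp

end

section \<open>The parallelogram identity for minimal relaxed slopes\<close>

lemma rational_nonneg_imp:
 fixes f :: "real => real"
 assumes "continuous_on UNIV f" "!!q. q : \<rat> ==> 0 <= f q"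
 shows "0 <= f r"
proof (rule ccontr)
 assume "~ 0 <= f r"
 then have "r : {r. f r < 0}" by simp
 moreover have "open {r. f r < 0}" using assms(1) by (intro open_Collect_less) auto
 ultimately obtain e where e: "e > 0" "ball r e \<subseteq> {r. f r < 0}" by (meson openE)
 obtain q where q: "q : \<rat>" "r < q" "q < r + e" using Rats_dense_in_real[of r "r + e"] e by auto
 then have "q : ball r e" by (simp add: dist_real_def)
 with e(2) assms(2)[OF q(1)] show False by auto
qed

text \<open>The triangle wave: near every point it is \<open>t\<close> or \<open>- t\<close> up to an even integer.\<close>

definition tri :: "real => real" where
 "tri t = infdist t (range (%j::int. 2 * real_of_int j))"

lemma tri_Lipschitz: "abs (tri s - tri t) <= abs (s - t)"
 unfolding tri_def using infdist_triangle_abs[of s _ t] by (simp add: dist_real_def)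

lemma tri_affine:
 "tri t = (if even \<lfloor>t\<rfloor> then 1 else -1) * t + (if even \<lfloor>t\<rfloor> then - real_of_int \<lfloor>t\<rfloor> else real_of_int \<lfloor>t\<rfloor> + 1)"
proof -
 define k where "k = \<lfloor>t\<rfloor>"
 have k: "real_of_int k <= t" "t < real_of_int k + 1" unfolding k_def by linarith+
 let ?R = "range (%j::int. 2 * real_of_int j)"
 have ub: "tri t <= abs (t - 2 * real_of_int j)" for j
  unfolding tri_def using infdist_le[of "2 * real_of_int j" ?R t] by (simp add: dist_real_def)
 have lb: "c <= tri t" if "!!j::int. c <= abs (t - 2 * real_of_int j)" for c
  unfolding tri_def infdist_def using that by (auto intro!: cINF_greatest simp: dist_real_def)
 show ?thesis
 proof (cases "even k")
  case True
  then obtain i where i: "k = 2 * i" by (elim evenE)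
  have "t - real_of_int k <= abs (t - 2 * real_of_int j)" for j
  proof (cases "j <= i")
   case True then show ?thesis using k i by (simp add: abs_if)
  next
   case False
   then have "real_of_int j >= real_of_int i + 1" by linarith
   then show ?thesis using k i by (simp add: abs_if)
  qed
  from lb[OF this] ub[of i] show ?thesis using k i True by (simp add: k_def[symmetric])
 next
  case False
  then obtain i where i: "k = 2 * i + 1" by (elim oddE)
  have "real_of_int k + 1 - t <= abs (t - 2 * real_of_int j)" for j
  proof (cases "j <= i")
   case True
   then have "real_of_int j <= real_of_int i" by simp
   then show ?thesis using k i by (simp add: abs_if)
  next
   case False
   then have "real_of_int j >= real_of_int i + 1" by linarith
   then show ?thesis using k i by (simp add: abs_if)
  qed
  from lb[OF this] ub[of "i + 1"] show ?thesis using k i False by (simp add: k_def[symmetric])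
 qed
qed

lemma tri_bounds: "0 <= tri t" "tri t <= 1"
proof -
 show "0 <= tri t" by (simp add: tri_def infdist_nonneg)
 have "real_of_int \<lfloor>t\<rfloor> <= t" "t < real_of_int \<lfloor>t\<rfloor> + 1" by linarith+
 then show "tri t <= 1" unfolding tri_affine[of t] by (cases "even \<lfloor>t\<rfloor>"; simp; linarith)
qed

lemma tri_0: "tri 0 = 0"
 by (simp add: tri_affine)

text \<open>A triangle wave of slope \<open>\<plusminus>1\<close> and amplitude \<open>1 / (n + 1)\<close>.\<close>

definition saw :: "nat => real => real" where
 "saw n s = tri (real (Suc n) * s) / real (Suc n)"

lemma saw_Lipschitz: "abs (saw n s - saw n t) <= abs (s - t)"
proof -
 have "abs (tri (real (Suc n) * s) - tri (real (Suc n) * t)) <= real (Suc n) * abs (s - t)"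
  using tri_Lipschitz[of "real (Suc n) * s" "real (Suc n) * t"]
  by (simp add: right_diff_distrib[symmetric] abs_mult del: of_nat_Suc)
 then show ?thesis unfolding saw_def diff_divide_distrib[symmetric] abs_divide
  by (simp add: divide_le_eq mult.commute del: of_nat_Suc)
qed

lemma saw_0: "saw n 0 = 0"
 by (simp add: saw_def tri_0)

lemma saw_bounds: "0 <= saw n s" "saw n s <= rcp n"
 using tri_bounds[of "real (Suc n) * s"] by (auto simp: saw_def divide_simps)

lemma saw_affine: "EX e:{1, -1}. EX k::int. saw n s = e * s + real_of_int k * rcp n"
proof -
 define t where "t = real (Suc n) * s"
 define e :: real where "e = (if even \<lfloor>t\<rfloor> then 1 else -1)"
 define k :: int where "k = (if even \<lfloor>t\<rfloor> then - \<lfloor>t\<rfloor> else \<lfloor>t\<rfloor> + 1)"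
 have "tri t = e * t + real_of_int k" unfolding tri_affine[of t] e_def k_def by simp
 then have "saw n s = (e * t + real_of_int k) / real (Suc n)" by (simp add: saw_def t_def del: of_nat_Suc)
 also have "\<dots> = e * s + real_of_int k * rcp n"
  by (simp add: t_def field_simps del: of_nat_Suc)
 finally show ?thesis by (intro bexI[of _ e] exI[of _ k]) (auto simp: e_def)
qed

locale ih_space = mms +
 assumes ih: "infinitesimally_Hilbertian m"
begin

lemma Ch_parallelogram:
 assumes f: "f : H12 m" and h: "h : H12 m"
 shows "(lnorm m (D (%x. f x + h x)))^2 + (lnorm m (D (%x. f x - h x)))^2 = 2 * (lnorm m (D f))^2 + 2 * (lnorm m (D h))^2"
proof -
 obtain B where B0: "ALL f:H12 m. ALL h:H12 m. B f h = B h f"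
  "ALL f:H12 m. ALL h:H12 m. ALL k:H12 m. B (%x. f x + h x) k = B f k + B h k"
  "ALL c. ALL f:H12 m. ALL h:H12 m. B (%x. c * f x) h = c * B f h"
  "ALL f:H12 m. B f f = H12_sqnorm m f"
  using ih unfolding infinitesimally_Hilbertian_def by (elim conjE exE) (rule that)
 note B = B0(1)[rule_format] B0(2)[rule_format] B0(3)[rule_format] B0(4)[rule_format]
 have BN: "B u u = (lnorm m u)^2 + (lnorm m (D u))^2" if "u : H12 m" for u
  using B(4)[OF that] by (simp add: H12_sqnorm_def lnorm_sq min_slope_spec(2)[OF that] del: lnorm_sq) (simp add: lnorm_sq)
 have h': "(%x. (-1) * h x) : H12 m" by (rule H12_cmult[OF h])
 have add: "B (%x. f x + k x) (%x. f x + k x) = B f f + 2 * B f k + B k k" if k: "k : H12 m" for k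
  using B(2)[OF f k H12_add[OF f k]] B(1)[OF f H12_add[OF f k]] B(1)[OF k H12_add[OF f k]]
   B(2)[OF f k f] B(2)[OF f k k] B(1)[OF f k] by simp
 have neg: "B f (%x. (-1) * h x) = - B f h" using B(1)[OF f h'] B(3)[OF h f, of "-1"] B(1)[OF f h] by simp
 have neg2: "B (%x. (-1) * h x) (%x. (-1) * h x) = B h h"
  using B(3)[OF h h', of "-1"] B(1)[OF h h'] B(3)[OF h h, of "-1"] by simp
 have eq: "(%x. f x + (-1) * h x) = (%x. f x - h x)" by auto
 have "B (%x. f x + h x) (%x. f x + h x) + B (%x. f x - h x) (%x. f x - h x) = 2 * B f f + 2 * B h h"
  using add[OF h] add[OF h'] unfolding eq neg neg2 by simp
 moreover have "(lnorm m (%x. f x + h x))^2 + (lnorm m (%x. f x - h x))^2 = 2 * (lnorm m f)^2 + 2 * (lnorm m h)^2"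
  using lnorm_sum_sq[of f m h] lnorm_diff_sq[of f m h] f h by (simp add: H12_L2)
 ultimately show ?thesis using BN[OF H12_add[OF f h]] BN[OF H12_diff[OF f h]] BN[OF f] BN[OF h] by simp
qed

text \<open>On the set where \<open>\<psi>\<close> is near a rational \<open>q\<close>, compare with \<open>q w\<close>; countably many \<open>q\<close> suffice.\<close>

lemma D_cutoff_mult:
 assumes w: "w : H12 m" and \<psi>: "cutoff \<psi>"
 shows "AE x in m. abs (D (%x. \<psi> x * w x + c * \<psi> x) x - \<psi> x * D w x) <= abs (w x + c) * lc \<psi> x"
proof -
 let ?v = "%x. \<psi> x * w x + c * \<psi> x"
 have v: "?v : H12 m" using D_leibniz(1)[OF w \<psi>, of 0 "-c"] by simp
 have "AE x in m. abs (D ?v x - abs q * D w x) <= abs (\<psi> x - q) * D w x + abs (w x + c) * lc \<psi> x" for q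
 proof -
  have eq: "(%x. ?v x - q * w x) = (%x. \<psi> x * w x - q * w x - (-c) * \<psi> x)" by auto
  from D_diff_le[OF v H12_cmult[OF w, of q], unfolded eq] D_leibniz(2)[OF w \<psi>, of q "-c"] D_cmult[OF w, of q]
  show ?thesis by eventually_elim auto
 qed
 then have "AE x in m. ALL q:\<rat>. abs (D ?v x - abs q * D w x) <= abs (\<psi> x - q) * D w x + abs (w x + c) * lc \<psi> x"
  by (subst AE_ball_countable[OF countable_rat]) auto
 then show ?thesis
 proof eventually_elim
  case (elim x)
  have "0 <= abs (\<psi> x - q) * D w x + abs (w x + c) * lc \<psi> x - abs (D ?v x - abs q * D w x)" for q
   by (rule rational_nonneg_imp[of "%q. abs (\<psi> x - q) * D w x + abs (w x + c) * lc \<psi> x - abs (D ?v x - abs q * D w x)"])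
    (use elim in "auto intro!: continuous_intros")
  from this[of "\<psi> x"] show ?case using \<psi> by (simp add: cutoff_def)
 qed
qed

text \<open>Where \<open>saw n (f x) = e f + k r\<close> and \<open>saw n (h x) = e' h + k' r\<close> with \<open>r = 1 / (n + 1)\<close> and signs \<open>e\<close>, \<open>e'\<close>, locality replaces the
  slope of \<open>a + b\<close> by that of the cut-off of \<open>e f + e' h + (k + k') r\<close>.  Depending on \<open>e e'\<close> this is the slope of
  \<open>f + h\<close> or of \<open>f - h\<close>, and \<open>a - b\<close> gets the other one.\<close>

lemma D_saw_pair:
 fixes n :: nat
 assumes f: "f : H12 m" and h: "h : H12 m" and \<psi>: "cutoff \<psi>"
 defines "a \<equiv> %x. \<psi> x * saw n (f x)" and "b \<equiv> %x. \<psi> x * saw n (h x)" and "\<delta> \<equiv> %x. 2 * rcp n * lc \<psi> x"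
 shows "AE x in m. abs (D (%x. a x + b x) x - \<psi> x * D (%x. f x + h x) x) <= \<delta> x & abs (D (%x. a x - b x) x - \<psi> x * D (%x. f x - h x) x) <= \<delta> x
  | abs (D (%x. a x + b x) x - \<psi> x * D (%x. f x - h x) x) <= \<delta> x & abs (D (%x. a x - b x) x - \<psi> x * D (%x. f x + h x) x) <= \<delta> x"
proof -
 have a: "a : H12 m" and b: "b : H12 m"
  unfolding a_def b_def by (intro cutoff_mult_H12 \<psi> H12_comp[OF f saw_Lipschitz saw_0] H12_comp[OF h saw_Lipschitz saw_0])+
 define r where "r = rcp n"
  \<comment> \<open>the affine pieces, indexed by the signs and the integer constants\<close>
 define v where "v e e' k = (%x. \<psi> x * (e * f x + e' * h x) + real_of_int k * r * \<psi> x)" for e e' :: real and k :: int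
 have w: "(%x. e * f x + e' * h x) : H12 m" for e e' by (rule H12_lincomb[OF f h])
 have vH: "v e e' k : H12 m" for e e' k using D_leibniz(1)[OF w \<psi>, of e e' 0 "- (real_of_int k * r)"] by (simp add: v_def)
 have near: "AE x in m. ALL e:{1,-1}. ALL e':{1,-1}. ALL k. abs (D (v e e' k) x - \<psi> x * D (%x. e * f x + e' * h x) x) <= abs (e * f x + e' * h x + real_of_int k * r) * lc \<psi> x"
  by (rule AE_ball_countable', rule AE_ball_countable', unfold AE_all_countable, rule allI, unfold v_def,
    rule D_cutoff_mult[OF w \<psi>]) auto
 have ex1: "AE x in m. ALL e:{1,-1}. ALL e':{1,-1}. ALL k. a x + b x = v e e' k x --> D (%x. a x + b x) x = D (v e e' k) x"
  using D_eq_on[OF H12_add[OF a b] vH] by (simp add: AE_all_countable)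
 have ex2: "AE x in m. ALL e:{1,-1}. ALL e':{1,-1}. ALL k. a x - b x = v e e' k x --> D (%x. a x - b x) x = D (v e e' k) x"
  using D_eq_on[OF H12_diff[OF a b] vH] by (simp add: AE_all_countable)
 have neg1: "AE x in m. D (%x. - f x - h x) x = D (%x. f x + h x) x"
  using D_cmult[OF H12_add[OF f h], of "-1"] by (simp add: add.commute minus_diff_commute)
 have neg2: "AE x in m. D (%x. - f x + h x) x = D (%x. f x - h x) x"
  using D_cmult[OF H12_diff[OF f h], of "-1"] by simp
 show ?thesis using near ex1 ex2 neg1 neg2
 proof eventually_elim
  case (elim x)
  obtain e k where e: "e : {1,-1}" "saw n (f x) = e * f x + real_of_int k * r" using saw_affine[of n "f x"] unfolding r_def by blast
  obtain e' k' where e': "e' : {1,-1}" "saw n (h x) = e' * h x + real_of_int k' * r" using saw_affine[of n "h x"] unfolding r_def by blast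
  have me': "- e' : {1,-1}" using e'(1) by auto
  have A: "a x + b x = v e e' (k + k') x" by (simp add: a_def b_def v_def e(2) e'(2) algebra_simps)
  have B: "a x - b x = v e (-e') (k - k') x" by (simp add: a_def b_def v_def e(2) e'(2) algebra_simps)
  have s1: "e * f x + e' * h x + real_of_int (k + k') * r = saw n (f x) + saw n (h x)" by (simp add: e(2) e'(2) algebra_simps)
  have s2: "e * f x + (-e') * h x + real_of_int (k - k') * r = saw n (f x) - saw n (h x)" by (simp add: e(2) e'(2) algebra_simps)
  have bd: "abs (saw n (f x) + saw n (h x)) <= 2 * r" "abs (saw n (f x) - saw n (h x)) <= 2 * r"
   using saw_bounds[of n "f x"] saw_bounds[of n "h x"] by (auto simp: r_def)
  have "abs (D (%x. a x + b x) x - \<psi> x * D (%x. e * f x + e' * h x) x) <= abs (saw n (f x) + saw n (h x)) * lc \<psi> x"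
   using elim(1)[rule_format, OF e(1) e'(1), of "k + k'"] elim(2)[rule_format, OF e(1) e'(1) A] unfolding s1 by simp
  also have "\<dots> <= \<delta> x" using mult_right_mono[OF bd(1), of "lc \<psi> x"] by (simp add: \<delta>_def r_def)
  finally have 1: "abs (D (%x. a x + b x) x - \<psi> x * D (%x. e * f x + e' * h x) x) <= \<delta> x" .
  have "abs (D (%x. a x - b x) x - \<psi> x * D (%x. e * f x + (-e') * h x) x) <= abs (saw n (f x) - saw n (h x)) * lc \<psi> x"
   using elim(1)[rule_format, OF e(1) me', of "k - k'"] elim(3)[rule_format, OF e(1) me' B] unfolding s2 by simp
  also have "\<dots> <= \<delta> x" using mult_right_mono[OF bd(2), of "lc \<psi> x"] by (simp add: \<delta>_def r_def)
  finally have 2: "abs (D (%x. a x - b x) x - \<psi> x * D (%x. e * f x + (-e') * h x) x) <= \<delta> x" .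
  show ?case using e(1) e'(1) 1 2 elim(4,5) by (auto simp: add.commute)
 qed
qed

lemma D_saw:
 assumes f: "f : H12 m" and \<psi>: "cutoff \<psi>"
 shows "AE x in m. abs (D (%x. \<psi> x * saw n (f x)) x - \<psi> x * D f x) <= 2 * rcp n * lc \<psi> x"
proof -
 have z: "(%x. 0) : H12 m" using H12_cmult[OF f, of 0] by simp
 show ?thesis using D_saw_pair[OF f z \<psi>, of n] by (simp add: saw_0)
qed

lemma sq_close:
 fixes u p d :: real
 assumes "abs (u - p) <= d" "0 <= p"
 shows "abs (u^2 - p^2) <= d^2 + 2 * d * p"
proof -
 have "u^2 - p^2 = (u - p) * ((u - p) + 2 * p)" by (simp add: algebra_simps power2_eq_square)
 then have "abs (u^2 - p^2) = abs (u - p) * abs ((u - p) + 2 * p)" by (simp add: abs_mult)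
 also have "\<dots> <= d * (d + 2 * p)" using assms by (intro mult_mono) auto
 finally show ?thesis by (simp add: algebra_simps power2_eq_square)
qed

text \<open>The parallelogram identity holds pointwise.  Sawtooth functions of \<open>f\<close> and \<open>h\<close> have
  small amplitude, hence can be multiplied by a cut-off function without changing slopes; their
  slopes are \<open>\<plusminus>\<close> those of \<open>f\<close> and \<open>h\<close>, and
  \<open>|D(f + h)|\<^sup>2 + |D(f - h)|\<^sup>2\<close> does not depend on the signs.  So the integrated identity
  localizes.\<close>

lemma D_parallelogram:
 assumes f: "f : H12 m" and h: "h : H12 m"
 shows "AE x in m. (D (%x. f x + h x) x)^2 + (D (%x. f x - h x) x)^2 = 2 * (D f x)^2 + 2 * (D h x)^2"
proof -
 define P where "P = D (%x. f x + h x)"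
 define M where "M = D (%x. f x - h x)"
 define z where "z x = (P x)^2 + (M x)^2 - 2 * (D f x)^2 - 2 * (D h x)^2" for x
 have PL: "P : L2 m" "M : L2 m" "D f : L2 m" "D h : L2 m"
  unfolding P_def M_def by (intro D_L2 H12_add H12_diff f h)+
 have nn: "AE x in m. 0 <= P x" "AE x in m. 0 <= M x" "AE x in m. 0 <= D f x" "AE x in m. 0 <= D h x"
  unfolding P_def M_def by (intro D_nonneg H12_add H12_diff f h)+
 have zi: "integrable m z" unfolding z_def using PL
  by (intro Bochner_Integration.integrable_diff Bochner_Integration.integrable_add integrable_mult_right L2_sq_integrable)
 have zero: "(LINT x|m. (\<psi> x)^2 * z x) = 0" if \<psi>: "cutoff \<psi>" for \<psi>
 proof -
  define S where "S x = P x + M x + 2 * D f x + 2 * D h x" for x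
    \<comment> \<open>the error at scale \<open>r \<le> 1\<close> is at most \<open>r R\<close>\<close>
  define R where "R x = 24 * (lc \<psi> x)^2 + 4 * (lc \<psi> x * S x)" for x
  have SL: "S : L2 m" unfolding S_def by (intro L2_add L2_cmult PL)
  have lL: "lc \<psi> : L2 m" by (rule cutoff_lc_L2[OF \<psi>])
  have Ri: "integrable m R" unfolding R_def using SL lL
   by (intro Bochner_Integration.integrable_add integrable_mult_right L2_sq_integrable L2_integrable_mult)
  have p01: "0 <= \<psi> x" "\<psi> x <= 1" for x using \<psi> by (auto simp: cutoff_def)
  have pm: "\<psi> : borel_measurable m" by (rule BL_measurable[OF cutoff_BL[OF \<psi>]])
  have pzi: "integrable m (%x. (\<psi> x)^2 * z x)"
  proof (rule Bochner_Integration.integrable_bound[OF zi])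
   show "AE x in m. norm ((\<psi> x)^2 * z x) <= norm (z x)"
    using p01 by (auto intro!: AE_I2 mult_left_le_one_le power_le_one simp: abs_mult)
  qed (use pm zi in auto)
  have "abs (\<integral>x. (\<psi> x)^2 * z x \<partial>m) <= rcp n * (LINT x|m. R x)" for n
  proof -
   define a where "a x = \<psi> x * saw n (f x)" for x
   define b where "b x = \<psi> x * saw n (h x)" for x
   define r where "r = rcp n"
   have r: "0 < r" "r <= 1" by (auto simp: r_def inverse_le_1_iff)
   have ab: "a : H12 m" "b : H12 m"
    unfolding a_def b_def by (intro cutoff_mult_H12 \<psi> H12_comp[OF f saw_Lipschitz saw_0] H12_comp[OF h saw_Lipschitz saw_0])+
   define W where "W x = (D (%x. a x + b x) x)^2 + (D (%x. a x - b x) x)^2 - 2 * (D a x)^2 - 2 * (D b x)^2" for x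
   have Di: "integrable m (%x. (D (%x. a x + b x) x)^2)" "integrable m (%x. (D (%x. a x - b x) x)^2)"
    "integrable m (%x. (D a x)^2)" "integrable m (%x. (D b x)^2)"
    by (intro L2_sq_integrable D_L2 H12_add H12_diff ab)+
   have Wi: "integrable m W" unfolding W_def using Di by simp
   have W0: "(LINT x|m. W x) = 0" unfolding W_def using Di Ch_parallelogram[OF ab] by (simp add: lnorm_sq)
   have "AE x in m. norm ((\<psi> x)^2 * z x - W x) <= r * R x"
    using D_saw_pair[OF f h \<psi>, of n] D_saw[OF f \<psi>, of n] D_saw[OF h \<psi>, of n] nn
   proof eventually_elim
    case (elim x)
    define \<delta> where "\<delta> = 2 * r * lc \<psi> x"
    have d0: "0 <= \<delta>" using r by (simp add: \<delta>_def)
    have bound: "abs (u^2 - (\<psi> x)^2 * p^2) <= \<delta>^2 + 2 * \<delta> * p" if "abs (u - \<psi> x * p) <= \<delta>" "0 <= p" for u p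
    proof -
     have "abs (u^2 - (\<psi> x * p)^2) <= \<delta>^2 + 2 * \<delta> * (\<psi> x * p)" using that p01[of x] by (intro sq_close) auto
     also have "2 * \<delta> * (\<psi> x * p) <= 2 * \<delta> * p" using p01[of x] that d0 by (intro mult_left_mono mult_left_le_one_le) auto
     finally show ?thesis by (simp add: power_mult_distrib)
    qed
    have AB: "abs ((D (%x. a x + b x) x)^2 + (D (%x. a x - b x) x)^2 - (\<psi> x)^2 * (P x)^2 - (\<psi> x)^2 * (M x)^2) <= 2 * \<delta>^2 + 2 * \<delta> * P x + 2 * \<delta> * M x"
     using elim(1)
    proof
     assume A: "abs (D (%x. \<psi> x * saw n (f x) + \<psi> x * saw n (h x)) x - \<psi> x * D (%x. f x + h x) x) <= 2 * rcp n * lc \<psi> x &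
      abs (D (%x. \<psi> x * saw n (f x) - \<psi> x * saw n (h x)) x - \<psi> x * D (%x. f x - h x) x) <= 2 * rcp n * lc \<psi> x"
     have "abs ((D (%x. a x + b x) x)^2 - (\<psi> x)^2 * (P x)^2) <= \<delta>^2 + 2 * \<delta> * P x"
      "abs ((D (%x. a x - b x) x)^2 - (\<psi> x)^2 * (M x)^2) <= \<delta>^2 + 2 * \<delta> * M x"
      using A elim(4,5) by (intro bound; simp add: a_def b_def P_def M_def \<delta>_def r_def)+
     then show ?thesis by linarith
    next
     assume A: "abs (D (%x. \<psi> x * saw n (f x) + \<psi> x * saw n (h x)) x - \<psi> x * D (%x. f x - h x) x) <= 2 * rcp n * lc \<psi> x &
      abs (D (%x. \<psi> x * saw n (f x) - \<psi> x * saw n (h x)) x - \<psi> x * D (%x. f x + h x) x) <= 2 * rcp n * lc \<psi> x"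
     have "abs ((D (%x. a x + b x) x)^2 - (\<psi> x)^2 * (M x)^2) <= \<delta>^2 + 2 * \<delta> * M x"
      "abs ((D (%x. a x - b x) x)^2 - (\<psi> x)^2 * (P x)^2) <= \<delta>^2 + 2 * \<delta> * P x"
      using A elim(4,5) by (intro bound; simp add: a_def b_def P_def M_def \<delta>_def r_def)+
     then show ?thesis by linarith
    qed
    have CD: "abs ((D a x)^2 - (\<psi> x)^2 * (D f x)^2) <= \<delta>^2 + 2 * \<delta> * D f x" "abs ((D b x)^2 - (\<psi> x)^2 * (D h x)^2) <= \<delta>^2 + 2 * \<delta> * D h x"
     using elim(2,3,6,7) by (intro bound; simp add: a_def[abs_def] b_def[abs_def] \<delta>_def r_def)+
    have "(\<psi> x)^2 * z x = (\<psi> x)^2 * (P x)^2 + (\<psi> x)^2 * (M x)^2 - 2 * ((\<psi> x)^2 * (D f x)^2) - 2 * ((\<psi> x)^2 * (D h x)^2)"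
     by (simp add: z_def algebra_simps)
    then have "abs ((\<psi> x)^2 * z x - W x) <= 6 * \<delta>^2 + 2 * \<delta> * P x + 2 * \<delta> * M x + 2 * (2 * \<delta> * D f x) + 2 * (2 * \<delta> * D h x)"
     using AB CD unfolding W_def by linarith
    also have "\<dots> = 6 * \<delta>^2 + 2 * \<delta> * S x" by (simp add: S_def algebra_simps)
    also have "6 * \<delta>^2 = r * r * (24 * (lc \<psi> x)^2)" by (simp add: \<delta>_def power2_eq_square)
    also have "r * r * (24 * (lc \<psi> x)^2) <= r * (24 * (lc \<psi> x)^2)"
     using r by (intro mult_right_mono mult_left_le_one_le) auto
    finally show ?case by (simp add: R_def \<delta>_def algebra_simps)
   qed
   then have "(LINT x|m. norm ((\<psi> x)^2 * z x - W x)) <= (LINT x|m. r * R x)"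
    by (intro integral_mono_AE integrable_mult_right Ri integrable_norm Bochner_Integration.integrable_diff pzi Wi)
   then have "norm (LINT x|m. (\<psi> x)^2 * z x - W x) <= (LINT x|m. r * R x)"
    by (rule order_trans[OF integral_norm_bound])
   then show ?thesis using pzi Wi W0 by (simp add: r_def)
  qed
  then have le: "abs (\<integral>x. (\<psi> x)^2 * z x \<partial>m) <= 0"
   by (intro LIMSEQ_le_const[OF tendsto_mult_left_zero[OF LIMSEQ_inverse_real_of_nat]]) auto
  then show ?thesis by simp
 qed
 have "AE x in m. 0 <= z x"
  by (rule cutoff_test_nonneg[OF sets_m zi, of 2]) (use zero in auto)
 moreover have "AE x in m. 0 <= - z x"
  by (rule cutoff_test_nonneg[OF sets_m, of _ 2]) (use zero zi in auto)
 ultimately show ?thesis by eventually_elim (simp add: z_def P_def M_def)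
qed

end

section \<open>The pointwise inner product of gradients\<close>

context ih_space
begin

definition pol :: "('a => real) => ('a => real) => 'a => real" where
 "pol f h x = ((D (%x. f x + h x) x)^2 - (D f x)^2 - (D h x)^2) / 2"

lemma pol_commute: "pol f h = pol h f"
 by (rule ext) (simp add: pol_def add.commute)

lemma pol_integrable: "f : H12 m ==> h : H12 m ==> integrable m (pol f h)"
 unfolding pol_def
 by (intro integrable_divide Bochner_Integration.integrable_diff L2_sq_integrable D_L2 H12_add)

lemma pol_neg:
 assumes f: "f : H12 m" and h: "h : H12 m"
 shows "AE x in m. pol f (%x. - h x) x = - pol f h x"
 using D_parallelogram[OF f h] D_cmult[OF h, of "-1"]
 by eventually_elim (simp add: pol_def field_simps)

lemma pol_add:
 assumes f: "f : H12 m" and g: "g : H12 m" and h: "h : H12 m"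
 shows "AE x in m. pol f (%x. g x + h x) x = pol f g x + pol f h x"
proof -
 have fg: "(%x. f x + g x) : H12 m" and fh: "(%x. f x + h x) : H12 m" and gmh: "(%x. g x - h x) : H12 m"
  by (intro H12_add H12_diff f g h)+
 have "AE x in m. (D (%x. f x + (g x + h x)) x)^2 + (D (%x. f x + (g x - h x)) x)^2 = 2 * (D (%x. f x + g x) x)^2 + 2 * (D h x)^2"
  using D_parallelogram[OF fg h] by (simp add: algebra_simps)
 moreover have "AE x in m. (D (%x. f x + (g x + h x)) x)^2 + (D (%x. f x - (g x - h x)) x)^2 = 2 * (D (%x. f x + h x) x)^2 + 2 * (D g x)^2"
  using D_parallelogram[OF fh g] by (simp add: algebra_simps)
 moreover have "AE x in m. (D (%x. f x + (g x - h x)) x)^2 + (D (%x. f x - (g x - h x)) x)^2 = 2 * (D f x)^2 + 2 * (D (%x. g x - h x) x)^2"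
  by (rule D_parallelogram[OF f gmh])
 ultimately show ?thesis using D_parallelogram[OF g h]
  by eventually_elim (simp add: pol_def field_simps)
qed

lemma pol_bound:
 assumes f: "f : H12 m" and h: "h : H12 m"
 shows "AE x in m. abs (pol f h x) <= D f x * D h x"
proof -
 have ub: "AE x in m. pol f k x <= D f x * D k x" if k: "k : H12 m" for k
  using D_lincomb[OF f k, of 1 1] D_nonneg[OF H12_add[OF f k]] D_nonneg[OF f] D_nonneg[OF k]
 proof eventually_elim
  case (elim x)
  then have "(D (%x. f x + k x) x)^2 <= (D f x + D k x)^2" by (intro power_mono) auto
  then show ?case by (simp add: pol_def power2_sum)
 qed
 have nh: "(%x. - h x) : H12 m" using H12_cmult[OF h, of "-1"] by simp
 show ?thesis using ub[OF h] ub[OF nh] pol_neg[OF f h] D_cmult[OF h, of "-1"]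
  by eventually_elim (simp add: abs_le_iff)
qed

text \<open>Additivity gives rational factors, and the bound by the slopes gives continuity in the factor.\<close>

lemma pol_cmult:
 assumes f: "f : H12 m" and h: "h : H12 m"
 shows "AE x in m. pol f (%x. c * h x) x = c * pol f h x"
proof -
 have ch: "(%x. c * h x) : H12 m" for c by (rule H12_cmult[OF h])
 have nat: "AE x in m. pol f (%x. real n * k x) x = real n * pol f k x" if k: "k : H12 m" for n k
 proof (induction n)
  case 0
  show ?case using D_cmult[OF f, of 1] D_cmult[OF f, of 0] D_cmult[OF k, of 0]
   by eventually_elim (simp add: pol_def)
 next
  case (Suc n)
  have "(%x. real n * k x) : H12 m" by (rule H12_cmult[OF k])
  from pol_add[OF f this k] Suc show ?case
   by eventually_elim (simp add: algebra_simps)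
 qed
 have rat: "AE x in m. pol f (%x. q * h x) x = q * pol f h x" if qR: "q : \<rat>" for q
 proof -
  have pos: "AE x in m. pol f (%x. r * k x) x = r * pol f k x" if r: "r = real a / real b" "b ~= 0" and k: "k : H12 m" for r a b k
  proof -
   have eq: "(%x. real b * (r * k x)) = (%x. real a * k x)" using r by auto
   have rb: "real a = real b * r" and b0: "real b ~= 0" using r by auto
   from nat[OF H12_cmult[OF k, of r], of b, unfolded eq] nat[OF k, of a] show ?thesis
   proof eventually_elim
    case (elim x)
    have "real b * pol f (%x. r * k x) x = real a * pol f k x" using elim by linarith
    also have "\<dots> = real b * (r * pol f k x)" by (simp add: rb)
    finally show ?case using b0 by simp
   qed
  qed
  obtain a b :: nat where ab: "b ~= 0" "abs q = real a / real b"
   using Rats_abs_nat_div_natE[OF qR] by blast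
  show ?thesis
  proof (cases "q >= 0")
   case True
   then show ?thesis using pos[OF ab(2,1) h] by simp
  next
   case False
   then have "AE x in m. pol f (%x. (- q) * h x) x = (- q) * pol f h x" using pos[OF ab(2,1) h] by simp
   with pol_neg[OF f ch[of "-q"]] show ?thesis by eventually_elim simp
  qed
 qed
 have "AE x in m. ALL q:\<rat>. abs (pol f (%x. c * h x) x - q * pol f h x) <= D f x * (abs (c - q) * D h x)"
 proof (rule AE_ball_countable'[OF _ countable_rat])
  fix q :: real assume q: "q : \<rat>"
  have eq: "(%x. q * h x + (c - q) * h x) = (%x. c * h x)" by (auto simp: algebra_simps)
  from pol_add[OF f ch[of q] ch[of "c - q"], unfolded eq] rat[OF q] pol_bound[OF f ch[of "c - q"]] D_cmult[OF h, of "c - q"]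
  show "AE x in m. abs (pol f (%x. c * h x) x - q * pol f h x) <= D f x * (abs (c - q) * D h x)"
   by eventually_elim simp
 qed
 then show ?thesis
 proof eventually_elim
  case (elim x)
  have "0 <= D f x * (abs (c - r) * D h x) - abs (pol f (%x. c * h x) x - r * pol f h x)" for r
   by (rule rational_nonneg_imp[of "%r. D f x * (abs (c - r) * D h x) - abs (pol f (%x. c * h x) x - r * pol f h x)"])
    (use elim in "auto intro!: continuous_intros")
  from this[of c] show ?case by simp
 qed
qed

lemma pol_self:
 assumes "f : H12 m" shows "AE x in m. pol f f x = (D f x)^2"
 using D_cmult[OF assms, of 2] by eventually_elim (simp add: pol_def power_mult_distrib)

abbreviation G :: "('a => real) => ('a => real) => 'a => real" where "G \<equiv> grad_inner m"

text \<open>By bilinearity \<open>|D(f + \<epsilon>h)|\<^sup>2\<close> is a quadratic polynomial in \<open>\<epsilon>\<close> whose linear coefficient is \<open>2 pol f h\<close>.\<close>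

lemma grad_inner_pol:
 assumes f: "f : H12 m" and h: "h : H12 m"
 shows "integrable m (G f h)" "AE x in m. G f h x = pol f h x"
proof -
 let ?a = "\<integral>x. abs (G f h x - pol f h x) \<partial>m"
 define q where "q e x = ((D (%y. f y + e * h y) x)^2 - (D f x)^2) / (2 * e)" for e :: real and x
 define spec where "spec g \<longleftrightarrow> integrable m g & ((%e. \<integral>x. abs (q e x - g x) \<partial>m) \<longlongrightarrow> 0) (at 0)" for g
 have qi: "integrable m (q e)" for e unfolding q_def
  by (intro integrable_divide Bochner_Integration.integrable_diff L2_sq_integrable D_L2 H12_add H12_cmult f h)
 have pi: "integrable m (pol f h)" by (rule pol_integrable[OF f h])
 have val: "(LINT x|m. abs (q e x - pol f h x)) = abs e / 2 * (lnorm m (D h))^2" if e: "e ~= 0" for e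
 proof -
  have "AE x in m. abs (q e x - pol f h x) = abs e / 2 * (D h x)^2"
   using pol_cmult[OF f h, of e] D_cmult[OF h, of e]
  proof eventually_elim
   case (elim x)
   have "(D (%y. f y + e * h y) x)^2 = 2 * e * pol f h x + (D f x)^2 + e^2 * (D h x)^2"
    using elim by (simp add: pol_def power_mult_distrib field_simps)
   then have "q e x - pol f h x = e / 2 * (D h x)^2" using e by (simp add: q_def field_simps power2_eq_square)
   then show ?case unfolding \<open>q e x - pol f h x = e / 2 * (D h x)^2\<close> by (simp add: abs_mult)
  qed
  then have "(LINT x|m. abs (q e x - pol f h x)) = (LINT x|m. abs e / 2 * (D h x)^2)"
   using qi[of e] pi D_L2[OF h] by (intro integral_cong_AE) (auto simp: L2_def)
  then show ?thesis by (simp add: lnorm_sq)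
 qed
 have lim: "((%e. \<integral>x. abs (q e x - pol f h x) \<partial>m) \<longlongrightarrow> 0) (at 0)"
 proof (rule Lim_transform_eventually)
  have "((%e::real. abs e / 2 * (lnorm m (D h))^2) \<longlongrightarrow> abs 0 / 2 * (lnorm m (D h))^2) (at 0)"
   by (intro tendsto_intros) simp
  then show "((%e::real. abs e / 2 * (lnorm m (D h))^2) \<longlongrightarrow> 0) (at 0)" by simp
  show "\<forall>\<^sub>F e in at 0. abs e / 2 * (lnorm m (D h))^2 = (LINT x|m. abs (q e x - pol f h x))"
  proof -
   have "\<forall>\<^sub>F e in at (0::real). e ~= 0" by (simp add: eventually_at_filter)
   then show ?thesis
   proof eventually_elim
    case (elim e)
    from val[OF elim] show ?case by (rule sym)
   qed
  qed
 qed
 have "spec (G f h)"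
  unfolding grad_inner_def spec_def[symmetric] q_def[symmetric]
  by (rule someI[where P="%g. spec g" and x="pol f h"]) (simp add: spec_def pi lim)
 then have Gi: "integrable m (G f h)" and Gl: "((%e. \<integral>x. abs (q e x - G f h x) \<partial>m) \<longlongrightarrow> 0) (at 0)" by (auto simp: spec_def)
 show "integrable m (G f h)" by (rule Gi)
 have le: "?a <= (LINT x|m. abs (q e x - G f h x)) + (LINT x|m. abs (q e x - pol f h x))" for e
 proof -
  have "?a <= (LINT x|m. abs (q e x - G f h x) + abs (q e x - pol f h x))"
   using qi[of e] pi Gi by (intro integral_mono) auto
  then show ?thesis using qi[of e] pi Gi by simp
 qed
 have "?a <= 0 + 0"
  by (rule tendsto_lowerbound[OF tendsto_add[OF Gl lim] always_eventually]) (use le in auto)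
 moreover have "0 <= ?a" by (rule integral_nonneg_AE) simp
 ultimately have "?a = 0" by simp
 then have "AE x in m. abs (G f h x - pol f h x) = 0"
  by (subst (asm) integral_nonneg_eq_0_iff_AE) (use pi Gi in auto)
 then show "AE x in m. G f h x = pol f h x" by eventually_elim simp
qed

lemma G_measurable: "f : H12 m ==> h : H12 m ==> G f h : borel_measurable m"
 using grad_inner_pol(1) by (rule borel_measurable_integrable)

lemma G_commute:
 assumes "f : H12 m" "h : H12 m" shows "AE x in m. G f h x = G h f x"
 using grad_inner_pol(2)[OF assms] grad_inner_pol(2)[OF assms(2,1)]
 by eventually_elim (simp add: pol_commute)

lemma G_add_right:
 assumes "f : H12 m" "g : H12 m" "h : H12 m"
 shows "AE x in m. G f (%x. g x + h x) x = G f g x + G f h x"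
 using grad_inner_pol(2)[OF assms(1,2)] grad_inner_pol(2)[OF assms(1,3)]
  grad_inner_pol(2)[OF assms(1) H12_add[OF assms(2,3)]] pol_add[OF assms]
 by eventually_elim simp

lemma G_cmult_right:
 assumes "f : H12 m" "h : H12 m"
 shows "AE x in m. G f (%x. c * h x) x = c * G f h x"
 using grad_inner_pol(2)[OF assms] grad_inner_pol(2)[OF assms(1) H12_cmult[OF assms(2)], of c] pol_cmult[OF assms, of c]
 by eventually_elim simp

lemma G_add_left:
 assumes "f : H12 m" "g : H12 m" "h : H12 m"
 shows "AE x in m. G (%x. f x + g x) h x = G f h x + G g h x"
 using G_commute[OF H12_add[OF assms(1,2)] assms(3)] G_commute[OF assms(1,3)] G_commute[OF assms(2,3)]
  G_add_right[OF assms(3,1,2)]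
 by eventually_elim simp

lemma G_cmult_left:
 assumes "f : H12 m" "h : H12 m"
 shows "AE x in m. G (%x. c * f x) h x = c * G f h x"
 using G_commute[OF H12_cmult[OF assms(1), of c] assms(2)] G_commute[OF assms] G_cmult_right[OF assms(2,1), of c]
 by eventually_elim simp

lemma G_self: "f : H12 m ==> AE x in m. G f f x = (D f x)^2"
 using grad_inner_pol(2)[of f f] pol_self[of f] by (auto elim: AE_mp)

lemma G_bound: "f : H12 m ==> h : H12 m ==> AE x in m. abs (G f h x) <= D f x * D h x"
 using grad_inner_pol(2)[of f h] pol_bound[of f h] by (auto elim: AE_mp)

lemma min_slope_cong_AE:
 assumes "f : borel_measurable m" "g : borel_measurable m" "AE x in m. f x = g x"
 shows "min_slope m f = min_slope m g" "Ch m f = Ch m g"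
proof -
 have L: "L2_tendsto m F f sequentially \<longleftrightarrow> L2_tendsto m F g sequentially" if F: "!!i. F i : bdd_Lip_L2 m" for F
 proof -
  have "(LINT x|m. (F i x - f x)^2) = (LINT x|m. (F i x - g x)^2)" for i
   using assms F[of i] by (intro integral_cong_AE) (auto simp: bdd_Lip_L2_def L2_def elim: AE_mp)
  then show ?thesis by (simp add: L2_tendsto_def)
 qed
 have "relaxed_slope m f = relaxed_slope m g"
  unfolding relaxed_slope_def fun_eq_iff using L by meson
 then show "min_slope m f = min_slope m g" by (simp add: min_slope_def)
 have "((ALL i. F i : bdd_Lip_L2 m) & L2_tendsto m F f sequentially) =
  ((ALL i. F i : bdd_Lip_L2 m) & L2_tendsto m F g sequentially)" for F using L by blast
 then show "Ch m f = Ch m g" unfolding Ch_def by simp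
qed

lemma H12_cong_AE:
 assumes "f : H12 m" "g : borel_measurable m" "AE x in m. f x = g x"
 shows "g : H12 m"
proof -
 have f: "f : L2 m" "Ch m f < \<infinity>" using assms(1) by (simp_all add: H12_def)
 have "Ch m f = Ch m g" by (rule min_slope_cong_AE(2)[OF L2_measurable[OF f(1)] assms(2,3)])
 with f(2) L2_AE_cong[OF f(1) assms(2,3)] show ?thesis by (simp add: H12_def)
qed

lemma G_cong_AE_left:
 assumes "f : H12 m" "g : borel_measurable m" "AE x in m. f x = g x"
  "h : H12 m"
 shows "AE x in m. G f h x = G g h x"
proof -
 have g: "g : H12 m" by (rule H12_cong_AE[OF assms(1-3)])
 have [simp]: "f : borel_measurable m" "h : borel_measurable m" using assms by (auto intro: L2_measurable H12_L2)
 have "D (%x. f x + h x) = D (%x. g x + h x)" "D f = D g"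
  using assms by (auto intro!: min_slope_cong_AE borel_measurable_add)
 then have "pol f h = pol g h" by (auto simp: pol_def fun_eq_iff)
 with grad_inner_pol(2)[OF assms(1,4)] grad_inner_pol(2)[OF g assms(4)] show ?thesis by (auto elim: AE_mp)
qed

definition E :: "('a => real) => ('a => real) => real" where
 "E f h = (LINT x|m. G f h x)"

lemma E_commute: "f : H12 m ==> h : H12 m ==> E f h = E h f"
 unfolding E_def by (intro integral_cong_AE G_measurable G_commute)

lemma E_self: "f : H12 m ==> E f f = (lnorm m (D f))^2"
 unfolding E_def lnorm_sq using L2_sq_integrable[OF D_L2]
 by (intro integral_cong_AE G_measurable G_self) auto

subsection \<open>Gram representation of finitely many gradients\<close>

text \<open>Finite positive semidefinite symmetric matrices are Gram matrices, by elimination of one index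
  after the other.\<close>

end

text \<open>Elimination of one index after the other, as in the Cholesky decomposition.\<close>

lemma psd_gram:
 fixes g :: "'b => 'b => real"
 assumes "finite A" "!!f h. f : A ==> h : A ==> g f h = g h f"
  "!!c. 0 <= (\<Sum>f\<in>A. \<Sum>h\<in>A. c f * c h * g f h)"
 shows "EX \<phi> N. ALL f:A. ALL h:A. g f h = (\<Sum>k<(N::nat). \<phi> f k * \<phi> h k)"
 using assms
proof (induction A arbitrary: g rule: finite_induct)
 case (insert a A)
 have sym: "g f h = g h f" if "f : insert a A" "h : insert a A" for f h using insert.prems(1) that by blast
 have full: "0 <= (c a)^2 * g a a + 2 * c a * (\<Sum>f\<in>A. c f * g f a) + (\<Sum>f\<in>A. \<Sum>h\<in>A. c f * c h * g f h)" for c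
 proof -
  have "(\<Sum>h\<in>A. c a * c h * g a h) = c a * (\<Sum>f\<in>A. c f * g f a)"
   using sym by (simp add: sum_distrib_left mult.assoc)
  moreover have "(\<Sum>f\<in>A. c f * c a * g f a) = c a * (\<Sum>f\<in>A. c f * g f a)"
   by (simp add: sum_distrib_left mult.assoc mult.left_commute)
  ultimately show ?thesis using insert.prems(2)[of c] insert.hyps
   by (simp add: sum.distrib power2_eq_square algebra_simps)
 qed
 have diag: "0 <= g a a"
 proof -
  let ?c = "%f. if f = a then 1 else (0::real)"
  have z: "?c f = 0" if "f : A" for f using that insert.hyps by auto
  have "(\<Sum>f\<in>A. ?c f * g f a) = 0" "(\<Sum>f\<in>A. \<Sum>h\<in>A. ?c f * ?c h * g f h) = 0"
   by (rule sum.neutral, simp add: z)+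
  with full[of ?c] show ?thesis by simp
 qed
 show ?case
 proof (cases "g a a = 0")
  case True
  have z: "g a f = 0" if f: "f : A" for f
  proof (rule ccontr)
   assume nz: "g a f ~= 0"
      \<comment> \<open>at \<open>t a + f\<close> the quadratic form would be \<open>- 1\<close>\<close>
   define t where "t = - (g f f + 1) / (2 * g f a)"
   define c where "c h = (if h = a then t else if h = f then 1 else (0::real))" for h
   have ca: "c a = t" by (simp add: c_def)
   have cA: "c h = (if h = f then 1 else 0)" if "h : A" for h using that insert.hyps by (auto simp: c_def)
   have "(\<Sum>h\<in>A. c h * g h a) = g f a" using f insert.hyps by (simp add: cA if_distrib[of "%u. u * _"] cong: sum.cong if_cong)
   moreover have "(\<Sum>f'\<in>A. \<Sum>h\<in>A. c f' * c h * g f' h) = (\<Sum>f'\<in>A. \<Sum>h\<in>A. (if f' = f then (if h = f then g f f else 0) else 0))"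
    by (intro sum.cong refl) (auto simp: cA)
   then have "(\<Sum>f'\<in>A. \<Sum>h\<in>A. c f' * c h * g f' h) = g f f"
    using f insert.hyps by (simp add: sum.If_cases if_distrib[of "sum _"] cong: sum.cong if_cong)
   ultimately have "0 <= 2 * t * g f a + g f f" using full[of c] True ca by simp
   moreover have "g f a ~= 0" using nz sym[of a f] f by simp
   moreover have "2 * t * g f a = - (g f f + 1)" using calculation(2) by (simp add: t_def)
   ultimately show False by linarith
  qed
  have "0 <= (\<Sum>f\<in>A. \<Sum>h\<in>A. c f * c h * g f h)" for c
   using full[of "c(a := 0)"] insert.hyps(2) by (simp add: fun_upd_def) (smt (verit) sum.cong)
  then obtain \<phi> and N :: nat where \<phi>: "ALL f:A. ALL h:A. g f h = (\<Sum>k<N. \<phi> f k * \<phi> h k)"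
   using insert.IH[of g] sym by blast
  show ?thesis
   by (rule exI[of _ "%f k. if f = a then 0 else \<phi> f k"], rule exI[of _ N])
    (use \<phi> z True sym insert.hyps(2) in "auto intro!: sum.cong")
 next
  case False
  with diag have pos: "g a a > 0" by simp
  define \<phi>0 where "\<phi>0 f = g f a / sqrt (g a a)" for f
  define g' where "g' f h = g f h - \<phi>0 f * \<phi>0 h" for f h
  have \<phi>0: "\<phi>0 f * \<phi>0 h = g f a * g h a / g a a" for f h using pos by (simp add: \<phi>0_def)
  have psd: "0 <= (\<Sum>f\<in>A. \<Sum>h\<in>A. c f * c h * g' f h)" for c
  proof -
   define S where "S = (\<Sum>f\<in>A. c f * g f a)"
      \<comment> \<open>the coefficient at \<open>a\<close> that minimizes the quadratic form\<close>
   define c' where "c' = c(a := - S / g a a)"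
   have cA: "c' f = c f" if "f : A" for f using that insert.hyps by (auto simp: c'_def)
   have S: "(\<Sum>f\<in>A. c' f * g f a) = S" unfolding S_def by (intro sum.cong refl) (simp add: cA)
   have T: "(\<Sum>f\<in>A. \<Sum>h\<in>A. c' f * c' h * g f h) = (\<Sum>f\<in>A. \<Sum>h\<in>A. c f * c h * g f h)"
    by (intro sum.cong refl) (simp add: cA)
   have "S * S = (\<Sum>f\<in>A. \<Sum>h\<in>A. (c f * g f a) * (c h * g h a))" unfolding S_def by (rule sum_product)
   then have "(\<Sum>f\<in>A. \<Sum>h\<in>A. c f * c h * g' f h) = (\<Sum>f\<in>A. \<Sum>h\<in>A. c f * c h * g f h) - S * S / g a a"
    by (simp add: g'_def \<phi>0 sum_subtractf right_diff_distrib sum_divide_distrib algebra_simps)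
   also have "\<dots> = (c' a)^2 * g a a + 2 * c' a * S + (\<Sum>f\<in>A. \<Sum>h\<in>A. c f * c h * g f h)"
    using pos by (simp add: c'_def power2_eq_square field_simps)
   also have "\<dots> >= 0" using full[of c'] unfolding S T .
   finally show ?thesis .
  qed
  have "g' f h = g' h f" if "f : A" "h : A" for f h using sym that by (simp add: g'_def)
  then obtain \<phi> and N :: nat where \<phi>: "ALL f:A. ALL h:A. g' f h = (\<Sum>k<N. \<phi> f k * \<phi> h k)"
   using insert.IH[of g'] psd by blast
  define \<Phi> where "\<Phi> f k = (if k = N then \<phi>0 f else if f = a then 0 else \<phi> f k)" for f k
  have "g f h = (\<Sum>k<Suc N. \<Phi> f k * \<Phi> h k)" if fh: "f : insert a A" "h : insert a A" for f h
  proof -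
   have tail: "(\<Sum>k<N. \<Phi> f k * \<Phi> h k) = (\<Sum>k<N. (if f = a then 0 else \<phi> f k) * (if h = a then 0 else \<phi> h k))"
    by (intro sum.cong) (auto simp: \<Phi>_def)
   have "g f h - \<phi>0 f * \<phi>0 h = (\<Sum>k<N. \<Phi> f k * \<Phi> h k)"
   proof (cases "f = a | h = a")
    case True
    then show ?thesis unfolding tail \<phi>0 using pos sym[OF fh] by auto
   next
    case False
    then show ?thesis unfolding tail using \<phi> fh by (auto simp: g'_def)
   qed
   then show ?thesis by (simp add: \<Phi>_def)
  qed
  then show ?thesis by blast
 qed
qed simp

context ih_space
begin

lemma H12_sum: "finite A ==> A ~= {} ==> A \<subseteq> H12 m ==> (%x. \<Sum>f\<in>A. c f * f x) : H12 m"
 by (induction A rule: finite_ne_induct) (auto intro!: H12_add H12_cmult)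

lemma G_sum_right:
 assumes "finite A" "A ~= {}" "A \<subseteq> H12 m" "h : H12 m"
 shows "AE x in m. G h (%x. \<Sum>f\<in>A. c f * f x) x = (\<Sum>f\<in>A. c f * G h f x)"
 using assms(1-3)
proof (induction A rule: finite_ne_induct)
 case (singleton f)
 then show ?case using G_cmult_right[OF assms(4), of f "c f"] by simp
next
 case (insert f A)
 then have f: "f : H12 m" and A: "A \<subseteq> H12 m" by auto
 have "AE x in m. G h (%x. c f * f x + (\<Sum>f\<in>A. c f * f x)) x = G h (%x. c f * f x) x + G h (%x. \<Sum>f\<in>A. c f * f x) x"
  by (intro G_add_right assms H12_cmult f H12_sum insert A)
 with insert.IH[OF A] G_cmult_right[OF assms(4) f, of "c f"] show ?case
  by eventually_elim (use insert.hyps in simp)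
qed

lemma G_psd:
 assumes A: "finite A" "A ~= {}" "A \<subseteq> H12 m"
 shows "AE x in m. 0 <= (\<Sum>f\<in>A. \<Sum>h\<in>A. c f * c h * G f h x)"
proof -
 let ?u = "%x. \<Sum>f\<in>A. c f * f x"
 have u: "?u : H12 m" by (rule H12_sum[OF A])
 have "AE x in m. ALL f:A. G f ?u x = (\<Sum>h\<in>A. c h * G f h x) & G ?u f x = G f ?u x"
  using A by (intro AE_ball_countable' AE_conjI G_sum_right G_commute u countable_finite) auto
 then show ?thesis using G_self[OF u] G_sum_right[OF A u, of c]
 proof eventually_elim
  case (elim x)
  have "0 <= G ?u ?u x" using elim by simp
  also have "G ?u ?u x = (\<Sum>f\<in>A. c f * (\<Sum>h\<in>A. c h * G f h x))" using elim by simp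
  finally show ?case by (simp add: sum_distrib_left mult.assoc)
 qed
qed

text \<open>Positivity of \<open>|D(\<Sum>f. c f * f)|\<^sup>2\<close> for rational \<open>c\<close> holds off one null set, and there for real \<open>c\<close> by continuity.\<close>

lemma G_gram:
 assumes A: "finite A" "A \<subseteq> H12 m"
 shows "AE x in m. EX \<phi> N. ALL f:A. ALL h:A. G f h x = (\<Sum>k<(N::nat). \<phi> f k * \<phi> h k)"
proof (cases "A = {}")
 case False
 define Q where "Q = PiE A (%_. \<rat> :: real set)"
 have "countable Q" unfolding Q_def by (intro countable_PiE A countable_rat)
 then have "AE x in m. ALL c:Q. 0 <= (\<Sum>f\<in>A. \<Sum>h\<in>A. c f * c h * G f h x)"
  by (intro AE_ball_countable' G_psd[OF A(1) False A(2)])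
 moreover have "AE x in m. ALL f:A. ALL h:A. G f h x = G h f x"
  using A by (intro AE_ball_countable' G_commute countable_finite) auto
 ultimately show ?thesis
 proof eventually_elim
  case (elim x)
  have "0 <= (\<Sum>f\<in>A. \<Sum>h\<in>A. c f * c h * G f h x)" for c
  proof -
   have ex: "EX q. q : \<rat> & abs (q - c f) < rcp n" for f n
   proof -
    obtain q where "q : \<rat>" "c f < q" "q < c f + rcp n"
     using Rats_dense_in_real[of "c f" "c f + rcp n"] by auto
    then show ?thesis by (intro exI[of _ q]) linarith
   qed
   define q where "q n f = (SOME q. q : \<rat> & abs (q - c f) < rcp n)" for n f
   have q: "q n f : \<rat>" "abs (q n f - c f) < rcp n" for n f
    using someI_ex[OF ex[of f n]] unfolding q_def by blast+
   have lim: "(%n. q n f) \<longlonglongrightarrow> c f" for f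
   proof (rule LIM_zero_cancel, rule Lim_null_comparison[OF _ LIMSEQ_inverse_real_of_nat])
    show "\<forall>\<^sub>F n in sequentially. norm (q n f - c f) <= rcp n"
     using q(2) by (auto intro!: always_eventually less_imp_le)
   qed
   have "0 <= (\<Sum>f\<in>A. \<Sum>h\<in>A. q n f * q n h * G f h x)" for n
   proof -
    have "restrict (q n) A : Q" using q(1) by (auto simp: Q_def)
    with elim(1) have "0 <= (\<Sum>f\<in>A. \<Sum>h\<in>A. restrict (q n) A f * restrict (q n) A h * G f h x)" by blast
    also have "\<dots> = (\<Sum>f\<in>A. \<Sum>h\<in>A. q n f * q n h * G f h x)" by (intro sum.cong refl) simp
    finally show ?thesis .
   qed
   moreover have "(%n. \<Sum>f\<in>A. \<Sum>h\<in>A. q n f * q n h * G f h x) \<longlonglongrightarrow> (\<Sum>f\<in>A. \<Sum>h\<in>A. c f * c h * G f h x)"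
    by (intro tendsto_intros lim)
   ultimately show ?thesis by (intro LIMSEQ_le_const) auto
  qed
  then show ?case using elim(2) by (intro psd_gram[OF A(1)]) auto
 qed
qed simp

end

section \<open>Completely monotone functions are analytic\<close>

text \<open>Bernstein's theorem: if all derivatives of \<open>g 0\<close> are nonnegative, then the Taylor remainder
  of order \<open>n\<close> divided by \<open>s ^ n\<close> is nondecreasing, and this makes it
  decay geometrically.\<close>

lemma Bernstein_series:
 fixes g :: "nat => real => real"
 assumes der: "!!n s. s < r ==> (g n has_real_derivative g (Suc n) s) (at s)"
  and pos: "!!n s. s < r ==> 0 <= g n s" and s: "0 <= s" "s < r"
 shows "(%n. g n 0 / fact n * s ^ n) sums g 0 s"
proof -
 define R where "R n k s = g k s - (\<Sum>i<n. g (k + i) 0 / fact i * s ^ i)" for n k s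
 define R1 where "R1 n k s = (if n = 0 then g (Suc k) s else R (n - 1) (Suc k) s)" for n k s
 have R_der: "(R n k has_real_derivative R1 n k s) (at s)" if "s < r" for n k s
 proof (cases n)
  case 0
  then show ?thesis using der[OF that, of k] by (simp add: R_def[abs_def] R1_def)
 next
  case (Suc n')
  have pder: "((%s. \<Sum>i<Suc n'. g (k + i) 0 / fact i * s ^ i) has_real_derivative (\<Sum>i<n'. g (Suc k + i) 0 / fact i * s ^ i)) (at s)"
  proof -
   have "((%s. \<Sum>i<Suc n'. g (k + i) 0 / fact i * s ^ i) has_real_derivative (\<Sum>i<Suc n'. g (k + i) 0 / fact i * (real i * s ^ (i - 1)))) (at s)"
    by (intro DERIV_sum DERIV_cmult) (use DERIV_pow in "fastforce")
   also have "(\<Sum>i<Suc n'. g (k + i) 0 / fact i * (real i * s ^ (i - 1))) = (\<Sum>i<n'. g (k + Suc i) 0 / fact (Suc i) * (real (Suc i) * s ^ i))"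
    by (subst sum.lessThan_Suc_shift) simp
   also have "\<dots> = (\<Sum>i<n'. g (Suc k + i) 0 / fact i * s ^ i)"
    by (intro sum.cong refl) (simp add: field_simps del: of_nat_Suc)
   finally show ?thesis .
  qed
  have "((%s. g k s - (\<Sum>i<n. g (k + i) 0 / fact i * s ^ i)) has_real_derivative g (Suc k) s - (\<Sum>i<n'. g (Suc k + i) 0 / fact i * s ^ i)) (at s)"
   unfolding Suc by (intro DERIV_diff der that pder)
  then show ?thesis using Suc by (simp add: R_def[abs_def] R1_def)
 qed
 have R_0: "R (Suc n) k 0 = 0" for n k by (simp add: R_def sum.lessThan_Suc_shift)
 have R_nonneg: "0 <= R n k s" if "0 <= s" "s < r" for n k s
  using that
 proof (induction n arbitrary: k s)
  case 0 then show ?case using pos by (simp add: R_def)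
 next
  case (Suc n)
  have "R (Suc n) k 0 <= R (Suc n) k s"
  proof (rule DERIV_nonneg_imp_nondecreasing[OF Suc.prems(1)])
   fix x assume "0 <= x" "x <= s"
   then show "EX y. DERIV (R (Suc n) k) x :> y & 0 <= y"
    using R_der[of x "Suc n" k] Suc by (auto simp: R1_def)
  qed
  then show ?case by (simp add: R_0)
 qed
  \<comment> \<open>up to a positive factor the derivative of \<open>R n k s / s ^ n\<close>\<close>
 have H_nonneg: "0 <= s * R1 n k s - real n * R n k s" if "0 <= s" "s < r" for n k s
  using that
 proof (induction n arbitrary: k s)
  case 0 then show ?case using pos by (simp add: R1_def)
 next
  case (Suc n)
  let ?H = "%s. s * R n (Suc k) s - real (Suc n) * R (Suc n) k s"
  have "?H 0 <= ?H s"
  proof (rule DERIV_nonneg_imp_nondecreasing[OF Suc.prems(1)])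
   fix x assume x: "0 <= x" "x <= s"
   then have xr: "x < r" using Suc.prems by simp
   have "(?H has_real_derivative (1 * R n (Suc k) x + R1 n (Suc k) x * x) - real (Suc n) * R1 (Suc n) k x) (at x)"
    by (intro DERIV_diff DERIV_mult DERIV_cmult DERIV_ident R_der xr)
   moreover have "(1 * R n (Suc k) x + R1 n (Suc k) x * x) - real (Suc n) * R1 (Suc n) k x = x * R1 n (Suc k) x - real n * R n (Suc k) x"
    by (simp add: R1_def[of "Suc n"] algebra_simps)
   ultimately show "EX y. DERIV ?H x :> y & 0 <= y" using Suc.IH[OF x(1) xr, of "Suc k"] by metis
  qed
  then show ?case by (simp add: R_0 R1_def)
 qed
 show ?thesis
 proof (cases "s = 0")
  case True
  have "(%n. g n 0 / fact n * 0 ^ n) sums (g 0 0 / fact 0)" by (rule powser_sums_zero)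
  then show ?thesis using True by simp
 next
  case False
  with s have s0: "0 < s" by simp
  define t where "t = (s + r) / 2"
  have t: "s < t" "t < r" "0 < t" using s s0 by (auto simp: t_def)
  have le: "R n 0 s <= (s / t) ^ n * g 0 t" for n
  proof -
   have "R n 0 s / s ^ n <= R n 0 t / t ^ n"
   proof (rule DERIV_nonneg_imp_nondecreasing[of s t "%s. R n 0 s / s ^ n"])
    show "s <= t" using t by simp
    fix x assume x: "s <= x" "x <= t"
    then have x0: "0 < x" and xr: "x < r" using s0 t by auto
    have quot: "((%s. R n 0 s / s ^ n) has_real_derivative (R1 n 0 x * x ^ n - R n 0 x * (real n * x ^ (n - 1))) / (x ^ n * x ^ n)) (at x)"
     by (intro DERIV_divide R_der xr) (use DERIV_pow[of n x] x0 in auto)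
    have pw: "real n * x ^ (n - 1) * x = real n * x ^ n" by (cases n) auto
    have "(R1 n 0 x * x ^ n - R n 0 x * (real n * x ^ (n - 1))) * x
     = x ^ n * (x * R1 n 0 x) - R n 0 x * (real n * x ^ (n - 1) * x)" by (rule trans[OF left_diff_distrib]) (simp only: ac_simps)
    then have "(R1 n 0 x * x ^ n - R n 0 x * (real n * x ^ (n - 1))) * x = x ^ n * (x * R1 n 0 x - real n * R n 0 x)"
     unfolding pw by (simp add: right_diff_distrib)
    moreover have "0 <= x ^ n * (x * R1 n 0 x - real n * R n 0 x)" using H_nonneg[of x n 0] x0 xr by simp
    ultimately have "0 <= (R1 n 0 x * x ^ n - R n 0 x * (real n * x ^ (n - 1))) * x" by simp
    then have "0 <= R1 n 0 x * x ^ n - R n 0 x * (real n * x ^ (n - 1))" using x0 by (simp add: zero_le_mult_iff)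
    then have "0 <= (R1 n 0 x * x ^ n - R n 0 x * (real n * x ^ (n - 1))) / (x ^ n * x ^ n)" using x0 by simp
    with quot show "EX y. DERIV (%s. R n 0 s / s ^ n) x :> y & 0 <= y" by blast
   qed
   then have "R n 0 s <= R n 0 t / t ^ n * s ^ n" using s0 by (simp add: divide_le_eq)
   also have "\<dots> = (s / t) ^ n * R n 0 t" by (simp add: power_divide)
   also have "R n 0 t <= g 0 t"
   proof -
    have "0 <= (\<Sum>i<n. g (0 + i) 0 / fact i * t ^ i)" using pos t s by (intro sum_nonneg mult_nonneg_nonneg divide_nonneg_nonneg) auto
    then show ?thesis by (simp add: R_def)
   qed
   finally show ?thesis using s0 t by (simp add: mult_left_mono)
  qed
  have "(%n. R n 0 s) \<longlonglongrightarrow> 0"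
  proof (rule Lim_null_comparison)
   show "\<forall>\<^sub>F n in sequentially. norm (R n 0 s) <= (s / t) ^ n * g 0 t"
    using le R_nonneg s by auto
   show "(%n. (s / t) ^ n * g 0 t) \<longlonglongrightarrow> 0"
    using t s0 by (intro tendsto_mult_left_zero LIMSEQ_realpow_zero) auto
  qed
  then have "(%n. g 0 s - R n 0 s) \<longlonglongrightarrow> g 0 s - 0" by (intro tendsto_intros)
  then show ?thesis by (simp add: sums_def R_def)
 qed
qed

text \<open>The property of a function of time that is inherited by countable sums and allows analytic
  continuation: at every base point it is a power series with nonnegative coefficients in the
  direction of the past, valid up to time \<open>e\<close>.\<close>

definition past_series :: "real => (real => real) => bool" where
 "past_series e F \<longleftrightarrow> (ALL b>e. EX c. (ALL n. 0 <= c n) & (ALL s. 0 <= s & s < b - e --> (%n. c n * s ^ n) sums F (b - s)))"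

text \<open>All terms are nonnegative, so the double series may be summed in either order.\<close>

lemma past_series_sums:
 assumes f: "!!k::nat. past_series e (f k)" and F: "!!t. t > e ==> (%k. f k t) sums F t"
 shows "past_series e F"
 unfolding past_series_def
proof (intro allI impI)
 fix b assume b: "b > e"
 have "ALL k. EX c. (ALL n. 0 <= c n) & (ALL s. 0 <= s & s < b - e --> (%n. c n * s ^ n) sums f k (b - s))"
  using f b unfolding past_series_def by blast
 from choice[OF this] obtain c where c0: "ALL k. (ALL n. 0 <= c k n) & (ALL s. 0 <= s & s < b - e --> (%n. c k n * s ^ n) sums f k (b - s))" ..
 have c: "0 <= c k n" "0 <= s ==> s < b - e ==> (%n. c k n * s ^ n) sums f k (b - s)" for k n s
  using c0 by auto
 have f0: "0 <= f k t" if te: "t > e" for k t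
 proof -
  obtain d where d: "ALL n. 0 <= d n" "ALL s. 0 <= s & s < t - e --> (%n. d n * s ^ n) sums f k (t - s)"
   using f[of k] te unfolding past_series_def by blast
  have "(%n. d n * 0 ^ n) sums f k (t - 0)" using te by (intro d(2)[rule_format]) auto
  from sums_unique2[OF this powser_sums_zero] have "f k t = d 0" by simp
  then show ?thesis using d(1) by simp
 qed
 have swap: "(\<Sum>k. \<Sum>n. ennreal (c k n * s ^ n)) = (\<Sum>n. \<Sum>k. ennreal (c k n * s ^ n))" for s
 proof -
  have "(\<Sum>k. \<Sum>n. ennreal (c k n * s ^ n)) = (\<integral>\<^sup>+k. (\<Sum>n. ennreal (c k n * s ^ n)) \<partial>count_space UNIV)"
   by (simp add: nn_integral_count_space_nat)
  also have "\<dots> = (\<Sum>n. \<integral>\<^sup>+k. ennreal (c k n * s ^ n) \<partial>count_space UNIV)" by (rule nn_integral_suminf) simp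
  finally show ?thesis by (simp add: nn_integral_count_space_nat)
 qed
 have total: "(\<Sum>n. \<Sum>k. ennreal (c k n * s ^ n)) = ennreal (F (b - s))" if s: "0 <= s" "s < b - e" for s
 proof -
  have "(\<Sum>n. ennreal (c k n * s ^ n)) = ennreal (f k (b - s))" for k
   using c s by (intro suminf_ennreal_eq) auto
  moreover have "(\<Sum>k. ennreal (f k (b - s))) = ennreal (F (b - s))"
   using f0 F s by (intro suminf_ennreal_eq) auto
  ultimately show ?thesis using swap[of s] by simp
 qed
 define s1 where "s1 = (b - e) / 2"
 have s1: "0 < s1" "s1 < b - e" using b by (auto simp: s1_def)
 have summ: "summable (%k. c k n)" for n
 proof -
  have "summable (%k. f k (b - s1))" using F[of "b - s1"] s1 by (simp add: sums_iff)
  moreover have "norm (c k n * s1 ^ n) <= f k (b - s1)" for k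
  proof -
   have "(\<Sum>i\<in>{n}. c k i * s1 ^ i) <= (\<Sum>i. c k i * s1 ^ i)"
    using c(1)[of k] c(2)[of s1 k] s1 by (intro sum_le_suminf) (auto simp: sums_iff)
   also have "\<dots> = f k (b - s1)" using c(2)[of s1 k] s1 by (simp add: sums_iff)
   finally show ?thesis using c(1)[of k n] s1 by simp
  qed
  ultimately have "summable (%k. c k n * s1 ^ n)" by (rule summable_comparison_test'[where N=0])
  from summable_mult2[OF this, of "1 / s1 ^ n"] show ?thesis using s1 by simp
 qed
 show "EX c. (ALL n. 0 <= c n) & (ALL s. 0 <= s & s < b - e --> (%n. c n * s ^ n) sums F (b - s))"
 proof (intro exI conjI allI impI)
  show "0 <= (\<Sum>k. c k n)" for n using summ c(1) by (intro suminf_nonneg) auto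
  fix s assume s: "0 <= s & s < b - e"
  have inner: "(\<Sum>k. ennreal (c k n * s ^ n)) = ennreal ((\<Sum>k. c k n) * s ^ n)" for n
   using summ c(1) s by (intro suminf_ennreal_eq sums_mult2 summable_sums) auto
  have tot: "(\<Sum>n. ennreal ((\<Sum>k. c k n) * s ^ n)) = ennreal (F (b - s))" using total[of s] s by (simp add: inner)
  have nn: "0 <= (\<Sum>k. c k n) * s ^ n" for n using summ c(1) s by (intro mult_nonneg_nonneg suminf_nonneg) auto
  have sm: "summable (%n. (\<Sum>k. c k n) * s ^ n)"
   using nn tot by (intro summable_suminf_not_top) auto
  have F0: "0 <= F (b - s)" by (rule sums_le[OF _ sums_zero F]) (use f0 s in auto)
  have "ennreal (\<Sum>n. (\<Sum>k. c k n) * s ^ n) = ennreal (F (b - s))"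
   using tot suminf_ennreal2[OF nn sm] by simp
  then have "(\<Sum>n. (\<Sum>k. c k n) * s ^ n) = F (b - s)"
   using F0 suminf_nonneg[OF sm nn] by simp
  with sm show "(%n. (\<Sum>k. c k n) * s ^ n) sums F (b - s)" by (simp add: sums_iff)
 qed
qed

lemma past_series_shift:
 assumes "past_series e F" shows "past_series (e + d) (%t. F (t - d))"
 unfolding past_series_def
proof (intro allI impI)
 fix b assume "b > e + d"
 then obtain c where "ALL n. 0 <= c n" "ALL s. 0 <= s & s < (b - d) - e --> (%n. c n * s ^ n) sums F ((b - d) - s)"
  using assms unfolding past_series_def by (metis less_diff_eq)
 then show "EX c. (ALL n. 0 <= c n) & (ALL s. 0 <= s & s < b - (e + d) --> (%n. c n * s ^ n) sums F (b - s - d))"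
  by (intro exI[of _ c]) (auto simp: algebra_simps)
qed

text \<open>Proportionality of two such functions propagates from a sequence of times with an
  accumulation point, by the identity theorem for the complexified power series.\<close>

lemma past_series_identity:
 assumes F: "past_series e F" and G: "past_series e G"
  and t0: "t0 > e" and lim: "t \<longlonglongrightarrow> t0" and freq: "\<exists>\<^sub>F i in sequentially. t i ~= t0"
  and eq: "!!i::nat. t i > e ==> \<alpha> * F (t i) = \<beta> * G (t i)" and T: "T > e"
 shows "\<alpha> * F T = \<beta> * G T"
proof -
  \<comment> \<open>a base point later than \<open>T\<close> and all \<open>t i\<close> near \<open>t0\<close>\<close>
 define b where "b = max T t0 + 1"
 have be: "b > e" using T by (auto simp: b_def)
 obtain c where c0: "ALL n. 0 <= c n" "ALL s. 0 <= s & s < b - e --> (%n. c n * s ^ n) sums F (b - s)"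
  using F be unfolding past_series_def by blast
 have c: "0 <= c n" "0 <= s ==> s < b - e ==> (%n. c n * s ^ n) sums F (b - s)" for n s
  using c0 by auto
 obtain d where d0: "ALL n. 0 <= d n" "ALL s. 0 <= s & s < b - e --> (%n. d n * s ^ n) sums G (b - s)"
  using G be unfolding past_series_def by blast
 have d: "0 <= d n" "0 <= s ==> s < b - e ==> (%n. d n * s ^ n) sums G (b - s)" for n s
  using d0 by auto
 define a where "a n = \<alpha> * c n - \<beta> * d n" for n
 define h where "h z = (\<Sum>n. complex_of_real (a n) * z ^ n)" for z
 have hs: "(%n. complex_of_real (a n) * z ^ n) sums h z" if z: "cmod z < b - e" for z
 proof -
  have "summable (%n. abs \<alpha> * (c n * cmod z ^ n) + abs \<beta> * (d n * cmod z ^ n))"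
   using c(2)[of "cmod z"] d(2)[of "cmod z"] z by (intro summable_add summable_mult) (auto simp: sums_iff)
  then have "summable (%n. complex_of_real (a n) * z ^ n)"
  proof (rule summable_comparison_test')
   fix n
   have "abs (a n) <= abs \<alpha> * c n + abs \<beta> * d n"
    unfolding a_def by (rule order_trans[OF abs_triangle_ineq4]) (use c(1)[of n] d(1)[of n] in "simp add: abs_mult")
   then have "abs (a n) * cmod z ^ n <= (abs \<alpha> * c n + abs \<beta> * d n) * cmod z ^ n" by (intro mult_right_mono) auto
   then show "norm (complex_of_real (a n) * z ^ n) <= abs \<alpha> * (c n * cmod z ^ n) + abs \<beta> * (d n * cmod z ^ n)"
    by (simp add: norm_mult norm_power algebra_simps)
  qed
  then show ?thesis by (simp add: h_def summable_sums)
 qed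
 have hol: "h holomorphic_on ball 0 (b - e)"
  by (rule power_series_holomorphic[where a="%n. complex_of_real (a n)"]) (use hs in "auto simp: dist_norm")
 have val: "h (complex_of_real s) = complex_of_real (\<alpha> * F (b - s) - \<beta> * G (b - s))" if s: "0 <= s" "s < b - e" for s
 proof -
  have "(%n. \<alpha> * (c n * s ^ n) - \<beta> * (d n * s ^ n)) sums (\<alpha> * F (b - s) - \<beta> * G (b - s))"
   by (intro sums_diff sums_mult c(2) d(2) s)
  then have "(%n. complex_of_real (\<alpha> * (c n * s ^ n) - \<beta> * (d n * s ^ n))) sums complex_of_real (\<alpha> * F (b - s) - \<beta> * G (b - s))"
   by (rule sums_of_real)
  moreover have "complex_of_real (\<alpha> * (c n * s ^ n) - \<beta> * (d n * s ^ n)) = complex_of_real (a n) * complex_of_real s ^ n" for n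
   by (simp add: a_def algebra_simps)
  ultimately show ?thesis using hs[of "complex_of_real s"] s sums_unique2 by fastforce
 qed
 define U where "U = {z : ball 0 (b - e). h z = 0}"
 have "h (complex_of_real (b - T)) = 0"
 proof (rule analytic_continuation[OF hol, of U "complex_of_real (b - t0)"])
  show "complex_of_real (b - t0) : ball 0 (b - e)" "complex_of_real (b - T) : ball 0 (b - e)"
   using t0 T by (auto simp: b_def dist_norm norm_of_real simp flip: of_real_diff)
  show "complex_of_real (b - t0) islimpt U"
   unfolding islimpt_approachable
  proof (intro allI impI)
   fix \<epsilon> :: real assume \<epsilon>: "\<epsilon> > 0"
   have "\<forall>\<^sub>F i in sequentially. dist (t i) t0 < min \<epsilon> (min 1 (t0 - e))"
    using lim \<epsilon> t0 by (intro tendstoD) auto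
   with freq have "\<exists>\<^sub>F i in sequentially. t i ~= t0 & dist (t i) t0 < min \<epsilon> (min 1 (t0 - e))"
    by (rule frequently_eventually_frequently)
   then obtain i where i: "t i ~= t0" "abs (t i - t0) < \<epsilon>" "abs (t i - t0) < 1" "abs (t i - t0) < t0 - e"
    by (elim frequentlyE) (auto simp: dist_real_def)
   have ti: "t i > e" "0 <= b - t i" using i unfolding b_def by linarith+
   have "complex_of_real (b - t i) : U"
    using val[of "b - t i"] ti eq[of i] unfolding U_def by (auto simp: dist_norm norm_of_real simp flip: of_real_diff)
   moreover have "complex_of_real (b - t i) ~= complex_of_real (b - t0)" using i(1) by simp
   moreover have "dist (complex_of_real (b - t i)) (complex_of_real (b - t0)) < \<epsilon>"
    using i(2) by (simp add: dist_norm norm_of_real flip: of_real_diff)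
   ultimately show "EX x':U. x' ~= complex_of_real (b - t0) & dist x' (complex_of_real (b - t0)) < \<epsilon>" by blast
  qed
 qed (auto simp: U_def)
 then have "complex_of_real (\<alpha> * F T - \<beta> * G T) = 0" using val[of "b - T"] T by (simp add: b_def)
 then show ?thesis by (simp only: of_real_eq_0_iff)
qed

section \<open>The heat semigroup\<close>

lemma L2_eq_if_ip:
 assumes f: "f : L2 m" and g: "g : L2 m" and eq: "!!b. b : L2 m ==> ip m f b = ip m g b"
 shows "AE x in m. f x = g x"
proof -
 have d: "(%x. f x - g x) : L2 m" by (rule L2_diff[OF f g])
 have "(lnorm m (%x. f x - g x))^2 = ip m f (%x. f x - g x) - ip m g (%x. f x - g x)"
  using ip_diff_left[OF f g d] by (simp add: ip_self)
 then have "lnorm m (%x. f x - g x) = 0" using eq[OF d] by simp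
 from lnorm_eq_0_AE[OF d this] show ?thesis by eventually_elim simp
qed

definition L2_deriv :: "'a measure => (real => 'a => real) => ('a => real) => real => bool" where
 "L2_deriv m u h t \<longleftrightarrow> L2_tendsto m (%s x. (u s x - u t x) / (s - t)) h (at t)"

lemma L2_deriv_continuous:
 assumes d: "L2_deriv m u h t" and u: "\<forall>\<^sub>F s in at t. u s : L2 m" "u t : L2 m" and h: "h : L2 m"
 shows "L2_tendsto m u (u t) (at t)"
proof -
 let ?q = "%s x. (u s x - u t x) / (s - t)"
 have qL: "\<forall>\<^sub>F s in at t. ?q s : L2 m"
  using u(1)
 proof eventually_elim
  case (elim s)
  from L2_cmult[OF L2_diff[OF elim u(2)], of "1 / (s - t)"] show ?case by simp
 qed
 have "((%s. lnorm m (?q s)) \<longlongrightarrow> lnorm m h) (at t)"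
  using d qL h unfolding L2_deriv_def by (rule L2_tendsto_norm)
 then have lim: "((%s. abs (s - t) * lnorm m (?q s)) \<longlongrightarrow> abs (t - t) * lnorm m h) (at t)"
  by (intro tendsto_intros)
 have "\<forall>\<^sub>F s in at t. s ~= t" by (simp add: eventually_at_filter)
 then have "\<forall>\<^sub>F s in at t. lnorm m (%x. u s x - u t x) <= abs (s - t) * lnorm m (?q s)"
 proof eventually_elim
  case (elim s)
  then have "(%x. u s x - u t x) = (%x. (s - t) * ?q s x)" by auto
  then show ?case by (simp only: lnorm_cmult)
 qed
 from L2_tendsto_le[OF this] lim show ?thesis by simp
qed

text \<open>The product rule for inner products of differentiable curves.\<close>

lemma L2_deriv_ip:
 assumes u: "L2_deriv m u h t" "\<forall>\<^sub>F s in at t. u s : L2 m" "u t : L2 m" "h : L2 m"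
  and v: "L2_deriv m v k t" "\<forall>\<^sub>F s in at t. v s : L2 m" "v t : L2 m" "k : L2 m"
 shows "((%s. ip m (u s) (v s)) has_real_derivative (ip m h (v t) + ip m (u t) k)) (at t)"
 unfolding has_field_derivative_iff
proof (rule Lim_transform_eventually)
 let ?q = "%s x. (u s x - u t x) / (s - t)" and ?r = "%s x. (v s x - v t x) / (s - t)"
 have qL: "\<forall>\<^sub>F s in at t. ?q s : L2 m"
  using u(2)
 proof eventually_elim
  case (elim s)
  from L2_cmult[OF L2_diff[OF elim u(3)], of "1 / (s - t)"] show ?case by simp
 qed
 have rL: "\<forall>\<^sub>F s in at t. ?r s : L2 m"
  using v(2)
 proof eventually_elim
  case (elim s)
  from L2_cmult[OF L2_diff[OF elim v(3)], of "1 / (s - t)"] show ?case by simp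
 qed
 show "((%s. ip m (?q s) (v s) + ip m (u t) (?r s)) \<longlongrightarrow> ip m h (v t) + ip m (u t) k) (at t)"
  using u v qL rL L2_deriv_continuous[OF v]
  by (intro tendsto_add L2_tendsto_ip L2_tendsto_const) (auto simp: L2_deriv_def)
 have "\<forall>\<^sub>F s in at t. s ~= t" by (simp add: eventually_at_filter)
 then show "\<forall>\<^sub>F s in at t. ip m (?q s) (v s) + ip m (u t) (?r s) = (ip m (u s) (v s) - ip m (u t) (v t)) / (s - t)"
  using u(2) v(2)
 proof eventually_elim
  case (elim s)
  have "ip m (?q s) (v s) = 1 / (s - t) * (ip m (u s) (v s) - ip m (u t) (v s))"
   using ip_cmult_left[of m "1 / (s - t)" "%x. u s x - u t x" "v s"] ip_diff_left[OF elim(2) u(3) elim(3)] by simp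
  moreover have "ip m (u t) (?r s) = 1 / (s - t) * (ip m (u t) (v s) - ip m (u t) (v t))"
   using ip_cmult_right[of m "u t" "1 / (s - t)" "%x. v s x - v t x"] ip_diff_right[OF elim(3) v(3) u(3)] by simp
  ultimately show ?case using elim(1) by (simp add: field_simps)
 qed
qed

lemma L2_deriv_const: "L2_deriv m (%s. a) (%x. 0) t"
 by (simp add: L2_deriv_def L2_tendsto_const)

lemma L2_tendsto_at_offset: "L2_tendsto m F f (at a) ==> L2_tendsto m (%s. F (s + k)) f (at (a - k))" for a k :: real
 unfolding L2_tendsto_def by (rule LIM_offset)

lemma L2_deriv_offset: "L2_deriv m u h (t + k) ==> L2_deriv m (%s. u (s + k)) h t" for t k :: real
 using L2_tendsto_at_offset[of m "%s x. (u s x - u (t + k) x) / (s - (t + k))" h "t + k" k]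
 by (simp add: L2_deriv_def add_diff_eq diff_diff_eq2 algebra_simps)

lemma L2_deriv_reverse:
 assumes "L2_deriv m u h (T - t)" shows "L2_deriv m (%s. u (T - s)) (%x. - h x) t"
proof -
 have "filterlim (%s. T - s) (at (T - t)) (at t)"
  by (rule filterlim_atI) (auto intro!: tendsto_intros simp: eventually_at_filter)
 then have "L2_tendsto m (%s x. (u (T - s) x - u (T - t) x) / ((T - s) - (T - t))) h (at t)"
  using assms unfolding L2_deriv_def L2_tendsto_def by (rule filterlim_compose[rotated])
 moreover have "T - s - (T - t) = - (s - t)" for s by simp
 ultimately have "L2_tendsto m (%s x. - ((u (T - s) x - u (T - t) x) / (s - t))) h (at t)"
  by (simp only: divide_minus_right)
 from L2_tendsto_cmult[OF this, of "-1"] show ?thesis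
  unfolding L2_deriv_def mult_minus1 minus_minus .
qed

context ih_space
begin

lemma has_laplacian_D:
 assumes "has_laplacian m f h"
 shows "f : H12 m" "f : L2 m" "h : L2 m" "\<phi> : H12 m ==> E f \<phi> = - ip m h \<phi>"
 using assms by (auto simp: has_laplacian_def H12_def E_def ip_def)

lemma laplacian_symmetric:
 assumes "has_laplacian m f h" "has_laplacian m g k"
 shows "ip m h g = ip m f k"
 using has_laplacian_D(4)[OF assms(1) has_laplacian_D(1)[OF assms(2)]]
  has_laplacian_D(4)[OF assms(2) has_laplacian_D(1)[OF assms(1)]]
  E_commute[OF has_laplacian_D(1)[OF assms(1)] has_laplacian_D(1)[OF assms(2)]]
 by (simp add: ip_commute)

lemma has_laplacian_cong_AE:
 assumes "has_laplacian m f h" "AE x in m. f x = f' x" "f' : borel_measurable m" "AE x in m. h x = h' x" "h' : borel_measurable m"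
 shows "has_laplacian m f' h'"
 unfolding has_laplacian_def
proof (intro conjI ballI)
 have f: "f : H12 m" and h: "h : L2 m" using assms(1) by (auto simp: has_laplacian_def)
 show f': "f' : H12 m" by (rule H12_cong_AE[OF f assms(3,2)])
 show "h' : L2 m" by (rule L2_AE_cong[OF h assms(5,4)])
 fix \<phi> assume \<phi>: "\<phi> : H12 m"
 have "(LINT x|m. G f' \<phi> x) = (LINT x|m. G f \<phi> x)"
  using G_cong_AE_left[OF f assms(3,2) \<phi>] by (intro integral_cong_AE G_measurable f f' \<phi>) (auto elim: AE_mp)
 also have "\<dots> = - ip m h \<phi>" using has_laplacian_D(4)[OF assms(1) \<phi>] by (simp add: E_def)
 also have "ip m h \<phi> = ip m h' \<phi>"
  using assms(4,5) h \<phi> by (intro ip_cong_AE) (auto intro: L2_measurable H12_L2)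
 finally show "(LINT x|m. G f' \<phi> x) = - (LINT x|m. h' x * \<phi> x)" by (simp add: ip_def)
qed

lemma laplacian_nonpos: "has_laplacian m f h ==> ip m h f = - (lnorm m (D f))\<^sup>2"
 using has_laplacian_D(4)[of f h f] has_laplacian_D(1)[of f h] E_self[of f] by simp

lemma heat_flow_D:
 assumes "heat_flow m f u" "t > 0"
 obtains h where "has_laplacian m (u t) h" "L2_deriv m u h t" "u t : L2 m" "h : L2 m" "\<forall>\<^sub>F s in at t. u s : L2 m"
proof -
 obtain h where h: "has_laplacian m (u t) h" "L2_deriv m u h t"
  using assms unfolding heat_flow_def L2_deriv_def by blast
 have all: "u s : L2 m" if s: "s > 0" for s
 proof -
  obtain k where "has_laplacian m (u s) k" using assms(1) s unfolding heat_flow_def by blast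
  then show ?thesis by (rule has_laplacian_D)
 qed
 have "\<forall>\<^sub>F s in at t. s : {0<..}" using assms(2) by (intro eventually_at_in_open') auto
 then have "\<forall>\<^sub>F s in at t. u s : L2 m" by eventually_elim (simp add: all)
 with that[of h] h has_laplacian_D[OF h(1)] show ?thesis by blast
qed

text \<open>For two heat flows \<open>u\<close> and \<open>v\<close> the inner product of \<open>u s\<close> and \<open>v (T - s)\<close>
  is constant in \<open>s\<close>.  This gives uniqueness as well as self-adjointness.\<close>

lemma heat_flow_duality:
 assumes u: "heat_flow m f u" and v: "heat_flow m g v" and f: "f : L2 m" and g: "g : L2 m" and T: "T > 0"
 shows "ip m f (v T) = ip m (u T) g"
proof -
 define w where "w s = ip m (u s) (v (T - s))" for s
 have uL: "u s : L2 m" and vL: "v s : L2 m" if "s > 0" for s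
  using heat_flow_D[OF u that] heat_flow_D[OF v that] by blast+
 have der: "(w has_real_derivative 0) (at s)" if s: "0 < s" "s < T" for s
 proof -
  obtain h where h: "has_laplacian m (u s) h" "L2_deriv m u h s" "u s : L2 m" "h : L2 m" "\<forall>\<^sub>F s in at s. u s : L2 m"
   by (rule heat_flow_D[OF u s(1)])
  obtain k where k: "has_laplacian m (v (T - s)) k" "L2_deriv m v k (T - s)" "v (T - s) : L2 m" "k : L2 m"
   by (rule heat_flow_D[OF v, of "T - s"]) (use s in auto)
  have "\<forall>\<^sub>F s in at s. s : {..<T}" using s by (intro eventually_at_in_open') auto
  then have ev: "\<forall>\<^sub>F s in at s. v (T - s) : L2 m" by eventually_elim (simp add: vL)
  have "(w has_real_derivative (ip m h (v (T - s)) + ip m (u s) (%x. - k x))) (at s)"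
   unfolding w_def[abs_def]
   by (rule L2_deriv_ip[OF h(2,5,3,4) L2_deriv_reverse[OF k(2)] ev k(3) L2_uminus[OF k(4)]])
  moreover have "ip m (u s) (%x. - k x) = - ip m (u s) k" by (simp add: ip_def)
  ultimately show ?thesis using laplacian_symmetric[OF h(1) k(1)] by simp
 qed
 have const: "w s = w (T / 2)" if s: "0 < s" "s < T" for s
  by (rule DERIV_isconst3[of 0 T]) (use s T der in auto)
 have uc: "L2_tendsto m v (v T) (at T)"
 proof -
  obtain k where k: "has_laplacian m (v T) k" "L2_deriv m v k T" "v T : L2 m" "k : L2 m" "\<forall>\<^sub>F s in at T. v s : L2 m"
   by (rule heat_flow_D[OF v T])
  show ?thesis by (rule L2_deriv_continuous[OF k(2,5,3,4)])
 qed
 have vc: "L2_tendsto m u (u T) (at T)"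
 proof -
  obtain k where k: "has_laplacian m (u T) k" "L2_deriv m u k T" "u T : L2 m" "k : L2 m" "\<forall>\<^sub>F s in at T. u s : L2 m"
   by (rule heat_flow_D[OF u T])
  show ?thesis by (rule L2_deriv_continuous[OF k(2,5,3,4)])
 qed
 have rev: "filterlim (%s. T - s) (at T) (at_right (0::real))"
  by (rule filterlim_atI) (auto intro!: tendsto_eq_intros simp: eventually_at_filter)
 have small: "\<forall>\<^sub>F s in at_right (0::real). 0 < s & s < T"
  using eventually_at_right_real[OF T] by eventually_elim auto
 have lim1: "((%s. ip m (u s) (v (T - s))) \<longlongrightarrow> ip m f (v T)) (at_right 0)"
 proof (rule L2_tendsto_ip)
  show "L2_tendsto m u f (at_right 0)" using u by (simp add: heat_flow_def)
  show "L2_tendsto m (%s. v (T - s)) (v T) (at_right 0)"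
   using uc rev unfolding L2_tendsto_def by (rule filterlim_compose)
  show "\<forall>\<^sub>F s in at_right 0. u s : L2 m" "\<forall>\<^sub>F s in at_right 0. v (T - s) : L2 m"
   using small by (eventually_elim, simp add: uL vL)+
 qed (use f vL T in auto)
 have lim2: "((%s. ip m (u (T - s)) (v s)) \<longlongrightarrow> ip m (u T) g) (at_right 0)"
 proof (rule L2_tendsto_ip)
  show "L2_tendsto m v g (at_right 0)" using v by (simp add: heat_flow_def)
  show "L2_tendsto m (%s. u (T - s)) (u T) (at_right 0)"
   using vc rev unfolding L2_tendsto_def by (rule filterlim_compose)
  show "\<forall>\<^sub>F s in at_right 0. v s : L2 m" "\<forall>\<^sub>F s in at_right 0. u (T - s) : L2 m"
   using small by (eventually_elim, simp add: uL vL)+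
 qed (use g uL T in auto)
 have "\<forall>\<^sub>F s in at_right (0::real). ip m (u s) (v (T - s)) = w (T / 2)"
  using small by eventually_elim (use const in "simp add: w_def")
 from tendsto_cong[THEN iffD1, OF this lim1] have "ip m f (v T) = w (T / 2)"
  by (simp add: tendsto_const_iff)
 moreover have "\<forall>\<^sub>F s in at_right (0::real). ip m (u (T - s)) (v s) = w (T / 2)"
  using small
 proof eventually_elim
  case (elim s)
  then show ?case using const[of "T - s"] by (simp add: w_def)
 qed
 from tendsto_cong[THEN iffD1, OF this lim2] have "ip m (u T) g = w (T / 2)"
  by (simp add: tendsto_const_iff)
 ultimately show ?thesis by simp
qed

lemma heat_flow_L2: "heat_flow m f u ==> t > 0 ==> u t : L2 m"
 using heat_flow_D by blast

end

locale heat_space = ih_space +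
 fixes \<rho> :: "'a => 'a => real => real"
 assumes hk: "heat_kernel m \<rho>"
begin

definition P :: "real => ('a => real) => 'a => real" where
 "P t f = (%x. \<integral>y. \<rho> x y t * f y \<partial>m)"

lemma P_flow: "f : L2 m ==> heat_flow m f (%t. P t f)"
 using hk by (simp add: heat_kernel_def P_def)

lemma P_integrable: "f : L2 m ==> t > 0 ==> AE x in m. integrable m (%y. \<rho> x y t * f y)"
 using hk by (simp add: heat_kernel_def)

lemma P_L2: "f : L2 m ==> t > 0 ==> P t f : L2 m"
 using heat_flow_L2[OF P_flow] .

lemma P_unique:
 assumes u: "heat_flow m f u" and f: "f : L2 m" and t: "t > 0"
 shows "AE x in m. u t x = P t f x"
proof (rule L2_eq_if_ip[OF heat_flow_L2[OF u t] P_L2[OF f t]])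
 fix b assume b: "b : L2 m"
 show "ip m (u t) b = ip m (P t f) b"
  using heat_flow_duality[OF u P_flow[OF b] f b t] heat_flow_duality[OF P_flow[OF f] P_flow[OF b] f b t] by simp
qed

lemma P_self_adjoint: "f : L2 m ==> g : L2 m ==> t > 0 ==> ip m (P t f) g = ip m f (P t g)"
 using heat_flow_duality[OF P_flow P_flow] by simp

lemma P_D:
 assumes "f : L2 m" "t > 0"
 obtains h where "has_laplacian m (P t f) h" "L2_deriv m (%t. P t f) h t" "h : L2 m" "\<forall>\<^sub>F s in at t. P s f : L2 m"
 using heat_flow_D[OF P_flow[OF assms(1)] assms(2)] by metis

lemma P_continuous: "f : L2 m ==> t > 0 ==> L2_tendsto m (%s. P s f) (P t f) (at t)"
 using P_D[of f t] L2_deriv_continuous P_L2 by metis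

lemma P_semigroup:
 assumes f: "f : L2 m" and t: "t > 0" and s: "s > 0"
 shows "AE x in m. P (s + t) f x = P s (P t f) x"
proof (rule P_unique[OF _ P_L2[OF f t] s])
 show "heat_flow m (P t f) (%s. P (s + t) f)"
  unfolding heat_flow_def
 proof (intro conjI allI impI)
  fix r :: real assume r: "r > 0"
  obtain h where h: "has_laplacian m (P (r + t) f) h" "L2_deriv m (%t. P t f) h (r + t)"
   by (rule P_D[OF f, of "r + t"]) (use r t in auto)
  from h(1) L2_deriv_offset[OF h(2)]
  show "EX h. has_laplacian m (P (r + t) f) h & L2_tendsto m (%s x. (P (s + t) f x - P (r + t) f x) / (s - r)) h (at r)"
   by (auto simp: L2_deriv_def)
 next
  have "L2_tendsto m (%s. P (s + t) f) (P t f) (at (t - t))"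
   by (rule L2_tendsto_at_offset[OF P_continuous[OF f t]])
  then show "L2_tendsto m (%s. P (s + t) f) (P t f) (at_right 0)"
   unfolding L2_tendsto_def by (auto intro: tendsto_mono[OF at_le])
 qed
qed

lemma P_add:
 assumes f: "f : L2 m" and g: "g : L2 m" and t: "t > 0"
 shows "AE x in m. P t (%x. f x + g x) x = P t f x + P t g x"
 using P_integrable[OF f t] P_integrable[OF g t]
 by eventually_elim (simp add: P_def distrib_left)

lemma P_cmult: "P t (%x. c * f x) x = c * P t f x"
 by (simp add: P_def mult.left_commute)

lemma P_diff:
 assumes f: "f : L2 m" and g: "g : L2 m" and t: "t > 0"
 shows "AE x in m. P t (%x. f x - g x) x = P t f x - P t g x"
 using P_integrable[OF f t] P_integrable[OF g t]
 by eventually_elim (simp add: P_def right_diff_distrib)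

lemma P_H12: "f : L2 m ==> t > 0 ==> P t f : H12 m"
 using P_D has_laplacian_D(1) by metis

lemma P_norm_deriv:
 assumes f: "f : L2 m" and t: "t > 0"
 shows "((%s. (lnorm m (P s f))^2) has_real_derivative - 2 * (lnorm m (D (P t f)))^2) (at t)"
proof -
 obtain h where h: "has_laplacian m (P t f) h" "L2_deriv m (%t. P t f) h t" "h : L2 m" "\<forall>\<^sub>F s in at t. P s f : L2 m"
  by (rule P_D[OF f t])
 have "((%s. ip m (P s f) (P s f)) has_real_derivative (ip m h (P t f) + ip m (P t f) h)) (at t)"
  by (rule L2_deriv_ip[OF h(2,4) P_L2[OF f t] h(3) h(2,4) P_L2[OF f t] h(3)])
 then show ?thesis using laplacian_nonpos[OF h(1)] by (simp add: ip_self ip_commute)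
qed

lemma P_norm_antimono:
 assumes f: "f : L2 m" and s: "0 < s" "s <= t"
 shows "lnorm m (P t f) <= lnorm m (P s f)"
proof -
 have "(lnorm m (P t f))^2 <= (lnorm m (P s f))^2"
 proof (rule DERIV_nonpos_imp_nonincreasing[OF s(2)])
  fix x assume "s <= x" "x <= t"
  then show "EX y. DERIV (%s. (lnorm m (P s f))^2) x :> y & y <= 0"
   using P_norm_deriv[OF f, of x] s by (intro exI[of _ "- 2 * (lnorm m (D (P x f)))^2"]) auto
 qed
 then show ?thesis by (simp add: power2_le_iff_abs_le)
qed

lemma P_contraction:
 assumes f: "f : L2 m" and t: "t > 0"
 shows "lnorm m (P t f) <= lnorm m f"
proof -
 have "L2_tendsto m (%s. P s f) f (at_right 0)" using P_flow[OF f] by (simp add: heat_flow_def)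
 moreover have ev: "\<forall>\<^sub>F s in at_right (0::real). 0 < s & s < t"
  using eventually_at_right_real[OF t] by eventually_elim auto
 moreover have "\<forall>\<^sub>F s in at_right 0. P s f : L2 m" using ev by eventually_elim (simp add: P_L2 f)
 ultimately have "((%s. lnorm m (P s f)) \<longlongrightarrow> lnorm m f) (at_right 0)" by (intro L2_tendsto_norm f)
 then show ?thesis
  by (rule tendsto_lowerbound) (use ev in "auto elim!: eventually_mono intro: P_norm_antimono f")
qed

lemma P_lnorm_diff:
 assumes f: "f : L2 m" and g: "g : L2 m" and t: "t > 0"
 shows "lnorm m (%x. P t f x - P t g x) <= lnorm m (%x. f x - g x)"
proof -
 have "lnorm m (%x. P t f x - P t g x) = lnorm m (P t (%x. f x - g x))"
  using P_diff[OF f g t] P_L2[OF f t] P_L2[OF g t] P_L2[OF L2_diff[OF f g] t]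
  by (intro lnorm_cong_AE) (auto intro: L2_measurable L2_diff elim: AE_mp)
 also have "\<dots> <= lnorm m (%x. f x - g x)" by (rule P_contraction[OF L2_diff[OF f g] t])
 finally show ?thesis .
qed

text \<open>Differentiate \<open>\<langle>P\<^sub>s a, b\<rangle> = \<langle>a, P\<^sub>s b\<rangle>\<close> at \<open>s = t\<close> and use the symmetry of the Laplacian.\<close>

lemma has_laplacian_P:
 assumes a: "has_laplacian m a a'" and t: "t > 0"
 shows "has_laplacian m (P t a) (P t a')" "L2_deriv m (%t. P t a) (P t a') t"
proof -
 note aL = has_laplacian_D(2,3)[OF a]
 obtain h where h: "has_laplacian m (P t a) h" "L2_deriv m (%t. P t a) h t" "h : L2 m" "\<forall>\<^sub>F s in at t. P s a : L2 m"
  by (rule P_D[OF aL(1) t])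
 have eq: "AE x in m. h x = P t a' x"
 proof (rule L2_eq_if_ip[OF h(3) P_L2[OF aL(2) t]])
  fix b assume b: "b : L2 m"
  obtain k where k: "has_laplacian m (P t b) k" "L2_deriv m (%t. P t b) k t" "k : L2 m" "\<forall>\<^sub>F s in at t. P s b : L2 m"
   by (rule P_D[OF b t])
  have d1: "((%s. ip m (P s a) b) has_real_derivative (ip m h b + ip m (P t a) (%x. 0))) (at t)"
   using L2_deriv_ip[OF h(2,4) P_L2[OF aL(1) t] h(3) L2_deriv_const _ b L2_zero] b by simp
  have d2: "((%s. ip m a (P s b)) has_real_derivative (ip m (%x. 0) (P t b) + ip m a k)) (at t)"
   using L2_deriv_ip[OF L2_deriv_const _ aL(1) L2_zero k(2,4) P_L2[OF b t] k(3)] aL by simp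
  have "\<forall>\<^sub>F s in nhds t. s : {0<..}" using t by (intro eventually_nhds_in_open) auto
  then have "\<forall>\<^sub>F s in nhds t. ip m (P s a) b = ip m a (P s b)" by eventually_elim (simp add: P_self_adjoint aL b)
  from DERIV_cong_ev[OF refl this refl] d1 d2 have "ip m h b = ip m a k"
   using DERIV_unique by (fastforce simp: ip_def)
  also have "\<dots> = ip m a' (P t b)" using laplacian_symmetric[OF a k(1)] by simp
  also have "\<dots> = ip m (P t a') b" by (simp add: P_self_adjoint aL b t)
  finally show "ip m h b = ip m (P t a') b" .
 qed
 have meas: "P t a' : borel_measurable m" "P t a : borel_measurable m" using P_L2 aL t by (auto intro: L2_measurable)
 show "has_laplacian m (P t a) (P t a')" by (rule has_laplacian_cong_AE[OF h(1) _ meas(2) eq meas(1)]) simp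
 have Leq: "(LINT x|m. ((P s a x - P t a x) / (s - t) - h x)^2) = (LINT x|m. ((P s a x - P t a x) / (s - t) - P t a' x)^2)" if "s > 0" for s
  using eq meas P_L2[OF aL(1) that] h(3) by (intro integral_cong_AE) (auto dest!: L2_measurable elim: AE_mp)
 have "\<forall>\<^sub>F s in at t. s : {0<..}" using t by (intro eventually_at_in_open') auto
 then have "\<forall>\<^sub>F s in at t. (LINT x|m. ((P s a x - P t a x) / (s - t) - h x)^2) = (LINT x|m. ((P s a x - P t a x) / (s - t) - P t a' x)^2)"
  by eventually_elim (simp add: Leq)
 from tendsto_cong[OF this] h(2) show "L2_deriv m (%t. P t a) (P t a') t" by (simp add: L2_deriv_def L2_tendsto_def)
qed

lemma P_ip_deriv:
 assumes a: "has_laplacian m a a'" and b: "b : L2 m" and t: "t > 0"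
 shows "((%s. ip m (P s a) b) has_real_derivative ip m (P t a') b) (at t)"
proof -
 note aL = has_laplacian_D(2,3)[OF a]
 have "\<forall>\<^sub>F s in at t. s : {0<..}" using t by (intro eventually_at_in_open') auto
 then have ev: "\<forall>\<^sub>F s in at t. P s a : L2 m" by eventually_elim (simp add: P_L2 aL)
 have "((%s. ip m (P s a) b) has_real_derivative (ip m (P t a') b + ip m (P t a) (%x. 0))) (at t)"
  using L2_deriv_ip[OF has_laplacian_P(2)[OF a t] ev P_L2[OF aL(1) t] P_L2[OF aL(2) t] L2_deriv_const _ b L2_zero] b by simp
 then show ?thesis by (simp add: ip_def)
qed

lemma ip_P_half:
 assumes a: "a : L2 m" and b: "b : L2 m" and t: "t > 0"
 shows "ip m (P t a) b = ip m (P (t/2) a) (P (t/2) b)"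
proof -
 have t2: "t / 2 > 0" using t by simp
 have "ip m (P t a) b = ip m (P (t/2) (P (t/2) a)) b"
  using P_semigroup[OF a t2 t2] P_L2[OF a t] P_L2[OF P_L2[OF a t2] t2] b
  by (intro ip_cong_AE) (auto intro: L2_measurable)
 also have "\<dots> = ip m (P (t/2) a) (P (t/2) b)" by (rule P_self_adjoint[OF P_L2[OF a t2] b t2])
 finally show ?thesis .
qed

text \<open>Half of the remaining time is kept at every step: \<open>\<Delta> P\<^sub>d w = P\<^bsub>d / 2\<^esub> (\<Delta> P\<^bsub>d / 2\<^esub> w)\<close>.\<close>

lemma smooth_chain:
 assumes w: "w : L2 m" and d: "d > 0"
 shows "EX v. v 0 = P d w & (ALL n::nat. has_laplacian m (v n) (v (Suc n)))"
proof -
 define S where "S v \<longleftrightarrow> (EX d>0. EX w:L2 m. v = P d w)" for v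
 have step: "EX v'. S v' & has_laplacian m v v'" if v: "S v" for v
 proof -
  obtain d w where dw: "d > 0" "w : L2 m" "v = P d w" using v by (auto simp: S_def)
  have d2: "d / 2 > 0" using dw by simp
  obtain h where h: "has_laplacian m (P (d/2) w) h" "h : L2 m" by (rule P_D[OF dw(2) d2])
  have "AE x in m. P (d/2) (P (d/2) w) x = v x" using P_semigroup[OF dw(2) d2 d2] dw(3) by (auto elim: AE_mp)
  moreover have vm: "v : borel_measurable m" using L2_measurable[OF P_L2[OF dw(2,1)]] dw(3) by simp
  ultimately have "has_laplacian m v (P (d/2) h)"
   by (rule has_laplacian_cong_AE[OF has_laplacian_P(1)[OF h(1) d2] _ _ AE_I2[OF refl] L2_measurable[OF P_L2[OF h(2) d2]]])
  moreover have "S (P (d/2) h)" unfolding S_def using d2 h(2) by blast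
  ultimately show ?thesis by blast
 qed
 have S0: "S (P d w)" using w d by (auto simp: S_def)
 have "EX v. (v 0 = P d w & S (v 0)) & (ALL n. S (v (Suc n)) & has_laplacian m (v n) (v (Suc n)))"
 proof -
  have "EX v. ALL n. ((n = 0 --> v n = P d w) & S (v n)) & has_laplacian m (v n) (v (Suc n))"
   by (rule dependent_nat_choice) (use S0 step in auto)
  then show ?thesis by blast
 qed
 then show ?thesis by blast
qed

text \<open>The \<open>n\<close>-th derivative of \<open>|P\<^sub>t w|\<^sup>2\<close> is \<open>2\<^sup>n \<langle>\<Delta>\<^sup>n P\<^sub>t w, P\<^sub>t w\<rangle>\<close>.  Since \<open>\<Delta>\<close> is symmetric and nonpositive it has the
  sign \<open>(-1)\<^sup>n\<close>, and all signs become positive when time runs backwards.\<close>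

lemma P_norm_series:
 assumes w: "w : L2 m" and d: "d > 0"
 shows "past_series d (%t. (lnorm m (P t w))^2)"
 unfolding past_series_def
proof (intro allI impI)
 fix b assume b: "b > d"
 obtain v where v0: "v 0 = P d w" and v: "!!n::nat. has_laplacian m (v n) (v (Suc n))"
  using smooth_chain[OF w d] by blast
 note vL = has_laplacian_D(2)[OF v]
 define r where "r n t = ip m (P t (v (n - n div 2))) (v (n div 2))" for n t
 have r_der: "(r n has_real_derivative r (Suc n) t) (at t)" if t: "t > 0" for n t
 proof -
  have "(r n has_real_derivative ip m (P t (v (Suc (n - n div 2)))) (v (n div 2))) (at t)"
   unfolding r_def[abs_def] by (rule P_ip_deriv[OF v vL t])
  moreover have "ip m (P t (v (Suc (n - n div 2)))) (v (n div 2)) = r (Suc n) t"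
  proof (cases "even n")
   case True
   then show ?thesis by (simp add: r_def Suc_diff_le)
  next
   case False
   then obtain j where j: "n = 2 * j + 1" by (elim oddE)
   have "ip m (P t (v (Suc (Suc j)))) (v j) = ip m (P t (v (Suc j))) (v (Suc j))"
    using laplacian_symmetric[OF has_laplacian_P(1)[OF v t] v, of "Suc j" j] by simp
   then show ?thesis by (simp add: j r_def)
  qed
  ultimately show ?thesis by simp
 qed
 have r_sign: "0 <= (-1) ^ n * r n t" if t: "t > 0" for n t
 proof (cases "even n")
  case True
  then obtain j where j: "n = 2 * j" by (elim evenE)
  then show ?thesis using ip_P_half[OF vL vL t, of j j] by (simp add: r_def ip_self)
 next
  case False
  then obtain j where j: "n = 2 * j + 1" by (elim oddE)
  have "ip m (P t (v (Suc j))) (v j) = - (lnorm m (D (P (t/2) (v j))))\<^sup>2"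
   using ip_P_half[OF vL vL t, of "Suc j" j] laplacian_nonpos[OF has_laplacian_P(1)[OF v, of "t/2" j]] t by simp
  then show ?thesis by (simp add: j r_def)
 qed
 have val: "r 0 (2 * (t - d)) = (lnorm m (P t w))^2" if t: "t > d" for t
 proof -
  have td: "t - d > 0" using t by simp
  have half: "2 * (t - d) / 2 = t - d" by simp
  have "r 0 (2 * (t - d)) = ip m (P (t - d) (P d w)) (P (t - d) (P d w))"
   using ip_P_half[OF vL[of 0] vL[of 0], of "2 * (t - d)", unfolded half v0] td by (simp add: r_def v0)
  also have "\<dots> = (lnorm m (P (t - d) (P d w)))^2" by (rule ip_self)
  also have "lnorm m (P (t - d) (P d w)) = lnorm m (P t w)"
   using P_semigroup[OF w d td] P_L2[OF w, of t] P_L2[OF P_L2[OF w d] td] t d by (intro lnorm_cong_AE) (auto intro: L2_measurable elim: AE_mp)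
  finally show ?thesis .
 qed
 define g where "g n s = (-2) ^ n * r n (2 * (b - s - d))" for n s
 have g_der: "(g n has_real_derivative g (Suc n) s) (at s)" if s: "s < b - d" for n s
 proof -
  have inner: "((%s. 2 * (b - s - d)) has_real_derivative -2) (at s)" by (auto intro!: derivative_eq_intros)
  have "((%s. r n (2 * (b - s - d))) has_real_derivative r (Suc n) (2 * (b - s - d)) * (-2)) (at s)"
   by (rule DERIV_chain2[OF r_der inner]) (use s in simp)
  moreover have "(-2) ^ n * (r (Suc n) (2 * (b - s - d)) * (-2)) = g (Suc n) s" by (simp add: g_def)
  ultimately show ?thesis unfolding g_def[of n, abs_def] using DERIV_cmult by metis
 qed
 have g_pos: "0 <= g n s" if s: "s < b - d" for n s
 proof -
  have "(-2::real) ^ n = 2 ^ n * (-1) ^ n" by (simp flip: power_mult_distrib)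
  then show ?thesis using r_sign[of "2 * (b - s - d)" n] s by (simp add: g_def mult.assoc)
 qed
 show "EX c. (ALL n. 0 <= c n) & (ALL s. 0 <= s & s < b - d --> (%n. c n * s ^ n) sums (lnorm m (P (b - s) w))^2)"
 proof (intro exI conjI allI impI)
  show "0 <= g n 0 / fact n" for n using g_pos[of 0 n] b by simp
  fix s assume s: "0 <= s & s < b - d"
  have "(%n. g n 0 / fact n * s ^ n) sums g 0 s"
   by (rule Bernstein_series[where g=g and r="b - d", OF g_der g_pos]) (use s in auto)
  then show "(%n. g n 0 / fact n * s ^ n) sums (lnorm m (P (b - s) w))^2"
   using val[of "b - s"] s by (simp add: g_def)
 qed
qed

end

context heat_space
begin

text \<open>Sum the second differences twice, starting from the end.\<close>

lemma second_difference_bound: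
 fixes a :: "nat => real" and n :: nat and \<delta> :: real
 assumes "!!j. j < n ==> \<delta> <= a j - 2 * a (Suc j) + a (Suc (Suc j))" "!!j. 0 <= a j" "!!j. a (Suc j) <= a j"
 shows "n * \<delta> <= a 0 - a 1 & n * (n + 1) / 2 * \<delta> <= a 0"
 using assms
proof (induction n arbitrary: a)
 case 0
 from 0(2)[of 0] 0(3)[of 0] show ?case by simp
next
 case (Suc n)
 have "n * \<delta> <= a 1 - a 2 & n * (n + 1) / 2 * \<delta> <= a 1"
  using Suc.IH[of "%j. a (Suc j)"] Suc.prems by (simp add: numeral_2_eq_2)
 moreover have "\<delta> <= a 0 - 2 * a 1 + a 2" using Suc.prems(1)[of 0] by (simp add: numeral_2_eq_2)
 ultimately show ?case by (auto simp: field_simps)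
qed

lemma ip_P_P:
 assumes f: "f : L2 m" and t: "t > 0" and h: "h > 0"
 shows "ip m (P (t + 2 * h) f) (P t f) = (lnorm m (P (t + h) f))^2"
proof -
 have th: "t + h > 0" "t + 2 * h > 0" using t h by auto
 have L: "P (t + h) f : L2 m" "P t f : L2 m" by (intro P_L2 f t th)+
 have "ip m (P (t + 2 * h) f) (P t f) = ip m (P h (P (t + h) f)) (P t f)"
  using P_semigroup[OF f th(1) h] P_L2[OF f th(2)] P_L2[OF L(1) h] L
  by (intro ip_cong_AE) (auto simp: algebra_simps dest!: L2_measurable elim: AE_mp)
 also have "\<dots> = ip m (P (t + h) f) (P h (P t f))" by (rule P_self_adjoint[OF L h])
 also have "\<dots> = ip m (P (t + h) f) (P (t + h) f)"
  using P_semigroup[OF f t h] P_L2[OF L(2) h] L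
  by (intro ip_cong_AE) (auto simp: algebra_simps dest!: L2_measurable elim: AE_mp)
 finally show ?thesis by (simp add: ip_self)
qed

text \<open>Standard smoothing estimates.  The increments \<open>|P\<^sub>s\<^sub>+\<^sub>h f - P\<^sub>s f|\<^sup>2\<close> are second
  differences of \<open>|P\<^sub>s f|\<^sup>2\<close>, and they decrease in \<open>s\<close>.\<close>

lemma P_smoothing:
 assumes f: "f : L2 m" and t: "t > 0"
 shows "0 <= h ==> lnorm m (%x. P (t + h) f x - P t f x) <= 8 * h / t * lnorm m f"
  and "t * (lnorm m (D (P t f)))^2 <= 8 * (lnorm m f)^2"
proof -
 have inc: "lnorm m (%x. P (t + h) f x - P t f x) <= 8 * h / t * lnorm m f" if "0 <= h" for h
 proof (cases "h = 0 | t < 4 * h")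
  case True
  have "lnorm m (%x. P (t + h) f x - P t f x) <= lnorm m (P (t + h) f) + lnorm m (P t f)"
   using lnorm_triangle[OF P_L2[OF f] L2_uminus[OF P_L2[OF f t]], of "t + h"] t that by simp
  also have "\<dots> <= 2 * lnorm m f" using P_contraction[OF f, of "t + h"] P_contraction[OF f t] t that by simp
  also have "h ~= 0 ==> 2 * lnorm m f <= 8 * h / t * lnorm m f" using True t by (intro mult_right_mono) (auto simp: field_simps)
  finally show ?thesis using True by (cases "h = 0") auto
 next
  case False
  then have h: "0 < h" "4 * h <= t" using that by auto
  define d where "d = lnorm m (%x. P (t + h) f x - P t f x)"
    \<comment> \<open>the increment over \<open>h\<close> decreases in time, so \<open>d\<close> is a lower bound for those starting at the \<open>n\<close> times \<open>t / 2 + j h / 2 \<le> t\<close>\<close>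
  define n where "n = nat \<lfloor>t / h\<rfloor> - 1"
  define a where "a j = (lnorm m (P (t/2 + j * (h/2)) f))^2" for j :: nat
  have "t / h >= 4" using h by (simp add: field_simps)
  then have "4 <= \<lfloor>t / h\<rfloor>" by linarith
  then have "int n = \<lfloor>t / h\<rfloor> - 1" unfolding n_def by arith
  then have "real n = real_of_int \<lfloor>t / h\<rfloor> - 1" by (metis of_int_1 of_int_diff of_int_of_nat_eq)
  then have "real n + 1 <= t / h" "t / h < real n + 2" by linarith+
  then have n: "real n * h + h <= t" "t < (real n + 2) * h" using h by (simp_all add: field_simps)
  have "d^2 <= a j - 2 * a (Suc j) + a (Suc (Suc j))" if "j < n" for j
  proof -
   define s where "s = t/2 + j * (h/2)"
   have s: "s > 0" "s + h > 0" using t h by (auto simp: s_def add_pos_nonneg)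
   have st: "t - s > 0" using mult_right_mono[of "real j + 1" n h] n(1) h that by (simp add: s_def algebra_simps)
   note L = P_L2[OF f s(1)] P_L2[OF f s(2)]
   have "d <= lnorm m (%x. P (s + h) f x - P s f x)"
   proof -
    have "d = lnorm m (%x. P (t - s) (P (s + h) f) x - P (t - s) (P s f) x)" unfolding d_def
     using P_semigroup[OF f s(1) st] P_semigroup[OF f s(2) st] P_L2[OF L(1) st] P_L2[OF L(2) st] P_L2[OF f, of t] P_L2[OF f, of "t + h"] t h
     by (intro lnorm_cong_AE) (auto simp: algebra_simps dest!: L2_measurable elim: AE_mp)
    then show ?thesis using P_lnorm_diff[OF L(2,1) st] by simp
   qed
   then have "d^2 <= (lnorm m (%x. P (s + h) f x - P s f x))^2" by (intro power_mono) (auto simp: d_def)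
   moreover have "t/2 + Suc j * (h/2) = s + h/2" "t/2 + Suc (Suc j) * (h/2) = s + h" by (simp_all add: s_def field_simps)
   ultimately show ?thesis using lnorm_diff_sq[OF L(2,1)] ip_P_P[OF f s(1), of "h/2"] h unfolding a_def s_def[symmetric] by simp
  qed
  moreover have "a (Suc j) <= a j" for j
   unfolding a_def using t h by (intro power_mono P_norm_antimono f add_pos_nonneg) (auto intro!: mult_right_mono)
  moreover have "0 <= a j" for j by (simp add: a_def)
  ultimately have "n * (n + 1) / 2 * d^2 <= a 0" using second_difference_bound[of n "d^2" a] by blast
  also have "\<dots> <= (lnorm m f)^2" unfolding a_def using P_contraction[OF f, of "t/2"] t by (intro power_mono) auto
  finally have "h^2 * (n * (n + 1) / 2 * d^2) <= h^2 * (lnorm m f)^2" by (intro mult_left_mono) auto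
  moreover have "t^2 / 8 <= h^2 * (n * (n + 1) / 2)"
  proof -
   have "t / 2 * (t / 2) <= (real n * h) * ((real n + 1) * h)" using n h t by (intro mult_mono) (auto simp: algebra_simps)
   then show ?thesis by (simp add: power2_eq_square algebra_simps)
  qed
  from mult_right_mono[OF this, of "d^2"] have "t^2 / 8 * d^2 <= h^2 * (n * (n + 1) / 2 * d^2)" by (simp add: mult.assoc)
  ultimately have "(t * d)^2 <= 8 * (h * lnorm m f)^2" by (simp add: power_mult_distrib algebra_simps)
  also have "\<dots> <= (8 * (h * lnorm m f))^2" by (simp add: power_mult_distrib)
  finally have "t * d <= 8 * (h * lnorm m f)" by (rule power2_le_imp_le) (use h in simp)
  then show ?thesis using t by (simp add: d_def field_simps)
 qed
 then show "0 <= h ==> lnorm m (%x. P (t + h) f x - P t f x) <= 8 * h / t * lnorm m f" by blast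
 obtain k where k: "has_laplacian m (P t f) k" "L2_deriv m (%t. P t f) k t" "k : L2 m" by (rule P_D[OF f t])
 note L = P_L2[OF f t]
 have "((%s. lnorm m (%x. (P s f x - P t f x) / (s - t))) \<longlongrightarrow> lnorm m k) (at_right t)"
 proof (rule L2_tendsto_norm)
  show "L2_tendsto m (%s x. (P s f x - P t f x) / (s - t)) k (at_right t)"
   using k(2) unfolding L2_deriv_def L2_tendsto_def by (rule filterlim_mono[OF _ order_refl]) (simp add: at_le)
  have "\<forall>\<^sub>F s in at_right t. s > t" by (simp add: eventually_at_filter)
  then show "\<forall>\<^sub>F s in at_right t. (%x. (P s f x - P t f x) / (s - t)) : L2 m"
  proof eventually_elim
   case (elim s)
   then show ?case using L2_cmult[OF L2_diff[OF P_L2[OF f, of s] L], of "inverse (s - t)"] t by (simp add: divide_inverse mult.commute)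
  qed
 qed (rule k)
 moreover have "\<forall>\<^sub>F s in at_right t. lnorm m (%x. (P s f x - P t f x) / (s - t)) <= 8 / t * lnorm m f"
  unfolding eventually_at_filter
 proof (intro always_eventually allI impI)
  fix s assume "s ~= t" "s : {t<..}"
  then show "lnorm m (%x. (P s f x - P t f x) / (s - t)) <= 8 / t * lnorm m f"
   using inc[of "s - t"] lnorm_cmult[of m "inverse (s - t)" "%x. P s f x - P t f x"] t
   by (simp add: divide_inverse mult.commute) (simp add: field_simps)
 qed
 ultimately have kn: "lnorm m k <= 8 / t * lnorm m f" by (rule tendsto_upperbound) simp
 have "(lnorm m (D (P t f)))^2 = - ip m k (P t f)" using laplacian_nonpos[OF k(1)] by simp
 also have "\<dots> <= lnorm m k * lnorm m (P t f)" using L2_CS[OF k(3) L] by linarith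
 also have "\<dots> <= (8 / t * lnorm m f) * lnorm m f" by (intro mult_mono kn P_contraction f t) (use t in auto)
 finally show "t * (lnorm m (D (P t f)))^2 <= 8 * (lnorm m f)^2" using t by (simp add: power2_eq_square field_simps)
qed

section \<open>The heat kernel\<close>

lemma rho_continuous:
 fixes x y :: 'a and t :: real
 assumes t: "t > 0" shows "isCont (%(x, y, t). \<rho> x y t) (x, y, t)"
proof -
 obtain r C where r: "r > 0" "C-lipschitz_on (ball (x, y, t) r \<inter> UNIV \<times> UNIV \<times> {0<..}) (%(x', y', t'). \<rho> x' y' t')"
  using hk t unfolding heat_kernel_def by blast
 have "open (ball (x, y, t) r \<inter> UNIV \<times> UNIV \<times> {0<..})" by (intro open_Int open_Times) auto
 moreover have "(x, y, t) : ball (x, y, t) r \<inter> UNIV \<times> UNIV \<times> {0<..}" using r t by auto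
 ultimately show "isCont (%(x, y, t). \<rho> x y t) (x, y, t)"
  using lipschitz_on_continuous_on[OF r(2)] continuous_on_eq_continuous_at by blast
qed

lemma rho_tendsto:
 assumes "(X \<longlongrightarrow> x) F" "(Y \<longlongrightarrow> y) F" "(S \<longlongrightarrow> t) F" "t > 0"
 shows "((%i. \<rho> (X i) (Y i) (S i)) \<longlongrightarrow> \<rho> x y t) F"
proof -
 have "((%i. (X i, Y i, S i)) \<longlongrightarrow> (x, y, t)) F" by (intro tendsto_Pair assms)
 from isCont_tendsto_compose[OF rho_continuous[OF assms(4)] this] show ?thesis by simp
qed

definition kf :: "'a => real => 'a => real" where
 "kf y t = (%x. \<rho> x y t)"

text \<open>Approximate unit mass at \<open>y\<close>; the kernel is continuous, so \<open>P t (avg y r) x\<close> tends to \<open>\<rho> x y t\<close>.\<close>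

definition avg :: "'a => real => 'a => real" where
 "avg y r x = indicator (ball y r) x / measure m (ball y r)"

lemma ball_measure:
 assumes "r > 0" shows "emeasure m (ball y r) < \<infinity>" "0 < measure m (ball y r)" "ball y r : sets m"
proof -
 show 1: "emeasure m (ball y r) < \<infinity>" by (rule fin_bounded) auto
 have "emeasure m (ball y r) > 0" using mms assms by (simp add: metric_measure_space_def)
 with 1 show "0 < measure m (ball y r)" by (simp add: measure_def enn2real_positive_iff)
 show "ball y r : sets m" by (simp add: sets_m)
qed

lemma avg_L2: "r > 0 ==> avg y r : L2 m"
proof -
 assume r: "r > 0"
 have "(%x. (indicator (ball y r) x :: real)^2) = indicator (ball y r)" by (auto simp: indicator_def)
 then have "(indicator (ball y r) :: 'a => real) : L2 m"
  unfolding L2_def using ball_measure[OF r] by (simp add: borel_measurable_indicator)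
 from L2_cmult[OF this, of "1 / measure m (ball y r)"] show ?thesis by (simp add: avg_def[abs_def])
qed

lemma avg_integral: "r > 0 ==> integrable m (avg y r) & (LINT x|m. avg y r x) = 1"
 unfolding avg_def using ball_measure[of r y] by (auto simp: less_top[symmetric])

lemma avg_close:
 assumes r: "r > 0" and i: "integrable m (%x. u x * avg y r x)" and c: "!!x. x : ball y r ==> abs (u x - c) <= e"
 shows "abs ((LINT x|m. u x * avg y r x) - c) <= e"
proof -
 have a: "integrable m (avg y r)" "(LINT x|m. avg y r x) = 1" using avg_integral[OF r] by auto
 have "(LINT x|m. u x * avg y r x) - c = (LINT x|m. u x * avg y r x - c * avg y r x)" using a i by simp
 then have "abs ((LINT x|m. u x * avg y r x) - c) <= (LINT x|m. abs (u x * avg y r x - c * avg y r x))"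
  using integral_norm_bound[of m "%x. u x * avg y r x - c * avg y r x"] by simp
 also have "\<dots> <= (LINT x|m. e * avg y r x)"
 proof (rule integral_mono)
  fix x
  show "abs (u x * avg y r x - c * avg y r x) <= e * avg y r x"
   using c[of x] ball_measure(2)[OF r, of y]
   by (cases "x : ball y r") (auto simp: avg_def diff_divide_distrib[symmetric] divide_right_mono)
 qed (use a i in auto)
 finally show ?thesis using a by simp
qed

lemma rho_local:
 assumes t: "t > 0" and e: "e > 0"
 shows "EX d>0. ALL x':ball x d. ALL y':ball y d. abs (\<rho> x' y' t - \<rho> x y t) <= e"
proof -
 obtain d where d0: "d > 0" "ALL p. dist p (x, y, t) < d --> dist ((%(x, y, t). \<rho> x y t) p) ((%(x, y, t). \<rho> x y t) (x, y, t)) < e"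
  using rho_continuous[OF t, of x y] e unfolding continuous_at_eps_delta by blast
 then have d: "d > 0" "!!p. dist p (x, y, t) < d ==> dist ((%(x, y, t). \<rho> x y t) p) (\<rho> x y t) < e"
  by auto
 have "abs (\<rho> x' y' t - \<rho> x y t) <= e" if "x' : ball x (d/2)" "y' : ball y (d/2)" for x' y'
 proof -
  have "dist (x', y', t) (x, y, t) <= dist x' x + dist y' y"
   by (simp add: dist_Pair_Pair sqrt_sum_squares_le_sum)
  also have "\<dots> < d" using that by (simp add: dist_commute)
  finally show ?thesis using d(2)[of "(x', y', t)"] by (simp add: dist_real_def)
 qed
 then show ?thesis using d(1) by (intro exI[of _ "d/2"]) auto
qed

text \<open>A definition rather than an abbreviation, to keep the simplifier from rewriting the radii and time steps.\<close>

definition rad :: "nat => real" where "rad n = rcp n"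

lemma rad: "rad n > 0" "rad \<longlonglongrightarrow> 0"
 unfolding rad_def[abs_def] by (simp, rule LIMSEQ_inverse_real_of_nat)

lemma rad_small: "d > 0 ==> EX N. ALL n>=N. rad n < d"
 using order_tendstoD(2)[OF rad(2), of d] by (simp add: eventually_sequentially)

lemma P_avg_AE_integrable:
 assumes t: "t > 0" and r: "r > 0" and x: "!!y'. y' : ball y r ==> abs (\<rho> x y' t - c) <= e"
 shows "integrable m (%y'. \<rho> x y' t * avg y r y')"
proof -
 have "continuous_on UNIV (%y'. \<rho> x y' t)"
  unfolding continuous_on_def by (auto intro!: rho_tendsto t tendsto_intros)
 then have [measurable]: "(%y'. \<rho> x y' t) : borel_measurable m" unfolding meas_m by (rule borel_measurable_continuous_onI)
 have a: "integrable m (avg y r)" using avg_integral[OF r] by auto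
 show ?thesis
 proof (rule Bochner_Integration.integrable_bound[OF integrable_mult_right[OF a, of "abs c + e"]])
  show "AE y' in m. norm (\<rho> x y' t * avg y r y') <= norm ((abs c + e) * avg y r y')"
  proof (rule AE_I2)
   fix y'
   show "norm (\<rho> x y' t * avg y r y') <= norm ((abs c + e) * avg y r y')"
   proof (cases "y' : ball y r")
    case True
    then have "abs (\<rho> x y' t) <= abs (abs c + e)" using x[OF True] by linarith
    then show ?thesis unfolding real_norm_def abs_mult by (intro mult_right_mono) auto
   qed (simp add: avg_def)
  qed
 qed (use a in auto)
qed

lemma P_avg_close:
 assumes t: "t > 0" and r: "r > 0" and x: "!!y'. y' : ball y r ==> abs (\<rho> x y' t - c) <= e"
 shows "abs (P t (avg y r) x - c) <= e"
 unfolding P_def by (rule avg_close[OF r P_avg_AE_integrable[OF t r x] x])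

lemma P_avg_tendsto: "t > 0 ==> (%n. P t (avg y (rad n)) x) \<longlonglongrightarrow> \<rho> x y t"
proof (rule LIMSEQ_I)
 fix e :: real assume t: "t > 0" and e: "e > 0"
 obtain d where d: "d > 0" "!!x' y'. x' : ball x d ==> y' : ball y d ==> abs (\<rho> x' y' t - \<rho> x y t) <= e / 2"
  using rho_local[OF t, of "e/2" x y] e by auto
 obtain N where N: "!!n. n >= N ==> rad n < d" using rad_small[OF d(1)] by blast
 have "abs (P t (avg y (rad n)) x - \<rho> x y t) <= e / 2" if "n >= N" for n
  by (rule P_avg_close[OF t rad(1)], rule d(2)) (use d(1) N[OF that] in auto)
 then show "EX N. ALL n>=N. norm (P t (avg y (rad n)) x - \<rho> x y t) < e" using e by (intro exI[of _ N]) fastforce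
qed

lemma ip_P_avg_close:
 assumes t: "t > 0" and e: "e > 0"
 shows "EX N. ALL n>=N. ALL k>=N. abs (ip m (P t (avg y (rad n))) (avg x (rad k)) - \<rho> x y t) <= e"
proof -
 obtain d where d: "d > 0" "!!x' y'. x' : ball x d ==> y' : ball y d ==> abs (\<rho> x' y' t - \<rho> x y t) <= e"
  using rho_local[OF t e, of x y] by auto
 obtain N where N: "!!n. n >= N ==> rad n < d" using rad_small[OF d(1)] by blast
 have "abs (ip m (P t (avg y (rad n))) (avg x (rad k)) - \<rho> x y t) <= e" if "n >= N" "k >= N" for n k
  unfolding ip_def
 proof (rule avg_close[OF rad(1)])
  show "integrable m (%xa. P t (avg y (rad n)) xa * avg x (rad k) xa)" by (intro L2_integrable_mult P_L2 avg_L2 rad t)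
  fix x' assume "x' : ball x (rad k)"
  then have x': "x' : ball x d" using N[OF that(2)] by auto
  show "abs (P t (avg y (rad n)) x' - \<rho> x y t) <= e"
   by (rule P_avg_close[OF t rad(1)], rule d(2)[OF x']) (use N[OF that(1)] in auto)
 qed
 then show ?thesis by blast
qed

text \<open>The heat flow is self-adjoint; test with approximate unit masses at \<open>x\<close> and \<open>y\<close>.\<close>

lemma rho_symmetric:
 assumes t: "t > 0" shows "\<rho> x y t = \<rho> y x t"
proof -
 have "abs (\<rho> x y t - \<rho> y x t) <= 0 + e" if e: "e > 0" for e
 proof -
  obtain N where N: "!!n k. n >= N ==> k >= N ==> abs (ip m (P t (avg y (rad n))) (avg x (rad k)) - \<rho> x y t) <= e/2"
   using ip_P_avg_close[OF t, of "e/2" y x] e by auto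
  obtain M where M: "!!n k. n >= M ==> k >= M ==> abs (ip m (P t (avg x (rad n))) (avg y (rad k)) - \<rho> y x t) <= e/2"
   using ip_P_avg_close[OF t, of "e/2" x y] e by auto
  let ?n = "max N M"
  have "ip m (P t (avg y (rad ?n))) (avg x (rad ?n)) = ip m (P t (avg x (rad ?n))) (avg y (rad ?n))"
   using P_self_adjoint[OF avg_L2[OF rad(1)] avg_L2[OF rad(1)] t, of y ?n x ?n] by (simp add: ip_commute)
  moreover have "abs (ip m (P t (avg y (rad ?n))) (avg x (rad ?n)) - \<rho> x y t) <= e/2" by (rule N) auto
  moreover have "abs (ip m (P t (avg x (rad ?n))) (avg y (rad ?n)) - \<rho> y x t) <= e/2" by (rule M) auto
  ultimately show ?thesis by linarith
 qed
 then have "abs (\<rho> x y t - \<rho> y x t) <= 0" by (rule field_le_epsilon)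
 then show ?thesis by simp
qed

lemma kf_measurable: "t > 0 ==> kf y t : borel_measurable m"
 unfolding meas_m kf_def
 by (rule borel_measurable_continuous_onI) (auto simp: continuous_on_def intro!: rho_tendsto tendsto_intros)

text \<open>\<open>\<rho>(\<cdot>, y, t)\<close> is the limit in \<open>L\<^sup>2\<close> of the heat flows of normalized indicators of balls
  shrinking to \<open>y\<close>.  These form a Cauchy sequence because their inner products are averages of \<open>\<rho>\<close> at time
  \<open>2 t\<close> near \<open>(y, y)\<close>.\<close>

lemma kf_limit:
 assumes t: "t > 0"
 shows "kf y t : L2 m" "L2_tendsto m (%n. P t (avg y (rad n))) (kf y t) sequentially"
proof -
 have aL: "avg y (rad n) : L2 m" for n by (rule avg_L2[OF rad(1)])
 have PL: "P t (avg y (rad n)) : L2 m" for n by (rule P_L2[OF aL t])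
 have ipq: "ip m (P t (avg y (rad n))) (P t (avg y (rad k))) = ip m (P (2 * t) (avg y (rad n))) (avg y (rad k))" for n k
  using ip_P_half[OF aL aL, of "2 * t" n k] t by simp
 have "EX u:L2 m. L2_tendsto m (%n. P t (avg y (rad n))) u sequentially"
 proof (rule L2_complete[OF PL])
  fix e :: real assume e: "e > 0"
  obtain N where N: "!!n k. n >= N ==> k >= N ==> abs (ip m (P (2*t) (avg y (rad n))) (avg y (rad k)) - \<rho> y y (2*t)) <= e^2/5"
   using ip_P_avg_close[of "2*t" "e^2/5" y y] e t by auto
  have "lnorm m (%x. P t (avg y (rad i)) x - P t (avg y (rad j)) x) < e" if "i >= N" "j >= N" for i j
  proof -
   have "(lnorm m (%x. P t (avg y (rad i)) x - P t (avg y (rad j)) x))^2 <= 4 * (e^2 / 5)"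
    using lnorm_diff_sq[OF PL PL, of i j] N[OF that] N[OF that(1,1)] N[OF that(2,2)]
    unfolding ip_self[symmetric] ipq abs_le_iff by linarith
   also have "\<dots> < e^2" using e by simp
   finally show ?thesis using e by (simp add: power2_less_imp_less)
  qed
  then show "EX N. ALL i>=N. ALL j>=N. lnorm m (%x. P t (avg y (rad i)) x - P t (avg y (rad j)) x) < e" by blast
 qed
 then obtain u where u: "u : L2 m" "L2_tendsto m (%n. P t (avg y (rad n))) u sequentially" by blast
 obtain r :: "nat => nat" where r: "strict_mono r" "AE x in m. (%n. P t (avg y (rad (r n))) x) \<longlonglongrightarrow> u x"
  using L2_tendsto_AE_subseq[OF u(2) PL u(1)] by blast
 have eq: "AE x in m. u x = kf y t x"
  using r(2)
 proof eventually_elim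
  case (elim x)
  have "(%n. P t (avg y (rad (r n))) x) \<longlonglongrightarrow> \<rho> x y t"
   using LIMSEQ_subseq_LIMSEQ[OF P_avg_tendsto[OF t, of y x] r(1)] by (simp add: o_def)
  with elim show ?case using LIMSEQ_unique by (fastforce simp: kf_def)
 qed
 show k: "kf y t : L2 m" by (rule L2_AE_cong[OF u(1) kf_measurable[OF t] eq])
 have "lnorm m (%x. P t (avg y (rad n)) x - u x) = lnorm m (%x. P t (avg y (rad n)) x - kf y t x)" for n
  using eq by (intro lnorm_cong_AE) (auto intro!: L2_measurable L2_diff PL u k elim: AE_mp)
 then show "L2_tendsto m (%n. P t (avg y (rad n))) (kf y t) sequentially" using u(2) by (simp add: L2_tendsto_lnorm)
qed

lemma kf_ip:
 assumes t: "t > 0" and s: "s > 0"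
 shows "ip m (kf y t) (kf z s) = \<rho> z y (t + s)"
proof -
 have aL: "avg y (rad n) : L2 m" for n y by (rule avg_L2[OF rad(1)])
 have "(%n. ip m (P t (avg y (rad n))) (P s (avg z (rad n)))) \<longlonglongrightarrow> ip m (kf y t) (kf z s)"
  by (intro L2_tendsto_ip kf_limit t s always_eventually allI P_L2 aL)
 moreover have "ip m (P t (avg y (rad n))) (P s (avg z (rad n))) = ip m (P (t + s) (avg y (rad n))) (avg z (rad n))" for n
 proof -
  have "ip m (P t (avg y (rad n))) (P s (avg z (rad n))) = ip m (P s (P t (avg y (rad n)))) (avg z (rad n))"
   by (rule P_self_adjoint[OF P_L2[OF aL t] aL s, symmetric])
  also have "\<dots> = ip m (P (s + t) (avg y (rad n))) (avg z (rad n))"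
   using P_semigroup[OF aL t s, of y n] P_L2[OF aL, of "s+t" y n] P_L2[OF P_L2[OF aL t] s, of y n] aL[of z n] t s
   by (intro ip_cong_AE) (auto intro: L2_measurable elim: AE_mp)
  finally show ?thesis by (simp add: add.commute)
 qed
 moreover have "(%n. ip m (P (t + s) (avg y (rad n))) (avg z (rad n))) \<longlonglongrightarrow> \<rho> z y (t + s)"
 proof (rule LIMSEQ_I)
  fix e :: real assume "e > 0"
  then obtain N where "!!n k. n >= N ==> k >= N ==> abs (ip m (P (t+s) (avg y (rad n))) (avg z (rad k)) - \<rho> z y (t+s)) <= e/2"
   using ip_P_avg_close[of "t+s" "e/2" y z] t s by auto
  then show "EX N. ALL n>=N. norm (ip m (P (t + s) (avg y (rad n))) (avg z (rad n)) - \<rho> z y (t + s)) < e"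
   using \<open>e > 0\<close> by (intro exI[of _ N]) fastforce
 qed
 ultimately show ?thesis using LIMSEQ_unique by fastforce
qed

lemma P_kf:
 assumes t: "t > 0" and s: "s > 0"
 shows "AE x in m. P s (kf y t) x = kf y (s + t) x"
proof -
 let ?d = "%x. P s (kf y t) x - kf y (s + t) x"
 have aL: "avg y (rad n) : L2 m" for n by (rule avg_L2[OF rad(1)])
 have st: "s + t > 0" using s t by simp
 define d where "d n = lnorm m ?d" for n :: nat
 have "lnorm m ?d <=
   lnorm m (%x. P t (avg y (rad n)) x - kf y t x) + lnorm m (%x. P (s + t) (avg y (rad n)) x - kf y (s + t) x)" for n
 proof -
  have "lnorm m ?d <= lnorm m (%x. P s (kf y t) x - P s (P t (avg y (rad n))) x)
    + lnorm m (%x. P s (P t (avg y (rad n))) x - kf y (s + t) x)"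
   by (intro lnorm_triangle_diff P_L2 kf_limit aL t s st)
  also have "lnorm m (%x. P s (kf y t) x - P s (P t (avg y (rad n))) x) <= lnorm m (%x. kf y t x - P t (avg y (rad n)) x)"
   by (intro P_lnorm_diff kf_limit P_L2 aL t s)
  also have "\<dots> = lnorm m (%x. P t (avg y (rad n)) x - kf y t x)" by (rule lnorm_minus_commute)
  also have "lnorm m (%x. P s (P t (avg y (rad n))) x - kf y (s + t) x) = lnorm m (%x. P (s + t) (avg y (rad n)) x - kf y (s + t) x)"
   using P_semigroup[OF aL t s, of n] by (intro lnorm_cong_AE) (auto intro!: L2_measurable L2_diff P_L2 aL kf_limit t s st elim: AE_mp)
  finally show ?thesis by simp
 qed
 moreover have "(%n. lnorm m (%x. P t (avg y (rad n)) x - kf y t x) + lnorm m (%x. P (s + t) (avg y (rad n)) x - kf y (s + t) x)) \<longlonglongrightarrow> 0 + 0"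
  using kf_limit(2)[OF t, of y] kf_limit(2)[OF st, of y] unfolding L2_tendsto_lnorm by (rule tendsto_add)
 ultimately have "lnorm m ?d <= 0 + 0"
  by (intro LIMSEQ_le_const) auto
 then have "lnorm m ?d = 0" by (simp add: antisym)
 from lnorm_eq_0_AE[OF L2_diff[OF P_L2[OF kf_limit(1)[OF t] s] kf_limit(1)[OF st]] this] show ?thesis by eventually_elim simp
qed

lemma P_pointwise: "t > 0 ==> P t f y = ip m (kf y t) f"
 by (simp add: P_def ip_def kf_def rho_symmetric[of t y])

lemma kf_norm: "t > 0 ==> (lnorm m (kf y t))^2 = \<rho> y y (2 * t)"
 using kf_ip[of t t y y] by (simp add: ip_self)

lemma kf_H12: assumes t: "t > 0" shows "kf y t : H12 m"
proof -
 have t2: "t / 2 > 0" using t by simp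
 have "AE x in m. P (t/2) (kf y (t/2)) x = kf y t x" using P_kf[OF t2 t2] by simp
 then show ?thesis by (intro H12_cong_AE[OF P_H12[OF kf_limit(1)[OF t2] t2] kf_measurable[OF t]])
qed

end

section \<open>Hilbert--Schmidt norms of the heat flow\<close>

text \<open>Gram--Schmidt without orthonormal systems: \<open>resid d n v\<close> is the component of \<open>v\<close> orthogonal
  to \<open>d 0, \<dots>, d (n - 1)\<close>.  The unit vector of a null function is \<open>0\<close>, so that linear dependence among the
  \<open>d i\<close> does no harm.\<close>

definition unit :: "'a measure => ('a => real) => 'a => real" where
 "unit m f x = (if lnorm m f = 0 then 0 else f x / lnorm m f)"

primrec resid :: "'a measure => (nat => 'a => real) => nat => ('a => real) => 'a => real" where
 "resid m d 0 v = v"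
| "resid m d (Suc n) v = (%x. resid m d n v x - ip m (resid m d n v) (unit m (resid m d n (d n))) * unit m (resid m d n (d n)) x)"

lemma unit_L2: "f : L2 m ==> unit m f : L2 m"
 using L2_cmult[of f m "1 / lnorm m f"] by (cases "lnorm m f = 0") (simp_all add: unit_def[abs_def])

lemma unit_norm: "lnorm m (unit m f) = 0 | lnorm m (unit m f) = 1"
 using lnorm_cmult[of m "1 / lnorm m f" f] by (cases "lnorm m f = 0") (simp_all add: unit_def[abs_def])

lemma resid_L2: "(!!n. d n : L2 m) ==> v : L2 m ==> resid m d n v : L2 m"
proof (induction n arbitrary: v)
 case (Suc n)
 then show ?case by (auto intro!: L2_diff L2_cmult unit_L2)
qed simp

lemma resid_diff:
 assumes d: "!!n. d n : L2 m" and v: "v : L2 m" and w: "w : L2 m"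
 shows "resid m d n (%x. v x - w x) = (%x. resid m d n v x - resid m d n w x)"
proof (induction n)
 case (Suc n)
 have "ip m (%x. resid m d n v x - resid m d n w x) (unit m (resid m d n (d n)))
  = ip m (resid m d n v) (unit m (resid m d n (d n))) - ip m (resid m d n w) (unit m (resid m d n (d n)))"
  by (intro ip_diff_left resid_L2 unit_L2 d v w)
 then show ?case unfolding resid.simps Suc by (intro ext) (simp add: left_diff_distrib)
qed simp

text \<open>Taking the residual is a composition of finite rank perturbations of the identity.\<close>

lemma resid_adjoint:
 assumes d: "!!n. d n : L2 m" and w: "w : L2 m"
 shows "EX w':L2 m. ALL v:L2 m. ip m (resid m d n v) w = ip m v w'"
 using w
proof (induction n arbitrary: w)
 case (Suc n)
 define u where "u = unit m (resid m d n (d n))"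
 have uL: "u : L2 m" unfolding u_def by (intro unit_L2 resid_L2 d)
 have "(%x. w x - ip m u w * u x) : L2 m" by (intro L2_diff L2_cmult uL Suc.prems)
 from Suc.IH[OF this] obtain w' where w': "w' : L2 m" "!!v. v : L2 m ==> ip m (resid m d n v) (%x. w x - ip m u w * u x) = ip m v w'" by blast
 have "ip m (resid m d (Suc n) v) w = ip m v w'" if v: "v : L2 m" for v
 proof -
  have r: "resid m d n v : L2 m" by (rule resid_L2[OF d v])
  have "ip m (resid m d (Suc n) v) w = ip m (resid m d n v) w - ip m (resid m d n v) u * ip m u w"
   using ip_diff_left[OF r L2_cmult[OF uL] Suc.prems] by (simp add: u_def[symmetric] ip_cmult_left)
  also have "\<dots> = ip m (resid m d n v) (%x. w x - ip m u w * u x)"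
   using ip_diff_right[OF Suc.prems L2_cmult[OF uL] r] by (simp add: ip_cmult_right)
  finally show ?thesis using w'(2)[OF v] by simp
 qed
 with w'(1) show ?case by blast
qed auto

lemma resid_norm_step:
 assumes d: "!!n. d n : L2 m" and v: "v : L2 m"
 shows "(lnorm m (resid m d (Suc n) v))^2 = (lnorm m (resid m d n v))^2 - (ip m (resid m d n v) (unit m (resid m d n (d n))))^2"
proof -
 define u where "u = unit m (resid m d n (d n))"
 define r where "r = resid m d n v"
 have uL: "u : L2 m" and rL: "r : L2 m" unfolding u_def r_def by (intro unit_L2 resid_L2 d v)+
 have "(lnorm m (%x. r x - ip m r u * u x))^2 = (lnorm m r)^2 - 2 * (ip m r u)^2 + (ip m r u)^2 * (lnorm m u)^2"
  using lnorm_diff_sq[OF rL L2_cmult[OF uL]] by (simp add: ip_cmult_right lnorm_cmult power_mult_distrib power2_eq_square)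
 moreover have "(ip m r u)^2 * (lnorm m u)^2 = (ip m r u)^2"
  using unit_norm[of m "resid m d n (d n)"] L2_CS[OF rL uL] by (auto simp: u_def[symmetric])
 ultimately show ?thesis by (simp add: u_def r_def)
qed

lemma resid_norm_sum:
 assumes d: "!!n. d n : L2 m" and v: "v : L2 m"
 shows "(lnorm m v)^2 = (\<Sum>k<n. (ip m (resid m d k v) (unit m (resid m d k (d k))))^2) + (lnorm m (resid m d n v))^2"
proof (induction n)
 case (Suc n)
 with resid_norm_step[where d=d and n=n, OF assms] show ?case by simp
qed simp

lemma resid_antimono:
 assumes d: "!!n. d n : L2 m" and v: "v : L2 m" and le: "n <= k"
 shows "lnorm m (resid m d k v) <= lnorm m (resid m d n v)"
 using le
proof (induction rule: dec_induct)
 case (step k)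
 have "(lnorm m (resid m d (Suc k) v))^2 <= (lnorm m (resid m d k v))^2" using resid_norm_step[where d=d and n=k, OF d v] by simp
 then have "lnorm m (resid m d (Suc k) v) <= lnorm m (resid m d k v)" by (simp only: power2_le_iff_abs_le lnorm_nonneg abs_of_nonneg)
 with step show ?case by simp
qed simp

lemma resid_self:
 assumes d: "!!n. d n : L2 m" shows "lnorm m (resid m d (Suc n) (d n)) = 0"
proof (cases "lnorm m (resid m d n (d n)) = 0")
 case True
 then show ?thesis using resid_antimono[where d=d and n=n and k="Suc n" and v="d n", OF d d] lnorm_nonneg[of m "resid m d (Suc n) (d n)"] by linarith
next
 case False
 define r where "r = resid m d n (d n)"
 have N: "lnorm m r ~= 0" using False by (simp add: r_def)
 have u: "unit m r = (%x. 1 / lnorm m r * r x)" using N by (auto simp: unit_def)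
 have "ip m r (unit m r) = lnorm m r" unfolding u ip_cmult_right ip_self using N by (simp add: power2_eq_square)
 then have "resid m d (Suc n) (d n) = (%x. 0)" using N by (simp add: r_def[symmetric]) (simp add: unit_def)
 then show ?thesis by simp
qed

text \<open>The vectors \<open>e k\<close> depend only on the sequence \<open>d\<close>, and Parseval's identity holds for every \<open>v\<close> in the closure
  of the range of \<open>d\<close>: the residuals of \<open>d i\<close> vanish after step \<open>i\<close>.\<close>

lemma countable_Parseval:
 assumes d: "!!n::nat. d n : L2 m"
 shows "EX e. (ALL k::nat. e k : L2 m) & (ALL v:L2 m. (ALL \<delta>>0. EX i. lnorm m (%x. v x - d i x) < \<delta>) --> (%k. (ip m v (e k))^2) sums (lnorm m v)^2)"
proof -
 have "EX w'. w' : L2 m & (ALL v:L2 m. ip m (resid m d k v) (unit m (resid m d k (d k))) = ip m v w')" for k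
 proof -
  have "unit m (resid m d k (d k)) : L2 m" by (intro unit_L2 resid_L2 d)
  from resid_adjoint[where d=d and n=k, OF d this] show ?thesis by blast
 qed
 from choice[OF allI, OF this] obtain e where e: "ALL k. e k : L2 m & (ALL v:L2 m. ip m (resid m d k v) (unit m (resid m d k (d k))) = ip m v (e k))" ..
 have "(%k. (ip m v (e k))^2) sums (lnorm m v)^2" if v: "v : L2 m" and ap: "!!\<delta>. \<delta> > 0 ==> EX i. lnorm m (%x. v x - d i x) < \<delta>" for v
 proof -
  have "(%n. lnorm m (resid m d n v)) \<longlonglongrightarrow> 0"
  proof (rule LIMSEQ_I)
   fix \<delta> :: real assume "\<delta> > 0"
   then obtain i where i: "lnorm m (%x. v x - d i x) < \<delta>" using ap by blast
   have "lnorm m (resid m d n v) < \<delta>" if n: "n >= Suc i" for n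
   proof -
    have "lnorm m (resid m d n v) <= lnorm m (resid m d (Suc i) v)" by (rule resid_antimono[OF d v n])
    also have "\<dots> <= lnorm m (%x. resid m d (Suc i) v x - resid m d (Suc i) (d i) x) + lnorm m (resid m d (Suc i) (d i))"
     using lnorm_triangle[of "%x. resid m d (Suc i) v x - resid m d (Suc i) (d i) x" m "resid m d (Suc i) (d i)"]
      L2_diff[OF resid_L2[where d=d and n="Suc i", OF d v] resid_L2[where d=d and n="Suc i", OF d d[of i]]] resid_L2[where d=d and n="Suc i", OF d d[of i]] by simp
    also have "\<dots> = lnorm m (resid m d (Suc i) (%x. v x - d i x))"
     unfolding resid_self[where d=d, OF d] resid_diff[where d=d, OF d v d] by simp
    also have "\<dots> <= lnorm m (resid m d 0 (%x. v x - d i x))"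
     by (rule resid_antimono[where d=d, OF d L2_diff[OF v d]]) simp
    also have "\<dots> < \<delta>" using i by simp
    finally show ?thesis .
   qed
   then show "EX N. ALL n>=N. norm (lnorm m (resid m d n v) - 0) < \<delta>" by (intro exI[of _ "Suc i"]) auto
  qed
  then have "(%n. (lnorm m v)^2 - (lnorm m (resid m d n v))^2) \<longlonglongrightarrow> (lnorm m v)^2 - 0^2" by (intro tendsto_intros)
  moreover have "(lnorm m v)^2 - (lnorm m (resid m d n v))^2 = (\<Sum>k<n. (ip m v (e k))^2)" for n
   using resid_norm_sum[where d=d and n=n, OF d v] e v by simp
  ultimately show ?thesis by (simp add: sums_def)
 qed
 with e show ?thesis by blast
qed

context heat_space
begin

lemma L2_tendsto_kf:
 assumes t: "t > 0" and X: "Y \<longlonglongrightarrow> y" "S \<longlonglongrightarrow> t"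
 shows "(%n. lnorm m (%x. kf y t x - kf (Y n) (S n) x)) \<longlonglongrightarrow> 0"
proof -
 have "\<forall>\<^sub>F n in sequentially. S n > 0" using X(2) t by (rule order_tendstoD)
 then have "\<forall>\<^sub>F n in sequentially. \<rho> y y (2 * t) - 2 * \<rho> (Y n) y (t + S n) + \<rho> (Y n) (Y n) (2 * S n) = (lnorm m (%x. kf y t x - kf (Y n) (S n) x))^2"
  by eventually_elim (simp add: lnorm_diff_sq kf_limit(1) t kf_norm kf_ip)
 moreover have "(%n. \<rho> y y (2 * t) - 2 * \<rho> (Y n) y (t + S n) + \<rho> (Y n) (Y n) (2 * S n)) \<longlonglongrightarrow> \<rho> y y (2 * t) - 2 * \<rho> y y (t + t) + \<rho> y y (2 * t)"
  using t by (intro tendsto_intros rho_tendsto X) auto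
 ultimately have "(%n. (lnorm m (%x. kf y t x - kf (Y n) (S n) x))^2) \<longlonglongrightarrow> \<rho> y y (2 * t) - 2 * \<rho> y y (t + t) + \<rho> y y (2 * t)"
  by (rule Lim_transform_eventually[rotated])
 then have "(%n. (lnorm m (%x. kf y t x - kf (Y n) (S n) x))^2) \<longlonglongrightarrow> 0" by (simp only: mult_2) simp
 from tendsto_real_sqrt[OF this] show ?thesis by simp
qed

definition bounded_op :: "(('a => real) => 'a => real) => bool" where
 "bounded_op T \<longleftrightarrow> (ALL f:H12 m. T f : L2 m) &
   (ALL f:H12 m. ALL g:H12 m. AE x in m. T (%x. f x + g x) x = T f x + T g x) &
   (ALL c. ALL f:H12 m. AE x in m. T (%x. c * f x) x = c * T f x) &
   (EX C. ALL f:H12 m. lnorm m (T f) <= C * lnorm m (D f))"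

text \<open>The squared Hilbert--Schmidt norm of \<open>T P\<^sub>t\<close>: for bounded linear \<open>T\<close> the image of \<open>P\<^sub>t f\<close> is
  \<open>\<integral>T(\<rho>(\<cdot>, y, t)) f(y) dm(y)\<close>.\<close>

definition HS :: "(('a => real) => 'a => real) => real => ennreal" where
 "HS T t = (\<integral>\<^sup>+y. ennreal ((lnorm m (T (kf y t)))^2) \<partial>m)"

lemma bounded_op_D:
 assumes "bounded_op T"
 shows "f : H12 m ==> T f : L2 m"
  "f : H12 m ==> g : H12 m ==> AE x in m. T (%x. f x + g x) x = T f x + T g x"
  "f : H12 m ==> AE x in m. T (%x. c * f x) x = c * T f x"
  "EX C>=0. ALL f:H12 m. lnorm m (T f) <= C * lnorm m (D f)"
proof -
 obtain C where C: "ALL f:H12 m. lnorm m (T f) <= C * lnorm m (D f)" using assms unfolding bounded_op_def by blast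
 have "lnorm m (T f) <= max C 0 * lnorm m (D f)" if "f : H12 m" for f
 proof -
  have "C * lnorm m (D f) <= max C 0 * lnorm m (D f)" by (intro mult_right_mono) auto
  with C that show ?thesis by fastforce
 qed
 then show "EX C>=0. ALL f:H12 m. lnorm m (T f) <= C * lnorm m (D f)" by (intro exI[of _ "max C 0"]) auto
qed (use assms in "auto simp: bounded_op_def")

lemma bounded_op_cong:
 assumes T: "bounded_op T" and f: "f : H12 m" and g: "g : H12 m" and eq: "AE x in m. f x = g x"
 shows "AE x in m. T f x = T g x"
proof -
 obtain C where C: "ALL f:H12 m. lnorm m (T f) <= C * lnorm m (D f)" using bounded_op_D(4)[OF T] by blast
 have g': "(%x. (-1) * g x) : H12 m" by (rule H12_cmult[OF g])
 have d: "(%x. f x + (-1) * g x) : H12 m" by (rule H12_add[OF f g'])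
 have z: "(%x. 0 * f x) : H12 m" by (rule H12_cmult[OF f])
 have "D (%x. f x + (-1) * g x) = D (%x. 0 * f x)"
  using eq H12_L2[OF d] H12_L2[OF z] by (intro min_slope_cong_AE(1)) (auto intro: L2_measurable elim: AE_mp)
 moreover have "lnorm m (D (%x. 0 * f x)) = lnorm m (%x. 0)"
  using D_cmult[OF f, of 0] D_L2[OF z] by (intro lnorm_cong_AE) (auto intro: L2_measurable)
 ultimately have "lnorm m (T (%x. f x + (-1) * g x)) = 0" using C[rule_format, OF d] by (intro antisym lnorm_nonneg) simp
 from lnorm_eq_0_AE[OF bounded_op_D(1)[OF T d] this] bounded_op_D(2)[OF T f g'] bounded_op_D(3)[OF T g, of "-1"]
 show ?thesis by eventually_elim simp
qed

lemma bounded_op_P: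
 assumes T: "bounded_op T" and e: "e > 0"
 shows "f : L2 m ==> T (P e f) : L2 m"
  "f : L2 m ==> g : L2 m ==> AE x in m. T (P e (%x. f x + g x)) x = T (P e f) x + T (P e g) x"
  "f : L2 m ==> AE x in m. T (P e (%x. c * f x)) x = c * T (P e f) x"
  "EX C>=0. ALL f:L2 m. lnorm m (T (P e f)) <= C * lnorm m f"
proof -
 show "f : L2 m ==> T (P e f) : L2 m" by (intro bounded_op_D(1)[OF T] P_H12 e)
 show "AE x in m. T (P e (%x. f x + g x)) x = T (P e f) x + T (P e g) x" if f: "f : L2 m" and g: "g : L2 m"
  using bounded_op_cong[OF T P_H12[OF L2_add[OF f g] e] H12_add[OF P_H12[OF f e] P_H12[OF g e]] P_add[OF f g e]]
   bounded_op_D(2)[OF T P_H12[OF f e] P_H12[OF g e]] by eventually_elim simp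
 show "AE x in m. T (P e (%x. c * f x)) x = c * T (P e f) x" if f: "f : L2 m"
 proof -
  have "P e (%x. c * f x) = (%x. c * P e f x)" by (rule ext) (rule P_cmult)
  then show ?thesis using bounded_op_D(3)[OF T P_H12[OF f e], of c] by simp
 qed
 obtain C where C: "C >= 0" "ALL f:H12 m. lnorm m (T f) <= C * lnorm m (D f)" using bounded_op_D(4)[OF T] by blast
 have "lnorm m (T (P e f)) <= C * sqrt (8 / e) * lnorm m f" if f: "f : L2 m" for f
 proof -
  have "(lnorm m (D (P e f)))^2 <= 8 / e * (lnorm m f)^2" using P_smoothing(2)[OF f e] e by (simp add: field_simps)
  also have "\<dots> = (sqrt (8 / e) * lnorm m f)^2" using e by (simp add: power_mult_distrib)
  finally have "lnorm m (D (P e f)) <= sqrt (8 / e) * lnorm m f" using e by (intro power2_le_imp_le[of "lnorm m (D (P e f))"]) auto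
  then have "C * lnorm m (D (P e f)) <= C * (sqrt (8 / e) * lnorm m f)" using C(1) by (rule mult_left_mono)
  with C(2)[rule_format, OF P_H12[OF f e]] show ?thesis by simp
 qed
 then show "EX C>=0. ALL f:L2 m. lnorm m (T (P e f)) <= C * lnorm m f"
  using C(1) e by (intro exI[of _ "C * sqrt (8 / e)"]) auto
qed

lemma bounded_op_P_diff:
 assumes T: "bounded_op T" and e: "e > 0" and f: "f : L2 m" and g: "g : L2 m"
 shows "AE x in m. T (P e (%x. f x - g x)) x = T (P e f) x - T (P e g) x"
 using bounded_op_P(2)[OF T e f L2_cmult[OF g, of "-1"]] bounded_op_P(3)[OF T e g, of "-1"]
 by eventually_elim simp

text \<open>The functions \<open>T \<rho>(\<cdot>, y, t)\<close> depend continuously on \<open>(y, t)\<close>, so they lie in the closure of a sequence and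
  Parseval's identity applies with fixed \<open>e\<^sub>k\<close>.  The coefficient of \<open>T P\<^sub>e f\<close> at \<open>e\<^sub>k\<close> is \<open>\<langle>f, w\<^sub>k\<rangle>\<close> by Riesz
  representation, and for \<open>f = \<rho>(\<cdot>, y, t - e)\<close> it is \<open>P\<^sub>t\<^sub>-\<^sub>e w\<^sub>k (y)\<close>.\<close>

lemma HS_expansion:
 assumes T: "bounded_op T" and e: "e > 0"
 shows "EX w. (ALL k::nat. w k : L2 m) & (ALL t>e. HS T t = (\<Sum>k. ennreal ((lnorm m (P (t - e) (w k)))^2)) &
  (ALL y. (%k. (P (t - e) (w k) y)^2) sums (lnorm m (T (kf y t)))^2))"
proof -
 define S where "S f = T (P e f)" for f
 have SL: "f : L2 m ==> S f : L2 m" for f unfolding S_def by (rule bounded_op_P(1)[OF T e])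
 obtain C where C: "C >= 0" "!!f. f : L2 m ==> lnorm m (S f) <= C * lnorm m f" using bounded_op_P(4)[OF T e] by (auto simp: S_def)
 have Sdiff: "lnorm m (%x. S f x - S g x) <= C * lnorm m (%x. f x - g x)" if "f : L2 m" "g : L2 m" for f g
 proof -
  have "lnorm m (%x. S f x - S g x) = lnorm m (S (%x. f x - g x))"
   using bounded_op_P_diff[OF T e that] SL[OF that(1)] SL[OF that(2)] SL[OF L2_diff[OF that]]
   unfolding S_def by (intro lnorm_cong_AE) (auto intro!: L2_measurable L2_diff elim: AE_mp)
  with C(2)[OF L2_diff[OF that]] show ?thesis by simp
 qed
 obtain Q :: "('a \<times> real) set" where Q: "countable Q" "!!U. open U ==> U ~= {} ==> EX q:Q. q : U"
  by (rule countable_dense_setE) blast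
  \<comment> \<open>a countable dense set of pairs \<open>(y, t)\<close> with \<open>t > 0\<close>\<close>
 define Q' where "Q' = Q \<inter> {p. snd p > 0}"
 have opn: "open {p::'a \<times> real. snd p > 0}" by (intro open_Collect_less continuous_intros)
 have "(undefined, 1) : {p::'a \<times> real. snd p > 0}" by simp
 then have Q'ne: "Q' ~= {}" using Q(2)[OF opn] unfolding Q'_def by blast
 have Q'c: "countable Q'" using Q(1) by (auto simp: Q'_def)
 define p where "p = from_nat_into Q'"
 have p: "snd (p i) > 0" for i using from_nat_into[OF Q'ne, of i] by (auto simp: p_def Q'_def)
 have dense: "EX i. p i : U" if "open U" "(y, t) : U" "t > 0" for U y t
 proof -
  have "open (U \<inter> {p. snd p > 0})" "U \<inter> {p. snd p > 0} ~= {}" using that opn by auto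
  from Q(2)[OF this] obtain q where "q : Q'" "q : U" by (auto simp: Q'_def)
  then show ?thesis using from_nat_into_surj[OF Q'c, of q] by (auto simp: p_def)
 qed
 define d where "d i = S (kf (fst (p i)) (snd (p i)))" for i
 have dL: "d i : L2 m" for i unfolding d_def by (intro SL kf_limit p)
 obtain E where E: "!!k::nat. E k : L2 m"
  "!!v. v : L2 m ==> (!!\<delta>. \<delta> > 0 ==> EX i. lnorm m (%x. v x - d i x) < \<delta>) ==> (%k. (ip m v (E k))^2) sums (lnorm m v)^2"
  using countable_Parseval[of d m, OF dL] by blast
 have "EX w:L2 m. ALL f:L2 m. ip m (S f) (E k) = ip m w f" for k
 proof (rule L2_Riesz)
  show "ip m (S (%x. f x + g x)) (E k) = ip m (S f) (E k) + ip m (S g) (E k)" if "f : L2 m" "g : L2 m" for f g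
  proof -
   have "ip m (S (%x. f x + g x)) (E k) = ip m (%x. S f x + S g x) (E k)"
    using bounded_op_P(2)[OF T e that] SL[OF that(1)] SL[OF that(2)] SL[OF L2_add[OF that]] E(1)[of k]
    unfolding S_def by (intro ip_cong_AE) (auto intro!: L2_measurable L2_add)
   then show ?thesis by (simp add: ip_add_left SL that E)
  qed
  show "ip m (S (%x. c * f x)) (E k) = c * ip m (S f) (E k)" if "f : L2 m" for f c
  proof -
   have "ip m (S (%x. c * f x)) (E k) = ip m (%x. c * S f x) (E k)"
    using bounded_op_P(3)[OF T e that, of c] SL[OF that] SL[OF L2_cmult[OF that, of c]] E(1)[of k]
    unfolding S_def by (intro ip_cong_AE) (auto intro!: L2_measurable L2_cmult)
   then show ?thesis by (simp add: ip_cmult_left)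
  qed
  show "abs (ip m (S f) (E k)) <= (C * lnorm m (E k)) * lnorm m f" if "f : L2 m" for f
  proof -
   have "abs (ip m (S f) (E k)) <= lnorm m (S f) * lnorm m (E k)" by (rule L2_CS[OF SL[OF that] E(1)])
   also have "\<dots> <= (C * lnorm m f) * lnorm m (E k)" by (intro mult_right_mono C that) simp
   finally show ?thesis by (simp add: ac_simps)
  qed
 qed
 then have "ALL k. EX w. w : L2 m & (ALL f:L2 m. ip m (S f) (E k) = ip m w f)" by blast
 from choice[OF this] obtain w where w: "ALL k. w k : L2 m & (ALL f:L2 m. ip m (S f) (E k) = ip m (w k) f)" ..
 have "HS T t = (\<Sum>k. ennreal ((lnorm m (P (t - e) (w k)))^2)) &
  (ALL y. (%k. (P (t - e) (w k) y)^2) sums (lnorm m (T (kf y t)))^2)" if t: "t > e" for t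
 proof -
  define s where "s = t - e"
  have s: "s > 0" "t > 0" "e + s = t" using t e by (auto simp: s_def)
  have sums: "(%k. (P s (w k) y)^2) sums (lnorm m (T (kf y t)))^2" for y
  proof -
   have "AE x in m. P e (kf y s) x = kf y t x" using P_kf[OF s(1) e] by (simp add: s)
   from bounded_op_cong[OF T P_H12[OF kf_limit(1)[OF s(1)] e] kf_H12[OF s(2)] this]
   have eq: "AE x in m. S (kf y s) x = T (kf y t) x" by (simp add: S_def)
   have kL: "kf y s : L2 m" by (rule kf_limit(1)[OF s(1)])
   have norm: "lnorm m (T (kf y t)) = lnorm m (S (kf y s))"
    using eq SL[OF kL] bounded_op_D(1)[OF T kf_H12[OF s(2), of y]] by (intro lnorm_cong_AE) (auto intro: L2_measurable elim: AE_mp)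
   have "EX i. lnorm m (%x. S (kf y s) x - d i x) < \<delta>" if \<delta>: "\<delta> > 0" for \<delta>
   proof -
    have "ALL n. EX i. dist (p i) (y, s) < rcp n"
     using dense[of "ball (y, s) (rcp _)" y s] s(1) by (simp add: dist_commute)
    from choice[OF this] obtain i where i: "!!n. dist (p (i n)) (y, s) < rcp n" by blast
    have "(%n. p (i n)) \<longlonglongrightarrow> (y, s)"
     using i by (intro metric_tendsto_imp_tendsto[OF LIMSEQ_inverse_real_of_nat]) (auto intro!: always_eventually less_imp_le)
    then have "(%n. fst (p (i n))) \<longlonglongrightarrow> y" "(%n. snd (p (i n))) \<longlonglongrightarrow> s"
     using tendsto_fst tendsto_snd by fastforce+
    from tendsto_mult_right_zero[OF L2_tendsto_kf[OF s(1) this], of C]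
    have "\<forall>\<^sub>F n in sequentially. C * lnorm m (%x. kf y s x - kf (fst (p (i n))) (snd (p (i n))) x) < \<delta>"
     using \<delta> by (intro order_tendstoD(2))
    then obtain n where n: "C * lnorm m (%x. kf y s x - kf (fst (p (i n))) (snd (p (i n))) x) < \<delta>" by (auto simp: eventually_sequentially)
    have "lnorm m (%x. S (kf y s) x - d (i n) x) <= C * lnorm m (%x. kf y s x - kf (fst (p (i n))) (snd (p (i n))) x)"
     unfolding d_def by (intro Sdiff kL kf_limit p)
    with n show ?thesis by (intro exI[of _ "i n"]) linarith
   qed
   from E(2)[OF SL[OF kL] this] have "(%k. (ip m (S (kf y s)) (E k))^2) sums (lnorm m (S (kf y s)))^2" .
   moreover have "ip m (S (kf y s)) (E k) = P s (w k) y" for k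
    using w kL by (simp add: P_pointwise[OF s(1)] ip_commute)
   ultimately show ?thesis by (simp add: norm)
  qed
  have ptw: "ennreal ((lnorm m (T (kf y t)))^2) = (\<Sum>k. ennreal ((P s (w k) y)^2))" for y
   using sums[of y] by (intro suminf_ennreal_eq[symmetric]) auto
  have wL: "P s (w k) : L2 m" for k using w s by (intro P_L2) auto
  have "HS T t = (\<integral>\<^sup>+y. (\<Sum>k. ennreal ((P s (w k) y)^2)) \<partial>m)" by (simp add: HS_def ptw)
  also have "\<dots> = (\<Sum>k. \<integral>\<^sup>+y. ennreal ((P s (w k) y)^2) \<partial>m)" by (rule nn_integral_suminf) (use L2_measurable[OF wL] in simp)
  also have "\<dots> = (\<Sum>k. ennreal ((lnorm m (P s (w k)))^2))" by (simp add: nn_integral_sq[OF wL])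
  finally show ?thesis using sums by (simp add: s_def)
 qed
 with w show ?thesis by blast
qed

lemma HS_measurable:
 assumes T: "bounded_op T" and t: "t > 0"
 shows "(%y. (lnorm m (T (kf y t)))^2) : borel_measurable m"
proof -
 have t2: "t / 2 > 0" "t > t / 2" using t by auto
 obtain w where w: "!!k::nat. w k : L2 m" "!!y. (%k. (P (t - t/2) (w k) y)^2) sums (lnorm m (T (kf y t)))^2"
  using HS_expansion[OF T t2(1)] t2(2) by blast
 have "(%y. (P (t - t/2) (w k) y)^2) : borel_measurable m" for k
  using L2_measurable[OF P_L2[OF w(1), of "t - t/2"]] t by simp
 then have "(%y. \<Sum>k. (P (t - t/2) (w k) y)^2) : borel_measurable m" by (intro borel_measurable_suminf)
 then show ?thesis using w(2) by (simp add: sums_iff)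
qed

lemma HS_past_series:
 assumes T: "bounded_op T" and e: "e > 0" and fin: "!!t. t > e ==> HS T t < \<infinity>" and e': "e' > e"
 shows "past_series e' (%t. enn2real (HS T t))"
proof -
 obtain w where w: "!!k::nat. w k : L2 m" "!!t. t > e ==> HS T t = (\<Sum>k. ennreal ((lnorm m (P (t - e) (w k)))^2))"
  using HS_expansion[OF T e] by blast
 show ?thesis
 proof (rule past_series_sums[where f="%k t. (lnorm m (P (t - e) (w k)))^2"])
  fix k
  have "past_series (e' - e + e) (%t. (lnorm m (P (t - e) (w k)))^2)"
   by (rule past_series_shift[OF P_norm_series[OF w(1)]]) (use e' in simp)
  then show "past_series e' (%t. (lnorm m (P (t - e) (w k)))^2)" by simp
 next
  fix t assume "t > e'"
  then have t: "t > e" using e' by simp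
  have ne: "(\<Sum>k. ennreal ((lnorm m (P (t - e) (w k)))^2)) ~= top" using fin[OF t] w(2)[OF t] by auto
  have sm: "summable (%k. (lnorm m (P (t - e) (w k)))^2)" by (rule summable_suminf_not_top[OF _ ne]) simp
  have "HS T t = ennreal (\<Sum>k. (lnorm m (P (t - e) (w k)))^2)" unfolding w(2)[OF t] by (rule suminf_ennreal2[OF _ sm]) simp
  then have "enn2real (HS T t) = (\<Sum>k. (lnorm m (P (t - e) (w k)))^2)" using suminf_nonneg[OF sm] by simp
  with sm show "(%k. (lnorm m (P (t - e) (w k)))^2) sums enn2real (HS T t)" by (simp add: sums_iff)
 qed
qed

end

section \<open>Local finiteness of the heat kernel energy\<close>

lemma cutoff_mult: assumes "cutoff \<psi>" "cutoff \<phi>" shows "cutoff (%x. \<psi> x * \<phi> x)"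
proof -
 have "BL (%x. \<psi> x * \<phi> x)" by (intro BL_mult cutoff_BL assms)
 moreover have "bounded {x. \<psi> x * \<phi> x ~= 0}" by (rule bounded_subset[of "{x. \<psi> x ~= 0}"]) (use assms in "auto simp: cutoff_def")
 ultimately show ?thesis using assms by (auto simp: cutoff_def BL_def intro: mult_le_one)
qed

lemma lc_square:
 assumes "BL \<psi>" shows "lc (%x. \<psi> x * \<psi> x) x <= 2 * abs (\<psi> x) * lc \<psi> x"
 using lc_product[OF assms assms BL_const BL_const BL_const, of 0 0 0 x] lc_lincomb[OF assms BL_const[of 0], of "\<psi> x" 0 x] by simp

context heat_space
begin

lemma lc_support: "x \<notin> closure {x. \<psi> x ~= 0} ==> lc \<psi> x = 0"
proof (rule lc_zero_outside)
 assume "x \<notin> closure {x. \<psi> x ~= 0}"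
 then have "\<forall>\<^sub>F y in nhds x. y : - closure {x. \<psi> x ~= 0}" by (intro eventually_nhds_in_open) auto
 then show "\<forall>\<^sub>F y in nhds x. \<psi> y = 0"
  by eventually_elim (meson ComplD closure_subset mem_Collect_eq subsetD)
qed

text \<open>Freeze \<open>\<phi>\<close> at a rational value \<open>q\<close> and use the Leibniz rule for slopes on \<open>(\<phi> - q) f\<close>; the values near \<open>\<phi> x\<close>
  give the estimate at \<open>x\<close>.\<close>

lemma G_leibniz_bound:
 assumes f: "f : H12 m" and \<phi>: "cutoff \<phi>"
 shows "AE x in m. abs (G f (%x. \<phi> x * f x) x - \<phi> x * (D f x)^2) <= abs (f x) * lc \<phi> x * D f x"
proof -
 let ?p = "%x. \<phi> x * f x"
 have pf: "?p : H12 m" by (rule cutoff_mult_H12[OF f \<phi>])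
 have "AE x in m. ALL q:\<rat>. abs (G f ?p x - q * (D f x)^2) <= D f x * (abs (\<phi> x - q) * D f x + abs (f x) * lc \<phi> x)"
 proof (rule AE_ball_countable'[OF _ countable_rat])
  fix q :: real
  have L: "(%x. \<phi> x * f x - q * f x) : H12 m" "AE x in m. D (%x. \<phi> x * f x - q * f x) x <= abs (\<phi> x - q) * D f x + abs (f x) * lc \<phi> x"
   using D_leibniz[OF f \<phi>, of q 0] by simp_all
  have qf: "(%x. q * f x) : H12 m" by (rule H12_cmult[OF f])
  have eq: "(%x. (\<phi> x * f x - q * f x) + q * f x) = ?p" by auto
  from G_add_right[OF f L(1) qf, unfolded eq] G_cmult_right[OF f f, of q] G_self[OF f] G_bound[OF f L(1)] L(2) D_nonneg[OF f]
  show "AE x in m. abs (G f ?p x - q * (D f x)^2) <= D f x * (abs (\<phi> x - q) * D f x + abs (f x) * lc \<phi> x)"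
  proof eventually_elim
   case (elim x)
   then have "abs (G f ?p x - q * (D f x)^2) <= D f x * D (%x. \<phi> x * f x - q * f x) x" by simp
   also have "\<dots> <= D f x * (abs (\<phi> x - q) * D f x + abs (f x) * lc \<phi> x)" using elim by (intro mult_left_mono) auto
   finally show ?case .
  qed
 qed
 then show ?thesis
 proof eventually_elim
  case (elim x)
  have "0 <= D f x * (abs (\<phi> x - r) * D f x + abs (f x) * lc \<phi> x) - abs (G f ?p x - r * (D f x)^2)" for r
   by (rule rational_nonneg_imp[of "%r. D f x * (abs (\<phi> x - r) * D f x + abs (f x) * lc \<phi> x) - abs (G f ?p x - r * (D f x)^2)"])
    (use elim in "auto intro!: continuous_intros")
  from this[of "\<phi> x"] show ?case by (simp add: ac_simps)
 qed
qed

text \<open>Test the equation \<open>\<Delta>f = h\<close> with \<open>\<psi>\<^sup>2 f\<close> and absorb half of the energy.\<close>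

lemma Caccioppoli:
 assumes f: "has_laplacian m f h" and \<psi>: "cutoff \<psi>" and L: "!!x. lc \<psi> x <= L"
  and U: "U : sets m" "closure {x. \<psi> x ~= 0} \<subseteq> U"
 shows "(LINT x|m. (\<psi> x)^2 * (D f x)^2) <= (LINT x|m. indicator U x * (h x)^2) + (1 + 4 * L^2) * (LINT x|m. indicator U x * (f x)^2)"
proof -
 let ?U = "%u. \<integral>x. indicator U x * (u x)^2 \<partial>m"
 define \<phi> where "\<phi> x = \<psi> x * \<psi> x" for x
 have \<phi>: "cutoff \<phi>" unfolding \<phi>_def by (rule cutoff_mult[OF \<psi> \<psi>])
 note fL = has_laplacian_D(1,2,3)[OF f]
 have p01: "0 <= \<phi> x" "\<phi> x <= 1" for x using \<phi> by (auto simp: cutoff_def)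
 have supp: "\<phi> x = 0" "lc \<psi> x = 0" if "x \<notin> U" for x
  using U(2) that lc_support[of x \<psi>] closure_subset[of "{x. \<psi> x ~= 0}"] by (auto simp: \<phi>_def)
 have pm: "\<phi> : borel_measurable m" by (rule BL_measurable[OF cutoff_BL[OF \<phi>]])
 have pfH: "(%x. \<phi> x * f x) : H12 m" by (rule cutoff_mult_H12[OF fL(1) \<phi>])
 have Gi: "integrable m (G f (%x. \<phi> x * f x))" by (rule grad_inner_pol(1)[OF fL(1) pfH])
 have DL: "D f : L2 m" by (rule D_L2[OF fL(1)])
 have pDi: "integrable m (%x. \<phi> x * (D f x)^2)"
 proof (rule Bochner_Integration.integrable_bound[OF L2_sq_integrable[OF DL]])
  show "AE x in m. norm (\<phi> x * (D f x)^2) <= norm ((D f x)^2)"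
   using p01 by (auto intro!: AE_I2 mult_left_le_one_le simp: abs_mult)
 qed (use pm L2_measurable[OF DL] in simp)
 have iU: "integrable m (%x. indicator U x * (u x)^2)" if "u : L2 m" for u
  using integrable_mult_indicator[OF U(1) L2_sq_integrable[OF that]] by simp
 have hfi: "integrable m (%x. h x * (\<phi> x * f x))" by (rule L2_integrable_mult[OF fL(3) H12_L2[OF pfH]])
 have "(LINT x|m. \<phi> x * (D f x)^2) <= (LINT x|m. (G f (%x. \<phi> x * f x) x) + (1/2 * (\<phi> x * (D f x)^2) + 2 * L^2 * (indicator U x * (f x)^2)))"
 proof (rule integral_mono_AE)
  show "AE x in m. \<phi> x * (D f x)^2 <= (G f (%x. \<phi> x * f x) x) + (1/2 * (\<phi> x * (D f x)^2) + 2 * L^2 * (indicator U x * (f x)^2))"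
   using G_leibniz_bound[OF fL(1) \<phi>] D_nonneg[OF fL(1)]
  proof eventually_elim
   case (elim x)
   have "abs (f x) * lc \<phi> x * D f x <= abs (f x) * (2 * abs (\<psi> x) * lc \<psi> x) * D f x"
    using elim lc_square[OF cutoff_BL[OF \<psi>], of x] unfolding \<phi>_def by (intro mult_right_mono mult_left_mono) auto
   also have "\<dots> = 2 * ((abs (\<psi> x) * D f x) / 2 * (abs (f x) * lc \<psi> x)) * 2" by simp
   also have "2 * ((abs (\<psi> x) * D f x) / 2 * (abs (f x) * lc \<psi> x)) <= ((abs (\<psi> x) * D f x) / 2)^2 + (abs (f x) * lc \<psi> x)^2"
    using sum_squares_bound[of "(abs (\<psi> x) * D f x) / 2" "abs (f x) * lc \<psi> x"] by (simp add: mult.assoc)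
   also have "(\<dots>) * 2 = 1/2 * (\<phi> x * (D f x)^2) + 2 * ((f x)^2 * (lc \<psi> x)^2)"
    by (simp add: power_mult_distrib power_divide \<phi>_def flip: power2_eq_square)
   also have "(f x)^2 * (lc \<psi> x)^2 <= L^2 * (indicator U x * (f x)^2)"
   proof (cases "x : U")
    case True
    have "(lc \<psi> x)^2 <= L^2" using L[of x] by (intro power_mono) auto
    from mult_right_mono[OF this, of "(f x)^2"] show ?thesis using True by (simp add: mult.commute)
   qed (simp add: supp)
   finally show ?case using elim(1) by linarith
  qed
 qed (use pDi Gi iU[OF fL(2)] in auto)
 also have "\<dots> = E f (%x. \<phi> x * f x) + (1/2 * (LINT x|m. \<phi> x * (D f x)^2) + 2 * L^2 * ?U f)"
  using pDi Gi iU[OF fL(2)] by (simp add: E_def)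
 also have "E f (%x. \<phi> x * f x) = (LINT x|m. - (h x * (\<phi> x * f x)))"
  using has_laplacian_D(4)[OF f pfH] by (simp add: ip_def)
 also have "\<dots> <= (LINT x|m. 1/2 * (indicator U x * (h x)^2) + 1/2 * (indicator U x * (f x)^2))"
 proof (rule integral_mono)
  fix x
  show "- (h x * (\<phi> x * f x)) <= 1/2 * (indicator U x * (h x)^2) + 1/2 * (indicator U x * (f x)^2)"
  proof (cases "x : U")
   case True
   have "- (h x * (\<phi> x * f x)) <= \<phi> x * (abs (h x) * abs (f x))"
    using p01[of x] by (metis abs_ge_minus_self abs_mult abs_of_nonneg mult.left_commute)
   also have "\<dots> <= abs (h x) * abs (f x)" using p01[of x] by (intro mult_left_le_one_le) auto
   also have "\<dots> <= 1/2 * (h x)^2 + 1/2 * (f x)^2" using sum_squares_bound[of "abs (h x)" "abs (f x)"] by simp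
   finally show ?thesis using True by simp
  qed (simp add: supp)
 qed (use hfi iU[OF fL(2)] iU[OF fL(3)] in auto)
 also have "\<dots> = 1/2 * ?U h + 1/2 * ?U f"
  using iU[OF fL(2)] iU[OF fL(3)] by simp
 finally have "(LINT x|m. \<phi> x * (D f x)^2) <= ?U h + (1 + 4 * L^2) * ?U f"
  by (simp add: algebra_simps)
 then show ?thesis by (simp add: \<phi>_def power2_eq_square)
qed

lemma sigma_finite_m: "sigma_finite_measure m"
proof
 show "EX A. countable A & A \<subseteq> sets m & \<Union>A = space m & (ALL a:A. emeasure m a ~= \<infinity>)"
 proof (intro exI[of _ "range (%n::nat. ball undefined (real n))"] conjI ballI)
  show "\<Union> (range (%n::nat. ball undefined (real n))) = space m"
   using reals_Archimedean2 by (auto simp: space_m)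
  show "emeasure m a ~= \<infinity>" if "a : range (%n::nat. ball undefined (real n))" for a
   using that fin_bounded[of a] by (auto simp: less_top)
 qed (auto simp: sets_m)
qed

lemma Tonelli_bound:
 assumes g: "continuous_on UNIV (%(x, y). g x y :: real)" and U: "U : sets m"
  and bd: "!!x. x : U ==> g x : L2 m & (lnorm m (g x))^2 <= C"
 shows "(\<integral>\<^sup>+y. (\<integral>\<^sup>+x. indicator U x * ennreal ((g x y)^2) \<partial>m) \<partial>m) <= ennreal C * emeasure m U"
  "(%y. \<integral>\<^sup>+x. indicator U x * ennreal ((g x y)^2) \<partial>m) : borel_measurable m"
proof -
 let ?k = "%x y. indicator U x * ennreal ((g x y)^2)"
 interpret sigma_finite_measure m by (rule sigma_finite_m)
 interpret pair_sigma_finite m m by (simp add: pair_sigma_finite_def sigma_finite_m)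
 have "sets (m \<Otimes>\<^sub>M m) = sets ((borel :: 'a measure) \<Otimes>\<^sub>M (borel :: 'a measure))" by (intro sets_pair_measure_cong sets_m)
 then have s: "sets (m \<Otimes>\<^sub>M m) = sets (borel :: ('a \<times> 'a) measure)" unfolding borel_prod .
 have "(%(x, y). g x y) : borel_measurable (m \<Otimes>\<^sub>M m)"
  using borel_measurable_continuous_onI[OF g] measurable_cong_sets[OF s refl] by blast
 then have gm: "(%p. g (fst p) (snd p)) : borel_measurable (m \<Otimes>\<^sub>M m)" by (simp add: case_prod_beta')
 have k: "(%p. indicator U (fst p) * ennreal ((g (fst p) (snd p))^2)) : borel_measurable (m \<Otimes>\<^sub>M m)"
  using gm U by measurable
 have sw: "(%p. (snd p, fst p)) : measurable (m \<Otimes>\<^sub>M m) (m \<Otimes>\<^sub>M m)" by measurable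
 have k': "(%p. indicator U (snd p) * ennreal ((g (snd p) (fst p))^2)) : borel_measurable (m \<Otimes>\<^sub>M m)"
  using measurable_compose[OF sw k] by simp
 show "(%y. \<integral>\<^sup>+x. ?k x y \<partial>m) : borel_measurable m"
  using sigma_finite_measure.borel_measurable_nn_integral_fst[OF sigma_finite_m k'] by simp
 have "(\<integral>\<^sup>+y. (\<integral>\<^sup>+x. ?k x y \<partial>m) \<partial>m) = (\<integral>\<^sup>+x. (\<integral>\<^sup>+y. ?k x y \<partial>m) \<partial>m)"
  by (rule Fubini') (use k in "simp add: case_prod_beta'")
 also have "\<dots> <= (\<integral>\<^sup>+x. ennreal C * indicator U x \<partial>m)"
 proof (rule nn_integral_mono)
  fix x
  show "(\<integral>\<^sup>+y. ?k x y \<partial>m) <= ennreal C * indicator U x"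
   using bd[of x] nn_integral_sq[of "g x" m] by (cases "x : U") (auto intro: ennreal_leI)
 qed
 finally show "(\<integral>\<^sup>+y. (\<integral>\<^sup>+x. ?k x y \<partial>m) \<partial>m) <= ennreal C * emeasure m U"
  using U by (simp add: nn_integral_cmult_indicator)
qed

lemma kf_sym: "t > 0 ==> kf y t x = kf x t y"
 by (simp add: kf_def rho_symmetric)

lemma kf_laplacian:
 assumes t: "t > 0"
 shows "EX h. has_laplacian m (kf y t) h & L2_tendsto m (%n x. real (Suc n) * (kf y (t + rad n) x - kf y t x)) h sequentially"
proof -
 have t2: "t / 2 > 0" using t by simp
 have kL: "kf y (t/2) : L2 m" by (rule kf_limit(1)[OF t2])
 obtain h where h: "has_laplacian m (P (t/2) (kf y (t/2))) h" "L2_deriv m (%s. P s (kf y (t/2))) h (t/2)" "h : L2 m"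
  by (rule P_D[OF kL t2])
 have eq: "AE x in m. P (t/2 + s) (kf y (t/2)) x = kf y (t + s) x" if "s >= 0" for s
  using P_kf[OF t2, of "t/2 + s" y] t2 that by (simp add: add.commute add.left_commute)
 have lap: "has_laplacian m (kf y t) h"
  by (rule has_laplacian_cong_AE[OF h(1) _ kf_measurable[OF t] AE_I2[OF refl] L2_measurable[OF h(3)]]) (use eq[of 0] in simp)
 have "filterlim (%n. t/2 + rad n) (at (t/2)) sequentially"
 proof (rule filterlim_atI)
  have "(%n. t/2 + rad n) \<longlonglongrightarrow> t/2 + 0" by (intro tendsto_intros rad)
  then show "(%n. t/2 + rad n) \<longlonglongrightarrow> t/2" by simp
 qed (use rad(1) in "auto intro!: always_eventually simp: less_imp_neq[THEN not_sym]")
 from filterlim_compose[OF h(2)[unfolded L2_deriv_def L2_tendsto_def] this]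
 have lim: "(%n. \<integral>x. ((P (t/2 + rad n) (kf y (t/2)) x - P (t/2) (kf y (t/2)) x) / (t/2 + rad n - t/2) - h x)^2 \<partial>m) \<longlonglongrightarrow> 0" .
 have "(LINT x|m. ((P (t/2 + rad n) (kf y (t/2)) x - P (t/2) (kf y (t/2)) x) / (t/2 + rad n - t/2) - h x)^2)
   = (LINT x|m. (real (Suc n) * (kf y (t + rad n) x - kf y t x) - h x)^2)" for n
 proof (rule integral_cong_AE)
  have r: "rad n >= 0" "1 / rad n = real (Suc n)" using rad(1)[of n] by (simp_all add: rad_def divide_inverse del: of_nat_Suc)
  show "AE x in m. ((P (t/2 + rad n) (kf y (t/2)) x - P (t/2) (kf y (t/2)) x) / (t/2 + rad n - t/2) - h x)^2
    = (real (Suc n) * (kf y (t + rad n) x - kf y t x) - h x)^2"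
   using eq[OF r(1)] eq[of 0, simplified]
  proof eventually_elim
   case (elim x)
   have "(kf y (t + rad n) x - kf y t x) / rad n = real (Suc n) * (kf y (t + rad n) x - kf y t x)"
    unfolding r(2)[symmetric] by simp
   then show ?case using elim by simp
  qed
  have pos: "t/2 + rad n > 0" "t + rad n > 0" using t r by auto
  have [measurable]: "P (t/2 + rad n) (kf y (t/2)) : borel_measurable m" "P (t/2) (kf y (t/2)) : borel_measurable m" "h : borel_measurable m"
   "kf y (t + rad n) : borel_measurable m" "kf y t : borel_measurable m"
   using P_L2[OF kL pos(1)] P_L2[OF kL t2] h(3) kf_measurable[OF pos(2)] kf_measurable[OF t] by (auto intro: L2_measurable)
  show "(%x. ((P (t/2 + rad n) (kf y (t/2)) x - P (t/2) (kf y (t/2)) x) / (t/2 + rad n - t/2) - h x)^2) : borel_measurable m" by measurable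
  show "(%x. (real (Suc n) * (kf y (t + rad n) x - kf y t x) - h x)^2) : borel_measurable m" by measurable
 qed
 with lim lap show ?thesis unfolding L2_tendsto_def by auto
qed

text \<open>The time increments of the kernel are those of the heat flow starting at time \<open>t / 2\<close>, where the norm is
  already finite.\<close>

lemma kf_increment:
 assumes t: "t > 0"
 shows "real (Suc n) * lnorm m (%y. kf x (t + rad n) y - kf x t y) <= 16 / t * lnorm m (kf x (t/2))"
proof -
 have t2: "t / 2 > 0" using t by simp
 have kL: "kf x (t/2) : L2 m" by (rule kf_limit(1)[OF t2])
 have r: "rad n >= 0" "real (Suc n) * rad n = 1" using rad(1)[of n] by (simp_all add: rad_def del: of_nat_Suc)
 have eq: "AE y in m. P (t/2 + s) (kf x (t/2)) y = kf x (t + s) y" if "s >= 0" for s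
  using P_kf[OF t2, of "t/2 + s" x] t2 that by (simp add: add.commute add.left_commute)
 have pos: "t/2 + rad n > 0" "t + rad n > 0" using t r by auto
 have "lnorm m (%y. kf x (t + rad n) y - kf x t y) = lnorm m (%y. P (t/2 + rad n) (kf x (t/2)) y - P (t/2) (kf x (t/2)) y)"
  using eq[OF r(1)] eq[of 0, simplified] P_L2[OF kL pos(1)] P_L2[OF kL t2] kf_limit(1)[OF pos(2)] kf_limit(1)[OF t]
  by (intro lnorm_cong_AE) (auto intro!: L2_measurable L2_diff elim: AE_mp)
 also have "\<dots> <= 8 * rad n / (t/2) * lnorm m (kf x (t/2))" by (rule P_smoothing(1)[OF kL t2 r(1)])
 finally have "real (Suc n) * lnorm m (%y. kf x (t + rad n) y - kf x t y) <= real (Suc n) * (8 * rad n / (t/2) * lnorm m (kf x (t/2)))"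
  by (intro mult_left_mono) auto
 also have "\<dots> = (real (Suc n) * rad n) * (16 / t * lnorm m (kf x (t/2)))" by simp
 finally show ?thesis by (simp only: r mult_1_left)
qed

abbreviation energy :: "'a set => real => ennreal" where
 "energy A t \<equiv> \<integral>\<^sup>+y. (\<integral>\<^sup>+x. indicator A x * ennreal ((D (kf y t) x)^2) \<partial>m) \<partial>m"

text \<open>The energies of the functions \<open>\<rho>(\<cdot>, y, t)\<close> in a small ball are integrable in \<open>y\<close>: by
  Caccioppoli's inequality they are controlled by \<open>\<rho>\<close> and its time derivative, and here the order
  of integration can be exchanged.\<close>

lemma local_energy_finite:
 assumes e: "e > 0"
 shows "EX r>0. ALL t>e. energy (ball x0 r) t < \<infinity>"
proof -
 obtain d where d: "d > 0" "!!x' y'. x' : ball x0 d ==> y' : ball x0 d ==> abs (\<rho> x' y' e - \<rho> x0 x0 e) <= 1"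
  using rho_local[OF e zero_less_one, of x0 x0] by auto
  \<comment> \<open>\<open>\<rho> x x e\<close> is the squared norm of \<open>\<rho>(\<cdot>, x, e / 2)\<close>, which bounds the later ones\<close>
 define M where "M = abs (\<rho> x0 x0 e) + 1"
 have M: "0 <= M" "\<rho> x x e <= M" if "x : ball x0 d" for x using d(2)[OF that that] by (auto simp: M_def)
 define r where "r = d / 3"
 have r: "r > 0" using d by (simp add: r_def)
 define U where "U = ball x0 d"
 define \<psi> where "\<psi> = bump (ball x0 r) r"
 have ne: "ball x0 r ~= {}" "bounded (ball x0 r)" using r by auto
 have \<psi>: "cutoff \<psi>" unfolding \<psi>_def by (rule bump_cutoff[OF ne(2,1) r])
 have one: "\<psi> x = 1" if "x : ball x0 r" for x using that by (simp add: \<psi>_def bump_def)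
 have "{x. \<psi> x ~= 0} \<subseteq> cball x0 (2 * r)"
 proof
  fix x assume "x : {x. \<psi> x ~= 0}"
  then have "infdist x (ball x0 r) < r" using r by (auto simp: \<psi>_def bump_def max_def field_simps split: if_splits)
  then obtain y where "y : ball x0 r" "dist x y < r"
   using ne cINF_less_iff[of "ball x0 r" "dist x" r] by (auto simp: infdist_def)
  then show "x : cball x0 (2 * r)" using dist_triangle[of x0 x y] by (simp add: dist_commute)
 qed
 then have "closure {x. \<psi> x ~= 0} \<subseteq> cball x0 (2 * r)" by (rule closure_minimal) simp
 also have "\<dots> \<subseteq> U" using r by (auto simp: U_def r_def)
 finally have supp: "closure {x. \<psi> x ~= 0} \<subseteq> U" .
 have Us: "U : sets m" by (simp add: U_def sets_m)
 have Ufin: "emeasure m U < \<infinity>" unfolding U_def by (rule ball_measure[OF d(1)])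
 obtain L where L: "0 <= L" "!!x y. abs (\<psi> x - \<psi> y) <= L * dist x y" using cutoff_BL[OF \<psi>] by (auto simp: BL_iff)
 have lcL: "lc \<psi> x <= L" for x by (rule lc_le_Lip[OF L(2,1)])
 have "energy (ball x0 r) t < \<infinity>" if t: "t > e" for t
 proof -
  have t0: "t > 0" using t e by simp
  have kbound: "(lnorm m (kf x s))^2 <= M" if "x : U" "s >= e / 2" for x s
  proof -
   have e2: "e / 2 > 0" using e by simp
   have "lnorm m (kf x s) <= lnorm m (kf x (e/2))"
   proof (cases "s = e / 2")
    case False
    then have s: "s - e/2 > 0" using that by simp
    have "lnorm m (kf x s) = lnorm m (P (s - e/2) (kf x (e/2)))"
     using P_kf[OF e2 s, of x] P_L2[OF kf_limit(1)[OF e2] s, of x] kf_measurable[of s x] that e2 by (intro lnorm_cong_AE) (auto intro: L2_measurable elim: AE_mp)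
    also have "\<dots> <= lnorm m (kf x (e/2))" by (rule P_contraction[OF kf_limit(1)[OF e2] s])
    finally show ?thesis .
   next
    case True
    show ?thesis unfolding True by simp
   qed
   then have "(lnorm m (kf x s))^2 <= (lnorm m (kf x (e/2)))^2" by (intro power_mono) auto
   also have "\<dots> <= M" using kf_norm[OF e2, of x] M(2)[of x] that by (simp add: U_def)
   finally show ?thesis .
  qed
  define q where "q n x y = real (Suc n) * (kf y (t + rad n) x - kf y t x)" for n x y
  define a where "a y = (\<integral>\<^sup>+x. indicator U x * ennreal ((kf y t x)^2) \<partial>m)" for y
  define b where "b n y = (\<integral>\<^sup>+x. indicator U x * ennreal ((q n x y)^2) \<partial>m)" for n y
  have tr: "t + rad n > 0" for n using rad(1)[of n] t0 by simp
  have cont1: "continuous_on UNIV (%(x, y). kf y s x)" if "s > 0" for s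
   unfolding continuous_on_def case_prod_beta' kf_def
   by (intro ballI rho_tendsto that tendsto_const tendsto_fst tendsto_snd tendsto_ident_at)
  have contq: "continuous_on UNIV (%(x, y). q n x y)" for n
   using cont1[OF tr[of n]] cont1[OF t0] unfolding q_def case_prod_beta' by (intro continuous_intros)
  have sym: "(%y. kf y t x) = kf x t" for x by (rule ext) (rule kf_sym[OF t0])
  have "(%y. kf y t x) : L2 m & (lnorm m (%y. kf y t x))^2 <= M" if "x : U" for x
   unfolding sym using kbound[OF that, of t] kf_limit(1)[OF t0, of x] t e by simp
  note a = Tonelli_bound[OF cont1[OF t0] Us this, folded a_def]
  have "q n x : L2 m & (lnorm m (q n x))^2 <= (16/t)^2 * M" if "x : U" for n x
  proof -
   have q: "q n x = (%y. real (Suc n) * (kf x (t + rad n) y - kf x t y))"         by (rule ext) (simp add: q_def kf_sym[OF tr[of n], of _ x] kf_sym[OF t0, of _ x])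
   have "lnorm m (q n x) <= 16 / t * lnorm m (kf x (t/2))" using kf_increment[OF t0, of n x] unfolding q lnorm_cmult by simp
   then have "(lnorm m (q n x))^2 <= (16 / t * lnorm m (kf x (t/2)))^2" by (intro power_mono) auto
   also have "\<dots> = (16/t)^2 * (lnorm m (kf x (t/2)))^2" by (rule power_mult_distrib)
   also have "\<dots> <= (16/t)^2 * M" using kbound[OF that, of "t/2"] t by (intro mult_left_mono) auto
   finally show ?thesis unfolding q by (auto intro!: L2_cmult L2_diff kf_limit tr t0)
  qed
  note b = Tonelli_bound[OF contq Us this, folded b_def]
  have main: "(\<integral>\<^sup>+x. indicator (ball x0 r) x * ennreal ((D (kf y t) x)^2) \<partial>m) <= liminf (%n. b n y) + ennreal (1 + 4 * L^2) * a y" for y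
  proof -
   obtain h where h: "has_laplacian m (kf y t) h" "L2_tendsto m (%n x. q n x y) h sequentially"
    using kf_laplacian[OF t0, of y] unfolding q_def by blast
   note hL = has_laplacian_D(1,2,3)[OF h(1)]
   have qL: "(%x. q n x y) : L2 m" for n unfolding q_def by (intro L2_cmult L2_diff kf_limit tr t0)
   have im: "indicator U : borel_measurable m" using Us by simp
   have iL: "(%x. indicator U x * u x) : L2 m" if "u : L2 m" for u
    by (rule L2_bounded_mult[OF that im, where C=1]) (auto simp: indicator_def)
   have isq: "indicator U x * ennreal (c^2) = ennreal ((indicator U x * c)^2)" for x c by (cases "x : U") auto
   have isq': "indicator U x * c^2 = (indicator U x * c)^2" for x and c :: real by (cases "x : U") auto
   have "L2_tendsto m (%n x. indicator U x * q n x y) (%x. indicator U x * h x) sequentially"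
    by (rule L2_tendsto_bounded_mult[OF h(2) always_eventually hL(3) im, where C=1]) (use qL in "auto simp: indicator_def")
   then have "(%n. (lnorm m (%x. indicator U x * q n x y))^2) \<longlonglongrightarrow> (lnorm m (%x. indicator U x * h x))^2"
    by (intro tendsto_power L2_tendsto_norm always_eventually allI iL qL hL)
   then have "(%n. ennreal ((lnorm m (%x. indicator U x * q n x y))^2)) \<longlonglongrightarrow> ennreal ((lnorm m (%x. indicator U x * h x))^2)"
    by (rule tendsto_ennrealI)
   moreover have "b n y = ennreal ((lnorm m (%x. indicator U x * q n x y))^2)" for n
    unfolding b_def isq by (rule nn_integral_sq[OF iL[OF qL]])
   ultimately have lim: "liminf (%n. b n y) = ennreal ((lnorm m (%x. indicator U x * h x))^2)"
    by (simp add: lim_imp_Liminf)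
   have ay: "a y = ennreal ((lnorm m (%x. indicator U x * kf y t x))^2)"
    unfolding a_def isq by (rule nn_integral_sq[OF iL[OF hL(2)]])
   have DL: "D (kf y t) : L2 m" by (rule D_L2[OF hL(1)])
   have pD: "(%x. \<psi> x * D (kf y t) x) : L2 m" by (rule L2_BL_mult[OF DL cutoff_BL[OF \<psi>]])
   have "(\<integral>\<^sup>+x. indicator (ball x0 r) x * ennreal ((D (kf y t) x)^2) \<partial>m) <= (\<integral>\<^sup>+x. ennreal ((\<psi> x * D (kf y t) x)^2) \<partial>m)"
    by (rule nn_integral_mono) (auto simp: indicator_def one)
   also have "\<dots> = ennreal ((lnorm m (%x. \<psi> x * D (kf y t) x))^2)" by (rule nn_integral_sq[OF pD])
   also have "(lnorm m (%x. \<psi> x * D (kf y t) x))^2 <= (lnorm m (%x. indicator U x * h x))^2 + (1 + 4 * L^2) * (lnorm m (%x. indicator U x * kf y t x))^2"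
    using Caccioppoli[OF h(1) \<psi> lcL Us supp] unfolding lnorm_sq isq' power_mult_distrib .
   finally show ?thesis unfolding lim ay by (simp add: ennreal_plus ennreal_mult ennreal_leI)
  qed
  have "energy (ball x0 r) t
    <= (\<integral>\<^sup>+y. liminf (%n. b n y) + ennreal (1 + 4 * L^2) * a y \<partial>m)" by (rule nn_integral_mono[OF main])
  also have "\<dots> = (\<integral>\<^sup>+y. liminf (%n. b n y) \<partial>m) + ennreal (1 + 4 * L^2) * (\<integral>\<^sup>+y. a y \<partial>m)"
   using a(2) b(2) by (subst nn_integral_add) (auto simp: nn_integral_cmult)
  also have "(\<integral>\<^sup>+y. liminf (%n. b n y) \<partial>m) <= liminf (%n. \<integral>\<^sup>+y. b n y \<partial>m)" by (rule nn_integral_liminf[OF b(2)])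
  also have "\<dots> <= liminf (%n::nat. ennreal ((16/t)^2 * M) * emeasure m U)" by (rule Liminf_mono) (use b(1) in auto)
  also have "\<dots> = ennreal ((16/t)^2 * M) * emeasure m U" by (simp add: Liminf_const)
  finally have "energy (ball x0 r) t
    <= ennreal ((16/t)^2 * M) * emeasure m U + ennreal (1 + 4 * L^2) * (\<integral>\<^sup>+y. a y \<partial>m)"
   by (simp add: add_right_mono)
  also have "\<dots> <= ennreal ((16/t)^2 * M) * emeasure m U + ennreal (1 + 4 * L^2) * (ennreal M * emeasure m U)"
   by (intro add_left_mono mult_left_mono a(1)) simp_all
  also have "\<dots> < \<infinity>" using Ufin by (auto simp: ennreal_mult_less_top)
  finally show ?thesis .
 qed
 with r show ?thesis by blast
qed

end

section \<open>Convergence in measure on bounded sets\<close>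

text \<open>The double sequence \<open>U\<close> tends to zero in measure as both indices tend to infinity.  Expressed by sequences,
  so that the transfer of limit theorems from almost everywhere convergence applies.\<close>

definition L0_null2 :: "'a::metric_space measure => (nat => nat => 'a => real) => bool" where
 "L0_null2 m U \<longleftrightarrow> (ALL p q. filterlim p at_top sequentially --> filterlim q at_top sequentially -->
   L0_tendsto m (%n. U (p n) (q n)) (%x. 0))"

lemma L0_null2_iff:
 "L0_null2 m U \<longleftrightarrow> (ALL B:sets borel. bounded B --> (ALL \<epsilon>>0. ALL \<delta>>0. EX N. ALL i>=N. ALL j>=N. measure m {x\<in>B. \<epsilon> <= abs (U i j x)} < \<delta>))"
 (is "_ \<longleftrightarrow> ?R")
proof
 assume U: "L0_null2 m U"
 show ?R
 proof (intro ballI impI allI, rule ccontr)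
  fix B :: "'a set" and \<epsilon> \<delta> :: real
  assume B: "B : sets borel" "bounded B" and e: "0 < \<epsilon>" and d: "0 < \<delta>" and "~ (EX N. ALL i>=N. ALL j>=N. measure m {x\<in>B. \<epsilon> <= abs (U i j x)} < \<delta>)"
  then have "ALL N. EX i. N <= fst i & N <= snd i & \<delta> <= measure m {x\<in>B. \<epsilon> <= abs (U (fst i) (snd i) x)}" by (simp add: not_less)
  from choice[OF this] obtain r where pq: "!!N. N <= fst (r N)" "!!N. N <= snd (r N)" "!!N. \<delta> <= measure m {x\<in>B. \<epsilon> <= abs (U (fst (r N)) (snd (r N)) x)}" by blast
  let ?p = "%n. fst (r n)" and ?q = "%n. snd (r n)"
  have "filterlim ?p at_top sequentially" "filterlim ?q at_top sequentially"
   using pq(1,2) by (auto intro!: filterlim_at_top_mono[OF filterlim_ident])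
  then have "L0_tendsto m (%n. U (?p n) (?q n)) (%x. 0)" using U unfolding L0_null2_def by blast
  then have "(%n. measure m {x\<in>B. \<epsilon> <= abs (U (?p n) (?q n) x)}) \<longlonglongrightarrow> 0" using B e by (simp add: L0_tendsto_def)
  from order_tendstoD(2)[OF this d] pq(3) show False by (auto simp: eventually_sequentially not_le[symmetric])
 qed
next
 assume R: ?R
 show "L0_null2 m U" unfolding L0_null2_def L0_tendsto_def
 proof (intro ballI impI allI order_tendstoI)
  fix p q :: "nat => nat" and B :: "'a set" and \<epsilon> a :: real
  assume pq: "filterlim p at_top sequentially" "filterlim q at_top sequentially" and B: "B : sets borel" "bounded B" "0 < \<epsilon>"
  show "\<forall>\<^sub>F n in sequentially. a < measure m {x\<in>B. \<epsilon> <= abs (U (p n) (q n) x - 0)}" if "a < 0"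
   using that by (intro always_eventually allI) (rule less_le_trans[OF _ measure_nonneg])
  assume "0 < a"
  from R[rule_format, OF B this] obtain N where N: "!!i j. N <= i ==> N <= j ==> measure m {x\<in>B. \<epsilon> <= abs (U i j x)} < a" by auto
  have "\<forall>\<^sub>F n in sequentially. N <= p n" "\<forall>\<^sub>F n in sequentially. N <= q n" using pq by (auto simp: filterlim_at_top)
  then show "\<forall>\<^sub>F n in sequentially. measure m {x\<in>B. \<epsilon> <= abs (U (p n) (q n) x - 0)} < a" by eventually_elim (simp add: N)
 qed
qed

lemma L0_tendsto_compose:
 assumes "L0_tendsto m F f" "filterlim r at_top sequentially" shows "L0_tendsto m (%n. F (r n)) f"
 unfolding L0_tendsto_def
proof (intro ballI impI allI)
 fix B :: "'a set" and \<epsilon> :: real assume "B : sets borel" "bounded B" "\<epsilon> > 0"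
 then have "(%n. measure m {x\<in>B. \<epsilon> <= abs (F n x - f x)}) \<longlonglongrightarrow> 0" using assms(1) by (simp add: L0_tendsto_def)
 from filterlim_compose[OF this assms(2)] show "(%n. measure m {x\<in>B. \<epsilon> <= abs (F (r n) x - f x)}) \<longlonglongrightarrow> 0" .
qed

lemma sq_bound_tendsto:
 fixes a :: "nat => real"
 assumes "!!n. (a n - c)^2 <= b n" "b \<longlonglongrightarrow> 0" shows "a \<longlonglongrightarrow> c"
proof -
 have "(%n. (a n - c)^2) \<longlonglongrightarrow> 0" by (rule tendsto_sandwich[OF _ _ tendsto_const assms(2)]) (use assms(1) in auto)
 from tendsto_real_sqrt[OF this] show ?thesis by (simp add: tendsto_rabs_zero_iff LIM_zero_iff)
qed

context mms
begin

lemma level_set: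
 fixes f :: "'a => real"
 assumes "f : borel_measurable m" "B : sets borel" "bounded B"
 shows "{x\<in>B. c <= abs (f x)} : sets m" "emeasure m {x\<in>B. c <= abs (f x)} < \<infinity>"
proof -
 have "{x\<in>B. c <= abs (f x)} = B \<inter> {x : space m. c <= abs (f x)}" by (auto simp: space_m)
 moreover have "{x : space m. c <= abs (f x)} : sets m" using borel_measurable_abs[OF assms(1)] by (intro borel_measurable_le) auto
 ultimately show 1: "{x\<in>B. c <= abs (f x)} : sets m" using assms(2) sets_m by auto
 have "emeasure m {x\<in>B. c <= abs (f x)} <= emeasure m B" using assms sets_m by (intro emeasure_mono) auto
 then show "emeasure m {x\<in>B. c <= abs (f x)} < \<infinity>" using fin_bounded[OF assms(2,3)] by (rule le_less_trans)
qed

lemma level_union: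
 fixes f g h :: "'a => real"
 assumes f: "f : borel_measurable m" and g: "g : borel_measurable m" and h: "h : borel_measurable m" and B: "B : sets borel" "bounded B"
  and imp: "!!x. c <= abs (f x) ==> d <= abs (g x) | e <= abs (h x)"
 shows "measure m {x\<in>B. c <= abs (f x)} <= measure m {x\<in>B. d <= abs (g x)} + measure m {x\<in>B. e <= abs (h x)}"
proof -
 let ?G = "{x\<in>B. d <= abs (g x)}" and ?H = "{x\<in>B. e <= abs (h x)}"
 have "emeasure m {x\<in>B. c <= abs (f x)} <= emeasure m (?G \<union> ?H)"
  using imp level_set(1)[OF g B] level_set(1)[OF h B] by (intro emeasure_mono) auto
 also have "\<dots> <= emeasure m ?G + emeasure m ?H"
  by (rule emeasure_subadditive[OF level_set(1)[OF g B] level_set(1)[OF h B]])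
 finally have "emeasure m {x\<in>B. c <= abs (f x)} <= emeasure m ?G + emeasure m ?H" .
 then have "enn2real (emeasure m {x\<in>B. c <= abs (f x)}) <= enn2real (emeasure m ?G + emeasure m ?H)"
  using level_set(2)[OF g B] level_set(2)[OF h B] by (intro enn2real_mono) auto
 then show ?thesis using level_set(2)[OF g B] level_set(2)[OF h B] by (simp add: measure_def enn2real_plus)
qed

lemma AE_imp_L0_tendsto:
 assumes F: "!!n. F n : borel_measurable m" "f : borel_measurable m" and lim: "AE x in m. (%n. F n x) \<longlonglongrightarrow> f x"
 shows "L0_tendsto m F f"
 unfolding L0_tendsto_def
proof (intro ballI impI allI)
 fix B :: "'a set" and \<epsilon> :: real assume B: "B : sets borel" "bounded B" and e: "\<epsilon> > 0"
 have s: "{x\<in>B. \<epsilon> <= abs (F n x - f x)} : sets m" "emeasure m {x\<in>B. \<epsilon> <= abs (F n x - f x)} < \<infinity>" for n using level_set[OF borel_measurable_diff[OF F] B] by auto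
 have "(%n. \<integral>x. indicator {x\<in>B. \<epsilon> <= abs (F n x - f x)} x \<partial>m) \<longlonglongrightarrow> (LINT x|m. (0::real))"
 proof (rule integral_dominated_convergence[where w="indicator B"])
  show "integrable m (indicator B :: 'a => real)" using B fin_bounded[OF B] sets_m by simp
  show "AE x in m. (%n. indicator {x\<in>B. \<epsilon> <= abs (F n x - f x)} x) \<longlonglongrightarrow> (0::real)"
   using lim
  proof eventually_elim
   case (elim x)
   have "\<forall>\<^sub>F n in sequentially. abs (F n x - f x) < \<epsilon>" using elim e by (auto dest!: tendstoD[of _ _ _ \<epsilon>] simp: dist_real_def)
   then have "\<forall>\<^sub>F n in sequentially. indicator {x\<in>B. \<epsilon> <= abs (F n x - f x)} x = (0::real)" by eventually_elim (simp add: indicator_def)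
   then show ?case by (rule tendsto_eventually)
  qed
  show "AE x in m. norm (indicator {x\<in>B. \<epsilon> <= abs (F n x - f x)} x :: real) <= indicator B x" for n by (auto simp: indicator_def)
 qed (use s in auto)
 then show "(%n. measure m {x\<in>B. \<epsilon> <= abs (F n x - f x)}) \<longlonglongrightarrow> 0" using s(1) by (simp add: space_m)
qed

lemma Borel_Cantelli_level:
 fixes v :: "nat => 'a => real"
 assumes v: "!!k. v k : borel_measurable m" and small: "!!k. measure m {x : ball undefined (real k). (1/2)^k <= abs (v k x)} < (1/2)^k"
 shows "AE x in m. summable (%k. v k x)"
proof -
 let ?A = "%k. {x : ball undefined (real k). (1/2)^k <= abs (v k x)}"
 have s: "summable (%k. (1/2::real)^k)" by (rule summable_geometric) simp
 have "summable (%k. measure m (?A k))"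
  by (rule summable_comparison_test'[OF s, of 0]) (use small in "simp add: less_imp_le")
 moreover have "?A k : sets m" "emeasure m (?A k) < \<infinity>" for k by (intro level_set[OF v] borel_open open_ball bounded_ball)+
 ultimately have "AE x in m. \<forall>\<^sub>F k in sequentially. x : space m - ?A k" by (intro borel_cantelli_AE1)
 then show ?thesis
 proof eventually_elim
  case (elim x)
  obtain k0 :: nat where k0: "dist undefined x < real k0" using reals_Archimedean2 by blast
  from elim have "\<forall>\<^sub>F k in sequentially. norm (v k x) <= (1/2)^k"
   using eventually_ge_at_top[of k0] by eventually_elim (use k0 in auto)
  then show ?case using s by (rule summable_comparison_test_ev)
 qed
qed

lemma L0_tendsto_subseq:
 assumes "L0_tendsto m F f" "!!n. F n : borel_measurable m" "f : borel_measurable m"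
 shows "EX r. strict_mono r & (AE x in m. (%k. F (r k) x) \<longlonglongrightarrow> f x)"
proof -
 let ?Q = "%k n. measure m {x : ball undefined (real k). (1/2)^k <= abs (F n x - f x)} < (1/2)^k"
 have "\<forall>\<^sub>F n in sequentially. ?Q k n" for k
  using order_tendstoD(2)[OF assms(1)[unfolded L0_tendsto_def, rule_format, of "ball undefined (real k)" "(1/2)^k"], of "(1/2)^k"] by simp
 from fast_subseq[of ?Q, OF this] obtain r where r: "strict_mono r" "!!k. ?Q k (r k)" by blast
 from Borel_Cantelli_level[OF _ r(2)] assms(2,3) have "AE x in m. summable (%k. F (r k) x - f x)" by auto
 then have "AE x in m. (%k. F (r k) x) \<longlonglongrightarrow> f x" by eventually_elim (rule LIM_zero_cancel, erule summable_LIMSEQ_zero)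
 with r(1) show ?thesis by blast
qed

lemma L0_subseq3:
 assumes L: "L0_tendsto m F f" "L0_tendsto m G g" "L0_tendsto m H h"
  and meas: "!!n. F n : borel_measurable m" "f : borel_measurable m" "!!n. G n : borel_measurable m" "g : borel_measurable m"
   "!!n. H n : borel_measurable m" "h : borel_measurable m"
 shows "EX r. strict_mono r & (AE x in m. (%k. F (r k) x) \<longlonglongrightarrow> f x & (%k. G (r k) x) \<longlonglongrightarrow> g x & (%k. H (r k) x) \<longlonglongrightarrow> h x)"
proof -
 obtain r where r: "strict_mono r" "AE x in m. (%k. F (r k) x) \<longlonglongrightarrow> f x" using L0_tendsto_subseq[OF L(1) meas(1,2)] by blast
 obtain s where s: "strict_mono s" "AE x in m. (%k. G (r (s k)) x) \<longlonglongrightarrow> g x"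
  using L0_tendsto_subseq[OF L0_tendsto_compose[OF L(2) filterlim_subseq[OF r(1)]] meas(3,4)] by blast
 have rs: "strict_mono (%k. r (s k))" using r(1) s(1) by (simp add: strict_mono_def)
 obtain q where q: "strict_mono q" "AE x in m. (%k. H (r (s (q k))) x) \<longlonglongrightarrow> h x"
  using L0_tendsto_subseq[OF L0_tendsto_compose[OF L(3) filterlim_subseq[OF rs]] meas(5,6)] by blast
 have "AE x in m. (%k. F (r (s (q k))) x) \<longlonglongrightarrow> f x & (%k. G (r (s (q k))) x) \<longlonglongrightarrow> g x & (%k. H (r (s (q k))) x) \<longlonglongrightarrow> h x"
  using r(2) s(2) q(2)
 proof eventually_elim
  case (elim x)
  then show ?case using LIMSEQ_subseq_LIMSEQ[OF elim(1) strict_mono_o[OF s(1) q(1)]] LIMSEQ_subseq_LIMSEQ[OF elim(2) q(1)] by (simp add: o_def)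
 qed
 moreover have "strict_mono (%k. r (s (q k)))" using rs q(1) by (simp add: strict_mono_def)
 ultimately show ?thesis by blast
qed

text \<open>A sequence converges in measure if every subsequence has a further subsequence that converges
  almost everywhere.  Therefore a limit theorem for real sequences holds for convergence in measure.\<close>

lemma L0_transfer:
 fixes R :: "nat => 'a => bool"
 assumes L: "L0_tendsto m F f" "L0_tendsto m G g"
  and meas: "!!n. F n : borel_measurable m" "f : borel_measurable m" "!!n. G n : borel_measurable m" "g : borel_measurable m"
   "!!n. H n : borel_measurable m" "h : borel_measurable m"
  and R: "!!n. AE x in m. R n x"
  and lim: "!!x r. (!!n. R n x) ==> (%k. F (r k) x) \<longlonglongrightarrow> f x ==> (%k. G (r k) x) \<longlonglongrightarrow> g x ==> (%k. H (r k) x) \<longlonglongrightarrow> h x"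
 shows "L0_tendsto m H h"
 unfolding L0_tendsto_def
proof (intro ballI impI allI, rule ccontr)
 fix B :: "'a set" and \<epsilon> :: real
 let ?\<mu> = "%n. measure m {x\<in>B. \<epsilon> <= abs (H n x - h x)}"
 assume B: "B : sets borel" "bounded B" and e: "\<epsilon> > 0" and "~ ?\<mu> \<longlonglongrightarrow> 0"
 then obtain \<delta> where d: "\<delta> > 0" and inf: "\<exists>\<^sub>F n in sequentially. \<delta> <= ?\<mu> n"
  by (auto simp: tendsto_iff frequently_def not_le)
 then have "infinite {n. \<delta> <= ?\<mu> n}" by (simp add: frequently_cofinite[symmetric] cofinite_eq_sequentially)
 from infinite_enumerate[OF this] obtain r :: "nat => nat" where r: "strict_mono r" "!!n. \<delta> <= ?\<mu> (r n)" by blast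
 note rL = L[THEN L0_tendsto_compose, OF filterlim_subseq[OF r(1)]]
 obtain s where s: "strict_mono s" "AE x in m. (%k. F (r (s k)) x) \<longlonglongrightarrow> f x & (%k. G (r (s k)) x) \<longlonglongrightarrow> g x"
  using L0_subseq3[OF rL(1,2,2) meas(1-4,3,4)] by (auto simp: conj_assoc)
 have "AE x in m. ALL n. R n x" using R unfolding AE_all_countable by blast
 with s(2) have "AE x in m. (%k. H (r (s k)) x) \<longlonglongrightarrow> h x"
 proof eventually_elim
  case (elim x)
  then show ?case using lim[of x "%k. r (s k)"] by simp
 qed
 from AE_imp_L0_tendsto[OF meas(5,6) this] B e have "(%n. ?\<mu> (r (s n))) \<longlonglongrightarrow> 0" by (simp add: L0_tendsto_def)
 from order_tendstoD(2)[OF this d] r(2) show False by (auto simp: eventually_sequentially not_le[symmetric])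
qed

lemma L0_tendsto_unique:
 assumes F: "!!n. F n : borel_measurable m" and f: "L0_tendsto m F f" "f : borel_measurable m" and g: "L0_tendsto m F g" "g : borel_measurable m"
 shows "AE x in m. f x = g x"
proof -
 obtain r where "AE x in m. (%k. F (r k) x) \<longlonglongrightarrow> f x & (%k. F (r k) x) \<longlonglongrightarrow> g x"
  using L0_subseq3[OF f(1) g(1) g(1) F f(2) F g(2) F g(2)] by auto
 then show ?thesis by eventually_elim (blast intro: LIMSEQ_unique)
qed

text \<open>By the Borel--Cantelli lemma a rapidly Cauchy subsequence converges almost everywhere.\<close>

lemma L0_complete:
 assumes F: "!!n. F n : borel_measurable m" and cau: "L0_null2 m (%i j x. F i x - F j x)"
 shows "EX f. f : borel_measurable m & L0_tendsto m F f"
proof -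
 have [measurable]: "F n : borel_measurable m" for n by (rule F)
 let ?Q = "%k N. ALL j>=N. measure m {x : ball undefined (real k). (1/2)^k <= abs (F j x - F N x)} < (1/2)^k"
 have "\<forall>\<^sub>F N in sequentially. ?Q k N" for k
 proof -
  obtain N where "!!i j. N <= i ==> N <= j ==> measure m {x : ball undefined (real k). (1/2)^k <= abs (F i x - F j x)} < (1/2)^k"
   using cau[unfolded L0_null2_iff, rule_format, of "ball undefined (real k)" "(1/2)^k" "(1/2)^k"] by auto
  then show ?thesis unfolding eventually_sequentially by (intro exI[of _ N] allI impI) (use order_trans in blast)
 qed
 from fast_subseq[of ?Q, OF this] obtain r where r: "strict_mono r"
  "!!k j. r k <= j ==> measure m {x : ball undefined (real k). (1/2)^k <= abs (F j x - F (r k) x)} < (1/2)^k" by blast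
 have "r k <= r (Suc k)" for k using r(1) by (simp add: strict_mono_Suc_iff less_imp_le)
 then have "AE x in m. summable (%k. F (r (Suc k)) x - F (r k) x)" by (intro Borel_Cantelli_level r(2)) auto
 then have conv: "AE x in m. convergent (%k. F (r k) x)"
 proof eventually_elim
  case (elim x)
  then show ?case by (rule convergent_telescope)
 qed
 define f where "f x = lim (%k. F (r k) x)" for x
 have f[measurable]: "f : borel_measurable m" unfolding f_def by (rule borel_measurable_lim_metric) simp
 have "AE x in m. (%k. F (r k) x) \<longlonglongrightarrow> f x" using conv by eventually_elim (simp add: f_def convergent_LIMSEQ_iff)
 then have s1: "L0_tendsto m (%k. F (r k)) f" by (intro AE_imp_L0_tendsto) auto
 have s2: "L0_tendsto m (%k x. F k x - F (r k) x) (%x. 0)"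
  using cau[unfolded L0_null2_def, rule_format, of "%k. k" r] filterlim_subseq[OF r(1)] by (simp add: filterlim_ident)
 have "L0_tendsto m F f"
 proof (rule L0_transfer[OF s1 s2, of F f "%_ _. True"])
  fix x and s :: "nat => nat" assume "(%k. F (r (s k)) x) \<longlonglongrightarrow> f x" "(%k. F (s k) x - F (r (s k)) x) \<longlonglongrightarrow> 0"
  from tendsto_add[OF this] show "(%k. F (s k) x) \<longlonglongrightarrow> f x" by simp
 qed auto
 with f show ?thesis by blast
qed

end

text \<open>The abstract completion behind the cotangent module and its tensor square: elements with a
  pointwise positive semidefinite inner product, and sequences that are Cauchy in measure.  Such a sequence
  \<open>u\<close> stands for its limit, and \<open>lim u v\<close> is the pointwise inner product of two limits.\<close>

locale L0_completion = mms +
 fixes inn :: "'e => 'e => 'a => real" and dif :: "'e => 'e => 'e" and Car :: "'e set"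
 assumes inn_meas: "u : Car ==> v : Car ==> inn u v : borel_measurable m"
  and dif_Car: "u : Car ==> v : Car ==> dif u v : Car"
  and dif_left: "inn (dif u v) w x = inn u w x - inn v w x"
  and dif_right: "inn w (dif u v) x = inn w u x - inn w v x"
  and inn_sym: "u : Car ==> v : Car ==> AE x in m. inn u v x = inn v u x"
  and inn_nonneg: "u : Car ==> AE x in m. 0 <= inn u u x"
  and inn_CS: "u : Car ==> v : Car ==> AE x in m. (inn u v x)^2 <= inn u u x * inn v v x"
begin

abbreviation sqn :: "'e => 'a => real" where "sqn u \<equiv> inn u u"

definition Cau :: "(nat => 'e) => bool" where
 "Cau u \<longleftrightarrow> (ALL n. u n : Car) & L0_null2 m (%i j. sqn (dif (u i) (u j)))"

definition lim :: "(nat => 'e) => (nat => 'e) => 'a => real" where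
 "lim u v = L0_lim m (%n. inn (u n) (v n))"

lemma CauD: "Cau u ==> u n : Car"
 "Cau u ==> filterlim p at_top sequentially ==> filterlim q at_top sequentially ==> L0_tendsto m (%n. sqn (dif (u (p n)) (u (q n)))) (%x. 0)"
 by (auto simp: Cau_def L0_null2_def)

lemma Cau_const: "c : Car ==> Cau (%n. c)"
 by (simp add: Cau_def L0_null2_def L0_tendsto_def dif_left dif_right)

lemma norm_diff:
 assumes "u : Car" "v : Car"
 shows "AE x in m. (sqrt (abs (sqn u x)) - sqrt (abs (sqn v x)))^2 <= sqn (dif u v) x"
 using inn_CS[OF assms] inn_sym[OF assms] inn_nonneg[OF assms(1)] inn_nonneg[OF assms(2)]
proof eventually_elim
 case (elim x)
 from elim(1) have "sqrt ((inn u v x)^2) <= sqrt (sqn u x * sqn v x)" by (rule real_sqrt_le_mono)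
 then show ?case using elim(2-4) by (simp add: power2_diff dif_left dif_right real_sqrt_mult abs_le_iff)
qed

text \<open>The difference of both sides is the squared norm of \<open>(a - a') + (b - b')\<close>.\<close>

lemma dif_parallelogram:
 assumes "a : Car" "a' : Car" "b : Car" "b' : Car"
 shows "AE x in m. sqn (dif (dif a b) (dif a' b')) x <= 2 * sqn (dif a a') x + 2 * sqn (dif b b') x"
proof -
 have C: "dif (dif a a') (dif b' b) : Car" "dif a a' : Car" "dif b b' : Car" by (intro dif_Car assms)+
 from inn_nonneg[OF C(1)] inn_sym[OF C(2,3)] show ?thesis by eventually_elim (simp add: dif_left dif_right)
qed

lemma Cau_bound:
 assumes u: "Cau u" and v: "Cau v" and w: "!!n. w n : Car"
  and le: "!!i j. AE x in m. sqn (dif (w i) (w j)) x <= 2 * sqn (dif (u i) (u j)) x + 2 * sqn (dif (v i) (v j)) x"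
 shows "Cau w"
 unfolding Cau_def L0_null2_def
proof (intro conjI allI impI w)
 fix p q :: "nat => nat" assume pq: "filterlim p at_top sequentially" "filterlim q at_top sequentially"
 have C: "dif (a i) (a j) : Car" if "!!n. a n : Car" for a :: "nat => 'e" and i j by (intro dif_Car that)
 note C = C[of u, OF CauD(1)[OF u]] C[of v, OF CauD(1)[OF v]] C[of w, OF w]
 let ?R = "%n x. 0 <= sqn (dif (w (p n)) (w (q n))) x &
  sqn (dif (w (p n)) (w (q n))) x <= 2 * sqn (dif (u (p n)) (u (q n))) x + 2 * sqn (dif (v (p n)) (v (q n))) x"
 show "L0_tendsto m (%n. sqn (dif (w (p n)) (w (q n)))) (%x. 0)"
 proof (rule L0_transfer[OF CauD(2)[OF u pq] CauD(2)[OF v pq], where R="?R"])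
  show "AE x in m. ?R n x" for n using le inn_nonneg[OF C(3)] by (auto elim: AE_mp)
  fix x and r :: "nat => nat" assume R: "!!n. ?R n x" and lim: "(%k. sqn (dif (u (p (r k))) (u (q (r k)))) x) \<longlonglongrightarrow> 0"
   "(%k. sqn (dif (v (p (r k))) (v (q (r k)))) x) \<longlonglongrightarrow> 0"
  from tendsto_add[OF lim[THEN tendsto_mult_right_zero[where c=2]]]
  have "(%k. 2 * sqn (dif (u (p (r k))) (u (q (r k)))) x + 2 * sqn (dif (v (p (r k))) (v (q (r k)))) x) \<longlonglongrightarrow> 0" by simp
  from tendsto_sandwich[OF _ _ tendsto_const this] R show "(%k. sqn (dif (w (p (r k))) (w (q (r k)))) x) \<longlonglongrightarrow> 0" by auto
 qed (auto intro: inn_meas C)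
qed

lemma Cau_dif: assumes u: "Cau u" and v: "Cau v" shows "Cau (%n. dif (u n) (v n))"
 by (rule Cau_bound[OF u v]) (intro dif_Car dif_parallelogram CauD(1)[OF u] CauD(1)[OF v])+

lemma Cau_norm_tendsto:
 assumes u: "Cau u"
 shows "EX f. f : borel_measurable m & L0_tendsto m (%n. sqn (u n)) f"
proof -
 let ?N = "%n x. sqrt (abs (sqn (u n) x))"
 have meas[measurable]: "inn (u i) (u j) : borel_measurable m" "sqn (dif (u i) (u j)) : borel_measurable m" for i j
  by (intro inn_meas dif_Car CauD[OF u])+
 have "L0_null2 m (%i j x. ?N i x - ?N j x)" unfolding L0_null2_def
 proof (intro allI impI)
  fix p q :: "nat => nat" assume pq: "filterlim p at_top sequentially" "filterlim q at_top sequentially"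
  show "L0_tendsto m (%n x. ?N (p n) x - ?N (q n) x) (%x. 0)"
  proof (rule L0_transfer[OF CauD(2)[OF u pq] CauD(2)[OF u pq], where R="%n x. (?N (p n) x - ?N (q n) x)^2 <= sqn (dif (u (p n)) (u (q n))) x"])
   fix x and r :: "nat => nat" assume R: "!!n. (?N (p n) x - ?N (q n) x)^2 <= sqn (dif (u (p n)) (u (q n))) x"
    and l: "(%k. sqn (dif (u (p (r k))) (u (q (r k)))) x) \<longlonglongrightarrow> 0"
   show "(%k. ?N (p (r k)) x - ?N (q (r k)) x) \<longlonglongrightarrow> 0" by (rule sq_bound_tendsto[OF _ l]) (simp add: R)
  qed (auto intro: norm_diff CauD(1)[OF u])
 qed
 from L0_complete[OF _ this] obtain f where f[measurable]: "f : borel_measurable m" and L: "L0_tendsto m ?N f" by auto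
 have "L0_tendsto m (%n. sqn (u n)) (%x. (f x)^2)"
 proof (rule L0_transfer[OF L L, where R="%n x. 0 <= sqn (u n) x"])
  fix x and r :: "nat => nat" assume "!!n. 0 <= sqn (u n) x" and "(%k. ?N (r k) x) \<longlonglongrightarrow> f x"
  from tendsto_power[OF this(2), of 2] this(1) show "(%k. sqn (u (r k)) x) \<longlonglongrightarrow> (f x)^2" by simp
 qed (auto intro: inn_nonneg CauD(1)[OF u])
 then show ?thesis by (intro exI[of _ "%x. (f x)^2"]) auto
qed

text \<open>The norms converge, hence by polarization so do the inner products.\<close>

lemma lim_tendsto:
 assumes u: "Cau u" and v: "Cau v"
 shows "lim u v : borel_measurable m" "L0_tendsto m (%n. inn (u n) (v n)) (lim u v)"
proof -
 note C = CauD(1)[OF u] CauD(1)[OF v]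
 have [measurable]: "sqn (u n) : borel_measurable m" "sqn (v n) : borel_measurable m" "sqn (dif (u n) (v n)) : borel_measurable m" "inn (u n) (v n) : borel_measurable m" for n
  by (intro inn_meas dif_Car C)+
 obtain f g h where [measurable]: "f : borel_measurable m" "g : borel_measurable m" "h : borel_measurable m" and L: "L0_tendsto m (%n. sqn (u n)) f"
  "L0_tendsto m (%n. sqn (v n)) g" "L0_tendsto m (%n. sqn (dif (u n) (v n))) h"
  using Cau_norm_tendsto[OF u] Cau_norm_tendsto[OF v] Cau_norm_tendsto[OF Cau_dif[OF u v]] by blast
 have fg: "L0_tendsto m (%n x. sqn (u n) x + sqn (v n) x) (%x. f x + g x)"
  by (rule L0_transfer[OF L(1,2), where R="%_ _. True"]) (auto intro: tendsto_add)
 have "L0_tendsto m (%n. inn (u n) (v n)) (%x. (f x + g x - h x) / 2)"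
 proof (rule L0_transfer[OF fg L(3), where R="%n x. inn (u n) (v n) x = inn (v n) (u n) x"])
  fix x and r :: "nat => nat" assume sym: "!!n. inn (u n) (v n) x = inn (v n) (u n) x"
   and lim: "(%k. sqn (u (r k)) x + sqn (v (r k)) x) \<longlonglongrightarrow> f x + g x" "(%k. sqn (dif (u (r k)) (v (r k))) x) \<longlonglongrightarrow> h x"
  from tendsto_divide[OF tendsto_diff[OF lim] tendsto_const, of 2] show "(%k. inn (u (r k)) (v (r k)) x) \<longlonglongrightarrow> (f x + g x - h x) / 2"
   by (simp add: dif_left dif_right sym)
 qed (auto intro: inn_sym C)
 then have "EX k. k : borel_measurable m & L0_tendsto m (%n. inn (u n) (v n)) k" by (intro exI[of _ "%x. (f x + g x - h x) / 2"]) auto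
 from someI_ex[OF this] show "lim u v : borel_measurable m" "L0_tendsto m (%n. inn (u n) (v n)) (lim u v)"
  by (auto simp: lim_def L0_lim_def)
qed

text \<open>Along a common subsequence the inner products converge almost everywhere.  Three pairs are enough for the
  Cauchy--Schwarz inequality and for linear relations.\<close>

lemma lim_closed:
 assumes C: "Cau u" "Cau v" "Cau u'" "Cau v'" "Cau u''" "Cau v''"
  and R: "!!n. AE x in m. R x (inn (u n) (v n) x) (inn (u' n) (v' n) x) (inn (u'' n) (v'' n) x)"
  and cl: "!!x a b c a' b' c'. a \<longlonglongrightarrow> a' ==> b \<longlonglongrightarrow> b' ==> c \<longlonglongrightarrow> c' ==> (!!n::nat. R x (a n) (b n) (c n)) ==> R x a' b' c'"
 shows "AE x in m. R x (lim u v x) (lim u' v' x) (lim u'' v'' x)"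
proof -
 note L = lim_tendsto[OF C(1,2)] lim_tendsto[OF C(3,4)] lim_tendsto[OF C(5,6)]
 have M: "inn (a n) (b n) : borel_measurable m" if "Cau a" "Cau b" for a b n by (intro inn_meas CauD(1) that)
 obtain r where "AE x in m. (%k. inn (u (r k)) (v (r k)) x) \<longlonglongrightarrow> lim u v x & (%k. inn (u' (r k)) (v' (r k)) x) \<longlonglongrightarrow> lim u' v' x
   & (%k. inn (u'' (r k)) (v'' (r k)) x) \<longlonglongrightarrow> lim u'' v'' x"
  using L0_subseq3[OF L(2,4,6) M[OF C(1,2)] L(1) M[OF C(3,4)] L(3) M[OF C(5,6)] L(5)] by blast
 moreover have "AE x in m. ALL n. R x (inn (u n) (v n) x) (inn (u' n) (v' n) x) (inn (u'' n) (v'' n) x)" using R by (simp add: AE_all_countable)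
 ultimately show ?thesis
 proof eventually_elim
  case (elim x)
  show ?case by (rule cl[OF elim(1)[THEN conjunct1] elim(1)[THEN conjunct2, THEN conjunct1] elim(1)[THEN conjunct2, THEN conjunct2]]) (simp add: elim(2))
 qed
qed

lemma lim_lincomb:
 assumes "Cau u" "Cau v" "Cau u'" "Cau v'" "Cau u''" "Cau v''"
  and "!!n. AE x in m. inn (u n) (v n) x = a x * inn (u' n) (v' n) x + b x * inn (u'' n) (v'' n) x"
 shows "AE x in m. lim u v x = a x * lim u' v' x + b x * lim u'' v'' x"
proof (rule lim_closed[OF assms(1-6), where R="%x p q r. p = a x * q + b x * r", OF assms(7)])
 fix x and p q r :: "nat => real" and p' q' r'
 assume l: "p \<longlonglongrightarrow> p'" "q \<longlonglongrightarrow> q'" "r \<longlonglongrightarrow> r'" and "!!n. p n = a x * q n + b x * r n"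
 then have "p = (%n. a x * q n + b x * r n)" by auto
 then show "p' = a x * q' + b x * r'" by (intro LIMSEQ_unique[OF l(1)]) (auto intro!: tendsto_intros l)
qed

lemma lim_AE_cong:
 assumes "Cau u" "Cau v" "Cau u'" "Cau v'" "!!n. AE x in m. inn (u n) (v n) x = inn (u' n) (v' n) x"
 shows "AE x in m. lim u v x = lim u' v' x"
 using lim_lincomb[OF assms(1-4,3,4), of "%x. 1" "%x. 0"] assms(5) by simp

lemma lim_unique:
 assumes "Cau u" "Cau v" "L0_tendsto m (%n. inn (u n) (v n)) f" "f : borel_measurable m"
 shows "AE x in m. lim u v x = f x"
 by (rule L0_tendsto_unique[OF _ lim_tendsto(2,1)[OF assms(1,2)] assms(3,4)]) (intro inn_meas CauD assms)

lemma lim_const: "c : Car ==> d : Car ==> AE x in m. lim (%n. c) (%n. d) x = inn c d x"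
 by (intro lim_unique Cau_const inn_meas) (simp_all add: L0_tendsto_def)

lemma lim_nonneg: "Cau u ==> AE x in m. 0 <= lim u u x"
 by (rule lim_closed[where R="%x a b c. 0 <= a"]) (auto intro: inn_nonneg CauD(1) LIMSEQ_le_const)

lemma lim_CS:
 assumes u: "Cau u" and v: "Cau v"
 shows "AE x in m. (lim u v x)^2 <= lim u u x * lim v v x"
 by (rule lim_closed[OF u v u u v v, where R="%x a b c. a^2 <= b * c"])
  (auto intro: inn_CS CauD(1)[OF u] CauD(1)[OF v] LIMSEQ_le tendsto_power tendsto_mult)

lemma lim_dif:
 assumes "Cau u" "Cau v" "Cau w"
 shows "AE x in m. lim (%n. dif (u n) (v n)) w x = lim u w x - lim v w x"
  "AE x in m. lim w (%n. dif (u n) (v n)) x = lim w u x - lim w v x"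
 using lim_lincomb[OF Cau_dif[OF assms(1,2)] assms(3,1,3,2,3), of "%x. 1" "%x. -1"]
  lim_lincomb[OF assms(3) Cau_dif[OF assms(1,2)] assms(3,1,3,2), of "%x. 1" "%x. -1"] by (simp_all add: dif_left dif_right)

lemma lim_eq_if_dif_zero:
 assumes u: "Cau u" and v: "Cau v" and w: "Cau w"
  and z: "AE x in m. lim (%n. dif (u n) (v n)) (%n. dif (u n) (v n)) x = 0"
 shows "AE x in m. lim u w x = lim v w x"
 using z lim_CS[OF Cau_dif[OF u v] w] lim_dif(1)[OF u v w] by eventually_elim simp

text \<open>Let the first index tend to infinity in the Cauchy condition.\<close>

lemma Cau_approx:
 assumes u: "Cau u"
 shows "L0_tendsto m (%k. lim (%n. dif (u n) (u k)) (%n. dif (u n) (u k))) (%x. 0)"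
 unfolding L0_tendsto_def
proof (intro ballI impI allI)
 fix B :: "'a set" and \<epsilon> :: real assume B: "B : sets borel" "bounded B" and e: "\<epsilon> > 0"
 let ?q = "%n k. sqn (dif (u n) (u k))"
 let ?l = "%k. lim (%n. dif (u n) (u k)) (%n. dif (u n) (u k))"
 have C: "Cau (%n. dif (u n) (u k))" for k by (intro Cau_dif u Cau_const CauD(1)[OF u])
 have qm: "?q n k : borel_measurable m" for n k by (intro inn_meas dif_Car CauD(1)[OF u])
 show "(%k. measure m {x\<in>B. \<epsilon> <= abs (?l k x - 0)}) \<longlonglongrightarrow> 0"
 proof (rule LIMSEQ_I)
  fix \<delta> :: real assume d: "\<delta> > 0"
  from u have "L0_null2 m ?q" by (simp add: Cau_def)
  from this[unfolded L0_null2_iff, rule_format, OF B, of "\<epsilon>/2" "\<delta>/2"] e d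
  obtain N where N: "!!i j. i >= N ==> j >= N ==> measure m {x\<in>B. \<epsilon>/2 <= abs (?q i j x)} < \<delta>/2" by auto
  have "measure m {x\<in>B. \<epsilon> <= abs (?l k x)} < \<delta>" if k: "k >= N" for k
  proof -
   have "(%n. measure m {x\<in>B. \<epsilon>/2 <= abs (?q n k x - ?l k x)}) \<longlonglongrightarrow> 0"
    using lim_tendsto(2)[OF C C, of k k] B e unfolding L0_tendsto_def by (meson half_gt_zero)
   from order_tendstoD(2)[OF this, of "\<delta>/2"] d obtain n0 where n0: "!!n. n >= n0 ==> measure m {x\<in>B. \<epsilon>/2 <= abs (?q n k x - ?l k x)} < \<delta>/2"
    by (auto simp: eventually_sequentially)
   let ?n = "max n0 N"
   have "measure m {x\<in>B. \<epsilon> <= abs (?l k x)} <= measure m {x\<in>B. \<epsilon>/2 <= abs (?q ?n k x)} + measure m {x\<in>B. \<epsilon>/2 <= abs (?q ?n k x - ?l k x)}"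
   proof (rule level_union[OF lim_tendsto(1)[OF C C] qm _ B])
    show "(%x. ?q ?n k x - ?l k x) : borel_measurable m" by (intro borel_measurable_diff qm lim_tendsto C)
    show "\<epsilon>/2 <= abs (?q ?n k x) | \<epsilon>/2 <= abs (?q ?n k x - ?l k x)" if "\<epsilon> <= abs (?l k x)" for x using that by linarith
   qed
   with N[of ?n k] n0[of ?n] k show ?thesis by simp
  qed
  then show "EX N. ALL k>=N. norm (measure m {x\<in>B. \<epsilon> <= abs (?l k x - 0)} - 0) < \<delta>" by (intro exI[of _ N]) auto
 qed
qed

lemma lim_approx_right:
 assumes u: "Cau u" and w: "Cau w"
 shows "L0_tendsto m (%k. lim w (%n. u k)) (lim w u)"
proof -
 let ?l = "%k. lim (%n. dif (u n) (u k)) (%n. dif (u n) (u k))"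
 have K: "Cau (%n. u k)" for k by (intro Cau_const CauD(1)[OF u])
 have C: "Cau (%n. dif (u n) (u k))" for k by (intro Cau_dif u K)
 show ?thesis
 proof (rule L0_transfer[OF Cau_approx[OF u] Cau_approx[OF u], where R="%k x. (lim w (%n. u k) x - lim w u x)^2 <= lim w w x * ?l k x"])
  show "AE x in m. (lim w (%n. u k) x - lim w u x)^2 <= lim w w x * ?l k x" for k
   using lim_dif(2)[OF u K w, of k] lim_CS[OF w C, of k] by eventually_elim (simp add: power2_commute)
  fix x and r :: "nat => nat" assume "!!k. (lim w (%n. u k) x - lim w u x)^2 <= lim w w x * ?l k x" and "(%k. ?l (r k) x) \<longlonglongrightarrow> 0"
  then show "(%k. lim w (%n. u (r k)) x) \<longlonglongrightarrow> lim w u x"       by (intro sq_bound_tendsto[of _ "lim w u x" "%k. lim w w x * ?l (r k) x"] tendsto_mult_right_zero)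
 qed (auto intro: lim_tendsto C K u w)
qed

end

context mms
begin

lemma Markov_level:
 assumes q: "integrable m q" "AE x in m. 0 <= q x" and B: "B : sets borel" "bounded B" and e: "\<epsilon> > 0"
 shows "\<epsilon> * measure m {x\<in>B. \<epsilon> <= abs (q x)} <= (LINT x|m. q x)"
proof -
 have qm: "q : borel_measurable m" using q(1) by (rule borel_measurable_integrable)
 let ?L = "{x\<in>B. \<epsilon> <= abs (q x)}"
 have "(LINT x|m. \<epsilon> * indicator ?L x) <= (LINT x|m. q x)"
 proof (rule integral_mono_AE)
  show "integrable m (%x. \<epsilon> * indicator ?L x :: real)" using level_set[OF qm B] by (intro integrable_mult_right) simp
  show "AE x in m. \<epsilon> * indicator ?L x <= q x" using q(2) by eventually_elim (auto simp: indicator_def)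
 qed (rule q)
 then show ?thesis using level_set(1)[OF qm B] by (simp add: space_m)
qed

end

section \<open>The cotangent module and its tensor square\<close>

text \<open>Coordinates at the point \<open>x\<close> of simple forms and simple tensors, for a representation of \<open>G f h x\<close> as
  \<open>\<Sum>k. \<phi> f k * \<phi> h k\<close>.  They reduce pointwise statements about pairings to finite sums.\<close>

definition fvec :: "(('a => real) => nat => real) => 'a => 'a simple_form => nat => real" where
 "fvec \<phi> x v k = (\<Sum>(a, f)\<leftarrow>v. a x * \<phi> f k)"

definition ten :: "(('a => real) => nat => real) => 'a => 'a simple_tensor => nat \<times> nat => real" where
 "ten \<phi> x S p = (\<Sum>(a, f, h)\<leftarrow>S. a x * \<phi> f (fst p) * \<phi> h (snd p))"

lemma fvec_Cons: "fvec \<phi> x ((a, f) # v) k = a x * \<phi> f k + fvec \<phi> x v k"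
 by (simp add: fvec_def)

lemma ten_Cons: "ten \<phi> x ((a, f, h) # S) p = a x * \<phi> f (fst p) * \<phi> h (snd p) + ten \<phi> x S p"
 by (simp add: ten_def)

lemma sform_inner_simps:
 "sform_inner m [] w x = 0" "sform_inner m v [] x = 0"
 "sform_inner m ((a, f) # v) w x = a x * sform_inner m [(%x. 1, f)] w x + sform_inner m v w x"
 "sform_inner m v ((b, h) # w) x = b x * sform_inner m v [(%x. 1, h)] x + sform_inner m v w x"
 "sform_inner m [(%x. 1, f)] [(%x. 1, h)] x = grad_inner m f h x"
proof -
 show "sform_inner m v [] x = 0" by (induction v) (auto simp: sform_inner_def)
 show "sform_inner m ((a, f) # v) w x = a x * sform_inner m [(%x. 1, f)] w x + sform_inner m v w x"
  by (induction w) (auto simp: sform_inner_def algebra_simps)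
 show "sform_inner m v ((b, h) # w) x = b x * sform_inner m v [(%x. 1, h)] x + sform_inner m v w x"
  by (induction v) (auto simp: sform_inner_def algebra_simps)
qed (auto simp: sform_inner_def)

lemma sform_inner_append:
 "sform_inner m (v @ v') w x = sform_inner m v w x + sform_inner m v' w x"
 "sform_inner m w (v @ v') x = sform_inner m w v x + sform_inner m w v' x"
proof -
 show "sform_inner m (v @ v') w x = sform_inner m v w x + sform_inner m v' w x" by (simp add: sform_inner_def)
 show "sform_inner m w (v @ v') x = sform_inner m w v x + sform_inner m w v' x"
  by (induction w) (auto simp: sform_inner_def)
qed

lemma sform_inner_map:
 assumes "!!a f. t (a, f) = (%x. c x * a x, f)"
 shows "sform_inner m (map t v) w x = c x * sform_inner m v w x" "sform_inner m w (map t v) x = c x * sform_inner m w v x"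
proof -
 show "sform_inner m (map t v) w x = c x * sform_inner m v w x"
 proof (induction v)
  case (Cons p v)
  obtain a f where p: "p = (a, f)" by force
  show ?case using Cons by (simp add: p assms sform_inner_simps(3)[of m _ _ v] sform_inner_simps(3)[of m _ _ "map t v"] distrib_left)
 qed (simp add: sform_inner_simps)
 show "sform_inner m w (map t v) x = c x * sform_inner m w v x"
 proof (induction v)
  case (Cons p v)
  obtain a f where p: "p = (a, f)" by force
  show ?case using Cons by (simp add: p assms sform_inner_simps(4)[of m _ _ _ v] sform_inner_simps(4)[of m _ _ _ "map t v"] distrib_left)
 qed (simp add: sform_inner_simps)
qed

lemma sform_inner_diff:
 "sform_inner m (sform_diff u v) w x = sform_inner m u w x - sform_inner m v w x"
 "sform_inner m w (sform_diff u v) x = sform_inner m w u x - sform_inner m w v x"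
 using sform_inner_map[of "%(a, f). (%x. - a x, f)" "%x. -1"]
 by (simp_all add: sform_diff_def sform_inner_append)

lemma sform_gram:
 assumes G: "ALL f:A. ALL h:A. grad_inner m f h x = (\<Sum>k<N. \<phi> f k * \<phi> h k)" and v: "snd ` set v \<subseteq> A" and w: "snd ` set w \<subseteq> A"
 shows "sform_inner m v w x = (\<Sum>k<N. fvec \<phi> x v k * fvec \<phi> x w k)"
 using v
proof (induction v)
 case Nil
 show ?case by (simp add: sform_inner_simps fvec_def)
next
 case (Cons p v)
 obtain a f where p: "p = (a, f)" by force
 have f: "f : A" using Cons.prems by (auto simp: p)
 have "sform_inner m [(%x. 1, f)] w x = (\<Sum>k<N. \<phi> f k * fvec \<phi> x w k)" using w
 proof (induction w)
  case (Cons q w)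
  obtain b h where q: "q = (b, h)" by force
  show ?case using Cons G f
   by (simp add: q sform_inner_simps(4)[of m _ _ _ w] sform_inner_simps(5) fvec_Cons algebra_simps sum.distrib sum_distrib_left)
 qed (simp add: sform_inner_simps fvec_def)
 then show ?case using Cons
  by (simp add: p sform_inner_simps(3)[of m _ _ v] fvec_Cons algebra_simps sum.distrib sum_distrib_left)
qed

lemma stensor_inner_simps:
 "stensor_inner m [] T x = 0" "stensor_inner m S [] x = 0"
 "stensor_inner m ((a, f, h) # S) T x = a x * stensor_inner m [(%x. 1, f, h)] T x + stensor_inner m S T x"
 "stensor_inner m S ((b, u, v) # T) x = b x * stensor_inner m S [(%x. 1, u, v)] x + stensor_inner m S T x"
 "stensor_inner m [(%x. 1, f, h)] [(%x. 1, u, v)] x = grad_inner m f u x * grad_inner m h v x"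
proof -
 show "stensor_inner m S [] x = 0" by (induction S) (auto simp: stensor_inner_def)
 show "stensor_inner m ((a, f, h) # S) T x = a x * stensor_inner m [(%x. 1, f, h)] T x + stensor_inner m S T x"
  by (induction T) (auto simp: stensor_inner_def algebra_simps)
 show "stensor_inner m S ((b, u, v) # T) x = b x * stensor_inner m S [(%x. 1, u, v)] x + stensor_inner m S T x"
  by (induction S) (auto simp: stensor_inner_def algebra_simps)
qed (auto simp: stensor_inner_def)

lemma stensor_inner_append:
 "stensor_inner m (S @ S') T x = stensor_inner m S T x + stensor_inner m S' T x"
 "stensor_inner m T (S @ S') x = stensor_inner m T S x + stensor_inner m T S' x"
proof -
 show "stensor_inner m (S @ S') T x = stensor_inner m S T x + stensor_inner m S' T x" by (simp add: stensor_inner_def)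
 show "stensor_inner m T (S @ S') x = stensor_inner m T S x + stensor_inner m T S' x"
  by (induction T) (auto simp: stensor_inner_def)
qed

lemma stensor_inner_scale:
 "stensor_inner m (stensor_scale c S) T x = c * stensor_inner m S T x"
 "stensor_inner m T (stensor_scale c S) x = c * stensor_inner m T S x"
proof -
 show "stensor_inner m (stensor_scale c S) T x = c * stensor_inner m S T x"
 proof (induction S)
  case (Cons p S)
  obtain a f h where p: "p = (a, f, h)" by (cases p) auto
  show ?case using Cons
   by (simp add: p stensor_scale_def stensor_inner_simps(3)[of m _ _ _ S] stensor_inner_simps(3)[of m _ _ _ "map _ S"] distrib_left)
 qed (simp add: stensor_scale_def stensor_inner_simps)
 show "stensor_inner m T (stensor_scale c S) x = c * stensor_inner m T S x"
 proof (induction S)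
  case (Cons p S)
  obtain a f h where p: "p = (a, f, h)" by (cases p) auto
  show ?case using Cons
   by (simp add: p stensor_scale_def stensor_inner_simps(4)[of m _ _ _ _ S] stensor_inner_simps(4)[of m _ _ _ _ "map _ S"] distrib_left)
 qed (simp add: stensor_scale_def stensor_inner_simps)
qed

lemma stensor_inner_diff:
 "stensor_inner m (stensor_diff S S') T x = stensor_inner m S T x - stensor_inner m S' T x"
 "stensor_inner m T (stensor_diff S S') x = stensor_inner m T S x - stensor_inner m T S' x"
 by (simp_all add: stensor_diff_def stensor_inner_append stensor_inner_scale)

lemma stensor_gram:
 assumes G: "ALL f:A. ALL h:A. grad_inner m f h x = (\<Sum>k<N. \<phi> f k * \<phi> h k)"
  and S: "\<forall>(a, f, h)\<in>set S. f : A & h : A" and T: "\<forall>(a, f, h)\<in>set T. f : A & h : A"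
 shows "stensor_inner m S T x = (\<Sum>p\<in>{..<N} \<times> {..<N}. ten \<phi> x S p * ten \<phi> x T p)"
 using S
proof (induction S)
 case Nil
 show ?case by (simp add: stensor_inner_simps ten_def)
next
 case (Cons p S)
 obtain a f h where p: "p = (a, f, h)" by (cases p) auto
 have f: "f : A" "h : A" using Cons.prems by (auto simp: p)
 have "stensor_inner m [(%x. 1, f, h)] T x = (\<Sum>p\<in>{..<N} \<times> {..<N}. \<phi> f (fst p) * \<phi> h (snd p) * ten \<phi> x T p)" using T
 proof (induction T)
  case (Cons q T)
  obtain b u v where q: "q = (b, u, v)" by (cases q) auto
  have "grad_inner m f u x * grad_inner m h v x = (\<Sum>p\<in>{..<N} \<times> {..<N}. (\<phi> f (fst p) * \<phi> u (fst p)) * (\<phi> h (snd p) * \<phi> v (snd p)))"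
   using G f Cons.prems by (simp add: q sum_product sum.cartesian_product case_prod_unfold)
  then show ?case using Cons
   by (simp add: q stensor_inner_simps(4)[of m _ _ _ _ T] stensor_inner_simps(5) ten_Cons algebra_simps sum.distrib sum_distrib_left)
 qed (simp add: stensor_inner_simps ten_def)
 then show ?case using Cons
  by (simp add: p stensor_inner_simps(3)[of m _ _ _ S] ten_Cons algebra_simps sum.distrib sum_distrib_left)
qed

definition sprod :: "'a simple_form => 'a simple_form => 'a simple_tensor" where
 "sprod v w = concat (map (%(a, f). map (%(b, h). (%x. a x * b x, f, h)) w) v)"

lemma tensor_prod_sprod: "tensor_prod \<omega> \<eta> = (%n. sprod (\<omega> n) (\<eta> n))"
 by (simp add: tensor_prod_def sprod_def)

lemma ten_sprod: "ten \<phi> x (sprod v w) p = fvec \<phi> x v (fst p) * fvec \<phi> x w (snd p)"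
proof (induction v)
 case (Cons q v)
 obtain a f where q: "q = (a, f)" by force
 have "ten \<phi> x (map (%(b, h). (%x. a x * b x, f, h)) w) p = a x * \<phi> f (fst p) * fvec \<phi> x w (snd p)"
  by (induction w) (auto simp: ten_def fvec_def algebra_simps)
 moreover have "ten \<phi> x (S @ T) p = ten \<phi> x S p + ten \<phi> x T p" for S T by (simp add: ten_def)
 ultimately show ?case using Cons by (simp add: q sprod_def fvec_def distrib_right)
qed (simp add: ten_def sprod_def fvec_def)

lemma fvec_diff: "fvec \<phi> x (sform_diff v w) k = fvec \<phi> x v k - fvec \<phi> x w k"
proof -
 have "fvec \<phi> x (map (%(a, f). (%x. - a x, f)) w) k = - fvec \<phi> x w k" by (induction w) (auto simp: fvec_def)
 then show ?thesis by (simp add: fvec_def sform_diff_def)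
qed

lemma ten_diff: "ten \<phi> x (stensor_diff S T) p = ten \<phi> x S p - ten \<phi> x T p"
proof -
 have "ten \<phi> x (stensor_scale (-1) T) p = - ten \<phi> x T p" by (induction T) (auto simp: ten_def stensor_scale_def)
 then show ?thesis by (simp add: ten_def stensor_diff_def)
qed

lemma coeff_fun_meas: "a : coeff_fun m ==> a : borel_measurable m" by (simp add: coeff_fun_def)

lemma coeff_fun_bound: "a : coeff_fun m ==> EX C. ALL x. abs (a x) <= C"
 by (auto simp: coeff_fun_def bounded_iff)

lemma coeff_fun_mult: assumes "a : coeff_fun m" "b : coeff_fun m" shows "(%x. a x * b x) : coeff_fun m"
proof -
 obtain C C' where C: "ALL x. abs (a x) <= C" "ALL x. abs (b x) <= C'" using assms[THEN coeff_fun_bound] by auto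
 have "abs (a x * b x) <= C * C'" for x unfolding abs_mult
 proof (rule mult_mono)
  show "0 <= C" using C(1) abs_ge_zero order_trans by blast
 qed (use C in auto)
 then show ?thesis using assms by (auto simp: coeff_fun_def bounded_iff intro!: borel_measurable_times)
qed

lemma coeff_fun_cmult: "a : coeff_fun m ==> (%x. c * a x) : coeff_fun m"
 by (rule coeff_fun_mult) (auto simp: coeff_fun_def)

lemma sform_diff_Car: "v : simple_forms m ==> w : simple_forms m ==> sform_diff v w : simple_forms m"
 using coeff_fun_cmult[of _ m "-1"] by (fastforce simp: simple_forms_def sform_diff_def)

lemma stensor_scale_Car: "S : simple_tensors m ==> stensor_scale c S : simple_tensors m"
 using coeff_fun_cmult by (fastforce simp: simple_tensors_def stensor_scale_def)

lemma stensor_diff_Car: "S : simple_tensors m ==> T : simple_tensors m ==> stensor_diff S T : simple_tensors m"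
 using stensor_scale_Car[of T m "-1"] by (auto simp: simple_tensors_def stensor_diff_def)

lemma sprod_Car: "v : simple_forms m ==> w : simple_forms m ==> sprod v w : simple_tensors m"
 by (fastforce simp: simple_forms_def simple_tensors_def sprod_def intro!: coeff_fun_mult)

lemma differential_Car: "f : H12 m ==> [(%x. 1, f)] : simple_forms m"
 by (simp add: simple_forms_def coeff_fun_def)

context ih_space
begin

text \<open>Only finitely many functions occur in finitely many simple forms and tensors.\<close>

lemma simple_gram:
 assumes "finite V" "V \<subseteq> simple_forms m" "finite W" "W \<subseteq> simple_tensors m"
 shows "AE x in m. EX \<phi> N. (ALL v:V. ALL w:V. sform_inner m v w x = (\<Sum>k<N. fvec \<phi> x v k * fvec \<phi> x w k)) &
  (ALL S:W. ALL T:W. stensor_inner m S T x = (\<Sum>p\<in>{..<N} \<times> {..<N}. ten \<phi> x S p * ten \<phi> x T p))"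
proof -
 let ?A = "(\<Union>v\<in>V. snd ` set v) \<union> (\<Union>S\<in>W. (%(a, f, h). f) ` set S \<union> (%(a, f, h). h) ` set S)"
 have "finite ?A" using assms by auto
 moreover have "?A \<subseteq> H12 m" using assms by (fastforce simp: simple_forms_def simple_tensors_def)
 ultimately have "AE x in m. EX \<phi> N. ALL f:?A. ALL h:?A. G f h x = (\<Sum>k<(N::nat). \<phi> f k * \<phi> h k)" by (rule G_gram)
 then show ?thesis
 proof eventually_elim
  case (elim x)
  then obtain \<phi> and N :: nat where G: "ALL f:?A. ALL h:?A. G f h x = (\<Sum>k<N. \<phi> f k * \<phi> h k)" by blast
  have V: "snd ` set v \<subseteq> ?A" if "v : V" for v using that by blast
  have W: "\<forall>(a, f, h)\<in>set S. f : ?A & h : ?A" if S: "S : W" for S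
  proof clarify
   fix a f h assume "(a, f, h) : set S"
   then have "f : (%(a, f, h). f) ` set S" "h : (%(a, f, h). h) ` set S" by force+
   with S show "f : ?A & h : ?A" by blast
  qed
  show ?case by (intro exI[of _ \<phi>] exI[of _ N] conjI ballI sform_gram[OF G V V] stensor_gram[OF G W W])
 qed
qed

lemma sform_inner_integrable:
 assumes v: "v : simple_forms m" and w: "w : simple_forms m"
 shows "integrable m (sform_inner m v w)"
proof -
 have one: "integrable m (%x. a x * b x * G f h x)" if a: "a : coeff_fun m" "b : coeff_fun m" "f : H12 m" "h : H12 m" for a b f h
 proof -
  obtain C where C: "ALL x. abs (a x * b x) <= C" using coeff_fun_bound[OF coeff_fun_mult[OF a(1,2)]] by auto
  show ?thesis
  proof (rule Bochner_Integration.integrable_bound)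
   show "integrable m (%x. C * G f h x)" using grad_inner_pol(1)[OF a(3,4)] by simp
   show "(%x. a x * b x * G f h x) : borel_measurable m"
    by (intro borel_measurable_times G_measurable coeff_fun_meas a)
   show "AE x in m. norm (a x * b x * G f h x) <= norm (C * G f h x)"
   proof (intro AE_I2)
    fix x
    have "abs (a x * b x) * abs (G f h x) <= abs C * abs (G f h x)" using C by (intro mult_right_mono order_trans[OF C[rule_format] abs_ge_self]) auto
    then show "norm (a x * b x * G f h x) <= norm (C * G f h x)" by (simp add: abs_mult)
   qed
  qed
 qed
 have two: "integrable m (%x. \<Sum>(b, h)\<leftarrow>w. a x * b x * G f h x)" if a: "a : coeff_fun m" "f : H12 m" for a f
  using w
 proof (induction w)
  case (Cons q w)
  then show ?case using one[OF a(1) _ a(2)] by (auto simp: simple_forms_def split: prod.splits)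
 qed simp
 show ?thesis unfolding sform_inner_def[abs_def] using v
 proof (induction v)
  case (Cons q v)
  then show ?case using two by (auto simp: simple_forms_def split: prod.splits)
 qed simp
qed

lemma stensor_inner_measurable:
 assumes S: "S : simple_tensors m" and T: "T : simple_tensors m"
 shows "stensor_inner m S T : borel_measurable m"
proof -
 have two: "(%x. \<Sum>(b, u, v)\<leftarrow>T. a x * b x * G f u x * G h v x) : borel_measurable m" if "a : coeff_fun m" "f : H12 m" "h : H12 m" for a f h
  using T
 proof (induction T)
  case (Cons q T)
  then show ?case using that(2,3) coeff_fun_meas[OF that(1)]
   by (auto simp: simple_tensors_def split: prod.splits dest!: coeff_fun_meas intro!: borel_measurable_add borel_measurable_times G_measurable)
 qed simp
 show ?thesis unfolding stensor_inner_def[abs_def] using S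
 proof (induction S)
  case (Cons q S)
  then show ?case using two by (auto simp: simple_tensors_def split: prod.splits intro!: borel_measurable_add)
 qed simp
qed

end

sublocale ih_space \<subseteq> F: L0_completion m "sform_inner m" sform_diff "simple_forms m"
proof
 fix u v assume uv: "u : simple_forms m" "v : simple_forms m"
 show "sform_inner m u v : borel_measurable m" by (intro borel_measurable_integrable sform_inner_integrable uv)
 from simple_gram[of "{u, v}" "{}"] uv have g: "AE x in m. EX \<phi> N. (ALL a:{u, v}. ALL b:{u, v}. sform_inner m a b x = (\<Sum>k<N. fvec \<phi> x a k * fvec \<phi> x b k))"
  by (auto elim: AE_mp)
 then show "AE x in m. (sform_inner m u v x)^2 <= sform_inner m u u x * sform_inner m v v x"
 proof eventually_elim
  case (elim x)
  then show ?case using Cauchy_Schwarz_ineq_sum by (auto simp: power2_eq_square)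
 qed
 from g show "AE x in m. sform_inner m u v x = sform_inner m v u x" by eventually_elim (auto simp: mult.commute)
 from g show "AE x in m. 0 <= sform_inner m u u x" by eventually_elim (auto intro!: sum_nonneg)
qed (simp_all add: sform_diff_Car sform_inner_diff)

sublocale ih_space \<subseteq> T: L0_completion m "stensor_inner m" stensor_diff "simple_tensors m"
proof
 fix u v assume uv: "u : simple_tensors m" "v : simple_tensors m"
 show "stensor_inner m u v : borel_measurable m" by (rule stensor_inner_measurable[OF uv])
 from simple_gram[of "{}" "{u, v}"] uv have g: "AE x in m. EX \<phi> N. (ALL a:{u, v}. ALL b:{u, v}. stensor_inner m a b x = (\<Sum>p\<in>{..<N}\<times>{..<N}. ten \<phi> x a p * ten \<phi> x b p))"
  by (auto elim: AE_mp)
 then show "AE x in m. (stensor_inner m u v x)^2 <= stensor_inner m u u x * stensor_inner m v v x"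
 proof eventually_elim
  case (elim x)
  then show ?case using Cauchy_Schwarz_ineq_sum by (auto simp: power2_eq_square)
 qed
 from g show "AE x in m. stensor_inner m u v x = stensor_inner m v u x" by eventually_elim (auto simp: mult.commute)
 from g show "AE x in m. 0 <= stensor_inner m u u x" by eventually_elim (auto intro!: sum_nonneg)
qed (simp_all add: stensor_diff_Car stensor_inner_diff)

definition iform :: "'a set => 'a form => 'a form" where
 "iform A \<eta> = (%n. map (%(a, f). (%x. indicator A x * a x, f)) (\<eta> n))"

definition form_diff :: "'a form => 'a form => 'a form" where
 "form_diff \<omega> \<eta> = (%n. sform_diff (\<omega> n) (\<eta> n))"

lemma sform_inner_iform:
 "sform_inner m (iform A \<eta> n) w x = indicator A x * sform_inner m (\<eta> n) w x"
 "sform_inner m w (iform A \<eta> n) x = indicator A x * sform_inner m w (\<eta> n) x"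
 using sform_inner_map[of "%(a, f). (%x. indicator A x * a x, f)" "indicator A"] by (simp_all add: iform_def)

context ih_space
begin

abbreviation fsq :: "'a form => 'a => real" where "fsq \<eta> \<equiv> form_inner m \<eta> \<eta>"

lemma form_inner_lim: "form_inner m \<omega> \<eta> = F.lim \<omega> \<eta>"
 by (simp add: form_inner_def F.lim_def)

lemma tensor_inner_lim: "tensor_inner m S T = T.lim S T"
 by (simp add: tensor_inner_def T.lim_def)

lemma L0_tensors_Cau: "S : L0_tensors m \<longleftrightarrow> T.Cau S"
proof (cases "ALL n. S n : simple_tensors m")
 case True
 let ?q = "%i j. T.sqn (stensor_diff (S i) (S j))"
 have q: "?q i j : borel_measurable m" for i j using True by (intro T.inn_meas stensor_diff_Car) auto
 have "measure m {x\<in>B. \<epsilon> <= ?q i j x} = measure m {x\<in>B. \<epsilon> <= abs (?q i j x)}"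
  if B: "B : sets borel" "bounded B" for B \<epsilon> i j
 proof (rule measure_eq_AE)
  show "{x\<in>B. \<epsilon> <= abs (?q i j x)} : sets m" by (rule level_set(1)[OF q B])
  have "{x\<in>B. \<epsilon> <= ?q i j x} = B \<inter> {x : space m. \<epsilon> <= ?q i j x}" by (auto simp: space_m)
  also have "\<dots> : sets m" using B(1) sets_m q by (intro sets.Int borel_measurable_le) auto
  finally show "{x\<in>B. \<epsilon> <= ?q i j x} : sets m" .
  show "AE x in m. (x : {x\<in>B. \<epsilon> <= ?q i j x}) = (x : {x\<in>B. \<epsilon> <= abs (?q i j x)})"
   using T.inn_nonneg[OF stensor_diff_Car, of "S i" "S j"] True by (auto elim: AE_mp)
 qed
 then show ?thesis using True by (simp add: L0_tensors_def T.Cau_def L0_null2_iff)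
qed (auto simp: L0_tensors_def T.Cau_def)

lemma L2_formsD:
 assumes "\<eta> : L2_forms m"
 shows "\<eta> n : simple_forms m" "e > 0 ==> EX N. ALL i>=N. ALL j>=N. (LINT x|m. F.sqn (sform_diff (\<eta> i) (\<eta> j)) x) < e"
 using assms by (simp_all add: L2_forms_def)

text \<open>Markov's inequality.\<close>

lemma L2_forms_Cau:
 assumes \<eta>: "\<eta> : L2_forms m" shows "F.Cau \<eta>"
 unfolding F.Cau_def L0_null2_iff
proof (intro conjI allI ballI impI L2_formsD(1)[OF \<eta>])
 have d: "sform_diff (\<eta> i) (\<eta> j) : simple_forms m" for i j by (intro sform_diff_Car L2_formsD(1)[OF \<eta>])
 fix B :: "'a set" and \<epsilon> \<delta> :: real assume B: "B : sets borel" "bounded B" and e: "\<epsilon> > 0" "\<delta> > 0"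
 obtain N where N: "ALL i>=N. ALL j>=N. (LINT x|m. F.sqn (sform_diff (\<eta> i) (\<eta> j)) x) < \<epsilon> * \<delta>" using L2_formsD(2)[OF \<eta>, of "\<epsilon> * \<delta>"] e by auto
 have "measure m {x\<in>B. \<epsilon> <= abs (F.sqn (sform_diff (\<eta> i) (\<eta> j)) x)} < \<delta>" if "i >= N" "j >= N" for i j
 proof -
  have "\<epsilon> * measure m {x\<in>B. \<epsilon> <= abs (F.sqn (sform_diff (\<eta> i) (\<eta> j)) x)} < \<epsilon> * \<delta>"
   by (rule le_less_trans[OF Markov_level[OF sform_inner_integrable[OF d d] F.inn_nonneg[OF d] B e(1)]]) (use N that in blast)
  then show ?thesis using e by simp
 qed
 then show "EX N. ALL i>=N. ALL j>=N. measure m {x\<in>B. \<epsilon> <= abs (F.sqn (sform_diff (\<eta> i) (\<eta> j)) x)} < \<delta>" by blast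
qed

lemma L2_forms_bound:
 assumes \<omega>: "\<omega> : L2_forms m" and \<eta>: "\<eta> : L2_forms m" and C: "!!n. \<xi> n : simple_forms m"
  and le: "!!i j. AE x in m. F.sqn (sform_diff (\<xi> i) (\<xi> j)) x <= 2 * F.sqn (sform_diff (\<omega> i) (\<omega> j)) x + 2 * F.sqn (sform_diff (\<eta> i) (\<eta> j)) x"
 shows "\<xi> : L2_forms m"
 unfolding L2_forms_def
proof (intro CollectI conjI allI impI C)
 fix e :: real assume e: "e > 0"
 have int: "integrable m (F.sqn (sform_diff (\<zeta> i) (\<zeta> j)))" if "!!n. \<zeta> n : simple_forms m" for \<zeta> :: "'a form" and i j
  by (intro sform_inner_integrable sform_diff_Car that)
 note int = int[of \<xi>, OF C] int[of \<omega>, OF L2_formsD(1)[OF \<omega>]] int[of \<eta>, OF L2_formsD(1)[OF \<eta>]]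
 obtain n1 n2 where n: "ALL i>=n1. ALL j>=n1. (LINT x|m. F.sqn (sform_diff (\<omega> i) (\<omega> j)) x) < e/4"
  "ALL i>=n2. ALL j>=n2. (LINT x|m. F.sqn (sform_diff (\<eta> i) (\<eta> j)) x) < e/4"
  using L2_formsD(2)[OF \<omega>, of "e/4"] L2_formsD(2)[OF \<eta>, of "e/4"] e by auto
 have "(LINT x|m. F.sqn (sform_diff (\<xi> i) (\<xi> j)) x) < e" if "i >= max n1 n2" "j >= max n1 n2" for i j
 proof -
  have "(LINT x|m. F.sqn (sform_diff (\<xi> i) (\<xi> j)) x) <= (LINT x|m. 2 * F.sqn (sform_diff (\<omega> i) (\<omega> j)) x + 2 * F.sqn (sform_diff (\<eta> i) (\<eta> j)) x)"
   using int le by (intro integral_mono_AE) auto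
  also have "\<dots> < e" using int n[rule_format, of i j] that by simp
  finally show ?thesis .
 qed
 then show "EX n0. ALL i>=n0. ALL j>=n0. (LINT x|m. F.sqn (sform_diff (\<xi> i) (\<xi> j)) x) < e" by blast
qed

lemma differential_Cau: "f : H12 m ==> F.Cau (differential f)"
 unfolding differential_def by (intro F.Cau_const differential_Car)

lemma form_inner_meas: "\<omega> : L2_forms m ==> \<eta> : L2_forms m ==> form_inner m \<omega> \<eta> : borel_measurable m"
 unfolding form_inner_lim by (intro F.lim_tendsto L2_forms_Cau)

lemma form_inner_nonneg: "\<eta> : L2_forms m ==> AE x in m. 0 <= fsq \<eta> x"
 unfolding form_inner_lim by (intro F.lim_nonneg L2_forms_Cau)

text \<open>Fatou's lemma along a subsequence that converges almost everywhere.\<close>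

lemma form_sq_integrable:
 assumes \<eta>: "\<eta> : L2_forms m"
 shows "integrable m (form_inner m \<eta> \<eta>)"
proof -
 note C = L2_formsD(1)[OF \<eta>] and Cau = L2_forms_Cau[OF \<eta>]
 have int: "integrable m (F.sqn (\<eta> n))" "integrable m (F.sqn (sform_diff (\<eta> i) (\<eta> j)))" for n i j by (intro sform_inner_integrable sform_diff_Car C)+
 note qm[measurable] = borel_measurable_integrable[OF int(1)] and fm[measurable] = form_inner_meas[OF \<eta> \<eta>]
 obtain N where N: "ALL i>=N. ALL j>=N. (LINT x|m. F.sqn (sform_diff (\<eta> i) (\<eta> j)) x) < 1" using L2_formsD(2)[OF \<eta>, of 1] by auto
 define K where "K = 2 + 2 * (LINT x|m. F.sqn (\<eta> N) x)"
 have K: "(LINT x|m. F.sqn (\<eta> n) x) <= K" if "n >= N" for n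
 proof -
  have "(LINT x|m. F.sqn (\<eta> n) x) <= (LINT x|m. 2 * F.sqn (sform_diff (\<eta> n) (\<eta> N)) x + 2 * F.sqn (\<eta> N) x)"
  proof (rule integral_mono_AE)
   show "AE x in m. F.sqn (\<eta> n) x <= 2 * F.sqn (sform_diff (\<eta> n) (\<eta> N)) x + 2 * F.sqn (\<eta> N) x"
    using F.inn_nonneg[OF sform_diff_Car[OF sform_diff_Car[OF C C] C], of n N N] F.inn_sym[OF C C, of n N]
    by eventually_elim (simp add: sform_inner_diff)
  qed (use int in auto)
  also have "\<dots> <= K" using int N[rule_format, of n N] that by (simp add: K_def)
  finally show ?thesis .
 qed
 obtain r where r: "strict_mono r" "AE x in m. (%k. F.sqn (\<eta> (r k)) x) \<longlonglongrightarrow> fsq \<eta> x"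
  using L0_tendsto_subseq[OF F.lim_tendsto(2)[OF Cau Cau] F.inn_meas[OF C C] F.lim_tendsto(1)[OF Cau Cau]] unfolding form_inner_lim by blast
 have "(\<integral>\<^sup>+x. ennreal (fsq \<eta> x) \<partial>m) = (\<integral>\<^sup>+x. liminf (%k. ennreal (F.sqn (\<eta> (r (k + N))) x)) \<partial>m)"
 proof (rule nn_integral_cong_AE)
  show "AE x in m. ennreal (fsq \<eta> x) = liminf (%k. ennreal (F.sqn (\<eta> (r (k + N))) x))" using r(2)
   by eventually_elim (rule lim_imp_Liminf[symmetric], simp, intro tendsto_ennrealI LIMSEQ_ignore_initial_segment)
 qed
 also have "\<dots> <= liminf (%k. \<integral>\<^sup>+x. ennreal (F.sqn (\<eta> (r (k + N))) x) \<partial>m)" by (rule nn_integral_liminf) simp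
 also have "\<dots> <= ennreal K"
 proof (rule order_trans[OF Liminf_le_Limsup Limsup_bounded])
  have "(\<integral>\<^sup>+x. ennreal (F.sqn (\<eta> (r (k + N))) x) \<partial>m) <= ennreal K" for k
   using K[of "r (k + N)"] seq_suble[OF r(1), of "k + N"] by (subst nn_integral_eq_integral[OF int(1) F.inn_nonneg[OF C]]) (auto intro: ennreal_leI)
  then show "\<forall>\<^sub>F k in sequentially. (\<integral>\<^sup>+x. ennreal (F.sqn (\<eta> (r (k + N))) x) \<partial>m) <= ennreal K" by simp
 qed simp
 finally show ?thesis by (intro integrableI_nonneg fm form_inner_nonneg[OF \<eta>]) (auto intro: le_less_trans)
qed

lemma form_inner_sym:
 assumes "\<omega> : L2_forms m" "\<eta> : L2_forms m"
 shows "AE x in m. form_inner m \<omega> \<eta> x = form_inner m \<eta> \<omega> x"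
 unfolding form_inner_lim by (intro F.lim_AE_cong L2_forms_Cau F.inn_sym L2_formsD assms)

lemma form_diff_L2:
 assumes "\<omega> : L2_forms m" "\<eta> : L2_forms m"
 shows "form_diff \<omega> \<eta> : L2_forms m"
 unfolding form_diff_def
 by (rule L2_forms_bound[OF assms]) (intro F.dif_parallelogram sform_diff_Car L2_formsD(1)[OF assms(1)] L2_formsD(1)[OF assms(2)])+

lemma form_inner_diff_sq:
 assumes \<omega>: "\<omega> : L2_forms m" and \<eta>: "\<eta> : L2_forms m"
 shows "AE x in m. fsq (form_diff \<omega> \<eta>) x = fsq \<omega> x + fsq \<eta> x - 2 * form_inner m \<omega> \<eta> x"
proof -
 note C = L2_forms_Cau[OF \<omega>] L2_forms_Cau[OF \<eta>]
 from F.lim_dif(1)[OF C F.Cau_dif[OF C]] F.lim_dif(2)[OF C C(1)] F.lim_dif(2)[OF C C(2)] form_inner_sym[OF assms]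
 show ?thesis unfolding form_inner_lim form_diff_def by eventually_elim simp
qed

lemma form_inner_diff_right:
 assumes \<omega>: "\<omega> : L2_forms m" and \<eta>: "\<eta> : L2_forms m" and f: "f : H12 m"
 shows "AE x in m. form_inner m (differential f) (form_diff \<omega> \<eta>) x = form_inner m (differential f) \<omega> x - form_inner m (differential f) \<eta> x"
 using F.lim_dif(2)[OF L2_forms_Cau[OF \<omega>] L2_forms_Cau[OF \<eta>] differential_Cau[OF f]]
 by (simp add: form_inner_lim form_diff_def)

lemma form_inner_differential_bound:
 assumes f: "f : H12 m" and \<eta>: "\<eta> : L2_forms m"
 shows "AE x in m. (form_inner m (differential f) \<eta> x)^2 <= (D f x)^2 * fsq \<eta> x"
 using F.lim_CS[OF differential_Cau[OF f] L2_forms_Cau[OF \<eta>]] F.lim_const[OF differential_Car[OF f] differential_Car[OF f]] G_self[OF f]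
 unfolding form_inner_lim differential_def by eventually_elim (simp add: sform_inner_simps(5))

lemma form_inner_differential_meas: "f : H12 m ==> \<eta> : L2_forms m ==> form_inner m (differential f) \<eta> : borel_measurable m"
 unfolding form_inner_lim by (intro F.lim_tendsto L2_forms_Cau differential_Cau)

lemma form_inner_differential_lincomb:
 assumes f: "f : H12 m" and g: "g : H12 m" and \<eta>: "\<eta> : L2_forms m"
 shows "AE x in m. form_inner m (differential (%x. a * f x + b * g x)) \<eta> x = a * form_inner m (differential f) \<eta> x + b * form_inner m (differential g) \<eta> x"
proof -
 have ab: "(%x. a * f x) : H12 m" "(%x. b * g x) : H12 m" by (intro H12_cmult f g)+
 have fg: "(%x. a * f x + b * g x) : H12 m" by (rule H12_add[OF ab])
 note C = differential_Cau[OF fg] differential_Cau[OF f] differential_Cau[OF g] and E = L2_forms_Cau[OF \<eta>]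
 show ?thesis unfolding form_inner_lim
 proof (rule F.lim_lincomb[OF C(1) E C(2) E C(3) E])
  fix n
  have "AE x in m. sform_inner m [(%x. 1, %x. a * f x + b * g x)] w x = a * sform_inner m [(%x. 1, f)] w x + b * sform_inner m [(%x. 1, g)] w x"
   if "w : simple_forms m" for w
   using that
  proof (induction w)
   case (Cons p w)
   obtain c h where p: "p = (c, h)" by force
   have h: "h : H12 m" "w : simple_forms m" using Cons.prems by (auto simp: p simple_forms_def)
   from Cons.IH[OF h(2)] G_add_left[OF ab h(1)] G_cmult_left[OF f h(1), of a] G_cmult_left[OF g h(1), of b]
   show ?case unfolding p sform_inner_simps(4)[of m _ _ _ w] sform_inner_simps(5) by eventually_elim (simp add: algebra_simps)
  qed (simp add: sform_inner_simps(2))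
  from this[OF L2_formsD(1)[OF \<eta>]]
  show "AE x in m. sform_inner m (differential (%x. a * f x + b * g x) n) (\<eta> n) x = a * sform_inner m (differential f n) (\<eta> n) x + b * sform_inner m (differential g n) (\<eta> n) x"
   by (simp add: differential_def)
 qed
qed

lemma iform_L2:
 assumes A: "A : sets m" and \<eta>: "\<eta> : L2_forms m"
 shows "iform A \<eta> : L2_forms m"
proof (rule L2_forms_bound[OF \<eta> \<eta>])
 have "indicator A : coeff_fun m" using A by (auto simp: coeff_fun_def bounded_iff indicator_def intro!: exI[of _ 1])
 then show "iform A \<eta> n : simple_forms m" for n
  using L2_formsD(1)[OF \<eta>, of n] coeff_fun_mult by (fastforce simp: simple_forms_def iform_def)
 show "AE x in m. F.sqn (sform_diff (iform A \<eta> i) (iform A \<eta> j)) x <= 2 * F.sqn (sform_diff (\<eta> i) (\<eta> j)) x + 2 * F.sqn (sform_diff (\<eta> i) (\<eta> j)) x" for i j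
  using F.inn_nonneg[OF sform_diff_Car[OF L2_formsD(1)[OF \<eta>] L2_formsD(1)[OF \<eta>]], of i j]
  by eventually_elim (auto simp: sform_inner_diff sform_inner_iform indicator_def)
qed

lemma form_inner_iform:
 assumes A: "A : sets m" and \<omega>: "F.Cau \<omega>" and \<eta>: "\<eta> : L2_forms m"
 shows "AE x in m. form_inner m \<omega> (iform A \<eta>) x = indicator A x * form_inner m \<omega> \<eta> x"
  "AE x in m. form_inner m (iform A \<eta>) \<omega> x = indicator A x * form_inner m \<eta> \<omega> x"
 using F.lim_lincomb[OF \<omega> L2_forms_Cau[OF iform_L2[OF A \<eta>]] \<omega> L2_forms_Cau[OF \<eta>] \<omega> \<omega>, of "indicator A" "%x. 0"]
  F.lim_lincomb[OF L2_forms_Cau[OF iform_L2[OF A \<eta>]] \<omega> L2_forms_Cau[OF \<eta>] \<omega> \<omega> \<omega>, of "indicator A" "%x. 0"]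
 by (simp_all add: form_inner_lim sform_inner_iform)

lemma form_inner_iform_iform:
 assumes A: "A : sets m" and \<eta>: "\<eta> : L2_forms m"
 shows "AE x in m. form_inner m (iform A \<eta>) (iform A \<eta>) x = indicator A x * fsq \<eta> x"
 using form_inner_iform(1)[OF A L2_forms_Cau[OF iform_L2[OF A \<eta>]] \<eta>] form_inner_iform(2)[OF A L2_forms_Cau[OF \<eta>] \<eta>]
 by eventually_elim (simp add: indicator_def)

section \<open>Tensor products and metrics\<close>

text \<open>In coordinates, expand \<open>a \<otimes> b - a' \<otimes> b' = (a - a') \<otimes> b + a' \<otimes> (b - b')\<close>.\<close>

lemma sprod_diff_bound:
 assumes "a : simple_forms m" "b : simple_forms m" "a' : simple_forms m" "b' : simple_forms m"
 shows "AE x in m. stensor_inner m (stensor_diff (sprod a b) (sprod a' b')) (stensor_diff (sprod a b) (sprod a' b')) x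
  <= 2 * (sform_inner m (sform_diff a a') (sform_diff a a') x * sform_inner m b b x) + 2 * (sform_inner m (sform_diff b b') (sform_diff b b') x * sform_inner m a' a' x)"
proof -
 let ?a = "sform_diff a a'" and ?b = "sform_diff b b'" and ?T = "stensor_diff (sprod a b) (sprod a' b')"
 have "AE x in m. EX \<phi> N. (ALL v:{?a, ?b, b, a'}. ALL w:{?a, ?b, b, a'}. sform_inner m v w x = (\<Sum>k<N. fvec \<phi> x v k * fvec \<phi> x w k)) &
  (ALL S:{?T}. ALL U:{?T}. stensor_inner m S U x = (\<Sum>p\<in>{..<N} \<times> {..<N}. ten \<phi> x S p * ten \<phi> x U p))"
  by (rule simple_gram) (use assms in "auto intro!: sform_diff_Car stensor_diff_Car sprod_Car")
 then show ?thesis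
 proof eventually_elim
  case (elim x)
  then obtain \<phi> and N :: nat where G: "ALL v:{?a, ?b, b, a'}. ALL w:{?a, ?b, b, a'}. sform_inner m v w x = (\<Sum>k<N. fvec \<phi> x v k * fvec \<phi> x w k)"
   "stensor_inner m ?T ?T x = (\<Sum>p\<in>{..<N} \<times> {..<N}. ten \<phi> x ?T p * ten \<phi> x ?T p)" by blast
  have P: "(\<Sum>p\<in>{..<N} \<times> {..<N}. (fvec \<phi> x v (fst p))^2 * (fvec \<phi> x w (snd p))^2) = sform_inner m v v x * sform_inner m w w x"
   if "v : {?a, ?b, b, a'}" "w : {?a, ?b, b, a'}" for v w
  proof -
   have "sform_inner m v v x = (\<Sum>k<N. (fvec \<phi> x v k)^2)" "sform_inner m w w x = (\<Sum>k<N. (fvec \<phi> x w k)^2)"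
    using G(1) that by (auto simp: power2_eq_square)
   then show ?thesis by (simp add: sum_product sum.cartesian_product case_prod_unfold)
  qed
  have "stensor_inner m ?T ?T x = (\<Sum>p\<in>{..<N} \<times> {..<N}. (fvec \<phi> x ?a (fst p) * fvec \<phi> x b (snd p) + fvec \<phi> x a' (fst p) * fvec \<phi> x ?b (snd p))^2)"
   unfolding G(2) by (intro sum.cong refl) (simp add: ten_diff ten_sprod fvec_diff power2_eq_square algebra_simps)
  also have "\<dots> <= (\<Sum>p\<in>{..<N} \<times> {..<N}. 2 * ((fvec \<phi> x ?a (fst p))^2 * (fvec \<phi> x b (snd p))^2) + 2 * ((fvec \<phi> x a' (fst p))^2 * (fvec \<phi> x ?b (snd p))^2))"
  proof (rule sum_mono)
   fix p
   have "(s + t)^2 <= 2 * s^2 + 2 * t^2" for s t :: real using sum_squares_bound[of s t] by (simp add: power2_sum)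
   from this[of "fvec \<phi> x ?a (fst p) * fvec \<phi> x b (snd p)" "fvec \<phi> x a' (fst p) * fvec \<phi> x ?b (snd p)"]
   show "(fvec \<phi> x ?a (fst p) * fvec \<phi> x b (snd p) + fvec \<phi> x a' (fst p) * fvec \<phi> x ?b (snd p))^2
     <= 2 * ((fvec \<phi> x ?a (fst p))^2 * (fvec \<phi> x b (snd p))^2) + 2 * ((fvec \<phi> x a' (fst p))^2 * (fvec \<phi> x ?b (snd p))^2)"
    by (simp add: power_mult_distrib)
  qed
  also have "\<dots> = 2 * (sform_inner m ?a ?a x * sform_inner m b b x) + 2 * (sform_inner m a' a' x * sform_inner m ?b ?b x)"
   unfolding sum.distrib sum_distrib_left[symmetric] using P[of ?a b] P[of a' ?b] by simp
  finally show ?case by (simp add: mult.commute)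
 qed
qed

lemma tensor_prod_Cau:
 assumes u: "F.Cau u" and v: "F.Cau v"
 shows "T.Cau (tensor_prod u v)"
 unfolding T.Cau_def L0_null2_def tensor_prod_sprod
proof (intro conjI allI impI)
 note C = F.CauD(1)[OF u] F.CauD(1)[OF v]
 show "sprod (u n) (v n) : simple_tensors m" for n by (intro sprod_Car C)
 fix p q :: "nat => nat" assume pq: "filterlim p at_top sequentially" "filterlim q at_top sequentially"
 have P: "L0_tendsto m (%n x. F.sqn (sform_diff (a (p n)) (a (q n))) x * F.sqn (b (s n)) x) (%x. 0)"
  if a: "F.Cau a" and b: "F.Cau b" and s: "filterlim s at_top sequentially" for a b :: "'a form" and s
 proof (rule L0_transfer[OF F.CauD(2)[OF a pq] L0_tendsto_compose[OF F.lim_tendsto(2)[OF b b] s], where R="%_ _. True"])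
  fix x and r :: "nat => nat" assume "(%k. F.sqn (sform_diff (a (p (r k))) (a (q (r k)))) x) \<longlonglongrightarrow> 0" "(%k. F.sqn (b (s (r k))) x) \<longlonglongrightarrow> F.lim b b x"
  from tendsto_mult[OF this] show "(%k. F.sqn (sform_diff (a (p (r k))) (a (q (r k)))) x * F.sqn (b (s (r k))) x) \<longlonglongrightarrow> 0" by simp
 qed (auto intro!: borel_measurable_times F.inn_meas sform_diff_Car F.CauD(1)[OF a] F.CauD(1)[OF b] F.lim_tendsto b)
 let ?t = "%n. T.sqn (stensor_diff (sprod (u (p n)) (v (p n))) (sprod (u (q n)) (v (q n))))"
 let ?b = "%n x. 2 * (F.sqn (sform_diff (u (p n)) (u (q n))) x * F.sqn (v (p n)) x) + 2 * (F.sqn (sform_diff (v (p n)) (v (q n))) x * F.sqn (u (q n)) x)"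
 have t: "stensor_diff (sprod (u (p n)) (v (p n))) (sprod (u (q n)) (v (q n))) : simple_tensors m" for n by (intro stensor_diff_Car sprod_Car C)
 show "L0_tendsto m ?t (%x. 0)"
 proof (rule L0_transfer[OF P[OF u v pq(1)] P[OF v u pq(2)], where R="%n x. 0 <= ?t n x & ?t n x <= ?b n x"])
  show "AE x in m. 0 <= ?t n x & ?t n x <= ?b n x" for n
   using T.inn_nonneg[OF t] sprod_diff_bound[OF C C] by (intro AE_conjI)
  fix x and r :: "nat => nat" assume R: "!!n. 0 <= ?t n x & ?t n x <= ?b n x"
   and l: "(%k. F.sqn (sform_diff (u (p (r k))) (u (q (r k)))) x * F.sqn (v (p (r k))) x) \<longlonglongrightarrow> 0"
    "(%k. F.sqn (sform_diff (v (p (r k))) (v (q (r k)))) x * F.sqn (u (q (r k))) x) \<longlonglongrightarrow> 0"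
  have "(%k. ?b (r k) x) \<longlonglongrightarrow> 0" using tendsto_add[OF l[THEN tendsto_mult_right_zero[where c=2]]] by simp
  from tendsto_sandwich[OF _ _ tendsto_const this] R show "(%k. ?t (r k) x) \<longlonglongrightarrow> 0" by auto
 qed (auto intro!: borel_measurable_times F.inn_meas T.inn_meas t sform_diff_Car C)
qed

text \<open>The pairing with \<open>g\<close> is linear and continuous in measure; it is prescribed on the tensors \<open>df \<otimes> dh\<close>, and
  the simple tensors built from them are dense.\<close>

lemma canonical_tensor_prod:
 assumes g: "canonical_metric m g" and \<omega>: "\<omega> : L2_forms m" and \<eta>: "\<eta> : L2_forms m"
 shows "AE x in m. tensor_inner m g (tensor_prod \<omega> \<eta>) x = form_inner m \<omega> \<eta> x"
proof -
 have gC: "T.Cau g" using g by (simp add: canonical_metric_def Riemannian_metric_def semi_Riemannian_metric_def Linf_loc_tensors_def L0_tensors_Cau)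
 note W = L2_forms_Cau[OF \<omega>] and E = L2_forms_Cau[OF \<eta>]
 have one: "[(%x. 1, f, h)] : simple_tensors m" if "f : H12 m" "h : H12 m" for f h
  using that by (simp add: simple_tensors_def coeff_fun_def)
 have base: "AE x in m. T.lim g (%n. [(%x. 1, f, h)]) x = G f h x" if "f : H12 m" "h : H12 m" for f h
 proof -
  have "tensor_prod (differential f) (differential h) = (%n. [(%x. 1, f, h)])" by (simp add: tensor_prod_def differential_def)
  moreover have "AE x in m. T.lim g (tensor_prod (differential f) (differential h)) x = G f h x"
   using g that unfolding canonical_metric_def metric_eval_def tensor_inner_lim by blast
  ultimately show ?thesis by simp
 qed
 have simple: "AE x in m. T.lim g (%n. S) x = (\<Sum>(a, f, h)\<leftarrow>S. a x * G f h x)" if "S : simple_tensors m" for S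
  using that
 proof (induction S)
  case Nil
  have N: "[] : simple_tensors m" by (simp add: simple_tensors_def)
  show ?case using T.lim_lincomb[OF gC T.Cau_const[OF N] gC T.Cau_const[OF N] gC T.Cau_const[OF N], of "%x. 0" "%x. 0"] by (simp add: stensor_inner_simps)
 next
  case (Cons p S)
  obtain a f h where p: "p = (a, f, h)" by (cases p) auto
  have S: "a : coeff_fun m" "f : H12 m" "h : H12 m" "S : simple_tensors m" using Cons.prems by (auto simp: p simple_tensors_def)
  note C1 = T.Cau_const[OF one[OF S(2,3)]] and C2 = T.Cau_const[OF S(4)] and C3 = T.Cau_const[OF Cons.prems]
  have "AE x in m. T.lim g (%n. p # S) x = a x * T.lim g (%n. [(%x. 1, f, h)]) x + 1 * T.lim g (%n. S) x"
   by (rule T.lim_lincomb[OF gC C3 gC C1 gC C2, of a "%x. 1"]) (simp add: p stensor_inner_simps(4)[of m _ _ _ _ S])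
  with Cons.IH[OF S(4)] base[OF S(2,3)] show ?case by eventually_elim (simp add: p)
 qed
 have "(\<Sum>(a, f, h)\<leftarrow>sprod v w. a x * G f h x) = sform_inner m v w x" for v w x
 proof (induction v)
  case (Cons q v)
  obtain a f where q: "q = (a, f)" by force
  have "(\<Sum>(a, f, h)\<leftarrow>map (%(b, h). (%x. a x * b x, f, h)) w. a x * G f h x) = (\<Sum>(b, h)\<leftarrow>w. a x * b x * G f h x)"
   by (induction w) auto
  then show ?case using Cons by (simp add: q sprod_def sform_inner_def)
 qed (simp add: sprod_def sform_inner_def)
 with simple[OF sprod_Car[OF F.CauD(1)[OF W] F.CauD(1)[OF E]]]
 have k: "AE x in m. T.lim g (%n. sprod (\<omega> k) (\<eta> k)) x = sform_inner m (\<omega> k) (\<eta> k) x" for k by simp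
 have PC: "T.Cau (tensor_prod \<omega> \<eta>)" by (rule tensor_prod_Cau[OF W E])
 have cc: "T.Cau (%n. sprod (\<omega> k) (\<eta> k))" for k by (intro T.Cau_const sprod_Car F.CauD(1)[OF W] F.CauD(1)[OF E])
 have L: "L0_tendsto m (%k. T.lim g (%n. sprod (\<omega> k) (\<eta> k))) (T.lim g (tensor_prod \<omega> \<eta>))"
  using T.lim_approx_right[OF PC gC] by (simp add: tensor_prod_sprod)
 have "L0_tendsto m (%k. sform_inner m (\<omega> k) (\<eta> k)) (T.lim g (tensor_prod \<omega> \<eta>))"
  by (rule L0_transfer[OF L L, where R="%k x. T.lim g (%n. sprod (\<omega> k) (\<eta> k)) x = sform_inner m (\<omega> k) (\<eta> k) x"])
   (use k in "auto intro!: T.lim_tendsto gC PC cc F.inn_meas F.CauD(1)[OF W] F.CauD(1)[OF E]")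
 from F.lim_unique[OF W E this] T.lim_tendsto(1)[OF gC PC] show ?thesis
  unfolding form_inner_lim tensor_inner_lim by (auto elim: AE_mp)
qed

lemma tensor_eq_inner:
 assumes "S : L0_tensors m" "S' : L0_tensors m" "tensor_eq m S S'" "T.Cau U"
 shows "AE x in m. tensor_inner m S U x = tensor_inner m S' U x"
 using T.lim_eq_if_dif_zero[of S S' U] assms unfolding tensor_eq_def tensor_diff_def L0_tensors_Cau tensor_inner_lim by blast

lemma tensor_eq_refl: "S : L0_tensors m ==> tensor_eq m S S"
 using T.lim_dif(1)[of S S "%n. stensor_diff (S n) (S n)"] T.Cau_dif[of S S]
 unfolding tensor_eq_def tensor_diff_def L0_tensors_Cau tensor_inner_lim by simp

lemma stensor_diff_scale: "stensor_inner m (stensor_diff (stensor_scale c S) (stensor_scale c S')) (stensor_diff (stensor_scale c U) (stensor_scale c U')) x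
  = c^2 * stensor_inner m (stensor_diff S S') (stensor_diff U U') x"
 by (simp add: stensor_inner_diff stensor_inner_scale power2_eq_square algebra_simps)

lemma tensor_scale_L0:
 assumes S: "S : L0_tensors m" shows "tensor_scale c S : L0_tensors m"
 unfolding L0_tensors_Cau T.Cau_def L0_null2_def tensor_scale_def
proof (intro conjI allI impI)
 have C: "T.Cau S" using S by (simp add: L0_tensors_Cau)
 show "stensor_scale c (S n) : simple_tensors m" for n by (intro stensor_scale_Car T.CauD(1)[OF C])
 fix p q :: "nat => nat" assume pq: "filterlim p at_top sequentially" "filterlim q at_top sequentially"
 show "L0_tendsto m (%n. T.sqn (stensor_diff (stensor_scale c (S (p n))) (stensor_scale c (S (q n))))) (%x. 0)"
  by (rule L0_transfer[OF T.CauD(2)[OF C pq] T.CauD(2)[OF C pq], where R="%_ _. True"])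
   (auto simp: stensor_diff_scale intro!: tendsto_mult_right_zero T.inn_meas stensor_diff_Car stensor_scale_Car T.CauD(1)[OF C])
qed

lemma tensor_inner_scale:
 assumes S: "S : L0_tensors m"
 shows "T.Cau U ==> AE x in m. tensor_inner m (tensor_scale c S) U x = c * tensor_inner m S U x"
  "AE x in m. tensor_inner m (tensor_scale c S) (tensor_scale c S) x = c^2 * tensor_inner m S S x"
proof -
 have C: "T.Cau S" "T.Cau (tensor_scale c S)" using S tensor_scale_L0[OF S] by (simp_all add: L0_tensors_Cau)
 show "AE x in m. tensor_inner m (tensor_scale c S) U x = c * tensor_inner m S U x" if "T.Cau U"
  using T.lim_lincomb[OF C(2) that C(1) that C(1) that, of "%x. c" "%x. 0"] by (simp add: tensor_inner_lim tensor_scale_def stensor_inner_scale)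
 show "AE x in m. tensor_inner m (tensor_scale c S) (tensor_scale c S) x = c^2 * tensor_inner m S S x"
  using T.lim_lincomb[OF C(2,2,1,1,1,1), of "%x. c^2" "%x. 0"]
  by (simp add: tensor_inner_lim tensor_scale_def stensor_inner_scale power2_eq_square)
qed

lemma tensor_transpose_L0:
 assumes S: "S : L0_tensors m" shows "tensor_transpose S : L0_tensors m"
proof -
 have C: "T.Cau S" using S by (simp add: L0_tensors_Cau)
 let ?t = "map (%(a, f, h). (a, h, f)) :: 'a simple_tensor => 'a simple_tensor"
 have "stensor_inner m (?t U) (?t V) x = stensor_inner m U V x" for U V :: "'a simple_tensor" and x
 proof -
  have "(\<Sum>(b, u, v)\<leftarrow>?t V. a x * b x * G h u x * G f v x) = (\<Sum>(b, u, v)\<leftarrow>V. a x * b x * G f u x * G h v x)" for a f h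
   by (induction V) (auto simp: mult_ac)
  then show ?thesis unfolding stensor_inner_def by (induction U) auto
 qed
 then have eq: "stensor_inner m (stensor_diff (?t U) (?t V)) (stensor_diff (?t U) (?t V)) = stensor_inner m (stensor_diff U V) (stensor_diff U V)" for U V
  by (intro ext) (simp add: stensor_inner_diff)
 have "?t (S n) : simple_tensors m" for n using T.CauD(1)[OF C, of n] by (auto simp: simple_tensors_def)
 then show ?thesis using C unfolding L0_tensors_Cau T.Cau_def tensor_transpose_def eq by blast
qed

lemma semi_Riemannian_scale:
 assumes g: "semi_Riemannian_metric m g" and c: "c >= 0"
 shows "semi_Riemannian_metric m (tensor_scale c g)"
proof -
 have g0: "g : L0_tensors m" using g by (simp add: semi_Riemannian_metric_def Linf_loc_tensors_def)
 have "tensor_scale c g : Linf_loc_tensors m" unfolding Linf_loc_tensors_def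
 proof (intro CollectI conjI allI impI tensor_scale_L0[OF g0])
  fix B :: "'a set" assume "bounded B"
  then obtain C where C: "AE x in m. x : B --> sqrt (tensor_inner m g g x) <= C"
   using g unfolding semi_Riemannian_metric_def Linf_loc_tensors_def by blast
  from tensor_inner_scale(2)[OF g0, of c] C
  have "AE x in m. x : B --> sqrt (tensor_inner m (tensor_scale c g) (tensor_scale c g) x) <= c * C"
   by eventually_elim (auto simp: real_sqrt_mult c intro: mult_left_mono)
  then show "EX C. AE x in m. x : B --> sqrt (tensor_inner m (tensor_scale c g) (tensor_scale c g) x) <= C" by blast
 qed
 moreover have "tensor_eq m (tensor_scale c g) (tensor_transpose (tensor_scale c g))"
 proof -
  have tr: "tensor_transpose (tensor_scale c g) = tensor_scale c (tensor_transpose g)"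
   by (auto simp: fun_eq_iff tensor_transpose_def tensor_scale_def stensor_scale_def)
  have d: "tensor_diff g (tensor_transpose g) : L0_tensors m"
   using g0 tensor_transpose_L0[OF g0] unfolding L0_tensors_Cau tensor_diff_def by (rule T.Cau_dif)
  have "AE x in m. tensor_inner m (tensor_diff g (tensor_transpose g)) (tensor_diff g (tensor_transpose g)) x = 0"
   using g by (simp add: semi_Riemannian_metric_def tensor_eq_def)
  moreover have "tensor_diff (tensor_scale c g) (tensor_scale c (tensor_transpose g)) = tensor_scale c (tensor_diff g (tensor_transpose g))"
   by (auto simp: fun_eq_iff tensor_diff_def tensor_scale_def stensor_diff_def stensor_scale_def)
  ultimately show ?thesis using tensor_inner_scale(2)[OF d, of c] unfolding tensor_eq_def tr by (auto elim: AE_mp)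
 qed
 moreover have "AE x in m. 0 <= metric_eval m (tensor_scale c g) V V x" if V: "V : L2_forms m" for V
 proof -
  have "AE x in m. 0 <= metric_eval m g V V x" using g V by (simp add: semi_Riemannian_metric_def)
  with tensor_inner_scale(1)[OF g0 tensor_prod_Cau[OF L2_forms_Cau[OF V] L2_forms_Cau[OF V]], of c]
  show ?thesis unfolding metric_eval_def by eventually_elim (simp add: c)
 qed
 ultimately show ?thesis by (simp add: semi_Riemannian_metric_def)
qed

lemma tensor_scale_inverse:
 fixes g :: "'a tensor"
 assumes "c * d = 1" shows "tensor_scale c (tensor_scale d g) = g"
proof -
 have "c * (d * y) = y" for y using assms by (simp add: mult.assoc[symmetric])
 then have "stensor_scale c (stensor_scale d S) = S" for S :: "'a simple_tensor" by (induction S) (auto simp: stensor_scale_def)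
 then show ?thesis by (simp add: tensor_scale_def)
qed

end

context heat_space
begin

section \<open>The energy densities of the heat kernel\<close>

abbreviation dk :: "real => 'a form => 'a => 'a => real" where
 "dk t \<eta> y \<equiv> form_inner m (differential (kf y t)) \<eta>"

definition Top :: "'a set => 'a form => ('a => real) => 'a => real" where
 "Top A \<eta> f x = indicator A x * form_inner m (differential f) \<eta> x"

definition mass :: "'a set => 'a form => real" where
 "mass A \<eta> = (LINT x|m. indicator A x * fsq \<eta> x)"

definition small :: "real => 'a set => bool" where
 "small e A \<longleftrightarrow> A : sets m & bounded A &
  (ALL t>e. energy A t < \<infinity>)"

text \<open>The pairs \<open>(A, \<eta>)\<close> for which \<open>Top A \<eta>\<close> is bounded by the slope and \<open>Top A \<eta>\<close> after the heat flow up to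
  time \<open>t > e\<close> is Hilbert--Schmidt.\<close>

definition piece :: "real => 'a set => 'a form => bool" where
 "piece e A \<eta> \<longleftrightarrow> small e A & \<eta> : L2_forms m & (EX c. AE x in m. x : A --> fsq \<eta> x <= c)"

lemma Top_bound:
 assumes A: "A : sets m" and \<eta>: "\<eta> : L2_forms m" and c: "AE x in m. x : A --> fsq \<eta> x <= c" and f: "f : H12 m"
 shows "AE x in m. (Top A \<eta> f x)^2 <= indicator A x * (abs c * (D f x)^2)" "Top A \<eta> f : borel_measurable m"
proof -
 from form_inner_differential_bound[OF f \<eta>] c
 show "AE x in m. (Top A \<eta> f x)^2 <= indicator A x * (abs c * (D f x)^2)"
 proof eventually_elim
  case (elim x)
  have "(D f x)^2 * fsq \<eta> x <= (D f x)^2 * abs c" if "x : A"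
   using elim(2) that by (intro mult_left_mono) auto
  with elim(1) show ?case by (auto simp: Top_def indicator_def mult.commute)
 qed
 show "Top A \<eta> f : borel_measurable m"
  unfolding Top_def[abs_def] using A by (intro borel_measurable_times form_inner_differential_meas f \<eta>) simp
qed

lemma piece_bounded_op:
 assumes p: "piece e A \<eta>" shows "bounded_op (Top A \<eta>)"
proof -
 obtain c where A: "A : sets m" and \<eta>: "\<eta> : L2_forms m" and c: "AE x in m. x : A --> fsq \<eta> x <= c"
  using p by (auto simp: piece_def small_def)
 have le: "AE x in m. abs (Top A \<eta> f x) <= abs (sqrt (abs c) * D f x)" if f: "f : H12 m" for f
  using Top_bound(1)[OF A \<eta> c f]
 proof eventually_elim
  case (elim x)
  then have "(Top A \<eta> f x)^2 <= (sqrt (abs c) * D f x)^2" by (auto simp: indicator_def power_mult_distrib intro: order_trans)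
  then show ?case by (simp add: abs_le_square_iff)
 qed
 have DL: "(%x. sqrt (abs c) * D f x) : L2 m" if "f : H12 m" for f by (intro L2_cmult D_L2 that)
 show ?thesis unfolding bounded_op_def
 proof (intro conjI ballI allI exI[of _ "sqrt (abs c)"])
  show "Top A \<eta> f : L2 m" if f: "f : H12 m" for f
   by (rule L2_bound[OF DL[OF f] Top_bound(2)[OF A \<eta> c f] le[OF f]])
  show "AE x in m. Top A \<eta> (%x. f x + g x) x = Top A \<eta> f x + Top A \<eta> g x" if "f : H12 m" "g : H12 m" for f g
   using form_inner_differential_lincomb[OF that \<eta>, of 1 1, simplified] by eventually_elim (simp add: Top_def distrib_left)
  show "AE x in m. Top A \<eta> (%x. k * f x) x = k * Top A \<eta> f x" if "f : H12 m" for k f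
   using form_inner_differential_lincomb[OF that that \<eta>, of k 0, simplified] by eventually_elim (simp add: Top_def)
  show "lnorm m (Top A \<eta> f) <= sqrt (abs c) * lnorm m (D f)" if f: "f : H12 m" for f
   using lnorm_mono_AE[OF DL[OF f] Top_bound(2)[OF A \<eta> c f] le[OF f]] by (simp add: lnorm_cmult)
 qed
qed

lemma piece_HS_finite:
 assumes p: "piece e A \<eta>" and e: "e > 0" and t: "t > e"
 shows "HS (Top A \<eta>) t < \<infinity>"
proof -
 obtain c where A: "small e A" "A : sets m" and \<eta>: "\<eta> : L2_forms m" and c: "AE x in m. x : A --> fsq \<eta> x <= c"
  using p by (auto simp: piece_def small_def)
 have T: "bounded_op (Top A \<eta>)" by (rule piece_bounded_op[OF p])
 have t0: "t > 0" using t e by simp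
 define k where "k = abs c + 1"
 have k: "k > 0" "abs c <= k" unfolding k_def by linarith+
 have le: "ennreal (inverse k) * ennreal ((lnorm m (Top A \<eta> (kf y t)))^2) <= (\<integral>\<^sup>+x. indicator A x * ennreal ((D (kf y t) x)^2) \<partial>m)" for y
 proof -
  have H: "kf y t : H12 m" by (rule kf_H12[OF t0])
  note L = bounded_op_D(1)[OF T H] and Tm = Top_bound(2)[OF A(2) \<eta> c H]
  have "ennreal (inverse k) * ennreal ((lnorm m (Top A \<eta> (kf y t)))^2) = (\<integral>\<^sup>+x. ennreal (inverse k) * ennreal ((Top A \<eta> (kf y t) x)^2) \<partial>m)"
   unfolding nn_integral_sq[OF L, symmetric] using Tm by (intro nn_integral_cmult[symmetric]) simp
  also have "\<dots> <= (\<integral>\<^sup>+x. indicator A x * ennreal ((D (kf y t) x)^2) \<partial>m)"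
  proof (rule nn_integral_mono_AE)
   show "AE x in m. ennreal (inverse k) * ennreal ((Top A \<eta> (kf y t) x)^2) <= indicator A x * ennreal ((D (kf y t) x)^2)"
    using Top_bound(1)[OF A(2) \<eta> c H]
   proof eventually_elim
    case (elim x)
    also have "indicator A x * (abs c * (D (kf y t) x)^2) <= indicator A x * (k * (D (kf y t) x)^2)"
     using k by (intro mult_left_mono mult_right_mono) auto
    finally have "inverse k * (Top A \<eta> (kf y t) x)^2 <= indicator A x * (D (kf y t) x)^2" using k by (simp add: field_simps)
    then have "ennreal (inverse k * (Top A \<eta> (kf y t) x)^2) <= ennreal (indicator A x * (D (kf y t) x)^2)" by (rule ennreal_leI)
    then show ?case using k by (simp add: ennreal_mult' ennreal_indicator)
   qed
  qed
  finally show ?thesis .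
 qed
 have "ennreal (inverse k) * HS (Top A \<eta>) t = (\<integral>\<^sup>+y. ennreal (inverse k) * ennreal ((lnorm m (Top A \<eta> (kf y t)))^2) \<partial>m)"
  unfolding HS_def using HS_measurable[OF T t0] by (intro nn_integral_cmult[symmetric]) simp
 also have "\<dots> <= energy A t" by (intro nn_integral_mono le)
 also have "\<dots> < \<infinity>" using A(1) t by (simp add: small_def)
 finally show ?thesis using k by (auto simp: ennreal_mult_less_top top.not_eq_extremum ennreal_mult_eq_top_iff)
qed

lemma mass_nonneg: "\<eta> : L2_forms m ==> 0 <= mass A \<eta>"
 unfolding mass_def by (rule integral_nonneg_AE) (use form_inner_nonneg[of \<eta>] in "auto elim: AE_mp")

lemma mass_integrable: "A : sets m ==> \<eta> : L2_forms m ==> integrable m (%x. indicator A x * fsq \<eta> x)"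
 using integrable_mult_indicator[OF _ form_sq_integrable[of \<eta>], of A] by simp

text \<open>The defining identity of the pull-back metric, with \<open>1\<^sub>A \<eta>\<close> in both slots.\<close>

lemma immersion_piece:
 assumes im: "heat_isometric_immersion m \<rho> s t" and t: "t > 0" and p: "piece e A \<eta>"
 shows "s^2 * enn2real (HS (Top A \<eta>) t) = mass A \<eta>"
proof -
 obtain gt g where gt: "heat_pullback_metric m \<rho> t gt" and g: "canonical_metric m g" and eq: "tensor_eq m (tensor_scale (s^2) gt) g"
  using im by (auto simp: heat_isometric_immersion_def)
 have A: "A : sets m" "bounded A" and \<eta>: "\<eta> : L2_forms m" using p by (auto simp: piece_def small_def)
 have T: "bounded_op (Top A \<eta>)" by (rule piece_bounded_op[OF p])
 let ?I = "iform A \<eta>"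
 let ?P = "tensor_prod ?I ?I"
 have I: "?I : L2_forms m" by (rule iform_L2[OF A(1) \<eta>])
 have gt0: "gt : L0_tensors m" using gt by (simp add: heat_pullback_metric_def semi_Riemannian_metric_def Linf_loc_tensors_def)
 have g0: "g : L0_tensors m" using g by (simp add: canonical_metric_def Riemannian_metric_def semi_Riemannian_metric_def Linf_loc_tensors_def)
 have bs: "bounded_support m ?I" unfolding bounded_support_def
  using form_inner_iform_iform[OF A(1) \<eta>] A(2) by (intro exI[of _ A]) (auto elim: AE_mp)
 have PC: "T.Cau ?P" by (intro tensor_prod_Cau L2_forms_Cau I)
 have tm: "tensor_inner m S ?P : borel_measurable m" if "S : L0_tensors m" for S
  unfolding tensor_inner_lim by (rule T.lim_tendsto(1)) (use that PC in "auto simp: L0_tensors_Cau")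
 have "s^2 * (LINT x|m. tensor_inner m gt ?P x) = (LINT x|m. s^2 * tensor_inner m gt ?P x)" by simp
 also have "\<dots> = mass A \<eta>" unfolding mass_def
 proof (rule integral_cong_AE)
  show "AE x in m. s^2 * tensor_inner m gt ?P x = indicator A x * fsq \<eta> x"
   using tensor_inner_scale(1)[OF gt0 PC, of "s^2"] tensor_eq_inner[OF tensor_scale_L0[OF gt0] g0 eq PC]
    canonical_tensor_prod[OF g I I] form_inner_iform_iform[OF A(1) \<eta>]
   by eventually_elim simp
 qed (use tm[OF gt0] mass_integrable[OF A(1) \<eta>] in auto)
 finally have 1: "s^2 * (LINT x|m. tensor_inner m gt ?P x) = mass A \<eta>" .
 have "(LINT x|m. tensor_inner m gt ?P x) = (LINT y|m. (LINT x|m. dk t ?I y x * dk t ?I y x))"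
  using gt I bs unfolding heat_pullback_metric_def kf_def by blast
 also have "\<dots> = (LINT y|m. (lnorm m (Top A \<eta> (kf y t)))^2)"
 proof (rule Bochner_Integration.integral_cong[OF refl])
  fix y
  have H: "kf y t : H12 m" by (rule kf_H12[OF t])
  have m1: "dk t ?I y : borel_measurable m" by (rule form_inner_differential_meas[OF H I])
  have m2: "Top A \<eta> (kf y t) : borel_measurable m" by (intro L2_measurable bounded_op_D(1)[OF T] H)
  show "(LINT x|m. dk t ?I y x * dk t ?I y x) = (lnorm m (Top A \<eta> (kf y t)))^2"
   unfolding lnorm_sq
  proof (rule integral_cong_AE)
   show "AE x in m. dk t ?I y x * dk t ?I y x = (Top A \<eta> (kf y t) x)^2"
    using form_inner_iform(1)[OF A(1) differential_Cau[OF H] \<eta>] by eventually_elim (simp add: Top_def power2_eq_square)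
  qed (use m1 m2 in auto)
 qed
 also have "\<dots> = enn2real (HS (Top A \<eta>) t)"
  unfolding HS_def using HS_measurable[OF T t] by (intro integral_eq_nn_integral) auto
 finally show ?thesis using 1 by simp
qed

text \<open>Backward uniqueness: the Hilbert--Schmidt norm is nonincreasing in time, so if it vanishes once, it
  vanishes on a half line, hence always by analyticity.\<close>

lemma HS_positive:
 assumes T: "bounded_op T" and e: "0 < e" "e < e'" and fin: "!!t. t > e ==> HS T t < \<infinity>"
  and t: "t > e'" and z: "HS T t = 0" and s: "s > e'"
 shows "HS T s = 0"
proof -
 obtain w where w: "ALL k::nat. w k : L2 m" "ALL t>e. HS T t = (\<Sum>k. ennreal ((lnorm m (P (t - e) (w k)))^2))"
  using HS_expansion[OF T e(1)] by blast
 have later: "HS T s = 0" if "s > t" for s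
 proof -
  have st: "s > e" "t > e" using t e(2) that by auto
  have "HS T s <= HS T t" unfolding w(2)[rule_format, OF st(1)] w(2)[rule_format, OF st(2)]
   using w(1) st that by (intro suminf_le ennreal_leI power_mono P_norm_antimono) auto
  with z show ?thesis by simp
 qed
 have ps: "past_series e' (%t. enn2real (HS T t))" by (rule HS_past_series[OF T e(1) fin e(2)])
 have ev: "enn2real (HS T (t + rad i)) = 0" for i using later[of "t + rad i"] rad(1)[of i] by simp
 have lim: "(%i. t + rad i) \<longlonglongrightarrow> t" using tendsto_add[OF tendsto_const[of t] rad(2)] by simp
 have fr: "\<exists>\<^sub>F i in sequentially. t + rad i ~= t" using rad(1) by (intro eventually_frequently always_eventually allI) (auto simp: less_imp_neq[symmetric])
 have "1 * enn2real (HS T s) = 0 * enn2real (HS T s)"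
  by (rule past_series_identity[OF ps ps t lim fr _ s]) (simp add: ev)
 then show ?thesis using fin[of s] s e by (auto simp: enn2real_eq_0_iff)
qed

text \<open>Fix one piece of positive mass.  At the times \<open>t i\<close> the norm of any other piece is the norm of this one times the
  ratio of the masses; the unknown factors \<open>s i\<close> cancel, and analyticity carries the relation to \<open>T\<close>.  If all masses
  vanish, all norms vanish too.\<close>

lemma proportionality:
 assumes t0: "t0 > 0" and lim: "t \<longlonglongrightarrow> t0" and fr: "\<exists>\<^sub>F i in sequentially. t i ~= t0"
  and im: "!!i::nat. t i > 0 & heat_isometric_immersion m \<rho> (s i) (t i)" and T: "T > 0"
 shows "EX e>0. EX \<mu>>0. e < T & (ALL A \<eta>. piece e A \<eta> --> HS (Top A \<eta>) T = ennreal (\<mu> * mass A \<eta>))"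
proof -
  \<comment> \<open>two losses of time: the expansion of the norm is valid after \<open>e\<close>, its power series after \<open>e'\<close>\<close>
 define e where "e = min T t0 / 3"
 define e' where "e' = min T t0 / 2"
 have e: "0 < e" "e < e'" "e' < T" "e' < t0" using T t0 by (auto simp: e_def e'_def)
 have eT: "e < T" using e by simp
 have ps: "past_series e' (%t. enn2real (HS (Top A \<eta>) t))" if "piece e A \<eta>" for A \<eta>
  by (rule HS_past_series[OF piece_bounded_op[OF that] e(1) piece_HS_finite[OF that e(1)] e(2)])
 have eq: "(s i)^2 * enn2real (HS (Top A \<eta>) (t i)) = mass A \<eta>" if "piece e A \<eta>" for A \<eta> i
  using immersion_piece[of "s i" "t i" e A \<eta>] im[of i] that by blast
 have nn: "0 <= mass A \<eta>" if "piece e A \<eta>" for A \<eta> using that by (intro mass_nonneg) (simp add: piece_def)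
 show ?thesis
 proof (cases "EX A0 \<eta>0. piece e A0 \<eta>0 & mass A0 \<eta>0 ~= 0")
  case True
  then obtain A0 \<eta>0 where p0: "piece e A0 \<eta>0" and N0: "mass A0 \<eta>0 ~= 0" by blast
  let ?N = "mass A0 \<eta>0" and ?F = "%t. enn2real (HS (Top A0 \<eta>0) t)"
  have N: "?N > 0" using nn[OF p0] N0 by simp
  have s: "s i ~= 0" for i using eq[OF p0, of i] N by auto
  have lin: "?N * enn2real (HS (Top A \<eta>) T) = mass A \<eta> * ?F T" if p: "piece e A \<eta>" for A \<eta>
  proof (rule past_series_identity[OF ps[OF p] ps[OF p0] e(4) lim fr _ e(3)])
   fix i
   have "(s i)^2 * (?N * enn2real (HS (Top A \<eta>) (t i))) = (s i)^2 * (mass A \<eta> * ?F (t i))"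
    unfolding eq[OF p, of i, symmetric] eq[OF p0, of i, symmetric] by (simp add: mult_ac)
   then show "?N * enn2real (HS (Top A \<eta>) (t i)) = mass A \<eta> * ?F (t i)" using s[of i] by simp
  qed
  have "\<forall>\<^sub>F i in sequentially. t i > e'" by (rule order_tendstoD(1)[OF lim e(4)])
  then obtain i where i: "t i > e'" by (auto simp: eventually_sequentially)
  have "HS (Top A0 \<eta>0) T ~= 0"
  proof
   assume "HS (Top A0 \<eta>0) T = 0"
   from HS_positive[OF piece_bounded_op[OF p0] e(1,2) piece_HS_finite[OF p0 e(1)] e(3) this i]
   show False using eq[OF p0, of i] N by simp
  qed
  then have F: "?F T > 0" using piece_HS_finite[OF p0 e(1) eT] by (simp add: enn2real_positive_iff zero_less_iff_neq_zero)
  have "HS (Top A \<eta>) T = ennreal (?F T / ?N * mass A \<eta>)" if p: "piece e A \<eta>" for A \<eta>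
  proof -
   have "enn2real (HS (Top A \<eta>) T) = ?F T / ?N * mass A \<eta>" using lin[OF p] N by (simp add: field_simps)
   moreover have "HS (Top A \<eta>) T = ennreal (enn2real (HS (Top A \<eta>) T))" using piece_HS_finite[OF p e(1) eT] by simp
   ultimately show ?thesis by simp
  qed
  then show ?thesis using F N e(1) eT by (intro exI[of _ e] conjI exI[of _ "?F T / ?N"]) auto
 next
  case False
  have "HS (Top A \<eta>) T = ennreal (1 * mass A \<eta>)" if p: "piece e A \<eta>" for A \<eta>
  proof -
   have A: "A : sets m" and \<eta>: "\<eta> : L2_forms m" using p by (auto simp: piece_def small_def)
   have z: "mass A \<eta> = 0" using False p by blast
   have "AE x in m. indicator A x * fsq \<eta> x = 0"
   proof (rule integral_nonneg_eq_0_iff_AE[THEN iffD1])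
    show "integrable m (%x. indicator A x * fsq \<eta> x)" by (rule mass_integrable[OF A \<eta>])
    show "AE x in m. 0 <= indicator A x * fsq \<eta> x" using form_inner_nonneg[OF \<eta>] by eventually_elim simp
   qed (use z in "simp add: mass_def")
   then have c: "AE x in m. x : A --> fsq \<eta> x <= 0" by eventually_elim (auto simp: indicator_def)
   have "lnorm m (Top A \<eta> (kf y T)) = 0" for y
   proof -
    have H: "kf y T : H12 m" by (rule kf_H12[OF T])
    have "AE x in m. Top A \<eta> (kf y T) x = 0" using Top_bound(1)[OF A \<eta> c H] by eventually_elim simp
    then have "lnorm m (Top A \<eta> (kf y T)) = lnorm m (%x. 0)" by (intro lnorm_cong_AE Top_bound(2)[OF A \<eta> c H]) auto
    then show ?thesis by simp
   qed
   then show ?thesis by (simp add: HS_def z)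
  qed
  then show ?thesis using e(1) eT by (intro exI[of _ e] conjI exI[of _ 1]) auto
 qed
qed

lemma small_subset: assumes "small e B" "A \<subseteq> B" "A : sets m" shows "small e A"
 unfolding small_def
proof (intro conjI allI impI assms(3))
 show "bounded A" using assms by (auto simp: small_def intro: bounded_subset)
 fix t assume "t > e"
 then have "energy B t < \<infinity>" using assms(1) by (simp add: small_def)
 moreover have "energy A t <= energy B t"
  using assms(2) by (intro nn_integral_mono mult_right_mono) (auto simp: indicator_def)
 ultimately show "energy A t < \<infinity>" by (rule le_less_trans[rotated])
qed

text \<open>By the Lindelof property countably many small balls cover the space; cut them along the level sets of \<open>h\<close>.\<close>

lemma decomposition:
 fixes h :: "'a => real"
 assumes e: "e > 0" and h: "h : borel_measurable m"
 shows "EX A::nat => 'a set. disjoint_family A & (\<Union>k. A k) = UNIV & (ALL k. small e (A k) & (EX c. ALL x:A k. h x <= c))"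
proof -
 have "EX r>0. small e (ball x r)" for x
 proof -
  obtain r where r: "r > 0" "ALL t>e. energy (ball x r) t < \<infinity>"
   using local_energy_finite[OF e] by blast
  then show ?thesis by (intro exI[of _ r]) (auto simp: small_def sets_m)
 qed
 then obtain r where r: "!!x. r x > 0" "!!x. small e (ball x (r x))" by metis
 obtain F where F: "F \<subseteq> range (%x. ball x (r x))" "countable F" "\<Union>F = \<Union>(range (%x. ball x (r x)))"
  by (rule Lindelof[of "range (%x. ball x (r x))"]) auto
 have U: "\<Union>F = UNIV" using F(3) r(1) by auto
 then have Fne: "F ~= {}" by auto
 define B where "B = from_nat_into F"
 have B: "small e (B i)" for i using from_nat_into[OF Fne, of i] F(1) r(2) by (auto simp: B_def)
 define C where "C k = B (fst (prod_decode k)) \<inter> {x : space m. h x <= real (snd (prod_decode k))}" for k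
 have Cm: "C k : sets m" for k using B[of "fst (prod_decode k)"] h unfolding C_def small_def by (intro sets.Int borel_measurable_le) auto
 have Am: "disjointed C k : sets m" for k using sets.range_disjointed_sets[of C m] Cm by auto
 have CU: "x : (\<Union>k. C k)" for x
 proof -
  have "x : \<Union>F" unfolding U by simp
  then obtain b where "b : F" "x : b" by (rule UnionE)
  moreover obtain i where "b = B i" using from_nat_into_surj[OF F(2) \<open>b : F\<close>] by (auto simp: B_def)
  moreover obtain n :: nat where "h x <= real n" using real_arch_simple by blast
  ultimately have "x : C (prod_encode (i, n))" by (simp add: C_def space_m)
  then show ?thesis by blast
 qed
 show ?thesis
 proof (intro exI[of _ "disjointed C"] conjI allI)
  show "disjoint_family (disjointed C)" by (rule disjoint_family_disjointed)
  show "(\<Union>k. disjointed C k) = UNIV" using CU by (auto simp: UN_disjointed_eq)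
  fix k
  have sub: "disjointed C k \<subseteq> C k" by (rule disjointed_subset)
  show "small e (disjointed C k)" by (rule small_subset[OF B _ Am]) (use sub in "auto simp: C_def")
  show "EX c. ALL x:disjointed C k. h x <= c" using sub by (intro exI[of _ "real (snd (prod_decode k))"]) (auto simp: C_def)
 qed
qed

lemma nn_integral_decomposition:
 assumes A: "disjoint_family A" "(\<Union>k::nat. A k) = UNIV" "!!k. A k : sets m" and h: "h : borel_measurable m"
 shows "(\<integral>\<^sup>+x. h x \<partial>m) = (\<Sum>k. \<integral>\<^sup>+x. h x * indicator (A k) x \<partial>m)"
 using nn_integral_disjoint_family[OF h A(3,1)] A(2) by simp

text \<open>Summation over a decomposition into pieces.\<close>

lemma energy_identity:
 assumes e: "e > 0" "e < T" and lam: "\<mu> > 0"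
  and lin: "!!A \<eta>. piece e A \<eta> ==> HS (Top A \<eta>) T = ennreal (\<mu> * mass A \<eta>)" and \<eta>: "\<eta> : L2_forms m"
 shows "(%y. \<integral>\<^sup>+x. ennreal ((dk T \<eta> y x)^2) \<partial>m) : borel_measurable m"
  "(\<integral>\<^sup>+y. (\<integral>\<^sup>+x. ennreal ((dk T \<eta> y x)^2) \<partial>m) \<partial>m) = ennreal (\<mu> * (LINT x|m. fsq \<eta> x))"
proof -
 let ?I = "\<integral>x. fsq \<eta> x \<partial>m"
 let ?q = "%y. \<integral>\<^sup>+x. ennreal ((dk T \<eta> y x)^2) \<partial>m"
 have T: "T > 0" using e by simp
 have fm: "fsq \<eta> : borel_measurable m" by (rule form_inner_meas[OF \<eta> \<eta>])
 obtain A :: "nat => 'a set" where A: "disjoint_family A" "(\<Union>k. A k) = UNIV" "ALL k. small e (A k) & (EX c. ALL x:A k. fsq \<eta> x <= c)"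
  using decomposition[OF e(1) fm] by blast
 have Am: "A k : sets m" for k using A(3) by (simp add: small_def)
 have p: "piece e (A k) \<eta>" for k unfolding piece_def
 proof (intro conjI \<eta>)
  show "small e (A k)" using A(3) by blast
  obtain c where "ALL x:A k. fsq \<eta> x <= c" using A(3) by blast
  then show "EX c. AE x in m. x : A k --> fsq \<eta> x <= c" by (intro exI[of _ c]) simp
 qed
 have H: "kf y T : H12 m" for y by (rule kf_H12[OF T])
 have m1: "(%x. ennreal ((dk T \<eta> y x)^2)) : borel_measurable m" for y
  using form_inner_differential_meas[OF H \<eta>, of y] by simp
 have inner: "?q y = (\<Sum>k. ennreal ((lnorm m (Top (A k) \<eta> (kf y T)))^2))" for y
 proof -
  have "(\<integral>\<^sup>+x. ennreal ((dk T \<eta> y x)^2) * indicator (A k) x \<partial>m) = ennreal ((lnorm m (Top (A k) \<eta> (kf y T)))^2)" for k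
   unfolding nn_integral_sq[OF bounded_op_D(1)[OF piece_bounded_op[OF p] H], symmetric]
   by (intro nn_integral_cong) (auto simp: Top_def indicator_def)
  then show ?thesis using nn_integral_decomposition[OF A(1,2) Am m1] by simp
 qed
 have m2: "(%y. ennreal ((lnorm m (Top (A k) \<eta> (kf y T)))^2)) : borel_measurable m" for k
  using HS_measurable[OF piece_bounded_op[OF p] T] by simp
 show "(%y. \<integral>\<^sup>+x. ennreal ((dk T \<eta> y x)^2) \<partial>m) : borel_measurable m"
  unfolding inner using m2 by simp
 have "(\<integral>\<^sup>+y. ?q y \<partial>m) = (\<Sum>k. HS (Top (A k) \<eta>) T)"
  unfolding inner HS_def using m2 by (intro nn_integral_suminf)
 also have "\<dots> = (\<Sum>k. ennreal \<mu> * ennreal (mass (A k) \<eta>))" using lin[OF p] mass_nonneg[OF \<eta>] lam by (simp add: ennreal_mult)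
 also have "\<dots> = ennreal \<mu> * (\<Sum>k. ennreal (mass (A k) \<eta>))" by (rule ennreal_suminf_cmult)
 also have "(\<Sum>k. ennreal (mass (A k) \<eta>)) = (\<integral>\<^sup>+x. ennreal (fsq \<eta> x) \<partial>m)"
 proof -
  have "ennreal (mass (A k) \<eta>) = (\<integral>\<^sup>+x. ennreal (fsq \<eta> x) * indicator (A k) x \<partial>m)" for k
  proof -
   have "ennreal (mass (A k) \<eta>) = (\<integral>\<^sup>+x. ennreal (indicator (A k) x * fsq \<eta> x) \<partial>m)"
    unfolding mass_def using form_inner_nonneg[OF \<eta>]
    by (intro nn_integral_eq_integral[symmetric] mass_integrable[OF Am \<eta>]) (auto elim: AE_mp)
   also have "\<dots> = (\<integral>\<^sup>+x. ennreal (fsq \<eta> x) * indicator (A k) x \<partial>m)"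
    by (intro nn_integral_cong) (auto simp: indicator_def)
   finally show ?thesis .
  qed
  then show ?thesis using nn_integral_decomposition[OF A(1,2) Am, of "%x. ennreal (fsq \<eta> x)"] fm by simp
 qed
 also have "(\<integral>\<^sup>+x. ennreal (fsq \<eta> x) \<partial>m) = ennreal ?I"
  by (rule nn_integral_eq_integral[OF form_sq_integrable[OF \<eta>] form_inner_nonneg[OF \<eta>]])
 also have "ennreal \<mu> * ennreal ?I = ennreal (\<mu> * ?I)"
  using lam integral_nonneg_AE[OF form_inner_nonneg[OF \<eta>]] by (simp add: ennreal_mult)
 finally show "(\<integral>\<^sup>+y. ?q y \<partial>m) = ennreal (\<mu> * ?I)" .
qed

text \<open>\<open>T \<rho>(\<cdot>, y, t)\<close> is the image of \<open>\<rho>(\<cdot>, y, t / 2)\<close> under the bounded operator \<open>T P\<^bsub>t / 2\<^esub>\<close> on \<open>L\<^sup>2\<close>.\<close>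

lemma op_kf_continuous:
 assumes T: "bounded_op T" and t: "t > 0" and Y: "Y \<longlonglongrightarrow> y"
 shows "L2_tendsto m (%n. T (kf (Y n) t)) (T (kf y t)) sequentially"
proof -
 have t2: "t/2 > 0" using t by simp
 have H: "kf z t : H12 m" for z by (rule kf_H12[OF t])
 have L: "kf z (t/2) : L2 m" for z by (rule kf_limit(1)[OF t2])
 have TL: "T (kf z t) : L2 m" "T (P (t/2) (kf z (t/2))) : L2 m" for z by (rule bounded_op_D(1)[OF T H], rule bounded_op_P(1)[OF T t2 L])
 obtain C where C: "C >= 0" "ALL f:L2 m. lnorm m (T (P (t/2) f)) <= C * lnorm m f" using bounded_op_P(4)[OF T t2] by blast
 have eq: "AE x in m. T (kf z t) x = T (P (t/2) (kf z (t/2))) x" for z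
 proof (rule bounded_op_cong[OF T H P_H12[OF L t2]])
  show "AE x in m. kf z t x = P (t/2) (kf z (t/2)) x" using P_kf[OF t2 t2, of z] by (auto elim: AE_mp)
 qed
 have "lnorm m (%x. T (kf (Y n) t) x - T (kf y t) x) <= C * lnorm m (%x. kf y (t/2) x - kf (Y n) (t/2) x)" for n
 proof -
  have d: "(%x. kf (Y n) (t/2) x - kf y (t/2) x) : L2 m" by (intro L2_diff L)
  have "lnorm m (%x. T (kf (Y n) t) x - T (kf y t) x) = lnorm m (T (P (t/2) (%x. kf (Y n) (t/2) x - kf y (t/2) x)))"
  proof (rule lnorm_cong_AE)
   show "AE x in m. T (kf (Y n) t) x - T (kf y t) x = T (P (t/2) (%x. kf (Y n) (t/2) x - kf y (t/2) x)) x"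
    using eq[of "Y n"] eq[of y] bounded_op_P_diff[OF T t2 L L, of "Y n" y] by eventually_elim simp
  qed (use L2_measurable[OF L2_diff[OF TL(1) TL(1)]] L2_measurable[OF bounded_op_P(1)[OF T t2 d]] in auto)
  also have "\<dots> <= C * lnorm m (%x. kf (Y n) (t/2) x - kf y (t/2) x)" using C(2) d by blast
  finally show ?thesis using lnorm_minus_commute[of m "kf (Y n) (t/2)" "kf y (t/2)"] by simp
 qed
 moreover have "(%n. C * lnorm m (%x. kf y (t/2) x - kf (Y n) (t/2) x)) \<longlonglongrightarrow> 0"
  by (intro tendsto_mult_right_zero L2_tendsto_kf[OF t2 Y tendsto_const])
 ultimately show ?thesis by (intro L2_tendsto_le[OF always_eventually]) auto
qed

lemma op_ip_measurable:
 assumes T: "bounded_op T" and S: "bounded_op S" and t: "t > 0"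
 shows "(%y. ip m (T (kf y t)) (S (kf y t))) : borel_measurable m"
  "(%y. ip m (%x. abs (T (kf y t) x)) (%x. abs (S (kf y t) x))) : borel_measurable m"
proof -
 have H: "kf z t : H12 m" for z by (rule kf_H12[OF t])
 note L = bounded_op_D(1)[OF T H] bounded_op_D(1)[OF S H]
 have ab: "L2_tendsto m (%n x. abs (u n x)) (%x. abs (f x)) sequentially"
  if u: "L2_tendsto m u f sequentially" "!!n. u n : L2 m" "f : L2 m" for u :: "nat => 'a => real" and f
 proof (rule L2_tendsto_le)
  show "\<forall>\<^sub>F n in sequentially. lnorm m (%x. abs (u n x) - abs (f x)) <= lnorm m (%x. u n x - f x)"
   by (intro always_eventually allI lnorm_mono_AE AE_I2 abs_triangle_ineq3 L2_measurable L2_diff L2_abs u)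
  show "(%n. lnorm m (%x. u n x - f x)) \<longlonglongrightarrow> 0" using u(1) by (simp add: L2_tendsto_lnorm)
 qed
 have "continuous_on UNIV (%y. ip m (T (kf y t)) (S (kf y t)))"
  unfolding continuous_on_sequentially comp_def
  by (intro allI ballI impI L2_tendsto_ip op_kf_continuous T S t always_eventually L) auto
 then show "(%y. ip m (T (kf y t)) (S (kf y t))) : borel_measurable m"
  unfolding meas_m by (rule borel_measurable_continuous_onI)
 have "continuous_on UNIV (%y. ip m (%x. abs (T (kf y t) x)) (%x. abs (S (kf y t) x)))"
  unfolding continuous_on_sequentially comp_def
  by (intro allI ballI impI L2_tendsto_ip ab op_kf_continuous T S t always_eventually L L2_abs) auto
 then show "(%y. ip m (%x. abs (T (kf y t) x)) (%x. abs (S (kf y t) x))) : borel_measurable m"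
  unfolding meas_m by (rule borel_measurable_continuous_onI)
qed

text \<open>The product of the two pairings may fail to be integrable for some \<open>y\<close>, where its integral is \<open>0\<close> by convention.
  Both the set of these \<open>y\<close> and the integral elsewhere are countable sums over pieces.\<close>

lemma energy_product_measurable:
 assumes e: "e > 0" "e < T" and \<omega>: "\<omega> : L2_forms m" and \<eta>: "\<eta> : L2_forms m"
 shows "(%y. \<integral>x. dk T \<omega> y x * dk T \<eta> y x \<partial>m) : borel_measurable m"
proof -
 have T: "T > 0" using e by simp
 have H: "kf y T : H12 m" for y by (rule kf_H12[OF T])
 have "(%x. fsq \<omega> x + fsq \<eta> x) : borel_measurable m" by (intro borel_measurable_add form_inner_meas \<omega> \<eta>)
 from decomposition[OF e(1) this] obtain A :: "nat => 'a set" where A: "disjoint_family A" "(\<Union>k. A k) = UNIV"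
  "ALL k. small e (A k) & (EX c. ALL x:A k. fsq \<omega> x + fsq \<eta> x <= c)" by blast
 have Am: "A k : sets m" for k using A(3) by (simp add: small_def)
 have p: "piece e (A k) \<omega>" "piece e (A k) \<eta>" for k
 proof -
  obtain c where c: "ALL x:A k. fsq \<omega> x + fsq \<eta> x <= c" using A(3) by blast
  have "AE x in m. x : A k --> fsq \<omega> x <= c" "AE x in m. x : A k --> fsq \<eta> x <= c"
   using form_inner_nonneg[OF \<omega>] form_inner_nonneg[OF \<eta>] by (eventually_elim, use c in fastforce)+
  then show "piece e (A k) \<omega>" "piece e (A k) \<eta>" using A(3) \<omega> \<eta> by (auto simp: piece_def)
 qed
 define f where "f y x = dk T \<omega> y x * dk T \<eta> y x" for y x
 have fm: "f y : borel_measurable m" for y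
  unfolding f_def[abs_def] by (intro borel_measurable_times form_inner_differential_meas H \<omega> \<eta>)
 let ?S = "%k y. Top (A k) \<omega> (kf y T)" and ?U = "%k y. Top (A k) \<eta> (kf y T)"
 define a where "a k y = ip m (%x. abs (?S k y x)) (%x. abs (?U k y x))" for k y
 define b where "b k y = ip m (?S k y) (?U k y)" for k y
 have [measurable]: "a k : borel_measurable m" "b k : borel_measurable m" for k
  unfolding a_def[abs_def] b_def[abs_def] by (rule op_ip_measurable[OF piece_bounded_op[OF p(1)] piece_bounded_op[OF p(2)] T])+
 have L: "?S k y : L2 m" "?U k y : L2 m" for k y
  by (rule bounded_op_D(1)[OF piece_bounded_op[OF p(1)] H], rule bounded_op_D(1)[OF piece_bounded_op[OF p(2)] H])
 have "(\<integral>\<^sup>+x. ennreal (abs (f y x)) * indicator (A k) x \<partial>m) = ennreal (a k y)" for k y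
 proof -
  have "(\<integral>\<^sup>+x. ennreal (abs (f y x)) * indicator (A k) x \<partial>m) = (\<integral>\<^sup>+x. ennreal (abs (?S k y x) * abs (?U k y x)) \<partial>m)"
   by (intro nn_integral_cong) (auto simp: f_def Top_def indicator_def abs_mult)
  also have "\<dots> = ennreal (a k y)" unfolding a_def ip_def
   by (rule nn_integral_eq_integral) (auto intro!: L2_integrable_mult L2_abs L)
  finally show ?thesis .
 qed
 then have abs: "(\<integral>\<^sup>+x. ennreal (abs (f y x)) \<partial>m) = (\<Sum>k. ennreal (a k y))" for y
  using nn_integral_decomposition[OF A(1,2) Am, of "%x. ennreal (abs (f y x))"] fm[of y] by simp
 have "(LINT x|m. f y x) = (if (\<Sum>k. ennreal (a k y)) < \<infinity> then \<Sum>k. b k y else 0)" for y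
 proof (cases "integrable m (f y)")
  case True
  have bk: "(LINT x:A k|m. f y x) = b k y" for k unfolding b_def ip_def set_lebesgue_integral_def
   by (intro Bochner_Integration.integral_cong) (auto simp: f_def Top_def indicator_def)
  have "(LINT x|m. f y x) = (\<Sum>k. LINT x:A k|m. f y x)"
   using lebesgue_integral_countable_add[of A m "f y"] A(1,2) Am True
   by (auto simp: disjoint_family_on_def set_integrable_def set_lebesgue_integral_def)
  then show ?thesis using True abs[of y] bk by (simp add: integrable_iff_bounded)
 next
  case False
  then show ?thesis using fm[of y] abs[of y] by (simp add: integrable_iff_bounded not_integrable_integral_eq)
 qed
 moreover have "(%y. if (\<Sum>k. ennreal (a k y)) < \<infinity> then \<Sum>k. b k y else 0) : borel_measurable m" by measurable
 ultimately show ?thesis unfolding f_def by simp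
qed

text \<open>The energy identity for \<open>\<omega>\<close>, \<open>\<eta>\<close> and \<open>\<omega> - \<eta>\<close>.\<close>

lemma polarized_energy_identity:
 assumes e: "e > 0" "e < T" and lam: "\<mu> > 0"
  and lin: "!!A \<eta>. piece e A \<eta> ==> HS (Top A \<eta>) T = ennreal (\<mu> * mass A \<eta>)"
  and \<omega>: "\<omega> : L2_forms m" and \<eta>: "\<eta> : L2_forms m"
 shows "(LINT y|m. (LINT x|m. dk T \<omega> y x * dk T \<eta> y x)) = \<mu> * (LINT x|m. form_inner m \<omega> \<eta> x)"
proof -
 have T: "T > 0" using e by simp
 have H: "kf y T : H12 m" for y by (rule kf_H12[OF T])
 let ?\<delta> = "form_diff \<omega> \<eta>"
 have \<delta>: "?\<delta> : L2_forms m" by (rule form_diff_L2[OF \<omega> \<eta>])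
 define f where "f \<theta> y = dk T \<theta> y" for \<theta> y
 define q where "q \<theta> y = (\<integral>\<^sup>+x. ennreal ((f \<theta> y x)^2) \<partial>m)" for \<theta> y
 have qm: "q \<theta> : borel_measurable m" and qi: "(\<integral>\<^sup>+y. q \<theta> y \<partial>m) = ennreal (\<mu> * (LINT x|m. fsq \<theta> x))" if "\<theta> : L2_forms m" for \<theta>
  using energy_identity[OF e lam lin that] by (simp_all add: q_def[abs_def] f_def)
 have fin: "AE y in m. q \<theta> y ~= \<infinity>" if "\<theta> : L2_forms m" for \<theta>
  by (rule nn_integral_PInf_AE[OF qm[OF that]]) (simp add: qi[OF that])
 have fm: "f \<theta> y : borel_measurable m" if "\<theta> : L2_forms m" for \<theta> y
  unfolding f_def by (rule form_inner_differential_meas[OF H that])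
 have fL: "f \<theta> y : L2 m & enn2real (q \<theta> y) = (lnorm m (f \<theta> y))^2" if "\<theta> : L2_forms m" "q \<theta> y ~= \<infinity>" for \<theta> y
 proof -
  have "integrable m (%x. (f \<theta> y x)^2)"
   using that fm[OF that(1), of y] by (intro integrableI_nonneg) (auto simp: q_def top.not_eq_extremum)
  then have "f \<theta> y : L2 m" using fm[OF that(1), of y] by (simp add: L2_def)
  then show ?thesis using nn_integral_sq[of "f \<theta> y" m] by (simp add: q_def)
 qed
 have qint: "integrable m (%y. enn2real (q \<theta> y)) & (LINT y|m. enn2real (q \<theta> y)) = \<mu> * (LINT x|m. fsq \<theta> x)" if \<theta>: "\<theta> : L2_forms m" for \<theta>
 proof -
  have "(\<integral>\<^sup>+y. ennreal (enn2real (q \<theta> y)) \<partial>m) = (\<integral>\<^sup>+y. q \<theta> y \<partial>m)"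
   by (rule nn_integral_cong_AE) (use fin[OF \<theta>] in "auto simp: less_top elim: AE_mp")
  moreover have "0 <= \<mu> * (LINT x|m. fsq \<theta> x)" using lam integral_nonneg_AE[OF form_inner_nonneg[OF \<theta>]] by simp
  ultimately have "has_bochner_integral m (%y. enn2real (q \<theta> y)) (\<mu> * (LINT x|m. fsq \<theta> x))"
   using qm[OF \<theta>] qi[OF \<theta>] by (intro has_bochner_integral_nn_integral) auto
  then show ?thesis by (simp add: has_bochner_integral_iff)
 qed
 note q = qint[OF \<omega>] qint[OF \<eta>] qint[OF \<delta>]
 have "(LINT y|m. (LINT x|m. f \<omega> y x * f \<eta> y x)) = (LINT y|m. (enn2real (q \<omega> y) + enn2real (q \<eta> y) - enn2real (q ?\<delta> y)) / 2)"
 proof (rule integral_cong_AE)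
  show "(%y. \<integral>x. f \<omega> y x * f \<eta> y x \<partial>m) : borel_measurable m"
   unfolding f_def by (rule energy_product_measurable[OF e \<omega> \<eta>])
  show "AE y in m. (LINT x|m. f \<omega> y x * f \<eta> y x) = (enn2real (q \<omega> y) + enn2real (q \<eta> y) - enn2real (q ?\<delta> y)) / 2"
   using fin[OF \<omega>] fin[OF \<eta>] fin[OF \<delta>]
  proof eventually_elim
   case (elim y)
   have L: "f \<omega> y : L2 m" "f \<eta> y : L2 m" "f ?\<delta> y : L2 m" using fL[OF \<omega> elim(1)] fL[OF \<eta> elim(2)] fL[OF \<delta> elim(3)] by auto
   have "lnorm m (f ?\<delta> y) = lnorm m (%x. f \<omega> y x - f \<eta> y x)"
   proof (rule lnorm_cong_AE)
    show "AE x in m. f ?\<delta> y x = f \<omega> y x - f \<eta> y x" unfolding f_def by (rule form_inner_diff_right[OF \<omega> \<eta> H])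
   qed (use L2_measurable[OF L(3)] L2_measurable[OF L2_diff[OF L(1,2)]] in auto)
   then show ?case using lnorm_diff_sq[OF L(1,2)] fL[OF \<omega> elim(1)] fL[OF \<eta> elim(2)] fL[OF \<delta> elim(3)] by (simp add: ip_def)
  qed
 qed (use q in auto)
 also have "\<dots> = \<mu> * (((LINT x|m. fsq \<omega> x) + (LINT x|m. fsq \<eta> x) - (LINT x|m. fsq ?\<delta> x)) / 2)"
  using q by (simp add: algebra_simps)
 also have "((LINT x|m. fsq \<omega> x) + (LINT x|m. fsq \<eta> x) - (LINT x|m. fsq ?\<delta> x)) / 2
   = (LINT x|m. (fsq \<omega> x + fsq \<eta> x - fsq ?\<delta> x) / 2)"
  using form_sq_integrable[OF \<omega>] form_sq_integrable[OF \<eta>] form_sq_integrable[OF \<delta>] by simp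
 also have "\<dots> = (LINT x|m. form_inner m \<omega> \<eta> x)"
 proof (rule integral_cong_AE)
  show "AE x in m. (fsq \<omega> x + fsq \<eta> x - fsq ?\<delta> x) / 2 = form_inner m \<omega> \<eta> x"
   using form_inner_diff_sq[OF \<omega> \<eta>] by eventually_elim simp
 qed (use form_inner_meas[OF \<omega> \<omega>] form_inner_meas[OF \<eta> \<eta>] form_inner_meas[OF \<delta> \<delta>] form_inner_meas[OF \<omega> \<eta>] in auto)
 finally show ?thesis by (simp add: f_def)
qed

text \<open>The metric \<open>\<mu> g\<close> has the property that defines the pull-back metric at time \<open>T\<close>.\<close>

lemma immersion_all_times:
 assumes t0: "t0 > 0" and lim: "t \<longlonglongrightarrow> t0" and fr: "\<exists>\<^sub>F i in sequentially. t i ~= t0"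
  and im: "!!i::nat. t i > 0 & heat_isometric_immersion m \<rho> (s i) (t i)" and T: "T > 0"
 shows "EX c>=0. heat_isometric_immersion m \<rho> (sqrt c) T"
proof -
 obtain e \<mu> where e: "e > 0" "e < T" and lam: "\<mu> > 0"
  and "ALL A \<eta>. piece e A \<eta> --> HS (Top A \<eta>) T = ennreal (\<mu> * mass A \<eta>)"
  using proportionality[OF t0 lim fr im T] by blast
 then have lin: "!!A \<eta>. piece e A \<eta> ==> HS (Top A \<eta>) T = ennreal (\<mu> * mass A \<eta>)" by blast
 obtain g where g: "canonical_metric m g" using im[of 0] by (auto simp: heat_isometric_immersion_def)
 have sg: "semi_Riemannian_metric m g" using g by (simp add: canonical_metric_def Riemannian_metric_def)
 have g0: "g : L0_tensors m" using sg by (simp add: semi_Riemannian_metric_def Linf_loc_tensors_def)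
 let ?gt = "tensor_scale \<mu> g"
 have "heat_pullback_metric m \<rho> T ?gt" unfolding heat_pullback_metric_def
 proof (intro conjI ballI impI)
  show "semi_Riemannian_metric m ?gt" using semi_Riemannian_scale[OF sg] lam by simp
  fix \<omega> \<eta> assume \<omega>: "\<omega> : L2_forms m" and \<eta>: "\<eta> : L2_forms m"
  have PC: "T.Cau (tensor_prod \<omega> \<eta>)" by (intro tensor_prod_Cau L2_forms_Cau \<omega> \<eta>)
  have C: "T.Cau ?gt" using tensor_scale_L0[OF g0] by (simp add: L0_tensors_Cau)
  have "(LINT x|m. tensor_inner m ?gt (tensor_prod \<omega> \<eta>) x) = (LINT x|m. \<mu> * form_inner m \<omega> \<eta> x)"
  proof (rule integral_cong_AE)
   show "AE x in m. tensor_inner m ?gt (tensor_prod \<omega> \<eta>) x = \<mu> * form_inner m \<omega> \<eta> x"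
    using tensor_inner_scale(1)[OF g0 PC, of \<mu>] canonical_tensor_prod[OF g \<omega> \<eta>] by eventually_elim simp
   show "tensor_inner m ?gt (tensor_prod \<omega> \<eta>) : borel_measurable m" unfolding tensor_inner_lim by (rule T.lim_tendsto(1)[OF C PC])
  qed (use form_inner_meas[OF \<omega> \<eta>] in simp)
  also have "\<dots> = \<mu> * (LINT x|m. form_inner m \<omega> \<eta> x)" by simp
  also have "\<dots> = (LINT y|m. (LINT x|m. dk T \<omega> y x * dk T \<eta> y x))"
   by (rule polarized_energy_identity[OF e lam lin \<omega> \<eta>, symmetric])
  finally show "(LINT x|m. tensor_inner m ?gt (tensor_prod \<omega> \<eta>) x) = (LINT y|m. (LINT x|m. form_inner m (differential (%x'. \<rho> x' y T)) \<omega> x * form_inner m (differential (%x'. \<rho> x' y T)) \<eta> x))"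
   by (simp add: kf_def)
 qed
 moreover have "tensor_eq m (tensor_scale ((sqrt (1/\<mu>))^2) ?gt) g"
 proof -
  have "(sqrt (1/\<mu>))^2 * \<mu> = 1" using lam by simp
  then show ?thesis using tensor_scale_inverse tensor_eq_refl[OF g0] by metis
 qed
 ultimately have "heat_isometric_immersion m \<rho> (sqrt (1/\<mu>)) T" using g unfolding heat_isometric_immersion_def by blast
 then show ?thesis using lam by (intro exI[of _ "1/\<mu>"]) simp
qed

end

theorem theorem1p5:
  fixes m :: "'a::polish_space measure" and K N :: real
    and \<rho> :: "'a \<Rightarrow> 'a \<Rightarrow> real \<Rightarrow> real"
  assumes "N \<ge> 1" and "RCD K N m" and "heat_kernel m \<rho>"
  shows "(\<exists>(t :: nat \<Rightarrow> real) (s :: nat \<Rightarrow> real) t0.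
            t0 > 0 \<and> t \<longlonglongrightarrow> t0 \<and> (\<exists>\<^sub>F i in sequentially. t i \<noteq> t0) \<and>
            (\<forall>i. t i > 0 \<and> heat_isometric_immersion m \<rho> (s i) (t i)))
         \<longleftrightarrow> IHKI K N m \<rho>"
proof
 interpret heat_space m \<rho>
  using assms by unfold_locales (simp_all add: RCD_def)
 assume "\<exists>(t :: nat => real) (s :: nat => real) t0.
      t0 > 0 & t \<longlonglongrightarrow> t0 & (\<exists>\<^sub>F i in sequentially. t i ~= t0) &
      (ALL i. t i > 0 & heat_isometric_immersion m \<rho> (s i) (t i))"
 then obtain t s :: "nat => real" and t0 where h: "t0 > 0" "t \<longlonglongrightarrow> t0" "\<exists>\<^sub>F i in sequentially. t i ~= t0"
  "!!i. t i > 0 & heat_isometric_immersion m \<rho> (s i) (t i)" by blast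
 have "ALL T. EX c. T > 0 --> c >= 0 & heat_isometric_immersion m \<rho> (sqrt c) T"
  using immersion_all_times[OF h] by blast
 then have "EX c. ALL T. T > 0 --> c T >= 0 & heat_isometric_immersion m \<rho> (sqrt (c T)) T" by (rule choice)
 with assms(2) show "IHKI K N m \<rho>" by (simp add: IHKI_def)
next
 assume "IHKI K N m \<rho>"
 then obtain c :: "real => real" where c: "ALL t>0. c t >= 0 & heat_isometric_immersion m \<rho> (sqrt (c t)) t" by (auto simp: IHKI_def)
 let ?t = "%i::nat. 1 + rcp i"
 have "?t \<longlonglongrightarrow> 1 + 0" by (intro tendsto_add tendsto_const LIMSEQ_inverse_real_of_nat)
 moreover have "\<exists>\<^sub>F i in sequentially. ?t i ~= 1" by (intro eventually_frequently always_eventually) auto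
 moreover have "?t i > 0 & heat_isometric_immersion m \<rho> (sqrt (c (?t i))) (?t i)" for i using c by (simp add: add_pos_pos)
 ultimately show "\<exists>(t :: nat => real) (s :: nat => real) t0.
      t0 > 0 & t \<longlonglongrightarrow> t0 & (\<exists>\<^sub>F i in sequentially. t i ~= t0) &
      (ALL i. t i > 0 & heat_isometric_immersion m \<rho> (s i) (t i))"
  by (intro exI[of _ ?t] exI[of _ "%i. sqrt (c (?t i))"] exI[of _ 1]) simp
qed

end
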